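(* A bounded operator $X$ on $H^2(S_\Omega)^\perp$ is a dual Toeplitz operator (i.e. $X=S_\phi$ for some $\phi\in L^\infty(S_\Omega)$) if and only if $\sum_{i=1}^dS_{\bar z_i}^*XS_{\bar z_i}=rX$.
   Context: $\Omega\subset\mathbb C^d$ is a classical (irreducible) Cartan domain of rank $r$ in Harish-Chandra realization; $S_\Omega$ its Shilov boundary with the unique probability measure $dz$ invariant under the stabilizer $\mathbb K$ of $0$ in the identity component of $\mathrm{Aut}(\Omega)$. $H^2(S_\Omega)$ is the Hardy space (closure of the polynomials in $L^2(S_\Omega,dz)$), $P_{H^2(S_\Omega)}$ the orthogonal projection onto it, and $H^2(S_\Omega)^\perp=L^2(S_\Omega)\ominus H^2(S_\Omega)$. For $\phi\in L^\infty(S_\Omega)$ the dual Toeplitz operator is $S_\phi h=(I-P_{H^2(S_\Omega)})(\phi h)$ for $h\in H^2(S_\Omega)^\perp$; $S_{\bar z_i}$ is the dual Toeplitz operator with symbol the conjugate coordinate function $\bar z_i$. *)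

theory Defs
  imports "HOL-Probability.Probability"
begin

definition holo_on :: "(complex^('d::finite)) set \<Rightarrow> (complex^'d \<Rightarrow> complex) \<Rightarrow> bool" where
  "holo_on A f \<longleftrightarrow> (\<forall>x\<in>A. \<exists>L. (f has_derivative L) (at x) \<and>
       (\<forall>(c::complex) v. L (c *s v) = c * L v))"

definition holo_map_on :: "(complex^'d) set \<Rightarrow> (complex^'d \<Rightarrow> complex^'d) \<Rightarrow> bool" where
  "holo_map_on A g \<longleftrightarrow> (\<forall>i. holo_on A (\<lambda>z. g z $ i))"

definition mat_contr :: "nat \<Rightarrow> nat \<Rightarrow> (nat \<Rightarrow> nat \<Rightarrow> complex) \<Rightarrow> bool" where
  "mat_contr n m Z \<longleftrightarrow> (\<forall>v::nat \<Rightarrow> complex. (\<exists>j<m. v j \<noteq> 0) \<longrightarrow>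
      (\<Sum>i<n. (cmod (\<Sum>j<m. Z i j * v j))\<^sup>2) < (\<Sum>j<m. (cmod (v j))\<^sup>2))"

definition cartan_I :: "(complex^'d) set \<Rightarrow> nat \<Rightarrow> bool" where
  "cartan_I \<Omega> r \<longleftrightarrow> (\<exists>n m (f :: nat \<times> nat \<Rightarrow> 'd).
      1 \<le> n \<and> n \<le> m \<and> bij_betw f ({..<n} \<times> {..<m}) UNIV \<and> r = n \<and>
      \<Omega> = {z. mat_contr n m (\<lambda>i j. z $ f (i, j))})"

definition cartan_II :: "(complex^'d) set \<Rightarrow> nat \<Rightarrow> bool" where
  "cartan_II \<Omega> r \<longleftrightarrow> (\<exists>n (f :: nat \<times> nat \<Rightarrow> 'd).
      2 \<le> n \<and> bij_betw f {(i, j). i < j \<and> j < n} UNIV \<and> r = n div 2 \<and>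
      \<Omega> = {z. mat_contr n n (\<lambda>i j. if i < j then z $ f (i, j)
                                     else if j < i then - (z $ f (j, i)) else 0)})"

definition cartan_III :: "(complex^'d) set \<Rightarrow> nat \<Rightarrow> bool" where
  "cartan_III \<Omega> r \<longleftrightarrow> (\<exists>n (f :: nat \<times> nat \<Rightarrow> 'd).
      1 \<le> n \<and> bij_betw f {(i, j). i \<le> j \<and> j < n} UNIV \<and> r = n \<and>
      \<Omega> = {z. mat_contr n n (\<lambda>i j. if i = j then z $ f (i, i)
                                     else if i < j then z $ f (i, j) / complex_of_real (sqrt 2)
                                     else z $ f (j, i) / complex_of_real (sqrt 2))})"

text \<open>Lie ball, normalized so that minimal tripotents have norm 1 (as for the other types).\<close>
definition cartan_IV :: "(complex^'d) set \<Rightarrow> nat \<Rightarrow> bool" where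
  "cartan_IV \<Omega> r \<longleftrightarrow> (\<exists>n (f :: nat \<Rightarrow> 'd).
      3 \<le> n \<and> bij_betw f {..<n} UNIV \<and> r = 2 \<and>
      \<Omega> = {z. (\<Sum>k<n. (cmod (z $ f k))\<^sup>2) < 2 \<and>
               0 < 1 - (\<Sum>k<n. (cmod (z $ f k))\<^sup>2) + (cmod (\<Sum>k<n. (z $ f k)\<^sup>2))\<^sup>2 / 4})"

definition classical_cartan :: "(complex^'d) set \<Rightarrow> nat \<Rightarrow> bool" where
  "classical_cartan \<Omega> r \<longleftrightarrow> cartan_I \<Omega> r \<or> cartan_II \<Omega> r \<or> cartan_III \<Omega> r \<or> cartan_IV \<Omega> r"

definition max_modulus_set :: "(complex^'d) set \<Rightarrow> (complex^'d) set \<Rightarrow> bool" where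
  "max_modulus_set \<Omega> S \<longleftrightarrow> (\<forall>f. continuous_on (closure \<Omega>) f \<and> holo_on \<Omega> f \<longrightarrow>
      (\<forall>z\<in>closure \<Omega>. \<exists>w\<in>S. cmod (f z) \<le> cmod (f w)))"

definition shilov :: "(complex^'d) set \<Rightarrow> (complex^'d) set" where
  "shilov \<Omega> = (THE S. closed S \<and> S \<subseteq> closure \<Omega> \<and> max_modulus_set \<Omega> S \<and>
      (\<forall>S'. closed S' \<and> S' \<subseteq> closure \<Omega> \<and> max_modulus_set \<Omega> S' \<longrightarrow> S \<subseteq> S'))"

definition aut :: "(complex^'d) set \<Rightarrow> (complex^'d \<Rightarrow> complex^'d) set" where
  "aut \<Omega> = {g. g ` \<Omega> = \<Omega> \<and> inj_on g \<Omega> \<and> holo_map_on \<Omega> g \<and> holo_map_on \<Omega> (inv_into \<Omega> g)}"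

text \<open>Identity component of Aut(Omega) (compact-open topology): path component of the identity.\<close>
definition in_id_comp :: "(complex^'d) set \<Rightarrow> (complex^'d \<Rightarrow> complex^'d) \<Rightarrow> bool" where
  "in_id_comp \<Omega> g \<longleftrightarrow> (\<exists>H :: real \<Rightarrow> complex^'d \<Rightarrow> complex^'d.
      continuous_on ({0..1} \<times> \<Omega>) (\<lambda>(t, z). H t z) \<and> (\<forall>t\<in>{0..1}. H t \<in> aut \<Omega>) \<and>
      (\<forall>z\<in>\<Omega>. H 0 z = z) \<and> (\<forall>z\<in>\<Omega>. H 1 z = g z))"

definition stabK :: "(complex^'d) set \<Rightarrow> (complex^'d \<Rightarrow> complex^'d) set" where
  "stabK \<Omega> = {g \<in> aut \<Omega>. g 0 = 0 \<and> in_id_comp \<Omega> g}"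

definition K_invariant :: "(complex^'d) set \<Rightarrow> (complex^'d) measure \<Rightarrow> bool" where
  "K_invariant \<Omega> \<mu> \<longleftrightarrow> (\<forall>g\<in>stabK \<Omega>. \<exists>gh. continuous_on (closure \<Omega>) gh \<and>
      (\<forall>z\<in>\<Omega>. gh z = g z) \<and> gh \<in> \<mu> \<rightarrow>\<^sub>M \<mu> \<and> distr \<mu> \<mu> gh = \<mu>)"

definition dz :: "(complex^'d) set \<Rightarrow> (complex^'d) measure" where
  "dz \<Omega> = (THE \<mu>. space \<mu> = shilov \<Omega> \<and> sets \<mu> = sets (restrict_space borel (shilov \<Omega>)) \<and>
      prob_space \<mu> \<and> K_invariant \<Omega> \<mu>)"

type_synonym ('d) fn = "complex^('d::finite) \<Rightarrow> complex"

inductive_set cpoly :: "('d::finite) fn set" where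
  const: "(\<lambda>z. c) \<in> cpoly"
| coord: "(\<lambda>z. z $ i) \<in> cpoly"
| add: "p \<in> cpoly \<Longrightarrow> q \<in> cpoly \<Longrightarrow> (\<lambda>z. p z + q z) \<in> cpoly"
| mult: "p \<in> cpoly \<Longrightarrow> q \<in> cpoly \<Longrightarrow> (\<lambda>z. p z * q z) \<in> cpoly"

definition L2 :: "(complex^'d) measure \<Rightarrow> 'd fn set" where
  "L2 \<mu> = {f. f \<in> borel_measurable \<mu> \<and> integrable \<mu> (\<lambda>x. (cmod (f x))\<^sup>2)}"

definition l2norm :: "(complex^'d) measure \<Rightarrow> 'd fn \<Rightarrow> real" where
  "l2norm \<mu> f = sqrt (\<integral>x. (cmod (f x))\<^sup>2 \<partial>\<mu>)"

definition ip :: "(complex^'d) measure \<Rightarrow> 'd fn \<Rightarrow> 'd fn \<Rightarrow> complex" where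
  "ip \<mu> f g = (\<integral>x. f x * cnj (g x) \<partial>\<mu>)"

definition H2 :: "(complex^'d) measure \<Rightarrow> 'd fn set" where
  "H2 \<mu> = {f \<in> L2 \<mu>. \<forall>\<epsilon>>0. \<exists>p\<in>cpoly. l2norm \<mu> (\<lambda>x. f x - p x) < \<epsilon>}"

definition H2perp :: "(complex^'d) measure \<Rightarrow> 'd fn set" where
  "H2perp \<mu> = {h \<in> L2 \<mu>. \<forall>f\<in>H2 \<mu>. ip \<mu> h f = 0}"

definition Qproj :: "(complex^'d) measure \<Rightarrow> 'd fn \<Rightarrow> 'd fn" where
  "Qproj \<mu> g = (SOME h. h \<in> H2perp \<mu> \<and> (\<lambda>x. g x - h x) \<in> H2 \<mu>)"

definition Linf :: "(complex^'d) measure \<Rightarrow> 'd fn set" where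
  "Linf \<mu> = {\<phi>. \<phi> \<in> borel_measurable \<mu> \<and> (\<exists>C. AE x in \<mu>. cmod (\<phi> x) \<le> C)}"

definition dualT :: "(complex^'d) measure \<Rightarrow> 'd fn \<Rightarrow> 'd fn \<Rightarrow> 'd fn" where
  "dualT \<mu> \<phi> h = Qproj \<mu> (\<lambda>x. \<phi> x * h x)"

definition adj :: "(complex^'d) measure \<Rightarrow> ('d fn \<Rightarrow> 'd fn) \<Rightarrow> 'd fn \<Rightarrow> 'd fn" where
  "adj \<mu> A h = (SOME k. k \<in> H2perp \<mu> \<and> (\<forall>g\<in>H2perp \<mu>. ip \<mu> (A g) h = ip \<mu> g k))"

text \<open>Bounded linear operator on H^2(S)^perp (elements = functions modulo a.e. equality).\<close>
definition bounded_op :: "(complex^'d) measure \<Rightarrow> ('d fn \<Rightarrow> 'd fn) \<Rightarrow> bool" where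
  "bounded_op \<mu> X \<longleftrightarrow>
     (\<forall>h\<in>H2perp \<mu>. X h \<in> H2perp \<mu>) \<and>
     (\<forall>h\<in>H2perp \<mu>. \<forall>k\<in>H2perp \<mu>. (AE x in \<mu>. h x = k x) \<longrightarrow> (AE x in \<mu>. X h x = X k x)) \<and>
     (\<forall>h\<in>H2perp \<mu>. \<forall>k\<in>H2perp \<mu>. AE x in \<mu>. X (\<lambda>y. h y + k y) x = X h x + X k x) \<and>
     (\<forall>c. \<forall>h\<in>H2perp \<mu>. AE x in \<mu>. X (\<lambda>y. c * h y) x = c * X h x) \<and>
     (\<exists>C. \<forall>h\<in>H2perp \<mu>. l2norm \<mu> (X h) \<le> C * l2norm \<mu> h)"

definition op_eq :: "(complex^'d) measure \<Rightarrow> ('d fn \<Rightarrow> 'd fn) \<Rightarrow> ('d fn \<Rightarrow> 'd fn) \<Rightarrow> bool" where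
  "op_eq \<mu> A B \<longleftrightarrow> (\<forall>h\<in>H2perp \<mu>. AE x in \<mu>. A h x = B h x)"

end

theory Submission
  imports Defs "HOL-Complex_Analysis.Complex_Analysis"
begin

text \<open>The Shilov boundary is the set \<open>S\<close> of all points of the closure with squared norm \<open>r\<close>: every other
  point of the closure is the centre of an affine analytic disc, and linear automorphisms act transitively on \<open>S\<close>.
  Elements of the stabilizer of \<open>0\<close> are linear, so the measure \<open>dz\<close> exists (push Lebesgue measure on the polar
  of \<open>S\<close> forward along the map to the almost everywhere unique maximizer) and is unique (balls of equal radius centred
  on \<open>S\<close> have equal measure).

  After that only the identity \<open>\<Sum> |z\<^sub>i|\<^sup>2 = r\<close> on \<open>S\<close> matters. The dual Toeplitz operator of the conjugate coordinate is
  plain multiplication, so with \<open>Q\<close> the projection onto the complement of the Hardy space the equation says that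
  \<open>\<langle>X Q f, Q g\<rangle>\<close> agrees on that complement with its image under
  \<open>Phi B (f, g) = (1 / r) \<Sum> B (cnj z\<^sub>i f, cnj z\<^sub>i g)\<close>. A cluster point of the Cesaro means of the iterates of \<open>Phi\<close>
  on this form is fixed by \<open>Phi\<close>; a bounded fixed point commutes with all coordinates and their conjugates, hence
  is multiplication by a bounded function, and its compression is \<open>X\<close>.\<close>

section \<open>Uniformly distributed measures\<close>

text \<open>The obstacle is that \<open>X\<close> lives on the complement of the Hardy space, which
  multiplication by \<open>cnj z\<^sub>i\<close> preserves but multiplication by
  \<open>z\<^sub>i\<close> in general does not, so commuting with all coordinates makes no sense
  there. \<open>X\<close> has to be lifted to all of \<open>L2\<close>. The lift exists because
  \<open>Phi\<close> does not expand bounded forms, a consequence of the sphere identity, and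
  because its iterates leave the form unchanged on the complement. Working with forms instead of
  operators turns weak compactness into compactness of a product of discs. The rank enters only as
  the squared radius of \<open>S\<close>: the coordinates of all four types are scaled so that
  minimal tripotents have norm 1, hence maximal ones have squared norm \<open>r\<close>. The
  geometric half therefore compares points by their Euclidean norm alone. The invariant measure is
  obtained without integrating over the group: a construction that involves only \<open>S\<close>
  and Lebesgue measure is automatically invariant under every linear symmetry of
  \<open>S\<close>.\<close>

text \<open>The mass of the pairs of points of \<open>U\<close> at distance below \<open>e k\<close>
  is computed in both orders. Integrating over \<open>N\<close> inside gives exactly
  \<open>n k\<close> for \<open>x\<close> in \<open>S \<inter> U\<close> once \<open>e k\<close> is
  small; integrating over \<open>M\<close> inside gives at most \<open>m k\<close>. After division
  by \<open>n k\<close>, Fatou's lemma yields the inequality.\<close>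

lemma open_measure_le_of_ball_ratio:
  fixes M N :: "'a::{metric_space,second_countable_topology} measure"
  assumes M: "prob_space M" "sets M = sets borel" and N: "prob_space N" "sets N = sets borel"
    and S: "emeasure M S = 1" "emeasure N S = 1" "S \<in> sets borel"
    and e: "e \<longlonglongrightarrow> (0::real)" "\<And>k::nat. 0 < e k"
    and m: "\<And>k x. x \<in> S \<Longrightarrow> emeasure M (ball x (e k)) = m k"
    and n: "\<And>k x. x \<in> S \<Longrightarrow> emeasure N (ball x (e k)) = n k"
    and pos: "\<And>k. n k > 0"
    and le: "\<And>k. m k \<le> c * n k"
    and U: "open U"
  shows "emeasure M U \<le> c * emeasure N U"
proof -
  interpret M: prob_space M by (rule M)
  interpret N: prob_space N by (rule N)
  interpret pair_sigma_finite M N ..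
  have [measurable]: "U \<in> sets borel" "S \<in> sets borel" using U S by auto
  have spM: "space M = UNIV" "space N = UNIV" using sets_eq_imp_space_eq[OF M(2)] sets_eq_imp_space_eq[OF N(2)] by simp_all
  have S0: "emeasure M (space M) = 1" "emeasure N (space N) = 1"
    using M.emeasure_space_1 N.emeasure_space_1 by auto
  have AEM: "AE x in M. x \<in> S"
    using S M by (intro M.AE_in_set_eq_1[THEN iffD2]) (auto simp: M.emeasure_eq_measure)
  have AEN: "AE x in N. x \<in> S"
    using S N by (intro N.AE_in_set_eq_1[THEN iffD2]) (auto simp: N.emeasure_eq_measure)
  have Sne: "S \<noteq> {}" using S by auto
  then obtain x0 where x0: "x0 \<in> S" by auto
  have nfin: "n k < \<infinity>" for k using n[OF x0, of k] N.emeasure_finite by (metis less_top infinity_ennreal_def)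
  have [measurable_cong]: "sets M = sets borel" "sets N = sets borel" using M N by auto
  have meas[measurable]: "(\<lambda>(x,y). indicator U x * indicator (ball x (e k) \<inter> U) y :: ennreal) \<in> borel_measurable (M \<Otimes>\<^sub>M N)" for k
  proof -
    have "(\<lambda>(x,y). indicator U x * indicator (ball x (e k) \<inter> U) y :: ennreal)
       = (\<lambda>p. indicator U (fst p) * (indicator {..<e k} (dist (fst p) (snd p)) * indicator U (snd p)))"
      by (auto simp: fun_eq_iff indicator_def)
    also have "\<dots> \<in> borel_measurable (M \<Otimes>\<^sub>M N)"
      by measurable
    finally show ?thesis .
  qed
  define F where "F k x = indicator U x * emeasure N (ball x (e k) \<inter> U)" for k x
  have Feq: "F k x = (\<integral>\<^sup>+y. indicator U x * indicator (ball x (e k) \<inter> U) y \<partial>N)" for k x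
  proof -
    have [simp]: "ball x (e k) \<inter> U \<in> sets N" using N(2) U by (simp add: open_Int)
    show ?thesis unfolding F_def by (subst nn_integral_cmult) (auto intro!: borel_measurable_indicator)
  qed
  have [measurable]: "F k \<in> borel_measurable M" for k
    
  proof -
    have "F k = (\<lambda>x. \<integral>\<^sup>+y. (\<lambda>(x,y). indicator U x * indicator (ball x (e k) \<inter> U) y) (x, y) \<partial>N)"
      by (rule ext) (simp only: Feq prod.case)
    then show ?thesis
      using N.borel_measurable_nn_integral_fst[OF meas[of k]] by (simp only:)
  qed
  have lim1: "1 = liminf (\<lambda>k. F k x / n k)" if "x \<in> S" "x \<in> U" for x
  proof -
    obtain d where d: "d > 0" "ball x d \<subseteq> U" using U \<open>x \<in> U\<close> openE by metis
    have "eventually (\<lambda>k. e k < d) sequentially" using e(1) d(1) by (auto simp: order_tendsto_iff)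
    then have "eventually (\<lambda>k. F k x / n k = 1) sequentially"
    proof eventually_elim
      case (elim k)
      then have "ball x (e k) \<inter> U = ball x (e k)" using d by auto
      then have "F k x = n k" using n[OF that(1)] that by (simp add: F_def)
      then show ?case using pos[of k] nfin[of k] by (simp add: ennreal_divide_self)
    qed
    then have "(\<lambda>k. F k x / n k) \<longlonglongrightarrow> 1" by (rule tendsto_eventually)
    then show ?thesis by (simp add: lim_imp_Liminf)
  qed
  have int: "(\<integral>\<^sup>+x. F k x \<partial>M) \<le> m k * emeasure N U" for k
  proof -
    have "(\<integral>\<^sup>+x. F k x \<partial>M) = (\<integral>\<^sup>+x. (\<integral>\<^sup>+y. indicator U x * indicator (ball x (e k) \<inter> U) y \<partial>N) \<partial>M)"
      by (simp only: Feq)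
    also have "\<dots> = (\<integral>\<^sup>+y. (\<integral>\<^sup>+x. indicator U x * indicator (ball x (e k) \<inter> U) y \<partial>M) \<partial>N)"
      by (rule Fubini'[symmetric, OF meas])
    also have "\<dots> \<le> (\<integral>\<^sup>+y. m k * indicator U y \<partial>N)"
    proof (rule nn_integral_mono_AE, use AEN in eventually_elim)
      fix y assume y: "y \<in> S"
      have "(\<integral>\<^sup>+x. indicator U x * indicator (ball x (e k) \<inter> U) y \<partial>M)
        \<le> (\<integral>\<^sup>+x. indicator U y * indicator (ball y (e k)) x \<partial>M)"
        by (intro nn_integral_mono) (auto simp: indicator_def dist_commute)
      also have "\<dots> = indicator U y * m k"
        using M(2) m[OF y] by (subst nn_integral_cmult) (auto intro!: borel_measurable_indicator)
      finally show "(\<integral>\<^sup>+x. indicator U x * indicator (ball x (e k) \<inter> U) y \<partial>M) \<le> m k * indicator U y"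
        by (simp add: mult.commute)
    qed
    also have "\<dots> = m k * emeasure N U"
      using N(2) U by (subst nn_integral_cmult) (auto intro!: borel_measurable_indicator)
    finally show ?thesis .
  qed
  have "emeasure M U = (\<integral>\<^sup>+x. indicator U x \<partial>M)" using M by simp
  also have "\<dots> \<le> (\<integral>\<^sup>+x. liminf (\<lambda>k. F k x / n k) \<partial>M)"
    by (rule nn_integral_mono_AE, use AEM in eventually_elim) (auto simp: indicator_def lim1[symmetric])
  also have "\<dots> \<le> liminf (\<lambda>k. \<integral>\<^sup>+x. F k x / n k \<partial>M)"
    by (rule nn_integral_liminf) measurable
  also have "\<dots> \<le> liminf (\<lambda>k. c * emeasure N U)"
  proof (rule Liminf_mono, rule always_eventually, rule allI)
    fix k
    have "(\<integral>\<^sup>+x. F k x / n k \<partial>M) = (\<integral>\<^sup>+x. F k x \<partial>M) / n k"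
      by (rule nn_integral_divide) measurable
    also have "\<dots> \<le> (c * n k * emeasure N U) / n k"
      by (intro divide_right_mono_ennreal order_trans[OF int] mult_right_mono le) auto
    also have "\<dots> = c * emeasure N U"
    proof -
      have "c * n k * emeasure N U = (c * emeasure N U) * n k" by (simp only: mult_ac)
      then show ?thesis using pos[of k] nfin[of k] by (simp add: ennreal_mult_divide_eq)
    qed
    finally show "(\<integral>\<^sup>+x. F k x / n k \<partial>M) \<le> c * emeasure N U" .
  qed
  also have "\<dots> = c * emeasure N U" by (simp add: Liminf_const)
  finally show ?thesis .
qed

text \<open>Convergence of the quotient of the ball masses of \<open>M\<close> and \<open>N\<close>
  is not known in advance. If it stayed below some \<open>c < 1\<close> along radii tending to 0,
  the preceding comparison on the whole space would give \<open>1 \<le> c\<close>. So it is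
  eventually at least \<open>c\<close>, and the comparison with exchanged measures gives the claim
  up to the factor \<open>1 / c\<close>, which tends to 1.\<close>

lemma uniformly_distributed_open_le:
  fixes M N :: "'a::{metric_space,second_countable_topology} measure"
  assumes M: "prob_space M" "sets M = sets borel" and N: "prob_space N" "sets N = sets borel"
    and S: "emeasure M S = 1" "emeasure N S = 1" "compact S"
    and m: "\<And>r x y. x \<in> S \<Longrightarrow> y \<in> S \<Longrightarrow> emeasure M (ball x r) = emeasure M (ball y r)"
    and n: "\<And>r x y. x \<in> S \<Longrightarrow> y \<in> S \<Longrightarrow> emeasure N (ball x r) = emeasure N (ball y r)"
    and U: "open U"
  shows "emeasure N U \<le> emeasure M U"
proof -
  interpret M: prob_space M by (rule M)
  interpret N: prob_space N by (rule N)
  have SB: "S \<in> sets borel" using S by (simp add: compact_imp_closed)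
  have Sne: "S \<noteq> {}" using S by auto
  then obtain x0 where x0: "x0 \<in> S" by auto
  \<comment> \<open>Finitely many balls of radius \<open>r\<close> centred on \<open>S\<close> cover
    \<open>S\<close> and have equal mass, so that mass cannot vanish.\<close>
  have pos: "0 < emeasure L (ball x0 r)" if "r > 0" "prob_space L" "sets L = sets borel" "emeasure L S = 1"
    and eq: "\<And>r x y. x \<in> S \<Longrightarrow> y \<in> S \<Longrightarrow> emeasure L (ball x r) = emeasure L (ball y r)" for L r
  proof (rule ccontr)
    assume "\<not> ?thesis"
    then have z: "emeasure L (ball x r) = 0" if "x \<in> S" for x using eq[OF that x0, of r] by (simp add: not_gr_zero)
    obtain C where C: "finite C" "C \<subseteq> S" "S \<subseteq> (\<Union>x\<in>C. ball x r)"
    proof (rule compactE_image[OF S(3), of S "\<lambda>x. ball x r"])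
      show "S \<subseteq> (\<Union>x\<in>S. ball x r)" using \<open>r > 0\<close> by auto
    qed auto
    have "emeasure L S \<le> emeasure L (\<Union>x\<in>C. ball x r)"
      using C that(3) by (intro emeasure_mono) auto
    also have "\<dots> \<le> (\<Sum>x\<in>C. emeasure L (ball x r))"
      using C that(3) by (intro emeasure_subadditive_finite) auto
    also have "\<dots> = 0" using z C by (intro sum.neutral) auto
    finally show False using that by simp
  qed
  have ev: "\<exists>d>0. \<forall>r. 0 < r \<and> r < d \<longrightarrow> ennreal c * emeasure N (ball x0 r) \<le> emeasure M (ball x0 r)"
    if c: "0 < c" "c < 1" for c
  proof (rule ccontr)
    assume "\<not> ?thesis"
    then have "\<forall>k. \<exists>r. 0 < r \<and> r < 1 / real (Suc k) \<and> \<not> ennreal c * emeasure N (ball x0 r) \<le> emeasure M (ball x0 r)"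
      by (metis of_nat_0_less_iff zero_less_Suc zero_less_divide_1_iff)
    then obtain e where e: "\<And>k. 0 < e k" "\<And>k. e k < 1 / real (Suc k)"
      "\<And>k. \<not> ennreal c * emeasure N (ball x0 (e k)) \<le> emeasure M (ball x0 (e k))" by metis
    have le: "emeasure M (ball x0 (e k)) \<le> ennreal c * emeasure N (ball x0 (e k))" for k
      using e(3)[of k] by (simp add: not_le less_imp_le)
    have "norm (e k) \<le> inverse (real (Suc k))" for k
      using e(1,2)[of k] by (simp add: inverse_eq_divide)
    then have elim: "e \<longlonglongrightarrow> 0"
      by (intro Lim_null_comparison[OF always_eventually LIMSEQ_inverse_real_of_nat] allI)
    have "emeasure M UNIV \<le> ennreal c * emeasure N UNIV"
      by (rule open_measure_le_of_ball_ratio[OF M N S(1,2) SB elim e(1), where m="\<lambda>k. emeasure M (ball x0 (e k))"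
            and n="\<lambda>k. emeasure N (ball x0 (e k))"]; (rule m[OF _ x0] n[OF _ x0] pos[OF e(1) N S(2) n] le open_UNIV; assumption?))
    moreover have "emeasure M UNIV = 1" "emeasure N UNIV = 1"
      using M.emeasure_space_1 N.emeasure_space_1 sets_eq_imp_space_eq[OF M(2)] sets_eq_imp_space_eq[OF N(2)]
    by simp_all
    ultimately show False using c by (simp add: ennreal_ge_1)
  qed
  have *: "emeasure N U \<le> ennreal (1/c) * emeasure M U" if c: "0 < c" "c < 1" for c
  proof -
    obtain d where d: "d > 0" "\<And>r. 0 < r \<Longrightarrow> r < d \<Longrightarrow> ennreal c * emeasure N (ball x0 r) \<le> emeasure M (ball x0 r)"
      using ev[OF c] by auto
    define e where "e k = d / real (Suc (Suc k))" for k
    have e: "0 < e k" "e k < d" for k using d by (auto simp: e_def field_simps intro: add_pos_nonneg)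
    have elim: "e \<longlonglongrightarrow> 0" unfolding e_def
      using LIMSEQ_Suc[OF LIMSEQ_Suc[OF lim_const_over_n[of d]]] by simp
    have le: "emeasure N (ball x0 (e k)) \<le> ennreal (1/c) * emeasure M (ball x0 (e k))" for k
    proof -
      have "emeasure N (ball x0 (e k)) = ennreal (1/c) * (ennreal c * emeasure N (ball x0 (e k)))"
        using c by (simp add: mult.assoc[symmetric] ennreal_mult[symmetric])
      also have "\<dots> \<le> ennreal (1/c) * emeasure M (ball x0 (e k))"
        using d(2)[OF e] by (intro mult_left_mono) auto
      finally show ?thesis .
    qed
    show ?thesis
      by (rule open_measure_le_of_ball_ratio[OF N M S(2,1) SB elim e(1), where m="\<lambda>k. emeasure N (ball x0 (e k))"
            and n="\<lambda>k. emeasure M (ball x0 (e k))"]; (rule m[OF _ x0] n[OF _ x0] pos[OF e(1) M S(1) m] le U; assumption?))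
  qed
  have real: "measure N U \<le> (1/c) * measure M U" if c: "0 < c" "c < 1" for c
    using *[OF c] c by (simp add: M.emeasure_eq_measure N.emeasure_eq_measure ennreal_mult[symmetric])
  have "c * measure N U \<le> measure M U" if c: "0 < c" "c < 1" for c
    using real[OF c] c by (simp add: field_simps)
  then have "measure N U \<le> measure M U"
    using field_le_mult_one_interval by blast
  then show ?thesis by (simp add: M.emeasure_eq_measure N.emeasure_eq_measure)
qed

lemma uniformly_distributed_unique:
  fixes M N :: "'a::{metric_space,second_countable_topology} measure"
  assumes M: "prob_space M" "sets M = sets borel" and N: "prob_space N" "sets N = sets borel"
    and S: "emeasure M S = 1" "emeasure N S = 1" "compact S"
    and m: "\<And>r x y. x \<in> S \<Longrightarrow> y \<in> S \<Longrightarrow> emeasure M (ball x r) = emeasure M (ball y r)"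
    and n: "\<And>r x y. x \<in> S \<Longrightarrow> y \<in> S \<Longrightarrow> emeasure N (ball x r) = emeasure N (ball y r)"
  shows "M = N"
proof (rule measure_eqI_generator_eq[where E="{U. open U}" and \<Omega>=UNIV and A="\<lambda>_. UNIV"])
  show "Int_stable {U::'a set. open U}" by (auto simp: Int_stable_def)
  show "sets M = sigma_sets UNIV {U. open U}" "sets N = sigma_sets UNIV {U. open U}"
    using M N by (auto simp: borel_def)
  fix U :: "'a set" assume "U \<in> {U. open U}"
  then have U: "open U" by simp
  show "emeasure M U = emeasure N U"
    by (rule antisym; rule uniformly_distributed_open_le[OF _ _ _ _ _ _ S(3) _ _ U]) (use assms in blast)+
next
  show "emeasure M UNIV \<noteq> \<infinity>" 
    using prob_space.finite_measure[OF M(1)] by (simp add: finite_measure.emeasure_finite)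
qed auto

section \<open>Measures invariant under linear symmetries of a compact set\<close>

text \<open>A translation-invariant measure is determined by one set of finite positive measure; this is
  applied to the image of Lebesgue measure.\<close>
lemma distr_lborel_linear_eq_lborel:
  fixes M :: "'a::euclidean_space \<Rightarrow> 'a"
  assumes M: "linear M" "bij M" and A: "A \<in> sets borel" "emeasure lborel A \<noteq> 0" "emeasure lborel A \<noteq> \<infinity>"
    and MA: "M ` A = A" and sym: "uminus ` A = A"
  shows "distr lborel borel M = (lborel :: 'a measure)"
proof -
  define \<nu> where "\<nu> = distr lborel borel M"
  note [measurable] = A(1)
  have contM: "continuous_on UNIV M" using M(1) by (simp add: linear_continuous_on linear_linear)
  have [measurable]: "M \<in> borel_measurable borel" using contM by (rule borel_measurable_continuous_onI)
  have [simp]: "sets \<nu> = sets borel" "space \<nu> = UNIV" by (auto simp: \<nu>_def)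
  have [measurable_cong]: "sets \<nu> = sets borel" by simp
  have lM: "linear (inv M)" using M by (simp add: bij_is_inj bij_is_surj linear_injective_imp_surjective inj_linear_imp_inv_linear)
  have nuA: "emeasure \<nu> A = emeasure lborel A"
  proof -
    have "M -` A = A" using MA M(2) by (metis bij_is_inj inj_vimage_image_eq)
    then show ?thesis by (simp add: \<nu>_def emeasure_distr)
  qed
  have sf: "sigma_finite_measure \<nu>"
  proof
    show "\<exists>C. countable C \<and> C \<subseteq> sets \<nu> \<and> \<Union>C = space \<nu> \<and> (\<forall>a\<in>C. emeasure \<nu> a \<noteq> \<infinity>)"
    proof (intro exI conjI ballI)
      show "countable (range (\<lambda>n::nat. cball (0::'a) n))" by simp
      show "range (\<lambda>n::nat. cball (0::'a) n) \<subseteq> sets \<nu>" by auto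
      show "\<Union> (range (\<lambda>n::nat. cball (0::'a) n)) = space \<nu>" by (auto simp: real_arch_simple)
      fix a :: "'a set" assume "a \<in> range (\<lambda>n::nat. cball (0::'a) n)"
      then obtain n :: nat where a: "a = cball 0 n" by auto
      have "bounded (inv M ` a)" unfolding a using lM by (intro bounded_linear_image) (auto simp: linear_linear)
      moreover have "M -` a = inv M ` a" using M(2) by (simp add: bij_vimage_eq_inv_image)
      ultimately have "bounded (M -` a)" by simp
      then show "emeasure \<nu> a \<noteq> \<infinity>"
        using emeasure_bounded_finite by (fastforce simp: \<nu>_def emeasure_distr a)
    qed
  qed
  then interpret nu: sigma_finite_measure \<nu> .
  interpret pair_sigma_finite lborel \<nu> ..
  \<comment> \<open>\<open>M\<close> intertwines translation by \<open>inv M x\<close> with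
    translation by \<open>x\<close>, so the image measure inherits translation invariance from
    Lebesgue measure.\<close>
  have trans: "distr \<nu> borel (\<lambda>y. x + y) = \<nu>" for x
  proof -
    have "M (inv M x + y) = x + M y" for y
      using M by (simp add: linear_add bij_is_surj surj_f_inv_f)
    then have "(\<lambda>y. x + y) \<circ> M = M \<circ> (\<lambda>y. inv M x + y)" by (auto simp: fun_eq_iff)
    then have "distr \<nu> borel (\<lambda>y. x + y) = distr (distr lborel borel ((+) (inv M x))) borel M"
      unfolding \<nu>_def by (simp add: distr_distr)
    then show ?thesis unfolding \<nu>_def by (simp add: lborel_distr_plus)
  qed
  show ?thesis
  proof (rule measure_eqI)
    fix C assume "C \<in> sets (distr lborel borel M)"
    then have C[measurable]: "C \<in> sets borel" by simp
    \<comment> \<open>Integrating \<open>indicator A x * indicator C (x + y)\<close> in both orders,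
      with translation invariance of each measure and \<open>A = - A\<close>, shows that
      \<open>lborel A * \<nu> C = \<nu> A * lborel C\<close>. Since the two measures agree on
      \<open>A\<close>, they agree on \<open>C\<close>.\<close>
    have "emeasure lborel A * emeasure \<nu> C = (\<integral>\<^sup>+x. indicator A x * emeasure \<nu> C \<partial>lborel)"
      by (subst nn_integral_multc) auto
    also have "\<dots> = (\<integral>\<^sup>+x. (\<integral>\<^sup>+y. indicator A x * indicator C (x + y) \<partial>\<nu>) \<partial>lborel)"
    proof (rule nn_integral_cong)
      fix x
      have "emeasure \<nu> C = emeasure (distr \<nu> borel (\<lambda>y. x + y)) C" by (simp add: trans)
      also have "\<dots> = (\<integral>\<^sup>+y. indicator C y \<partial>distr \<nu> borel (\<lambda>y. x + y))"
        by (subst nn_integral_indicator) auto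
      also have "\<dots> = (\<integral>\<^sup>+y. indicator C (x + y) \<partial>\<nu>)"
        by (subst nn_integral_distr) auto
      finally show "indicator A x * emeasure \<nu> C = (\<integral>\<^sup>+y. indicator A x * indicator C (x + y) \<partial>\<nu>)"
        by (subst nn_integral_cmult) auto
    qed
    also have "\<dots> = (\<integral>\<^sup>+y. (\<integral>\<^sup>+x. indicator A x * indicator C (x + y) \<partial>lborel) \<partial>\<nu>)"
      by (rule Fubini'[symmetric]) measurable
    also have "\<dots> = (\<integral>\<^sup>+y. (\<integral>\<^sup>+x. indicator A (x - y) * indicator C x \<partial>lborel) \<partial>\<nu>)"
    proof (rule nn_integral_cong)
      fix y
      have "(\<integral>\<^sup>+x. indicator A x * indicator C (x + y) \<partial>lborel)
         = (\<integral>\<^sup>+x. indicator A (y + x - y) * indicator C (y + x) \<partial>lborel)"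
        by (simp add: add.commute)
      also have "\<dots> = (\<integral>\<^sup>+x. indicator A (x - y) * indicator C x \<partial>distr lborel borel ((+) y))"
        by (subst nn_integral_distr) auto
      finally show "(\<integral>\<^sup>+x. indicator A x * indicator C (x + y) \<partial>lborel) =
          (\<integral>\<^sup>+x. indicator A (x - y) * indicator C x \<partial>lborel)"
        by (simp only: lborel_distr_plus)
    qed
    also have "\<dots> = (\<integral>\<^sup>+x. (\<integral>\<^sup>+y. indicator A (x - y) * indicator C x \<partial>\<nu>) \<partial>lborel)"
      by (rule Fubini') measurable
    also have "\<dots> = (\<integral>\<^sup>+x. emeasure \<nu> A * indicator C x \<partial>lborel)"
    proof (rule nn_integral_cong)
      fix x
      have A': "x - y \<in> A \<longleftrightarrow> y - x \<in> A" for y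
        using sym by (metis image_eqI minus_diff_eq)
      have "(\<integral>\<^sup>+y. indicator A (x - y) * indicator C x \<partial>\<nu>) = (\<integral>\<^sup>+y. indicator A (y - x) * indicator C x \<partial>distr \<nu> borel (\<lambda>y. x + y))"
        using A' by (auto simp: trans indicator_def intro!: nn_integral_cong)
      also have "\<dots> = (\<integral>\<^sup>+y. indicator A y * indicator C x \<partial>\<nu>)"
        by (subst nn_integral_distr) auto
      also have "\<dots> = emeasure \<nu> A * indicator C x"
        by (subst nn_integral_multc) auto
      finally show "(\<integral>\<^sup>+y. indicator A (x - y) * indicator C x \<partial>\<nu>) = emeasure \<nu> A * indicator C x" .
    qed
    also have "\<dots> = emeasure lborel A * emeasure lborel C"
      by (subst nn_integral_cmult) (auto simp: nuA)
    finally show "emeasure (distr lborel borel M) C = emeasure lborel C"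
      using A(2,3) by (simp add: \<nu>_def ennreal_mult_cancel_left)
  qed simp
qed

section \<open>Almost everywhere uniqueness of maximizers of linear functionals\<close>

text \<open>All translates of \<open>N\<close> along \<open>b\<close> have the measure of
  \<open>N\<close>; averaging over \<open>t\<close> in the unit interval and exchanging the
  integrals reduces this measure to one-dimensional slices, which are countable.\<close>

lemma null_set_if_lines_countable:
  fixes N :: "'a::euclidean_space set"
  assumes N: "N \<in> sets borel" and c: "\<And>z. countable {t::real. z + t *\<^sub>R b \<in> N}"
  shows "emeasure lborel N = 0"
proof -
  note [measurable] = N
  have [measurable]: "(\<lambda>p. fst p + snd p *\<^sub>R b) \<in> (lborel :: 'a measure) \<Otimes>\<^sub>M (lborel :: real measure) \<rightarrow>\<^sub>M borel"
    by measurable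
  have m: "(\<lambda>(z,t). indicator N (z + t *\<^sub>R b) * indicator {0..1} t :: ennreal)
     \<in> borel_measurable ((lborel :: 'a measure) \<Otimes>\<^sub>M (lborel :: real measure))"
    by measurable
  have "emeasure lborel N = (\<integral>\<^sup>+t. emeasure lborel N * indicator {0..1::real} t \<partial>lborel)"
    by (subst nn_integral_cmult) auto
  also have "\<dots> = (\<integral>\<^sup>+t. (\<integral>\<^sup>+z. indicator N (z + t *\<^sub>R b) * indicator {0..1} t \<partial>lborel) \<partial>lborel)"
  proof (rule nn_integral_cong)
    fix t :: real
    have "emeasure lborel N = (\<integral>\<^sup>+z. indicator N z \<partial>lborel)" by simp
    also have "\<dots> = (\<integral>\<^sup>+z. indicator N z \<partial>distr lborel borel ((+) (t *\<^sub>R b)))"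
      by (simp only: lborel_distr_plus)
    also have "\<dots> = (\<integral>\<^sup>+z. indicator N (t *\<^sub>R b + z) \<partial>lborel)"
      by (subst nn_integral_distr) auto
    finally show "emeasure lborel N * indicator {0..1} t = (\<integral>\<^sup>+z. indicator N (z + t *\<^sub>R b) * indicator {0..1} t \<partial>lborel)"
      by (subst nn_integral_multc) (auto simp: add.commute)
  qed
  also have "\<dots> = (\<integral>\<^sup>+z. (\<integral>\<^sup>+t. indicator N (z + t *\<^sub>R b) * indicator {0..1} t \<partial>lborel) \<partial>lborel)"
    by (rule lborel_pair.Fubini'[OF m])
  also have "\<dots> = (\<integral>\<^sup>+(z::'a). 0 \<partial>lborel)"
  proof (rule nn_integral_cong)
    fix z
    have "(\<integral>\<^sup>+t. indicator N (z + t *\<^sub>R b) * indicator {0..1} t \<partial>lborel)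
       \<le> (\<integral>\<^sup>+t. indicator {t. z + t *\<^sub>R b \<in> N} t \<partial>lborel)"
      by (intro nn_integral_mono) (auto simp: indicator_def)
    also have "\<dots> = emeasure lborel {t. z + t *\<^sub>R b \<in> N}"
      using c[of z] by (intro nn_integral_indicator) (simp add: countable_imp_null_set_lborel null_setsD2)
    also have "\<dots> = 0" using c by (rule emeasure_lborel_countable)
    finally show "(\<integral>\<^sup>+t. indicator N (z + t *\<^sub>R b) * indicator {0..1} t \<partial>lborel) = 0" by simp
  qed
  finally show ?thesis by simp
qed

text \<open>Maximizers are the subgradients at \<open>z\<close>, lying in \<open>S\<close>, of the
  support function of \<open>S\<close>. Their uniqueness almost everywhere is the almost everywhere
  differentiability of that convex function.\<close>

definition maximizer :: "'a::euclidean_space set \<Rightarrow> 'a \<Rightarrow> 'a \<Rightarrow> bool" where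
  "maximizer S z s \<longleftrightarrow> s \<in> S \<and> (\<forall>t\<in>S. t \<bullet> z \<le> s \<bullet> z)"

text \<open>The relation between \<open>s\<close> and \<open>z\<close> is closed and
  \<open>s\<close> ranges over a compact set, so projecting to \<open>z\<close> keeps it closed.
  This is what later makes the choice of a maximizer measurable.\<close>

lemma closed_maximizers:
  assumes "compact S" "closed C"
  shows "closed {z. \<exists>s\<in>C. maximizer S z s}"
proof -
  have "closed {z. \<exists>s. s \<in> S \<inter> C \<and> (s, z) \<in> {p. \<forall>t\<in>S. t \<bullet> snd p \<le> fst p \<bullet> snd p}}"
  proof (rule closed_compact_projection)
    show "compact (S \<inter> C)" using assms by (simp add: compact_Int_closed)
    have "{p. \<forall>t\<in>S. t \<bullet> snd p \<le> fst p \<bullet> snd p} = (\<Inter>t\<in>S. {p. t \<bullet> snd p \<le> fst p \<bullet> snd p})" by auto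
    also have "closed \<dots>" by (intro closed_INT ballI closed_Collect_le continuous_intros)
    finally show "closed {p. \<forall>t\<in>S. t \<bullet> snd p \<le> fst p \<bullet> snd p}" .
  qed
  also have "{z. \<exists>s. s \<in> S \<inter> C \<and> (s, z) \<in> {p. \<forall>t\<in>S. t \<bullet> snd p \<le> fst p \<bullet> snd p}} = {z. \<exists>s\<in>C. maximizer S z s}"
    by (auto simp: maximizer_def)
  finally show ?thesis .
qed

lemma closed_two_maximizers:
  assumes "compact S"
  shows "closed {z. \<exists>s s'. maximizer S z s \<and> maximizer S z s' \<and> s \<bullet> b + e \<le> s' \<bullet> b}"
proof -
  let ?F = "{p. (\<forall>t\<in>S. t \<bullet> snd p \<le> fst (fst p) \<bullet> snd p \<and> t \<bullet> snd p \<le> snd (fst p) \<bullet> snd p) \<and>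
     fst (fst p) \<bullet> b + e \<le> snd (fst p) \<bullet> b}"
  have "closed {z. \<exists>s. s \<in> S \<times> S \<and> (s, z) \<in> ?F}"
  proof (rule closed_compact_projection)
    show "compact (S \<times> S)" using assms by (rule compact_Times[OF _ assms])
    have "?F = (\<Inter>t\<in>S. {p. t \<bullet> snd p \<le> fst (fst p) \<bullet> snd p} \<inter> {p. t \<bullet> snd p \<le> snd (fst p) \<bullet> snd p}) \<inter> {p. fst (fst p) \<bullet> b + e \<le> snd (fst p) \<bullet> b}"
      by auto
    also have "closed \<dots>" by (intro closed_Int closed_INT ballI closed_Collect_le continuous_intros)
    finally show "closed ?F" .
  qed
  also have "{z. \<exists>s. s \<in> S \<times> S \<and> (s, z) \<in> ?F} = {z. \<exists>s s'. maximizer S z s \<and> maximizer S z s' \<and> s \<bullet> b + e \<le> s' \<bullet> b}"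
    by (auto simp: maximizer_def)
  finally show ?thesis .
qed

text \<open>Subgradients of a convex function are monotone along a line: add the two maximality
  inequalities.\<close>

lemma maximizer_monotone:
  assumes "maximizer S (z + t *\<^sub>R b) s" "maximizer S (z + t' *\<^sub>R b) s'" "t < t'"
  shows "s \<bullet> b \<le> s' \<bullet> b"
proof -
  have "s' \<bullet> (z + t *\<^sub>R b) \<le> s \<bullet> (z + t *\<^sub>R b)" "s \<bullet> (z + t' *\<^sub>R b) \<le> s' \<bullet> (z + t' *\<^sub>R b)"
    using assms by (auto simp: maximizer_def)
  then have "(t' - t) * (s \<bullet> b) \<le> (t' - t) * (s' \<bullet> b)"
    by (simp add: inner_add_right algebra_simps)
  then show ?thesis using assms(3) by simp
qed

text \<open>Two maximizers that differ in the direction \<open>b\<close> span an open interval of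
  values \<open>s \<bullet> b\<close>. Along a line parallel to \<open>b\<close> the intervals of
  different points are disjoint by monotonicity, so each holds its own rational and only countably
  many such points exist.\<close>

lemma non_unique_maximizer_null:
  fixes S :: "'a::euclidean_space set"
  assumes "compact S"
  defines "N \<equiv> {z. \<exists>s s'. maximizer S z s \<and> maximizer S z s' \<and> s \<noteq> s'}"
  shows "N \<in> sets borel" "emeasure lborel N = 0"
proof -
  define Nb where "Nb b = {z. \<exists>s s'. maximizer S z s \<and> maximizer S z s' \<and> s \<bullet> b < s' \<bullet> b}" for b
  \<comment> \<open>A strict gap is not a closed condition; a gap of at least
    \<open>1 / (k + 1)\<close> is, which exhibits \<open>Nb b\<close> as a countable union of closed
    sets.\<close>
  have "Nb b = (\<Union>k::nat. {z. \<exists>s s'. maximizer S z s \<and> maximizer S z s' \<and> s \<bullet> b + inverse (Suc k) \<le> s' \<bullet> b})" for b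
  proof (intro set_eqI iffI)
    fix z assume "z \<in> Nb b"
    then obtain s s' where s: "maximizer S z s" "maximizer S z s'" "s \<bullet> b < s' \<bullet> b" by (auto simp: Nb_def)
    then obtain k where "inverse (real (Suc k)) < s' \<bullet> b - s \<bullet> b"
      using reals_Archimedean[of "s' \<bullet> b - s \<bullet> b"] by auto
    then have "s \<bullet> b + inverse (Suc k) \<le> s' \<bullet> b" by simp
    then show "z \<in> (\<Union>k::nat. {z. \<exists>s s'. maximizer S z s \<and> maximizer S z s' \<and> s \<bullet> b + inverse (Suc k) \<le> s' \<bullet> b})"
      using s by blast
  next
    fix z assume "z \<in> (\<Union>k::nat. {z. \<exists>s s'. maximizer S z s \<and> maximizer S z s' \<and> s \<bullet> b + inverse (Suc k) \<le> s' \<bullet> b})"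
    then obtain k :: nat and s s' where s: "maximizer S z s" "maximizer S z s'" "s \<bullet> b + inverse (Suc k) \<le> s' \<bullet> b" by blast
    have "0 < inverse (real (Suc k))" by simp
    then have "s \<bullet> b < s' \<bullet> b" using s(3) by linarith
    then show "z \<in> Nb b" using s by (auto simp: Nb_def)
  qed
  then have meas: "Nb b \<in> sets borel" for b
    using closed_two_maximizers[OF assms(1)] by (auto intro!: sets.countable_UN)
  have null: "emeasure lborel (Nb b) = 0" for b
  proof (rule null_set_if_lines_countable[OF meas])
    fix z
    let ?T = "{t::real. z + t *\<^sub>R b \<in> Nb b}"
    have "\<forall>t\<in>?T. \<exists>q s s'. maximizer S (z + t *\<^sub>R b) s \<and> maximizer S (z + t *\<^sub>R b) s' \<and> s \<bullet> b < q \<and> q < s' \<bullet> b \<and> q \<in> \<rat>"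
      using Rats_dense_in_real unfolding Nb_def by blast
    then obtain q where q: "\<And>t. t \<in> ?T \<Longrightarrow> \<exists>s s'. maximizer S (z + t *\<^sub>R b) s \<and> maximizer S (z + t *\<^sub>R b) s' \<and> s \<bullet> b < q t \<and> q t < s' \<bullet> b \<and> q t \<in> \<rat>"
      by metis
    have less: "q t < q t'" if "t \<in> ?T" "t' \<in> ?T" "t < t'" for t t'
      using q[OF that(1)] q[OF that(2)] maximizer_monotone[OF _ _ that(3), of S z b] by fastforce
    have "inj_on q ?T"
    proof (rule linorder_inj_onI)
      fix x y assume "x < y" "x \<in> ?T" "y \<in> ?T"
      then show "q x \<noteq> q y" using less[of x y] by simp
    qed linarith
    moreover have "q ` ?T \<subseteq> \<rat>" using q by blast
    then have "countable (q ` ?T)" using countable_rat countable_subset by blast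
    ultimately show "countable ?T" using countable_image_inj_on by blast
  qed
  have eq: "N = (\<Union>b\<in>Basis. Nb b)"
  proof (intro set_eqI iffI)
    fix z assume "z \<in> N"
    then obtain s s' where s: "maximizer S z s" "maximizer S z s'" "s \<noteq> s'" by (auto simp: N_def)
    then obtain b where b: "b \<in> Basis" "s \<bullet> b \<noteq> s' \<bullet> b" using euclidean_eqI by blast
    then show "z \<in> (\<Union>b\<in>Basis. Nb b)" using s unfolding Nb_def by (cases "s \<bullet> b < s' \<bullet> b") force+
  qed (auto simp: N_def Nb_def)
  show "N \<in> sets borel" unfolding eq using meas by (intro sets.finite_UN) auto
  have "N \<in> null_sets lborel"
    unfolding eq using meas null by (intro null_sets_UN') (auto simp: null_sets_def countable_finite)
  then show "emeasure lborel N = 0" by auto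
qed

text \<open>The maximizer map is natural: for a linear symmetry \<open>L\<close> of \<open>S\<close>
  the adjoint \<open>M\<close> preserves the polar \<open>A\<close>, hence normalized Lebesgue
  measure on it, and \<open>\<pi> z = L (\<pi> (M z))\<close> almost everywhere. So the image of
  that measure under \<open>\<pi>\<close> is invariant under every such \<open>L\<close> at
  once.\<close>

lemma exists_linear_invariant_measure:
  fixes S :: "'a::euclidean_space set"
  assumes S: "compact S" "S \<noteq> {}" "uminus ` S = S"
    and bd: "bounded {z. \<forall>s\<in>S. s \<bullet> z \<le> 1}"
  shows "\<exists>\<mu>. prob_space \<mu> \<and> sets \<mu> = sets borel \<and> emeasure \<mu> S = 1 \<and>
    (\<forall>L. linear L \<and> bij L \<and> L ` S = S \<longrightarrow> distr \<mu> borel L = \<mu>)"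
proof -
  define A where "A = {z. \<forall>s\<in>S. s \<bullet> z \<le> 1}"
  define N where "N = {z. \<exists>s s'. maximizer S z s \<and> maximizer S z s' \<and> s \<noteq> s'}"
  note N = non_unique_maximizer_null[OF S(1), folded N_def]
  obtain s0 where s0: "s0 \<in> S" using S by auto
  have ex: "\<exists>s. maximizer S z s" for z
  proof -
    have "continuous_on S (\<lambda>s. s \<bullet> z)" by (intro continuous_intros)
    then show ?thesis
      using continuous_attains_sup[OF S(1,2), of "\<lambda>s. s \<bullet> z"] unfolding maximizer_def by blast
  qed
  \<comment> \<open>On the null set of non-unique maximizers a fixed point \<open>s0\<close> of
    \<open>S\<close> is used, so that \<open>\<pi>\<close> takes all its values in \<open>S\<close>
    and is still Borel.\<close>
  define \<pi> where "\<pi> z = (if z \<in> N then s0 else THE s. maximizer S z s)" for z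
  have pi1: "maximizer S z s \<longleftrightarrow> s = \<pi> z" if "z \<notin> N" for z s
  proof -
    obtain s1 where s1: "maximizer S z s1" using ex by auto
    have u: "s' = s1" if "maximizer S z s'" for s' using that s1 \<open>z \<notin> N\<close> unfolding N_def by blast
    then have "(THE s. maximizer S z s) = s1" using s1 by (intro the_equality)
    then have "\<pi> z = s1" using that by (simp add: \<pi>_def)
    then show ?thesis using u s1 by blast
  qed
  have piS: "\<pi> z \<in> S" for z using pi1[of z "\<pi> z"] s0 by (cases "z \<in> N") (auto simp: \<pi>_def maximizer_def)
  have A_closed: "closed A"
  proof -
    have "A = (\<Inter>s\<in>S. {z. s \<bullet> z \<le> 1})" by (auto simp: A_def)
    then show ?thesis by (auto intro!: closed_INT closed_Collect_le continuous_intros)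
  qed
  have SB[measurable]: "S \<in> sets borel" using S by (simp add: compact_imp_closed)
  have AB[measurable]: "A \<in> sets borel" using A_closed by simp
  have A_fin: "emeasure lborel A \<noteq> \<infinity>" using bd A_def emeasure_bounded_finite by fastforce
  have A_pos: "emeasure lborel A \<noteq> 0"
  proof
    assume "emeasure lborel A = 0"
    obtain R where R: "R > 0" "\<And>s. s \<in> S \<Longrightarrow> norm s \<le> R"
      using compact_imp_bounded[OF S(1)] by (auto simp: bounded_pos)
    have "ball 0 (1/R) \<subseteq> A"
    proof
      fix z :: 'a assume "z \<in> ball 0 (1/R)"
      then have z: "norm z \<le> 1/R" by simp
      show "z \<in> A" unfolding A_def
      proof (intro CollectI ballI)
        fix s assume "s \<in> S"
        have "s \<bullet> z \<le> norm s * norm z" by (rule norm_cauchy_schwarz)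
        also have "\<dots> \<le> R * (1/R)" using R z \<open>s \<in> S\<close> by (intro mult_mono) auto
        finally show "s \<bullet> z \<le> 1" using R by simp
      qed
    qed
    then have "emeasure lborel (ball (0::'a) (1/R)) = 0"
      using emeasure_mono[of "ball 0 (1/R)" A lborel] \<open>emeasure lborel A = 0\<close> by simp
    then have "negligible (ball (0::'a) (1/R))"
      by (simp add: negligible_iff_null_sets null_sets_def null_sets_completionI)
    then show False using open_not_negligible[of "ball (0::'a) (1/R)"] R by simp
  qed
  have A_sym: "uminus ` A = A"
  proof -
    have "- z \<in> A" if "z \<in> A" for z
      unfolding A_def
    proof (intro CollectI ballI)
      fix s assume "s \<in> S"
      then have "- s \<in> S" using S(3) by blast
      then show "s \<bullet> - z \<le> 1" using that by (auto simp: A_def)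
    qed
    then show ?thesis by (force simp: image_iff)
  qed
  define \<alpha> where "\<alpha> = uniform_measure lborel A"
  interpret a: prob_space \<alpha> unfolding \<alpha>_def using A_pos A_fin by (intro prob_space_uniform_measure) auto
  have [simp]: "sets \<alpha> = sets borel" "space \<alpha> = UNIV" by (auto simp: \<alpha>_def)
  have [measurable_cong]: "sets \<alpha> = sets borel" by simp
  have pim[measurable]: "\<pi> \<in> borel_measurable borel"
  proof (rule borel_measurableI)
    fix U :: "'a set" assume U: "open U"
    have "z \<in> \<pi> -` U \<longleftrightarrow> z \<in> - ((- N \<inter> {z. \<exists>s\<in>-U. maximizer S z s}) \<union> (if s0 \<in> U then {} else N))" for z
    proof (cases "z \<in> N")
      case True
      then show ?thesis by (simp add: \<pi>_def)
    next
      case False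
      then show ?thesis using pi1[OF False] by simp
    qed
    then have eq: "\<pi> -` U = - ((- N \<inter> {z. \<exists>s\<in>-U. maximizer S z s}) \<union> (if s0 \<in> U then {} else N))"
      by (rule set_eqI)
    have "closed {z. \<exists>s\<in>-U. maximizer S z s}" using U by (intro closed_maximizers S) auto
    then show "\<pi> -` U \<inter> space borel \<in> sets borel"
      using N(1) unfolding eq by auto
  qed
  have aN: "AE z in \<alpha>. z \<notin> N"
  proof (rule AE_I[of _ _ N])
    have "emeasure lborel (A \<inter> N) \<le> emeasure lborel N" using N by (intro emeasure_mono) auto
    then show "emeasure \<alpha> N = 0" using N by (simp add: \<alpha>_def)
  qed (use N in auto)
  define \<mu> where "\<mu> = distr \<alpha> borel \<pi>"
  have prob: "prob_space \<mu>" unfolding \<mu>_def by (rule a.prob_space_distr) simp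
  have "emeasure \<mu> S = emeasure \<alpha> (\<pi> -` S)" unfolding \<mu>_def by (simp add: emeasure_distr)
  also have "\<pi> -` S = UNIV" using piS by auto
  also have "emeasure \<alpha> UNIV = 1" using a.emeasure_space_1 by simp
  finally have muS: "emeasure \<mu> S = 1" .
  have inv: "distr \<mu> borel L = \<mu>" if L: "linear L" "bij L" "L ` S = S" for L
  proof -
    define M where "M = adjoint L"
    have M: "s \<bullet> M z = L s \<bullet> z" for s z unfolding M_def using adjoint_works[OF L(1)] by (simp add: inner_commute)
    have linM: "linear M" unfolding M_def using L(1) by (rule adjoint_linear)
    have "inj M"
    proof (rule linear_injective_0[OF linM, THEN iffD2], intro allI impI)
      fix z assume "M z = 0"
      then have "L s \<bullet> z = 0" for s using M[of s z] by simp
      moreover obtain s where "L s = z" using L(2) by (metis bij_pointE)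
      ultimately have "z \<bullet> z = 0" by metis
      then show "z = 0" by simp
    qed
    then have bijM: "bij M" using linM linear_injective_imp_surjective by (auto simp: bij_def)
    have MA: "M z \<in> A \<longleftrightarrow> z \<in> A" for z
    proof -
      have "(\<forall>s\<in>S. L s \<bullet> z \<le> 1) \<longleftrightarrow> (\<forall>s\<in>L ` S. s \<bullet> z \<le> 1)" by simp
      then show ?thesis unfolding A_def using L(3) by (simp add: M)
    qed
    then have MA': "M ` A = A" using bijM by (auto simp: image_iff) (metis bij_pointE)
    have mx: "maximizer S (M z) s \<longleftrightarrow> maximizer S z (L s)" if "s \<in> S" for z s
    proof -
      have "(\<forall>t\<in>S. L t \<bullet> z \<le> L s \<bullet> z) \<longleftrightarrow> (\<forall>t\<in>L ` S. t \<bullet> z \<le> L s \<bullet> z)" by simp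
      then show ?thesis unfolding maximizer_def using that L(3) by (auto simp: M)
    qed
    \<comment> \<open>Invariance of \<open>A\<close>, a set of finite positive measure, forces
      \<open>M\<close> to preserve volume; no determinant is computed.\<close>
    have lM: "distr lborel borel M = lborel"
      by (rule distr_lborel_linear_eq_lborel[OF linM bijM AB A_pos A_fin MA' A_sym])
    have [measurable]: "M \<in> borel_measurable borel" "L \<in> borel_measurable borel"
      using linM L(1) by (auto intro!: borel_measurable_continuous_onI linear_continuous_on simp: linear_linear)
    have aM: "distr \<alpha> borel M = \<alpha>"
    proof (rule measure_eqI)
      fix B assume "B \<in> sets (distr \<alpha> borel M)"
      then have B[measurable]: "B \<in> sets borel" by simp
      have "M -` B \<in> sets borel" using measurable_sets[of M borel borel B] by simp
      moreover have "A \<inter> M -` B = M -` (A \<inter> B)" using MA by auto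
      moreover have "emeasure lborel (M -` (A \<inter> B)) = emeasure lborel (A \<inter> B)"
        using emeasure_distr[of M lborel borel "A \<inter> B"] lM by simp
      ultimately show "emeasure (distr \<alpha> borel M) B = emeasure \<alpha> B"
        by (simp add: emeasure_distr \<alpha>_def)
    qed simp
    have NM: "M z \<notin> N \<and> \<pi> z = L (\<pi> (M z))" if z: "z \<notin> N" for z
    proof -
      have mM: "maximizer S (M z) s \<longleftrightarrow> L s = \<pi> z" if "s \<in> S" for s
        using mx[OF that] pi1[OF z] by simp
      have "M z \<notin> N"
      proof
        assume "M z \<in> N"
        then obtain s s' where "maximizer S (M z) s" "maximizer S (M z) s'" "s \<noteq> s'" by (auto simp: N_def)
        moreover from this have "s \<in> S" "s' \<in> S" by (auto simp: maximizer_def)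
        ultimately have "L s = L s'" "s \<noteq> s'" using mM by auto
        then show False using L(2) by (simp add: bij_is_inj inj_eq)
      qed
      moreover from this have "maximizer S (M z) (\<pi> (M z))" using pi1 by simp
      then have "L (\<pi> (M z)) = \<pi> z" using mM piS by blast
      ultimately show ?thesis by simp
    qed
    have "distr \<mu> borel L = distr \<alpha> borel (\<lambda>z. L (\<pi> z))"
      unfolding \<mu>_def by (simp add: distr_distr comp_def)
    also have "\<dots> = distr (distr \<alpha> borel M) borel (\<lambda>z. L (\<pi> z))" by (simp only: aM)
    also have "\<dots> = distr \<alpha> borel (\<lambda>z. L (\<pi> (M z)))" by (simp add: distr_distr comp_def)
    also have "\<dots> = distr \<alpha> borel \<pi>"
    proof (rule distr_cong_AE)
      show "AE z in \<alpha>. L (\<pi> (M z)) = \<pi> z"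
        using aN by eventually_elim (use NM in metis)
    qed measurable
    finally show ?thesis by (simp add: \<mu>_def)
  qed
  show ?thesis using prob muS inv by (intro exI[of _ \<mu>]) (auto simp: \<mu>_def)
qed

section \<open>Hardy space of a measure on a sphere\<close>

lemma borel_measurable_cnj [measurable (raw)]:
  "f \<in> borel_measurable M \<Longrightarrow> (\<lambda>x. cnj (f x)) \<in> borel_measurable M"
  by (rule borel_measurable_continuous_on[of cnj]) (intro continuous_intros)

text \<open>This is all that the operator-theoretic half retains of the domain. Elements of the
  spaces are functions, not classes, so equality almost everywhere is tracked explicitly.\<close>

locale sphere_space = prob_space \<mu> for \<mu> :: "(complex^'d::finite) measure" +
  fixes S :: "(complex^'d) set" and r :: nat
  assumes space_mu: "space \<mu> = S" and sets_mu: "sets \<mu> = sets (restrict_space borel S)"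
    and compact_S: "compact S" and r_pos: "0 < r"
    and sphere: "z \<in> S \<Longrightarrow> (\<Sum>i\<in>UNIV. (cmod (z $ i))\<^sup>2) = real r"
begin

lemma borel_measurable_mu: "f \<in> borel_measurable borel \<Longrightarrow> f \<in> borel_measurable \<mu>"
  by (subst measurable_cong_sets[OF sets_mu refl]) (rule measurable_restrict_space1)

lemma coord_borel [measurable]: "(\<lambda>x::complex^'d. x $ i) \<in> borel_measurable borel"
  by (intro borel_measurable_continuous_onI continuous_intros)

lemma coord_mu [measurable]: "(\<lambda>x. x $ i) \<in> borel_measurable \<mu>"
  by (rule borel_measurable_mu) measurable

section \<open>Square-integrable functions: inner product, norm, completeness\<close>

lemma L2_measurable [measurable_dest]: "f \<in> L2 \<mu> \<Longrightarrow> f \<in> borel_measurable \<mu>"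
  by (simp add: L2_def)

lemma L2_integrable: "f \<in> L2 \<mu> \<Longrightarrow> integrable \<mu> (\<lambda>x. (cmod (f x))\<^sup>2)"
  by (simp add: L2_def)

lemma L2_bound:
  assumes "f \<in> L2 \<mu>" "h \<in> borel_measurable \<mu>" "\<And>x. x \<in> S \<Longrightarrow> cmod (h x) \<le> c * cmod (f x)"
  shows "h \<in> L2 \<mu>"
proof -
  have "integrable \<mu> (\<lambda>x. (cmod (h x))\<^sup>2)"
  proof (rule Bochner_Integration.integrable_bound)
    show "integrable \<mu> (\<lambda>x. c\<^sup>2 * (cmod (f x))\<^sup>2)" using L2_integrable[OF assms(1)] by simp
    show "AE x in \<mu>. norm ((cmod (h x))\<^sup>2) \<le> norm (c\<^sup>2 * (cmod (f x))\<^sup>2)"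
    proof (rule AE_I2)
      fix x assume "x \<in> space \<mu>"
      then have "(cmod (h x))\<^sup>2 \<le> (c * cmod (f x))\<^sup>2" using assms(3)[of x] by (intro power_mono) (auto simp: space_mu)
      then show "norm ((cmod (h x))\<^sup>2) \<le> norm (c\<^sup>2 * (cmod (f x))\<^sup>2)" by (simp add: power_mult_distrib)
    qed
  qed (use assms in measurable)
  then show ?thesis using assms(2) by (simp add: L2_def)
qed

lemma L2_add: assumes f: "f \<in> L2 \<mu>" and g: "g \<in> L2 \<mu>" shows "(\<lambda>x. f x + g x) \<in> L2 \<mu>"
proof -
  have "integrable \<mu> (\<lambda>x. (cmod (f x + g x))\<^sup>2)"
  proof (rule Bochner_Integration.integrable_bound)
    show "integrable \<mu> (\<lambda>x. 2 * (cmod (f x))\<^sup>2 + 2 * (cmod (g x))\<^sup>2)"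
      using L2_integrable[OF f] L2_integrable[OF g] by simp
    show "AE x in \<mu>. norm ((cmod (f x + g x))\<^sup>2) \<le> norm (2 * (cmod (f x))\<^sup>2 + 2 * (cmod (g x))\<^sup>2)"
    proof (rule AE_I2)
      fix x
      have "(cmod (f x + g x))\<^sup>2 \<le> (cmod (f x) + cmod (g x))\<^sup>2" by (intro power_mono norm_triangle_ineq) auto
      also have "\<dots> \<le> 2 * (cmod (f x))\<^sup>2 + 2 * (cmod (g x))\<^sup>2"
        using sum_squares_bound[of "cmod (f x)" "cmod (g x)"] by (simp add: power2_sum)
      finally show "norm ((cmod (f x + g x))\<^sup>2) \<le> norm (2 * (cmod (f x))\<^sup>2 + 2 * (cmod (g x))\<^sup>2)" by simp
    qed
  qed (use f g in measurable)
  moreover have "(\<lambda>x. f x + g x) \<in> borel_measurable \<mu>" using f g by measurable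
  ultimately show ?thesis by (simp add: L2_def)
qed

lemma L2_cmult: assumes f: "f \<in> L2 \<mu>" shows "(\<lambda>x. c * f x) \<in> L2 \<mu>"
  using f by (intro L2_bound[OF f, of _ "cmod c"]) (auto simp: norm_mult)

lemma L2_diff: assumes f: "f \<in> L2 \<mu>" and g: "g \<in> L2 \<mu>" shows "(\<lambda>x. f x - g x) \<in> L2 \<mu>"
  using L2_add[OF f L2_cmult[OF g, of "-1"]] by simp

lemma L2_zero [simp]: "(\<lambda>x. 0) \<in> L2 \<mu>" by (simp add: L2_def)

lemma L2_const [simp]: "(\<lambda>x. c) \<in> L2 \<mu>" by (simp add: L2_def)

lemma L2_mult:
  assumes f: "f \<in> L2 \<mu>" and m: "m \<in> borel_measurable \<mu>" "\<And>x. x \<in> S \<Longrightarrow> cmod (m x) \<le> c"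
  shows "(\<lambda>x. m x * f x) \<in> L2 \<mu>"
  using f m(1) by (intro L2_bound[OF f, of _ c]) (auto simp: norm_mult intro!: mult_right_mono m(2))

lemma integrable_ip: assumes f: "f \<in> L2 \<mu>" and g: "g \<in> L2 \<mu>"
  shows "integrable \<mu> (\<lambda>x. f x * cnj (g x))"
proof (rule Bochner_Integration.integrable_bound)
  show "integrable \<mu> (\<lambda>x. (cmod (f x))\<^sup>2 + (cmod (g x))\<^sup>2)"
    using L2_integrable[OF f] L2_integrable[OF g] by simp
  show "AE x in \<mu>. norm (f x * cnj (g x)) \<le> norm ((cmod (f x))\<^sup>2 + (cmod (g x))\<^sup>2)"
  proof (rule AE_I2)
    fix x
    have "0 \<le> cmod (f x) * cmod (g x)" by simp
    then have "cmod (f x) * cmod (g x) \<le> (cmod (f x))\<^sup>2 + (cmod (g x))\<^sup>2"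
      using sum_squares_bound[of "cmod (f x)" "cmod (g x)"] by linarith
    then show "norm (f x * cnj (g x)) \<le> norm ((cmod (f x))\<^sup>2 + (cmod (g x))\<^sup>2)"
      by (simp add: norm_mult)
  qed
qed (use f g in measurable)

lemma ip_add_left: "f \<in> L2 \<mu> \<Longrightarrow> f' \<in> L2 \<mu> \<Longrightarrow> g \<in> L2 \<mu> \<Longrightarrow> ip \<mu> (\<lambda>x. f x + f' x) g = ip \<mu> f g + ip \<mu> f' g"
  unfolding ip_def by (simp add: distrib_right integrable_ip)

lemma ip_add_right: "f \<in> L2 \<mu> \<Longrightarrow> g' \<in> L2 \<mu> \<Longrightarrow> g \<in> L2 \<mu> \<Longrightarrow> ip \<mu> f (\<lambda>x. g x + g' x) = ip \<mu> f g + ip \<mu> f g'"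
  unfolding ip_def by (simp add: distrib_left integrable_ip)

lemma ip_diff_left: "f \<in> L2 \<mu> \<Longrightarrow> f' \<in> L2 \<mu> \<Longrightarrow> g \<in> L2 \<mu> \<Longrightarrow> ip \<mu> (\<lambda>x. f x - f' x) g = ip \<mu> f g - ip \<mu> f' g"
  unfolding ip_def by (simp add: left_diff_distrib integrable_ip)

lemma ip_diff_right: "f \<in> L2 \<mu> \<Longrightarrow> g' \<in> L2 \<mu> \<Longrightarrow> g \<in> L2 \<mu> \<Longrightarrow> ip \<mu> f (\<lambda>x. g x - g' x) = ip \<mu> f g - ip \<mu> f g'"
  unfolding ip_def by (simp add: right_diff_distrib integrable_ip)

lemma ip_cmult_left: "ip \<mu> (\<lambda>x. c * f x) g = c * ip \<mu> f g"
  unfolding ip_def by (simp add: mult.assoc)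

lemma ip_cmult_right: "ip \<mu> f (\<lambda>x. c * g x) = cnj c * ip \<mu> f g"
  unfolding ip_def by (simp add: mult.left_commute)

lemma ip_cnj: "cnj (ip \<mu> f g) = ip \<mu> g f"
proof -
  have "cnj (\<integral>x. f x * cnj (g x) \<partial>\<mu>) = (\<integral>x. cnj (f x * cnj (g x)) \<partial>\<mu>)"
    by (rule Bochner_Integration.integral_cnj[symmetric])
  then show ?thesis by (simp add: ip_def mult.commute)
qed

lemma ip_sum_left:
  assumes "\<And>i. i \<in> I \<Longrightarrow> f i \<in> L2 \<mu>" "g \<in> L2 \<mu>"
  shows "ip \<mu> (\<lambda>x. \<Sum>i\<in>I. f i x) g = (\<Sum>i\<in>I. ip \<mu> (f i) g)"
  unfolding ip_def using assms by (simp add: sum_distrib_right integrable_ip)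

lemma ip_mult_shift: "ip \<mu> (\<lambda>x. m x * f x) g = ip \<mu> f (\<lambda>x. cnj (m x) * g x)"
  unfolding ip_def by (simp add: mult_ac)

lemma l2norm_nonneg [simp]: "0 \<le> l2norm \<mu> f"
  unfolding l2norm_def by (simp add: integral_nonneg_AE)

lemma l2norm_sq: "(l2norm \<mu> f)\<^sup>2 = (\<integral>x. (cmod (f x))\<^sup>2 \<partial>\<mu>)"
  unfolding l2norm_def by (simp add: integral_nonneg_AE)

lemma ip_self: "ip \<mu> f f = complex_of_real ((l2norm \<mu> f)\<^sup>2)"
  unfolding l2norm_sq ip_def by (simp add: complex_norm_square[symmetric] del: of_real_power)

lemma ip_cong_AE:
  assumes "f \<in> L2 \<mu>" "f' \<in> L2 \<mu>" "g \<in> L2 \<mu>" "g' \<in> L2 \<mu>" "AE x in \<mu>. f x = f' x" "AE x in \<mu>. g x = g' x"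
  shows "ip \<mu> f g = ip \<mu> f' g'"
proof -
  note [measurable] = assms(1-4)[THEN L2_measurable]
  have "AE x in \<mu>. f x * cnj (g x) = f' x * cnj (g' x)"
    using assms(5,6) by eventually_elim simp
  then show ?thesis unfolding ip_def by (intro integral_cong_AE) measurable
qed

lemma l2norm_cong_AE:
  assumes "f \<in> L2 \<mu>" "f' \<in> L2 \<mu>" "AE x in \<mu>. f x = f' x"
  shows "l2norm \<mu> f = l2norm \<mu> f'"
  unfolding l2norm_def using assms by (intro arg_cong[where f=sqrt] integral_cong_AE) auto

lemma l2norm_diff_expand:
  assumes f: "f \<in> L2 \<mu>" and g: "g \<in> L2 \<mu>"
  shows "(l2norm \<mu> (\<lambda>x. f x - g x))\<^sup>2 = (l2norm \<mu> f)\<^sup>2 - 2 * Re (ip \<mu> f g) + (l2norm \<mu> g)\<^sup>2"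
proof -
  have "complex_of_real ((l2norm \<mu> (\<lambda>x. f x - g x))\<^sup>2) = ip \<mu> (\<lambda>x. f x - g x) (\<lambda>x. f x - g x)"
    by (rule ip_self[symmetric])
  also have "\<dots> = ip \<mu> f f - ip \<mu> f g - (cnj (ip \<mu> f g)) + ip \<mu> g g"
    using f g by (simp add: ip_diff_left ip_diff_right L2_diff ip_cnj)
  finally have "Re (complex_of_real ((l2norm \<mu> (\<lambda>x. f x - g x))\<^sup>2)) = Re (ip \<mu> f f - ip \<mu> f g - (cnj (ip \<mu> f g)) + ip \<mu> g g)"
    by (rule arg_cong)
  then show ?thesis by (simp add: ip_self del: of_real_power)
qed

lemma l2norm_cmult: "l2norm \<mu> (\<lambda>x. c * f x) = cmod c * l2norm \<mu> f"
  unfolding l2norm_def by (simp add: norm_mult power_mult_distrib real_sqrt_mult)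

lemma l2norm_eq_0_AE: assumes f: "f \<in> L2 \<mu>" shows "l2norm \<mu> f = 0 \<longleftrightarrow> (AE x in \<mu>. f x = 0)"
proof -
  have "l2norm \<mu> f = 0 \<longleftrightarrow> (\<integral>x. (cmod (f x))\<^sup>2 \<partial>\<mu>) = 0" unfolding l2norm_def by simp
  also have "\<dots> \<longleftrightarrow> (AE x in \<mu>. (cmod (f x))\<^sup>2 = 0)"
    using L2_integrable[OF f] by (intro integral_nonneg_eq_0_iff_AE) auto
  finally show ?thesis by simp
qed

lemma Cauchy_Schwarz_ip:
  assumes f: "f \<in> L2 \<mu>" and g: "g \<in> L2 \<mu>"
  shows "cmod (ip \<mu> f g) \<le> l2norm \<mu> f * l2norm \<mu> g"
proof (cases "l2norm \<mu> g = 0")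
  case True
  then have "AE x in \<mu>. g x = 0" using g by (simp add: l2norm_eq_0_AE)
  then have "ip \<mu> f g = ip \<mu> f (\<lambda>x. 0)" using f g by (intro ip_cong_AE) auto
  then show ?thesis using True by (simp add: ip_def)
next
  case False
  define b where "b = (l2norm \<mu> g)\<^sup>2"
  define c where "c = ip \<mu> f g"
  have b: "b > 0" using False l2norm_nonneg[of g] by (simp add: b_def)
  \<comment> \<open>The coefficient \<open>c / b\<close> is that of the projection of
    \<open>f\<close> onto \<open>g\<close>, for which the expansion is smallest.\<close>
  have "0 \<le> (l2norm \<mu> (\<lambda>x. f x - (c / b) * g x))\<^sup>2" by simp
  also have "\<dots> = (l2norm \<mu> f)\<^sup>2 - 2 * Re (cnj (c / b) * c) + (cmod (c / b))\<^sup>2 * b"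
    using l2norm_diff_expand[OF f L2_cmult[OF g, of "c/b"]]
    by (simp only: ip_cmult_right l2norm_cmult power_mult_distrib b_def c_def)
  also have "cnj (c / b) * c = of_real ((cmod c)\<^sup>2 / b)"
    by (simp add: complex_norm_square mult.commute del: of_real_power)
  also have "(cmod (c / b))\<^sup>2 * b = (cmod c)\<^sup>2 / b"
    using b by (simp add: norm_divide power_divide power2_eq_square)
  finally have "(cmod c)\<^sup>2 / b \<le> (l2norm \<mu> f)\<^sup>2" by simp
  then have "(cmod c)\<^sup>2 \<le> (l2norm \<mu> f * l2norm \<mu> g)\<^sup>2"
    using b by (simp add: field_simps b_def power_mult_distrib)
  then show ?thesis unfolding c_def by (rule power2_le_imp_le) simp
qed

lemma l2norm_triangle:
  assumes f: "f \<in> L2 \<mu>" and g: "g \<in> L2 \<mu>"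
  shows "l2norm \<mu> (\<lambda>x. f x + g x) \<le> l2norm \<mu> f + l2norm \<mu> g"
proof (rule power2_le_imp_le)
  have g': "(\<lambda>x. -1 * g x) \<in> L2 \<mu>" by (rule L2_cmult[OF g])
  have "(l2norm \<mu> (\<lambda>x. f x + g x))\<^sup>2 = (l2norm \<mu> f)\<^sup>2 + 2 * Re (ip \<mu> f g) + (l2norm \<mu> g)\<^sup>2"
    using l2norm_diff_expand[OF f g'] ip_cmult_right[of f "-1" g] l2norm_cmult[of "-1" g] by simp
  also have "\<dots> \<le> (l2norm \<mu> f + l2norm \<mu> g)\<^sup>2"
    using Cauchy_Schwarz_ip[OF f g] complex_Re_le_cmod[of "ip \<mu> f g"] by (simp add: power2_sum)
  finally show "(l2norm \<mu> (\<lambda>x. f x + g x))\<^sup>2 \<le> (l2norm \<mu> f + l2norm \<mu> g)\<^sup>2" .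
qed simp

lemma l2norm_diff_triangle:
  assumes f: "f \<in> L2 \<mu>" and g: "g \<in> L2 \<mu>" and h: "h \<in> L2 \<mu>"
  shows "l2norm \<mu> (\<lambda>x. f x - h x) \<le> l2norm \<mu> (\<lambda>x. f x - g x) + l2norm \<mu> (\<lambda>x. g x - h x)"
  using l2norm_triangle[OF L2_diff[OF f g] L2_diff[OF g h]] by simp

lemma l2norm_diff_commute: "l2norm \<mu> (\<lambda>x. f x - g x) = l2norm \<mu> (\<lambda>x. g x - f x)"
  by (simp add: l2norm_def norm_minus_commute)

lemma l2norm_mono:
  assumes "f \<in> L2 \<mu>" "h \<in> L2 \<mu>" "0 \<le> c" "\<And>x. x \<in> S \<Longrightarrow> cmod (h x) \<le> c * cmod (f x)"
  shows "l2norm \<mu> h \<le> c * l2norm \<mu> f"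
proof (rule power2_le_imp_le)
  have "(\<integral>x. (cmod (h x))\<^sup>2 \<partial>\<mu>) \<le> (\<integral>x. c\<^sup>2 * (cmod (f x))\<^sup>2 \<partial>\<mu>)"
  proof (rule integral_mono)
    fix x assume "x \<in> space \<mu>"
    then have "(cmod (h x))\<^sup>2 \<le> (c * cmod (f x))\<^sup>2" using assms(4)[of x] by (intro power_mono) (auto simp: space_mu)
    then show "(cmod (h x))\<^sup>2 \<le> c\<^sup>2 * (cmod (f x))\<^sup>2" by (simp add: power_mult_distrib)
  qed (use assms L2_integrable in auto)
  then show "(l2norm \<mu> h)\<^sup>2 \<le> (c * l2norm \<mu> f)\<^sup>2" by (simp add: l2norm_sq power_mult_distrib)
qed (use assms in simp)

text \<open>The total mass is 1, so this is Cauchy-Schwarz against the constant function.\<close>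

lemma l1_le_l2:
  assumes f: "f \<in> L2 \<mu>" shows "(\<integral>\<^sup>+x. ennreal (cmod (f x)) \<partial>\<mu>) \<le> ennreal (l2norm \<mu> f)"
proof -
  have m: "(\<lambda>x. complex_of_real (cmod (f x))) \<in> L2 \<mu>" using f by (intro L2_bound[OF f, of _ 1]) auto
  have "integrable \<mu> (\<lambda>x. complex_of_real (cmod (f x)) * cnj 1)" by (rule integrable_ip[OF m L2_const])
  then have "integrable \<mu> (\<lambda>x. norm (complex_of_real (cmod (f x)) * cnj 1))" by (rule integrable_norm)
  then have i: "integrable \<mu> (\<lambda>x. cmod (f x))" by simp
  have "cmod (ip \<mu> (\<lambda>x. complex_of_real (cmod (f x))) (\<lambda>x. 1)) \<le> l2norm \<mu> (\<lambda>x. complex_of_real (cmod (f x))) * l2norm \<mu> (\<lambda>x. 1)"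
    by (rule Cauchy_Schwarz_ip[OF m L2_const])
  also have "ip \<mu> (\<lambda>x. complex_of_real (cmod (f x))) (\<lambda>x. 1) = complex_of_real (\<integral>x. cmod (f x) \<partial>\<mu>)"
    by (simp add: ip_def)
  also have "l2norm \<mu> (\<lambda>x. complex_of_real (cmod (f x))) = l2norm \<mu> f" by (simp add: l2norm_def)
  also have "l2norm \<mu> (\<lambda>x. 1) = 1" by (simp add: l2norm_def prob_space)
  finally have "(\<integral>x. cmod (f x) \<partial>\<mu>) \<le> l2norm \<mu> f" by simp
  then show ?thesis using i by (simp add: nn_integral_eq_integral ennreal_leI)
qed

lemma nn_integral_cmod_sq:
  assumes "f \<in> L2 \<mu>" shows "(\<integral>\<^sup>+x. ennreal ((cmod (f x))\<^sup>2) \<partial>\<mu>) = ennreal ((l2norm \<mu> f)\<^sup>2)"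
  unfolding l2norm_sq by (rule nn_integral_eq_integral) (use L2_integrable[OF assms] in auto)

text \<open>Riesz-Fischer: along a subsequence the increments have summable norms in
  \<open>L\<^sup>1\<close>, hence it converges almost everywhere, and Fatou's lemma turns the Cauchy
  estimate into an estimate for the limit.\<close>

lemma L2_complete:
  fixes F :: "nat \<Rightarrow> complex^'d \<Rightarrow> complex"
  assumes F: "\<And>n. F n \<in> L2 \<mu>"
    and Cauchy: "\<And>e. e > 0 \<Longrightarrow> \<exists>N. \<forall>m\<ge>N. \<forall>n\<ge>N. l2norm \<mu> (\<lambda>x. F m x - F n x) < e"
  shows "\<exists>f\<in>L2 \<mu>. (\<lambda>n. l2norm \<mu> (\<lambda>x. F n x - f x)) \<longlonglongrightarrow> 0"
proof -
  note [measurable] = L2_measurable[OF F]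
  obtain N where N: "\<And>k m n. m \<ge> N k \<Longrightarrow> n \<ge> N k \<Longrightarrow> l2norm \<mu> (\<lambda>x. F m x - F n x) < (1/2)^k"
  proof -
    have "\<exists>N. \<forall>m\<ge>N. \<forall>n\<ge>N. l2norm \<mu> (\<lambda>x. F m x - F n x) < (1/2)^k" for k :: nat
      by (rule Cauchy) simp
    then show ?thesis using that by metis
  qed
  \<comment> \<open>The indices \<open>s k\<close> and \<open>s (Suc k)\<close> are both at least
    \<open>N k\<close>, whatever the order of the numbers \<open>N j\<close>, and the summand
    \<open>k\<close> makes them tend to infinity.\<close>
  define s where "s k = k + (\<Sum>j\<le>k. N j)" for k
  have sN: "N k \<le> s k" for k unfolding s_def by (simp add: sum.atMost_Suc trans_le_add2 member_le_sum)
  have sN': "N k \<le> s (Suc k)" for k using sN[of k] by (simp add: s_def)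
  have sk: "k \<le> s k" for k by (simp add: s_def)
  define G where "G k = F (s k)" for k
  have [measurable]: "G k \<in> borel_measurable \<mu>" for k by (simp add: G_def)
  have GL: "(\<lambda>x. G (Suc k) x - G k x) \<in> L2 \<mu>" for k unfolding G_def by (intro L2_diff F)
  have Gn: "l2norm \<mu> (\<lambda>x. G (Suc k) x - G k x) \<le> (1/2)^k" for k
    unfolding G_def using N[OF sN' sN, of k] by simp
  have "(\<integral>\<^sup>+x. (\<Sum>k. ennreal (cmod (G (Suc k) x - G k x))) \<partial>\<mu>) = (\<Sum>k. \<integral>\<^sup>+x. ennreal (cmod (G (Suc k) x - G k x)) \<partial>\<mu>)"
    by (rule nn_integral_suminf) measurable
  also have "\<dots> \<le> (\<Sum>k. ennreal ((1/2)^k))"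
    using order_trans[OF l1_le_l2[OF GL] ennreal_leI[OF Gn]] by (intro suminf_le) auto
  also have "\<dots> = ennreal (\<Sum>k. (1/2)^k)"
    by (rule suminf_ennreal2) auto
  also have "\<dots> < \<infinity>" by simp
  finally have "(\<integral>\<^sup>+x. (\<Sum>k. ennreal (cmod (G (Suc k) x - G k x))) \<partial>\<mu>) \<noteq> \<infinity>" by simp
  then have "AE x in \<mu>. (\<Sum>k. ennreal (cmod (G (Suc k) x - G k x))) \<noteq> \<infinity>"
    by (intro nn_integral_noteq_infinite) auto
  then have conv: "AE x in \<mu>. convergent (\<lambda>k. G k x)"
  proof eventually_elim
    case (elim x)
    have "summable (\<lambda>k. cmod (G (Suc k) x - G k x))"
      by (rule summable_suminf_not_top) (use elim in auto)
    then have "summable (\<lambda>k. G (Suc k) x - G k x)" by (rule summable_norm_cancel)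
    then obtain l where l: "(\<lambda>k. G (Suc k) x - G k x) sums l" by (auto simp: summable_def)
    have "(\<lambda>n. \<Sum>k<n. G (Suc k) x - G k x) = (\<lambda>n. G n x - G 0 x)"
      by (rule ext) (rule sum_lessThan_telescope)
    then have "(\<lambda>n. G n x - G 0 x) \<longlonglongrightarrow> l" using l by (simp add: sums_def)
    then have "(\<lambda>n. G n x - G 0 x + G 0 x) \<longlonglongrightarrow> l + G 0 x" by (intro tendsto_intros)
    then show ?case by (auto simp: convergent_def)
  qed
  define f where "f x = lim (\<lambda>k. G k x)" for x
  have fm[measurable]: "f \<in> borel_measurable \<mu>" unfolding f_def[abs_def] by (rule borel_measurable_lim_metric) simp
  have lim: "AE x in \<mu>. (\<lambda>k. G k x) \<longlonglongrightarrow> f x"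
    using conv by eventually_elim (simp add: f_def convergent_LIMSEQ_iff)
  have fatou: "(\<integral>\<^sup>+x. ennreal ((cmod (F n x - f x))\<^sup>2) \<partial>\<mu>) \<le> ennreal (e\<^sup>2)"
    if e: "e > 0" "\<And>k. k \<ge> n0 \<Longrightarrow> l2norm \<mu> (\<lambda>x. F n x - F k x) \<le> e" for n n0 e
  proof -
    have "(\<integral>\<^sup>+x. ennreal ((cmod (F n x - f x))\<^sup>2) \<partial>\<mu>) = (\<integral>\<^sup>+x. liminf (\<lambda>k. ennreal ((cmod (F n x - G k x))\<^sup>2)) \<partial>\<mu>)"
    proof (rule nn_integral_cong_AE, use lim in eventually_elim)
      case (elim x)
      then have "(\<lambda>k. ennreal ((cmod (F n x - G k x))\<^sup>2)) \<longlonglongrightarrow> ennreal ((cmod (F n x - f x))\<^sup>2)"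
        by (intro tendsto_intros)
      from lim_imp_Liminf[OF _ this] show ?case by simp
    qed
    also have "\<dots> \<le> liminf (\<lambda>k. \<integral>\<^sup>+x. ennreal ((cmod (F n x - G k x))\<^sup>2) \<partial>\<mu>)"
      by (rule nn_integral_liminf) measurable
    also have "\<dots> = liminf (\<lambda>k. ennreal ((l2norm \<mu> (\<lambda>x. F n x - G k x))\<^sup>2))"
      using nn_integral_cmod_sq[OF L2_diff[OF F F]] by (simp add: G_def)
    also have "\<dots> \<le> liminf (\<lambda>k. ennreal (e\<^sup>2))"
    proof (rule Liminf_mono, rule eventually_sequentiallyI[of n0])
      fix k assume "n0 \<le> k"
      then have "l2norm \<mu> (\<lambda>x. F n x - G k x) \<le> e" using e(2)[of "s k"] sk[of k] by (simp add: G_def)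
      then show "ennreal ((l2norm \<mu> (\<lambda>x. F n x - G k x))\<^sup>2) \<le> ennreal (e\<^sup>2)"
        by (intro ennreal_leI power_mono) auto
    qed
    also have "\<dots> = ennreal (e\<^sup>2)" by (simp add: Liminf_const)
    finally show ?thesis .
  qed
  have L: "(\<lambda>x. F n x - f x) \<in> L2 \<mu> \<and> l2norm \<mu> (\<lambda>x. F n x - f x) \<le> e"
    if e: "e > 0" "\<And>k. k \<ge> n0 \<Longrightarrow> l2norm \<mu> (\<lambda>x. F n x - F k x) \<le> e" for n n0 e
  proof -
    have m: "(\<lambda>x. F n x - f x) \<in> borel_measurable \<mu>" by measurable
    have le: "(\<integral>\<^sup>+x. ennreal ((cmod (F n x - f x))\<^sup>2) \<partial>\<mu>) \<le> ennreal (e\<^sup>2)"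
      using e by (rule fatou)
    have i: "integrable \<mu> (\<lambda>x. (cmod (F n x - f x))\<^sup>2)"
      using le by (intro integrableI_bounded) (auto intro: le_less_trans)
    then have *: "(\<lambda>x. F n x - f x) \<in> L2 \<mu>" by (simp add: L2_def)
    have "ennreal ((l2norm \<mu> (\<lambda>x. F n x - f x))\<^sup>2) \<le> ennreal (e\<^sup>2)"
      using le by (simp only: nn_integral_cmod_sq[OF *])
    then have "(l2norm \<mu> (\<lambda>x. F n x - f x))\<^sup>2 \<le> e\<^sup>2" by (rule ennreal_le_iff[THEN iffD1, OF zero_le_power2])
    then have "l2norm \<mu> (\<lambda>x. F n x - f x) \<le> e" using less_imp_le[OF e(1)] by (rule power2_le_imp_le)
    then show ?thesis using * by blast
  qed
  obtain n0 where n0: "\<And>m n. m \<ge> n0 \<Longrightarrow> n \<ge> n0 \<Longrightarrow> l2norm \<mu> (\<lambda>x. F m x - F n x) < 1"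
    using Cauchy[of 1] by auto
  have "(\<lambda>x. F n0 x - f x) \<in> L2 \<mu>" using L[of 1 n0 n0] n0 by (force intro: less_imp_le)
  from L2_diff[OF F[of n0] this] have fL: "f \<in> L2 \<mu>" by simp
  have "(\<lambda>n. l2norm \<mu> (\<lambda>x. F n x - f x)) \<longlonglongrightarrow> 0"
  proof (rule LIMSEQ_I)
    fix e :: real assume e: "e > 0"
    then obtain n1 where n1: "\<And>m n. m \<ge> n1 \<Longrightarrow> n \<ge> n1 \<Longrightarrow> l2norm \<mu> (\<lambda>x. F m x - F n x) < e/2"
      using Cauchy[of "e/2"] by auto
    have "l2norm \<mu> (\<lambda>x. F n x - f x) \<le> e/2" if "n \<ge> n1" for n
      using L[of "e/2" n1 n] n1[OF that] e by (force intro: less_imp_le)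
    then show "\<exists>no. \<forall>n\<ge>no. norm (l2norm \<mu> (\<lambda>x. F n x - f x) - 0) < e"
      using e by (intro exI[of _ n1]) fastforce
  qed
  then show ?thesis using fL by blast
qed

section \<open>Closed subspaces, orthogonal projection and representation of functionals\<close>

definition closed_subspace :: "(complex^'d \<Rightarrow> complex) set \<Rightarrow> bool" where
  "closed_subspace V \<longleftrightarrow> V \<subseteq> L2 \<mu> \<and> (\<lambda>x. 0) \<in> V \<and> (\<forall>f\<in>V. \<forall>g\<in>V. (\<lambda>x. f x + g x) \<in> V) \<and>
     (\<forall>c. \<forall>f\<in>V. (\<lambda>x. c * f x) \<in> V) \<and>
     (\<forall>f\<in>L2 \<mu>. (\<forall>e>0. \<exists>g\<in>V. l2norm \<mu> (\<lambda>x. f x - g x) < e) \<longrightarrow> f \<in> V)"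

text \<open>A minimizing sequence for the distance is Cauchy by the parallelogram law. Its limit is
  the projection, since a residue not orthogonal to \<open>V\<close> could be shortened by a step
  inside \<open>V\<close>.\<close>

lemma orthogonal_projection:
  assumes V: "closed_subspace V" and g: "g \<in> L2 \<mu>"
  shows "\<exists>h\<in>V. \<forall>v\<in>V. ip \<mu> (\<lambda>x. g x - h x) v = 0"
proof -
  have VL: "v \<in> L2 \<mu>" if "v \<in> V" for v using V that by (auto simp: closed_subspace_def)
  have Vadd: "(\<lambda>x. u x + v x) \<in> V" if "u \<in> V" "v \<in> V" for u v using V that by (auto simp: closed_subspace_def)
  have Vc: "(\<lambda>x. c * v x) \<in> V" if "v \<in> V" for c v using V that by (auto simp: closed_subspace_def)
  define D where "D = (\<lambda>v. (l2norm \<mu> (\<lambda>x. g x - v x))\<^sup>2) ` V"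
  define d where "d = Inf D"
  have Dne: "D \<noteq> {}" using V by (auto simp: D_def closed_subspace_def)
  have Dbd: "bdd_below D" by (rule bdd_belowI[of _ 0]) (auto simp: D_def)
  have dle: "d \<le> (l2norm \<mu> (\<lambda>x. g x - v x))\<^sup>2" if "v \<in> V" for v
    unfolding d_def using that by (intro cInf_lower Dbd) (auto simp: D_def)
  have "\<exists>v\<in>V. (l2norm \<mu> (\<lambda>x. g x - v x))\<^sup>2 < d + inverse (Suc n)" for n
  proof -
    have "Inf D < d + inverse (real (Suc n))" by (simp add: d_def)
    then show ?thesis using cInf_lessD[OF Dne] by (auto simp: D_def)
  qed
  then obtain v where v: "\<And>n. v n \<in> V" "\<And>n. (l2norm \<mu> (\<lambda>x. g x - v n x))\<^sup>2 < d + inverse (Suc n)" by metis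
  have par: "(l2norm \<mu> (\<lambda>x. v m x - v n x))\<^sup>2 \<le> 2 * inverse (Suc m) + 2 * inverse (Suc n)" for m n
  proof -
    let ?a = "\<lambda>x. g x - v n x" and ?b = "\<lambda>x. g x - v m x"
    have a: "?a \<in> L2 \<mu>" and b: "?b \<in> L2 \<mu>" using g v(1) VL by (auto intro: L2_diff)
    have b': "(\<lambda>x. -1 * ?b x) \<in> L2 \<mu>" by (rule L2_cmult[OF b])
    have e1: "(l2norm \<mu> (\<lambda>x. v m x - v n x))\<^sup>2 = (l2norm \<mu> ?a)\<^sup>2 - 2 * Re (ip \<mu> ?a ?b) + (l2norm \<mu> ?b)\<^sup>2"
      using l2norm_diff_expand[OF a b] by simp
    have e2: "(l2norm \<mu> (\<lambda>x. ?a x + ?b x))\<^sup>2 = (l2norm \<mu> ?a)\<^sup>2 + 2 * Re (ip \<mu> ?a ?b) + (l2norm \<mu> ?b)\<^sup>2"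
      using l2norm_diff_expand[OF a b'] ip_cmult_right[of ?a "-1" ?b] l2norm_cmult[of "-1" ?b] by simp
    let ?w = "\<lambda>x. (1/2) * (v n x + v m x)"
    \<comment> \<open>The midpoint of two approximants is again in \<open>V\<close>, so its squared
      distance to \<open>g\<close> is at least \<open>d\<close>; this is what the parallelogram law
      needs.\<close>
    have "?w \<in> V" by (intro Vc Vadd v)
    then have "d \<le> (l2norm \<mu> (\<lambda>x. g x - ?w x))\<^sup>2" by (rule dle)
    also have "(\<lambda>x. g x - ?w x) = (\<lambda>x. (1/2) * (?a x + ?b x))" by (simp add: fun_eq_iff field_simps)
    also have "(l2norm \<mu> \<dots>)\<^sup>2 = (l2norm \<mu> (\<lambda>x. ?a x + ?b x))\<^sup>2 / 4"
      by (subst l2norm_cmult) (simp add: power_mult_distrib power_divide)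
    finally have "4 * d \<le> (l2norm \<mu> (\<lambda>x. ?a x + ?b x))\<^sup>2" by simp
    then show ?thesis using e1 e2 v(2)[of n] v(2)[of m] by linarith
  qed
  have "\<exists>h\<in>L2 \<mu>. (\<lambda>n. l2norm \<mu> (\<lambda>x. v n x - h x)) \<longlonglongrightarrow> 0"
  proof (rule L2_complete)
    fix e :: real assume e: "e > 0"
    then obtain N where N: "inverse (real (Suc N)) < e\<^sup>2 / 4" using reals_Archimedean[of "e\<^sup>2/4"] by auto
    have "l2norm \<mu> (\<lambda>x. v m x - v n x) < e" if "m \<ge> N" "n \<ge> N" for m n
    proof -
      have i: "inverse (real (Suc k)) \<le> inverse (real (Suc N))" if "k \<ge> N" for k
        using that by (intro le_imp_inverse_le) auto
      have "(l2norm \<mu> (\<lambda>x. v m x - v n x))\<^sup>2 < e\<^sup>2"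
        using par[of m n] i[OF that(1)] i[OF that(2)] N by linarith
      then show ?thesis using e by (simp add: power2_less_imp_less)
    qed
    then show "\<exists>N. \<forall>m\<ge>N. \<forall>n\<ge>N. l2norm \<mu> (\<lambda>x. v m x - v n x) < e" by blast
  qed (use v VL in auto)
  then obtain h where h: "h \<in> L2 \<mu>" "(\<lambda>n. l2norm \<mu> (\<lambda>x. v n x - h x)) \<longlonglongrightarrow> 0" by auto
  have hV: "h \<in> V"
  proof -
    have "\<exists>u\<in>V. l2norm \<mu> (\<lambda>x. h x - u x) < e" if "e > 0" for e
    proof -
      have "eventually (\<lambda>n. l2norm \<mu> (\<lambda>x. v n x - h x) < e) sequentially"
        using h(2) that by (simp add: order_tendsto_iff)
      then obtain n where "l2norm \<mu> (\<lambda>x. v n x - h x) < e" by (auto simp: eventually_sequentially)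
      then show ?thesis using v(1)[of n] l2norm_diff_commute by metis
    qed
    then show ?thesis using V h(1) by (auto simp: closed_subspace_def)
  qed
  define w where "w = (\<lambda>x. g x - h x)"
  have w: "w \<in> L2 \<mu>" unfolding w_def using g h by (intro L2_diff)
  have wd: "(l2norm \<mu> w)\<^sup>2 \<le> d"
  proof -
    have "l2norm \<mu> w \<le> sqrt (d + inverse (Suc n)) + l2norm \<mu> (\<lambda>x. v n x - h x)" for n
    proof -
      have "l2norm \<mu> w \<le> l2norm \<mu> (\<lambda>x. g x - v n x) + l2norm \<mu> (\<lambda>x. v n x - h x)"
        unfolding w_def using g v VL h by (intro l2norm_diff_triangle) auto
      moreover have "l2norm \<mu> (\<lambda>x. g x - v n x) \<le> sqrt (d + inverse (Suc n))"
        using v(2)[of n] by (intro real_le_rsqrt) simp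
      ultimately show ?thesis by simp
    qed
    moreover have "(\<lambda>n. sqrt (d + inverse (Suc n)) + l2norm \<mu> (\<lambda>x. v n x - h x)) \<longlonglongrightarrow> sqrt (d + 0) + 0"
      by (intro tendsto_intros h LIMSEQ_inverse_real_of_nat)
    ultimately have "l2norm \<mu> w \<le> sqrt d" by (intro LIMSEQ_le_const[where x="sqrt d"]) auto
    moreover have "0 \<le> d" unfolding d_def using Dne by (intro cInf_greatest) (auto simp: D_def)
    ultimately show ?thesis using power_mono[of "l2norm \<mu> w" "sqrt d" 2] by simp
  qed
  have "ip \<mu> w u = 0" if u: "u \<in> V" for u
  proof (rule ccontr)
    define c where "c = ip \<mu> w u"
    assume "ip \<mu> w u \<noteq> 0"
    then have c: "(cmod c)\<^sup>2 > 0" by (simp add: c_def)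
    define b where "b = (l2norm \<mu> u)\<^sup>2"
    have b: "b \<ge> 0" by (simp add: b_def)
    \<comment> \<open>The step along \<open>u\<close> changes the squared residue by
      \<open>- \<epsilon> * (2 - \<epsilon> * b) * |c|\<^sup>2\<close>, which is negative as soon as
      \<open>\<epsilon> * b < 1\<close>.\<close>
    define \<epsilon> where "\<epsilon> = 1 / (b + 1)"
    have eps: "\<epsilon> > 0" "\<epsilon> * b < 1" using b by (auto simp: \<epsilon>_def)
    let ?t = "of_real \<epsilon> * c"
    have "(\<lambda>x. h x + ?t * u x) \<in> V" using u hV by (intro Vadd Vc)
    then have "d \<le> (l2norm \<mu> (\<lambda>x. g x - (h x + ?t * u x)))\<^sup>2" by (rule dle)
    also have "(\<lambda>x. g x - (h x + ?t * u x)) = (\<lambda>x. w x - ?t * u x)" by (simp add: w_def fun_eq_iff)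
    also have "(l2norm \<mu> \<dots>)\<^sup>2 = (l2norm \<mu> w)\<^sup>2 - 2 * Re (cnj ?t * c) + (cmod ?t)\<^sup>2 * b"
      using l2norm_diff_expand[OF w L2_cmult[OF VL[OF u], of ?t]]
      by (simp add: ip_cmult_right l2norm_cmult power_mult_distrib b_def c_def)
    also have "cnj ?t * c = of_real (\<epsilon> * (cmod c)\<^sup>2)"
      by (simp add: complex_norm_square mult_ac del: of_real_power)
    also have "(cmod ?t)\<^sup>2 * b = \<epsilon> * (\<epsilon> * b) * (cmod c)\<^sup>2"
      using eps by (simp add: norm_mult power_mult_distrib power2_eq_square)
    finally have "2 * (\<epsilon> * (cmod c)\<^sup>2) \<le> (\<epsilon> * b) * (\<epsilon> * (cmod c)\<^sup>2)" using wd by (simp add: mult_ac)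
    also have "\<dots> \<le> 1 * (\<epsilon> * (cmod c)\<^sup>2)" using eps c by (intro mult_right_mono) auto
    finally show False using eps c by simp
  qed
  then show ?thesis using hV by (auto simp: w_def)
qed

text \<open>A vector \<open>w\<close> orthogonal to the kernel of \<open>F\<close> represents it up
  to a factor, because \<open>f - (F f / F w) * w\<close> lies in the kernel.\<close>

lemma Riesz_representation:
  fixes F :: "(complex^'d \<Rightarrow> complex) \<Rightarrow> complex"
  assumes add: "\<And>f g. f \<in> L2 \<mu> \<Longrightarrow> g \<in> L2 \<mu> \<Longrightarrow> F (\<lambda>x. f x + g x) = F f + F g"
    and cm: "\<And>c f. f \<in> L2 \<mu> \<Longrightarrow> F (\<lambda>x. c * f x) = c * F f"
    and bd: "\<And>f. f \<in> L2 \<mu> \<Longrightarrow> cmod (F f) \<le> C * l2norm \<mu> f"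
  shows "\<exists>k\<in>L2 \<mu>. \<forall>f\<in>L2 \<mu>. F f = ip \<mu> f k"
proof (cases "\<forall>f\<in>L2 \<mu>. F f = 0")
  case True
  then show ?thesis by (intro bexI[of _ "\<lambda>x. 0"]) (auto simp: ip_def)
next
  case False
  then obtain g where g: "g \<in> L2 \<mu>" "F g \<noteq> 0" by auto
  have diff: "F (\<lambda>x. f x - h x) = F f - F h" if "f \<in> L2 \<mu>" "h \<in> L2 \<mu>" for f h
    using add[OF that(1) L2_cmult[OF that(2), of "-1"]] cm[OF that(2), of "-1"] by simp
  let ?V = "{f \<in> L2 \<mu>. F f = 0}"
  have "closed_subspace ?V" unfolding closed_subspace_def
  proof (intro conjI ballI allI impI)
    show "(\<lambda>x. 0) \<in> ?V" using cm[OF L2_zero, of 0] by simp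
    fix f assume f: "f \<in> L2 \<mu>" and ex: "\<forall>e>0. \<exists>g\<in>?V. l2norm \<mu> (\<lambda>x. f x - g x) < e"
    have "cmod (F f) \<le> (\<bar>C\<bar> + 1) * e" if e: "e > 0" for e
    proof -
      obtain g where g: "g \<in> ?V" "l2norm \<mu> (\<lambda>x. f x - g x) < e" using ex[rule_format, OF e] by blast
      have "cmod (F f) = cmod (F (\<lambda>x. f x - g x))" using g f diff by simp
      also have "\<dots> \<le> C * l2norm \<mu> (\<lambda>x. f x - g x)" using g f by (intro bd L2_diff) auto
      also have "\<dots> \<le> (\<bar>C\<bar> + 1) * e" using g by (intro mult_mono) auto
      finally show ?thesis .
    qed
    note le = this
    have "cmod (F f) \<le> e" if "e > 0" for e
    proof -
      have pos: "\<bar>C\<bar> + 1 > 0" by simp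
      then have "cmod (F f) \<le> (\<bar>C\<bar> + 1) * (e / (\<bar>C\<bar> + 1))" using that by (intro le divide_pos_pos)
      then show ?thesis using pos by simp
    qed
    then have "cmod (F f) \<le> 0" by (rule field_le_epsilon) simp
    then show "f \<in> ?V" using f by simp
  qed (auto simp: add cm L2_add L2_cmult)
  from orthogonal_projection[OF this g(1)] obtain h where h: "h \<in> L2 \<mu>" "F h = 0"
    "\<And>v. v \<in> ?V \<Longrightarrow> ip \<mu> (\<lambda>x. g x - h x) v = 0" by auto
  define w where "w = (\<lambda>x. g x - h x)"
  have w: "w \<in> L2 \<mu>" unfolding w_def using g h by (intro L2_diff)
  have Fw: "F w = F g" unfolding w_def using diff g h by simp
  have Fw0: "F w \<noteq> 0" using Fw g by simp
  have nw: "(l2norm \<mu> w)\<^sup>2 \<noteq> 0"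
  proof
    assume "(l2norm \<mu> w)\<^sup>2 = 0"
    then have "cmod (F w) \<le> 0" using bd[OF w] by simp
    then show False using Fw0 by simp
  qed
  have "F f = ip \<mu> f (\<lambda>x. (cnj (F w) / of_real ((l2norm \<mu> w)\<^sup>2)) * w x)" if f: "f \<in> L2 \<mu>" for f
  proof -
    let ?v = "\<lambda>x. f x - (F f / F w) * w x"
    have "F ?v = F f - (F f / F w) * F w"
      using diff[OF f L2_cmult[OF w, of "F f / F w"]] cm[OF w, of "F f / F w"] by simp
    then have "F ?v = 0" using Fw0 by simp
    moreover have "?v \<in> L2 \<mu>" by (rule L2_diff[OF f L2_cmult[OF w]])
    ultimately have "?v \<in> ?V" by blast
    then have "ip \<mu> w ?v = 0" using h(3) by (simp add: w_def)
    then have "ip \<mu> ?v w = 0" by (metis ip_cnj complex_cnj_zero)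
    then have "ip \<mu> f w = (F f / F w) * of_real ((l2norm \<mu> w)\<^sup>2)"
      by (simp only: ip_diff_left[OF f L2_cmult[OF w] w] ip_cmult_left ip_self eq_iff_diff_eq_0[symmetric])
    then show ?thesis using nw Fw0 by (simp only: ip_cmult_right) (simp add: field_simps)
  qed
  then show ?thesis by (intro bexI[OF _ L2_cmult[OF w]] ballI)
qed

lemma L2_eq_AE_I:
  assumes f: "f \<in> L2 \<mu>" and g: "g \<in> L2 \<mu>" and "\<And>k. k \<in> L2 \<mu> \<Longrightarrow> ip \<mu> f k = ip \<mu> g k"
  shows "AE x in \<mu>. f x = g x"
proof -
  have d: "(\<lambda>x. f x - g x) \<in> L2 \<mu>" using f g by (rule L2_diff)
  have "ip \<mu> (\<lambda>x. f x - g x) (\<lambda>x. f x - g x) = 0"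
    using assms(3)[OF d] f g d by (simp add: ip_diff_left)
  then have "l2norm \<mu> (\<lambda>x. f x - g x) = 0" by (simp add: ip_self)
  then show ?thesis using d by (simp add: l2norm_eq_0_AE)
qed

end

lemma cpoly_continuous: "p \<in> cpoly \<Longrightarrow> continuous_on UNIV p"
  by (induction rule: cpoly.induct) (intro continuous_intros; assumption?)+

section \<open>Multiplication by the coordinates and their conjugates\<close>

definition (in sphere_space) zmul :: "'d \<Rightarrow> 'd fn \<Rightarrow> 'd fn" where "zmul i f = (\<lambda>x. x $ i * f x)"
definition (in sphere_space) zbmul :: "'d \<Rightarrow> 'd fn \<Rightarrow> 'd fn" where "zbmul i f = (\<lambda>x. cnj (x $ i) * f x)"

context sphere_space begin

lemma coord_bound: "x \<in> S \<Longrightarrow> cmod (x $ i) \<le> sqrt r"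
proof (rule real_le_rsqrt)
  assume "x \<in> S"
  have "(cmod (x $ i))\<^sup>2 \<le> (\<Sum>i\<in>UNIV. (cmod (x $ i))\<^sup>2)" by (rule member_le_sum) auto
  then show "(cmod (x $ i))\<^sup>2 \<le> r" using sphere[OF \<open>x \<in> S\<close>] by simp
qed

lemma bounded_continuous_L2: assumes "continuous_on UNIV p" shows "p \<in> L2 \<mu>"
proof -
  have "compact (p ` S)" using assms compact_S by (meson compact_continuous_image continuous_on_subset subset_UNIV)
  then obtain c where c: "\<And>x. x \<in> S \<Longrightarrow> cmod (p x) \<le> c"
    using compact_imp_bounded bounded_iff by (metis imageI)
  show ?thesis
    by (rule L2_bound[OF L2_const[of 1], of _ c])
      (use c assms in \<open>auto intro!: borel_measurable_mu borel_measurable_continuous_onI\<close>)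
qed

lemma cpoly_L2: "p \<in> cpoly \<Longrightarrow> p \<in> L2 \<mu>"
  by (intro bounded_continuous_L2 cpoly_continuous)

lemma zmul_L2: "f \<in> L2 \<mu> \<Longrightarrow> zmul i f \<in> L2 \<mu>"
  unfolding zmul_def by (rule L2_mult[of _ _ "sqrt r"]) (auto intro: coord_bound)

lemma zbmul_L2: "f \<in> L2 \<mu> \<Longrightarrow> zbmul i f \<in> L2 \<mu>"
  unfolding zbmul_def by (rule L2_mult[of _ _ "sqrt r"]) (auto intro: coord_bound)

lemma l2norm_zmul: assumes "f \<in> L2 \<mu>" shows "l2norm \<mu> (zmul i f) \<le> sqrt r * l2norm \<mu> f"
  using assms zmul_L2[OF assms]
  by (rule l2norm_mono) (auto simp: zmul_def norm_mult intro!: mult_right_mono coord_bound)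

lemma l2norm_zbmul: assumes "f \<in> L2 \<mu>" shows "l2norm \<mu> (zbmul i f) \<le> sqrt r * l2norm \<mu> f"
  using assms zbmul_L2[OF assms]
  by (rule l2norm_mono) (auto simp: zbmul_def norm_mult intro!: mult_right_mono coord_bound)

lemma ip_zbmul_left: "ip \<mu> (zbmul i f) g = ip \<mu> f (zmul i g)"
  unfolding zbmul_def zmul_def by (subst ip_mult_shift) simp

text \<open>The identity \<open>\<Sum> |z\<^sub>i|\<^sup>2 = r\<close> is applied under the
  integral: the column of the operators \<open>zbmul i\<close> is \<open>sqrt r\<close> times an
  isometry. This is where the factor \<open>r\<close> of the equation comes from.\<close>

lemma sum_ip_zbmul:
  assumes f: "f \<in> L2 \<mu>" and g: "g \<in> L2 \<mu>"
  shows "(\<Sum>i\<in>UNIV. ip \<mu> (zbmul i f) (zbmul i g)) = of_nat r * ip \<mu> f g"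
proof -
  have "(\<Sum>i\<in>UNIV. ip \<mu> (zbmul i f) (zbmul i g)) = (\<Sum>i\<in>UNIV. \<integral>x. zbmul i f x * cnj (zbmul i g x) \<partial>\<mu>)"
    by (simp add: ip_def)
  also have "\<dots> = (\<integral>x. (\<Sum>i\<in>UNIV. zbmul i f x * cnj (zbmul i g x)) \<partial>\<mu>)"
    using f g by (intro Bochner_Integration.integral_sum[symmetric] integrable_ip zbmul_L2)
  also have "\<dots> = (\<integral>x. of_nat r * (f x * cnj (g x)) \<partial>\<mu>)"
  proof (rule Bochner_Integration.integral_cong[OF refl])
    fix x assume "x \<in> space \<mu>"
    then have x: "x \<in> S" by (simp add: space_mu)
    have "(\<Sum>i\<in>UNIV. zbmul i f x * cnj (zbmul i g x)) = (\<Sum>i\<in>UNIV. of_real ((cmod (x $ i))\<^sup>2) * (f x * cnj (g x)))"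
      by (intro sum.cong refl) (simp only: zbmul_def complex_norm_square, simp add: mult_ac)
    also have "\<dots> = of_real (\<Sum>i\<in>UNIV. (cmod (x $ i))\<^sup>2) * (f x * cnj (g x))"
      by (simp only: of_real_sum sum_distrib_right)
    finally show "(\<Sum>i\<in>UNIV. zbmul i f x * cnj (zbmul i g x)) = of_nat r * (f x * cnj (g x))"
      using sphere[OF x] by simp
  qed
  finally show ?thesis by (simp add: ip_def)
qed

lemma sum_l2norm_zbmul:
  assumes f: "f \<in> L2 \<mu>"
  shows "(\<Sum>i\<in>UNIV. (l2norm \<mu> (zbmul i f))\<^sup>2) = r * (l2norm \<mu> f)\<^sup>2"
proof -
  have "complex_of_real (\<Sum>i\<in>UNIV. (l2norm \<mu> (zbmul i f))\<^sup>2) = complex_of_real (r * (l2norm \<mu> f)\<^sup>2)"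
    using sum_ip_zbmul[OF f f] by (simp add: ip_self)
  then show ?thesis using of_real_eq_iff by blast
qed

text \<open>Cauchy-Schwarz in the index \<open>i\<close>. It lets the averaging map preserve the
  bound of a form without loss, which is essential for iterating it.\<close>

lemma sum_l2norm_zbmul2:
  assumes f: "f \<in> L2 \<mu>" and g: "g \<in> L2 \<mu>"
  shows "(\<Sum>i\<in>UNIV. l2norm \<mu> (zbmul i f) * l2norm \<mu> (zbmul i g)) \<le> r * (l2norm \<mu> f * l2norm \<mu> g)"
proof -
  have "(\<Sum>i\<in>UNIV. \<bar>l2norm \<mu> (zbmul i f)\<bar> * \<bar>l2norm \<mu> (zbmul i g)\<bar>) \<le>
     L2_set (\<lambda>i. l2norm \<mu> (zbmul i f)) UNIV * L2_set (\<lambda>i. l2norm \<mu> (zbmul i g)) UNIV"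
    by (rule L2_set_mult_ineq)
  then show ?thesis
    by (simp add: L2_set_def sum_l2norm_zbmul f g real_sqrt_mult mult_ac flip: power2_eq_square)
qed

lemma zbmul_commute: "zbmul i (zbmul j f) = zbmul j (zbmul i f)"
  by (simp add: zbmul_def fun_eq_iff)

lemma zbmul_zmul: "zbmul i (zmul j f) = zmul j (zbmul i f)"
  by (simp add: zbmul_def zmul_def fun_eq_iff)

lemma zbmul_add: "zbmul i (\<lambda>x. f x + g x) = (\<lambda>x. zbmul i f x + zbmul i g x)"
  by (simp add: zbmul_def fun_eq_iff algebra_simps)

lemma zbmul_cmult: "zbmul i (\<lambda>x. c * f x) = (\<lambda>x. c * zbmul i f x)"
  by (simp add: zbmul_def fun_eq_iff algebra_simps)

lemma zmul_add: "zmul i (\<lambda>x. f x + g x) = (\<lambda>x. zmul i f x + zmul i g x)"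
  by (simp add: zmul_def fun_eq_iff algebra_simps)

lemma zmul_cmult: "zmul i (\<lambda>x. c * f x) = (\<lambda>x. c * zmul i f x)"
  by (simp add: zmul_def fun_eq_iff algebra_simps)

lemma zmul_diff: "zmul i (\<lambda>x. f x - g x) = (\<lambda>x. zmul i f x - zmul i g x)"
  by (simp add: zmul_def fun_eq_iff algebra_simps)

section \<open>The Hardy space, its complement and the projection\<close>

lemma H2_L2: "f \<in> H2 \<mu> \<Longrightarrow> f \<in> L2 \<mu>" by (simp add: H2_def)

lemma H2perp_L2: "f \<in> H2perp \<mu> \<Longrightarrow> f \<in> L2 \<mu>" by (simp add: H2perp_def)

lemma H2_closed_subspace: "closed_subspace (H2 \<mu>)"
  unfolding closed_subspace_def
proof (intro conjI ballI allI impI)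
  show "H2 \<mu> \<subseteq> L2 \<mu>" by (auto simp: H2_def)
  have "l2norm \<mu> (\<lambda>x. 0 - 0) = 0" by (simp add: l2norm_def)
  then have "\<exists>p\<in>cpoly. l2norm \<mu> (\<lambda>x. 0 - p x) < e" if "e > 0" for e
    using that by (intro bexI[OF _ cpoly.const[of 0]]) simp
  then show "(\<lambda>x. 0) \<in> H2 \<mu>" unfolding H2_def by (intro CollectI conjI L2_zero allI impI)
next
  fix f g assume f: "f \<in> H2 \<mu>" and g: "g \<in> H2 \<mu>"
  show "(\<lambda>x. f x + g x) \<in> H2 \<mu>" unfolding H2_def
  proof (intro CollectI conjI allI impI)
    show "(\<lambda>x. f x + g x) \<in> L2 \<mu>" using f g by (intro L2_add H2_L2)
    fix e :: real assume e: "e > 0"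
    obtain p where p: "p \<in> cpoly" "l2norm \<mu> (\<lambda>x. f x - p x) < e/2" using f e unfolding H2_def by (auto dest: spec[of _ "e/2"])
    obtain q where q: "q \<in> cpoly" "l2norm \<mu> (\<lambda>x. g x - q x) < e/2" using g e unfolding H2_def by (auto dest: spec[of _ "e/2"])
    have "l2norm \<mu> (\<lambda>x. (f x - p x) + (g x - q x)) \<le> l2norm \<mu> (\<lambda>x. f x - p x) + l2norm \<mu> (\<lambda>x. g x - q x)"
      by (rule l2norm_triangle[OF L2_diff[OF H2_L2[OF f] cpoly_L2[OF p(1)]] L2_diff[OF H2_L2[OF g] cpoly_L2[OF q(1)]]])
    also have "(\<lambda>x. (f x - p x) + (g x - q x)) = (\<lambda>x. f x + g x - (p x + q x))" by (simp add: fun_eq_iff)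
    finally have "l2norm \<mu> (\<lambda>x. f x + g x - (p x + q x)) < e" using p q by simp
    then show "\<exists>p\<in>cpoly. l2norm \<mu> (\<lambda>x. f x + g x - p x) < e"
      using cpoly.add[OF p(1) q(1)] by (intro bexI[of _ "\<lambda>x. p x + q x"])
  qed
next
  fix c f assume f: "f \<in> H2 \<mu>"
  show "(\<lambda>x. c * f x) \<in> H2 \<mu>" unfolding H2_def
  proof (intro CollectI conjI allI impI)
    show "(\<lambda>x. c * f x) \<in> L2 \<mu>" using f by (intro L2_cmult H2_L2)
    fix e :: real assume e: "e > 0"
    have "e / (cmod c + 1) > 0" using e by (intro divide_pos_pos add_nonneg_pos) auto
    then obtain p where p: "p \<in> cpoly" "l2norm \<mu> (\<lambda>x. f x - p x) < e / (cmod c + 1)"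
      using f unfolding H2_def by (auto dest: spec[of _ "e / (cmod c + 1)"])
    have "l2norm \<mu> (\<lambda>x. c * f x - c * p x) = cmod c * l2norm \<mu> (\<lambda>x. f x - p x)"
      using l2norm_cmult[of c "\<lambda>x. f x - p x"] by (simp add: algebra_simps)
    also have "\<dots> \<le> (cmod c + 1) * l2norm \<mu> (\<lambda>x. f x - p x)" by (intro mult_right_mono) auto
    also have "\<dots> < e" using p(2) by (simp add: pos_less_divide_eq add_nonneg_pos mult.commute)
    finally show "\<exists>p\<in>cpoly. l2norm \<mu> (\<lambda>x. c * f x - p x) < e"
      using cpoly.mult[OF cpoly.const p(1)] by (intro bexI[of _ "\<lambda>x. c * p x"])
  qed
next
  fix f assume f: "f \<in> L2 \<mu>" and ex: "\<forall>e>0. \<exists>g\<in>H2 \<mu>. l2norm \<mu> (\<lambda>x. f x - g x) < e"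
  show "f \<in> H2 \<mu>" unfolding H2_def
  proof (intro CollectI conjI allI impI f)
    fix e :: real assume e: "e > 0"
    obtain g where g: "g \<in> H2 \<mu>" "l2norm \<mu> (\<lambda>x. f x - g x) < e/2" using ex[rule_format, of "e/2"] e by auto
    obtain q where q: "q \<in> cpoly" "l2norm \<mu> (\<lambda>x. g x - q x) < e/2" using g e unfolding H2_def by (auto dest: spec[of _ "e/2"])
    have "l2norm \<mu> (\<lambda>x. f x - q x) \<le> l2norm \<mu> (\<lambda>x. f x - g x) + l2norm \<mu> (\<lambda>x. g x - q x)"
      by (rule l2norm_diff_triangle[OF f H2_L2[OF g(1)] cpoly_L2[OF q(1)]])
    then show "\<exists>p\<in>cpoly. l2norm \<mu> (\<lambda>x. f x - p x) < e" using q g by (intro bexI[of _ q]) auto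
  qed
qed

lemma H2_zmul: assumes f: "f \<in> H2 \<mu>" shows "zmul i f \<in> H2 \<mu>"
  unfolding H2_def
proof (intro CollectI conjI allI impI)
  show "zmul i f \<in> L2 \<mu>" using f by (intro zmul_L2 H2_L2)
  fix e :: real assume e: "e > 0"
  have s: "sqrt r > 0" using r_pos by simp
  then obtain p where p: "p \<in> cpoly" "l2norm \<mu> (\<lambda>x. f x - p x) < e / sqrt r"
    using f e unfolding H2_def by (auto dest: spec[of _ "e / sqrt r"])
  have "l2norm \<mu> (zmul i (\<lambda>x. f x - p x)) \<le> sqrt r * l2norm \<mu> (\<lambda>x. f x - p x)"
    by (rule l2norm_zmul[OF L2_diff[OF H2_L2[OF f] cpoly_L2[OF p(1)]]])
  also have "\<dots> < e" using p(2) s by (simp add: pos_less_divide_eq mult.commute)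
  finally show "\<exists>p\<in>cpoly. l2norm \<mu> (\<lambda>x. zmul i f x - p x) < e"
    using cpoly.mult[OF cpoly.coord p(1), of i] by (intro bexI[of _ "\<lambda>x. x $ i * p x"]) (simp_all add: zmul_diff, simp add: zmul_def)
qed

lemma H2perp_ip: "h \<in> H2perp \<mu> \<Longrightarrow> f \<in> H2 \<mu> \<Longrightarrow> ip \<mu> h f = 0"
  by (simp add: H2perp_def)

text \<open>Multiplication by a coordinate preserves the Hardy space and is adjoint to
  multiplication by its conjugate, so the latter preserves the complement. Hence the projection in
  the dual Toeplitz operator of \<open>cnj z\<^sub>i\<close> has no effect.\<close>

lemma H2perp_zbmul: assumes "h \<in> H2perp \<mu>" shows "zbmul i h \<in> H2perp \<mu>"
  using assms by (auto simp: H2perp_def ip_zbmul_left H2_zmul zbmul_L2)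

lemma H2perp_add: "f \<in> H2perp \<mu> \<Longrightarrow> g \<in> H2perp \<mu> \<Longrightarrow> (\<lambda>x. f x + g x) \<in> H2perp \<mu>"
  by (auto simp: H2perp_def L2_add ip_add_left H2_L2)

lemma H2perp_cmult: "f \<in> H2perp \<mu> \<Longrightarrow> (\<lambda>x. c * f x) \<in> H2perp \<mu>"
  by (auto simp: H2perp_def L2_cmult ip_cmult_left)

lemma H2perp_diff: "f \<in> H2perp \<mu> \<Longrightarrow> g \<in> H2perp \<mu> \<Longrightarrow> (\<lambda>x. f x - g x) \<in> H2perp \<mu>"
  by (auto simp: H2perp_def L2_diff ip_diff_left H2_L2)

lemma H2perp_zero: "(\<lambda>x. 0) \<in> H2perp \<mu>"
  by (auto simp: H2perp_def ip_def)

lemma H2perp_sum: "(\<And>i. i \<in> I \<Longrightarrow> f i \<in> H2perp \<mu>) \<Longrightarrow> (\<lambda>x. \<Sum>i\<in>I. f i x) \<in> H2perp \<mu>"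
  by (induction I rule: infinite_finite_induct) (auto intro: H2perp_add H2perp_zero)

lemma H2perp_eq_AE_I:
  assumes f: "f \<in> H2perp \<mu>" and g: "g \<in> H2perp \<mu>" and "\<And>k. k \<in> H2perp \<mu> \<Longrightarrow> ip \<mu> f k = ip \<mu> g k"
  shows "AE x in \<mu>. f x = g x"
proof -
  have d: "(\<lambda>x. f x - g x) \<in> H2perp \<mu>" using f g by (rule H2perp_diff)
  have "ip \<mu> (\<lambda>x. f x - g x) (\<lambda>x. f x - g x) = 0"
    using assms(3)[OF d] f g d by (simp add: ip_diff_left H2perp_L2)
  then have "l2norm \<mu> (\<lambda>x. f x - g x) = 0" by (simp add: ip_self)
  then show ?thesis using H2perp_L2[OF d] by (simp add: l2norm_eq_0_AE)
qed

text \<open>The choice in \<open>Qproj\<close> has a witness: \<open>g\<close> minus its projection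
  onto the closed subspace \<open>H2 \<mu>\<close>.\<close>

lemma Qproj:
  assumes g: "g \<in> L2 \<mu>"
  shows Qproj_H2perp: "Qproj \<mu> g \<in> H2perp \<mu>" and Qproj_H2: "(\<lambda>x. g x - Qproj \<mu> g x) \<in> H2 \<mu>"
proof -
  obtain p where p: "p \<in> H2 \<mu>" "\<And>v. v \<in> H2 \<mu> \<Longrightarrow> ip \<mu> (\<lambda>x. g x - p x) v = 0"
    using orthogonal_projection[OF H2_closed_subspace g] by auto
  have "(\<lambda>x. g x - p x) \<in> H2perp \<mu> \<and> (\<lambda>x. g x - (g x - p x)) \<in> H2 \<mu>"
    using p g by (auto simp: H2perp_def L2_diff H2_L2)
  then have "Qproj \<mu> g \<in> H2perp \<mu> \<and> (\<lambda>x. g x - Qproj \<mu> g x) \<in> H2 \<mu>"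
    unfolding Qproj_def by (rule someI[of "\<lambda>h. h \<in> H2perp \<mu> \<and> (\<lambda>x. g x - h x) \<in> H2 \<mu>"])
  then show "Qproj \<mu> g \<in> H2perp \<mu>" "(\<lambda>x. g x - Qproj \<mu> g x) \<in> H2 \<mu>" by auto
qed

lemma Qproj_L2: "g \<in> L2 \<mu> \<Longrightarrow> Qproj \<mu> g \<in> L2 \<mu>"
  by (rule H2perp_L2[OF Qproj_H2perp])

lemma ip_Qproj_right:
  assumes g: "g \<in> L2 \<mu>" and k: "k \<in> H2perp \<mu>" shows "ip \<mu> k (Qproj \<mu> g) = ip \<mu> k g"
proof -
  have "ip \<mu> k (\<lambda>x. g x - Qproj \<mu> g x) = 0" using Qproj_H2[OF g] k by (rule H2perp_ip[rotated])
  then show ?thesis using g k by (simp add: ip_diff_right H2perp_L2 Qproj_L2)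
qed

lemma ip_Qproj_left:
  assumes g: "g \<in> L2 \<mu>" and k: "k \<in> H2perp \<mu>" shows "ip \<mu> (Qproj \<mu> g) k = ip \<mu> g k"
  using arg_cong[OF ip_Qproj_right[OF g k], of cnj] by (simp add: ip_cnj)

lemma l2norm_Qproj: assumes g: "g \<in> L2 \<mu>" shows "l2norm \<mu> (Qproj \<mu> g) \<le> l2norm \<mu> g"
proof -
  let ?q = "Qproj \<mu> g"
  have "(l2norm \<mu> ?q)\<^sup>2 = cmod (ip \<mu> ?q ?q)" by (simp add: ip_self norm_power)
  also have "\<dots> = cmod (ip \<mu> g ?q)" using g Qproj_H2perp[OF g] by (simp add: ip_Qproj_left)
  also have "\<dots> \<le> l2norm \<mu> g * l2norm \<mu> ?q" using g by (intro Cauchy_Schwarz_ip Qproj_L2)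
  finally have *: "l2norm \<mu> ?q * l2norm \<mu> ?q \<le> l2norm \<mu> g * l2norm \<mu> ?q" by (simp add: power2_eq_square)
  show ?thesis
  proof (cases "l2norm \<mu> ?q = 0")
    case False
    then have "l2norm \<mu> ?q > 0" using l2norm_nonneg[of ?q] by linarith
    then show ?thesis using * by simp
  qed simp
qed

lemma Qproj_H2perp_id: assumes "h \<in> H2perp \<mu>" shows "AE x in \<mu>. Qproj \<mu> h x = h x"
  by (rule H2perp_eq_AE_I) (use assms in \<open>auto intro: Qproj_H2perp H2perp_L2 ip_Qproj_left\<close>)

lemma Qproj_add:
  assumes "f \<in> L2 \<mu>" "g \<in> L2 \<mu>"
  shows "AE x in \<mu>. Qproj \<mu> (\<lambda>x. f x + g x) x = Qproj \<mu> f x + Qproj \<mu> g x"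
proof (rule H2perp_eq_AE_I)
  fix k assume "k \<in> H2perp \<mu>"
  then show "ip \<mu> (Qproj \<mu> (\<lambda>x. f x + g x)) k = ip \<mu> (\<lambda>x. Qproj \<mu> f x + Qproj \<mu> g x) k"
    using assms by (simp add: ip_Qproj_left L2_add ip_add_left Qproj_L2 H2perp_L2)
qed (use assms in \<open>auto intro!: Qproj_H2perp L2_add H2perp_add\<close>)

lemma Qproj_cmult:
  assumes "f \<in> L2 \<mu>"
  shows "AE x in \<mu>. Qproj \<mu> (\<lambda>x. c * f x) x = c * Qproj \<mu> f x"
proof (rule H2perp_eq_AE_I)
  fix k assume "k \<in> H2perp \<mu>"
  then show "ip \<mu> (Qproj \<mu> (\<lambda>x. c * f x)) k = ip \<mu> (\<lambda>x. c * Qproj \<mu> f x) k"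
    using assms by (simp add: ip_Qproj_left L2_cmult ip_cmult_left Qproj_L2 H2perp_L2)
qed (use assms in \<open>auto intro!: Qproj_H2perp L2_cmult H2perp_cmult\<close>)

section \<open>Dual Toeplitz operators and the weak form of the equation\<close>

lemma dualT_zb:
  assumes h: "h \<in> H2perp \<mu>"
  shows "dualT \<mu> (\<lambda>z. cnj (z $ i)) h \<in> H2perp \<mu>" "AE x in \<mu>. dualT \<mu> (\<lambda>z. cnj (z $ i)) h x = zbmul i h x"
  using Qproj_H2perp_id[OF H2perp_zbmul[OF h, of i]] Qproj_H2perp[OF zbmul_L2[OF H2perp_L2[OF h], of i]]
  by (simp_all add: dualT_def zbmul_def)

text \<open>The adjoint is a choice as well. \<open>Qproj \<mu> (zmul i h)\<close> shows that there
  is something to choose; afterwards only membership and the defining pairing are used.\<close>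

lemma adj_dualT_zb:
  assumes h: "h \<in> H2perp \<mu>"
  shows "adj \<mu> (dualT \<mu> (\<lambda>z. cnj (z $ i))) h \<in> H2perp \<mu>"
    and "\<And>g. g \<in> H2perp \<mu> \<Longrightarrow> ip \<mu> g (adj \<mu> (dualT \<mu> (\<lambda>z. cnj (z $ i))) h) = ip \<mu> (zbmul i g) h"
proof -
  let ?A = "dualT \<mu> (\<lambda>z. cnj (z $ i))"
  have eq: "ip \<mu> (?A g) h = ip \<mu> (zbmul i g) h" if g: "g \<in> H2perp \<mu>" for g
    using dualT_zb[OF g, of i] g h by (intro ip_cong_AE) (auto intro: H2perp_L2 H2perp_zbmul)
  have "Qproj \<mu> (zmul i h) \<in> H2perp \<mu> \<and> (\<forall>g\<in>H2perp \<mu>. ip \<mu> (?A g) h = ip \<mu> g (Qproj \<mu> (zmul i h)))"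
    using h by (auto intro!: Qproj_H2perp simp: eq ip_zbmul_left ip_Qproj_right zmul_L2 H2perp_L2)
  then have "adj \<mu> ?A h \<in> H2perp \<mu> \<and> (\<forall>g\<in>H2perp \<mu>. ip \<mu> (?A g) h = ip \<mu> g (adj \<mu> ?A h))"
    unfolding adj_def
    by (rule someI[of "\<lambda>k. k \<in> H2perp \<mu> \<and> (\<forall>g\<in>H2perp \<mu>. ip \<mu> (?A g) h = ip \<mu> g k)"])
  then show "adj \<mu> ?A h \<in> H2perp \<mu>" "\<And>g. g \<in> H2perp \<mu> \<Longrightarrow> ip \<mu> g (adj \<mu> ?A h) = ip \<mu> (zbmul i g) h"
    using eq by auto
qed

lemma bounded_opD:
  assumes "bounded_op \<mu> X"
  shows "\<And>h. h \<in> H2perp \<mu> \<Longrightarrow> X h \<in> H2perp \<mu>"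
    and "\<And>h k. h \<in> H2perp \<mu> \<Longrightarrow> k \<in> H2perp \<mu> \<Longrightarrow> AE x in \<mu>. h x = k x \<Longrightarrow> AE x in \<mu>. X h x = X k x"
    and "\<And>h k. h \<in> H2perp \<mu> \<Longrightarrow> k \<in> H2perp \<mu> \<Longrightarrow> AE x in \<mu>. X (\<lambda>y. h y + k y) x = X h x + X k x"
    and "\<And>c h. h \<in> H2perp \<mu> \<Longrightarrow> AE x in \<mu>. X (\<lambda>y. c * h y) x = c * X h x"
  using assms unfolding bounded_op_def by blast+

text \<open>Tested against \<open>g\<close> in the complement, each adjoint moves over to
  \<open>zbmul i g\<close>, and the inner dual Toeplitz operator may be replaced by
  \<open>zbmul i\<close> because \<open>X\<close> respects equality almost everywhere. The resulting
  condition mentions neither \<open>adj\<close> nor \<open>Qproj\<close>.\<close>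

lemma dual_toeplitz_equation_iff:
  assumes X: "bounded_op \<mu> X"
  shows "op_eq \<mu> (\<lambda>h x. \<Sum>i\<in>UNIV. adj \<mu> (dualT \<mu> (\<lambda>z. cnj (z $ i))) (X (dualT \<mu> (\<lambda>z. cnj (z $ i)) h)) x)
      (\<lambda>h x. of_nat r * X h x) \<longleftrightarrow>
    (\<forall>h\<in>H2perp \<mu>. \<forall>g\<in>H2perp \<mu>. (\<Sum>i\<in>UNIV. ip \<mu> (X (zbmul i h)) (zbmul i g)) = of_nat r * ip \<mu> (X h) g)"
proof -
  note X = bounded_opD[OF X]
  let ?Y = "\<lambda>h x. \<Sum>i\<in>UNIV. adj \<mu> (dualT \<mu> (\<lambda>z. cnj (z $ i))) (X (dualT \<mu> (\<lambda>z. cnj (z $ i)) h)) x"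
  have Y: "?Y h \<in> H2perp \<mu>" if "h \<in> H2perp \<mu>" for h
    using that by (intro H2perp_sum adj_dualT_zb X dualT_zb)
  have ipY: "ip \<mu> (?Y h) g = (\<Sum>i\<in>UNIV. ip \<mu> (X (zbmul i h)) (zbmul i g))" if h: "h \<in> H2perp \<mu>" and g: "g \<in> H2perp \<mu>" for h g
  proof -
    have "ip \<mu> (?Y h) g = (\<Sum>i\<in>UNIV. ip \<mu> (adj \<mu> (dualT \<mu> (\<lambda>z. cnj (z $ i))) (X (dualT \<mu> (\<lambda>z. cnj (z $ i)) h))) g)"
      using h g by (intro ip_sum_left H2perp_L2 adj_dualT_zb X dualT_zb)
    also have "\<dots> = (\<Sum>i\<in>UNIV. ip \<mu> (X (zbmul i h)) (zbmul i g))"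
    proof (rule sum.cong[OF refl])
      fix i
      have "ip \<mu> (adj \<mu> (dualT \<mu> (\<lambda>z. cnj (z $ i))) (X (dualT \<mu> (\<lambda>z. cnj (z $ i)) h))) g
          = cnj (ip \<mu> (zbmul i g) (X (dualT \<mu> (\<lambda>z. cnj (z $ i)) h)))"
        using adj_dualT_zb(2)[OF X(1)[OF dualT_zb(1)[OF h, of i]] g, of i] by (metis ip_cnj)
      also have "\<dots> = ip \<mu> (X (dualT \<mu> (\<lambda>z. cnj (z $ i)) h)) (zbmul i g)" by (rule ip_cnj)
      also have "\<dots> = ip \<mu> (X (zbmul i h)) (zbmul i g)"
        using h g X(2)[OF dualT_zb(1)[OF h, of i] H2perp_zbmul[OF h] dualT_zb(2)[OF h]]
        by (intro ip_cong_AE H2perp_L2 X H2perp_zbmul dualT_zb) auto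
      finally show "ip \<mu> (adj \<mu> (dualT \<mu> (\<lambda>z. cnj (z $ i))) (X (dualT \<mu> (\<lambda>z. cnj (z $ i)) h))) g = ip \<mu> (X (zbmul i h)) (zbmul i g)" .
    qed
    finally show ?thesis .
  qed
  show ?thesis
  proof
    assume eq: "op_eq \<mu> ?Y (\<lambda>h x. of_nat r * X h x)"
    show "\<forall>h\<in>H2perp \<mu>. \<forall>g\<in>H2perp \<mu>. (\<Sum>i\<in>UNIV. ip \<mu> (X (zbmul i h)) (zbmul i g)) = of_nat r * ip \<mu> (X h) g"
    proof (intro ballI)
      fix h g assume h: "h \<in> H2perp \<mu>" and g: "g \<in> H2perp \<mu>"
      have "ip \<mu> (?Y h) g = ip \<mu> (\<lambda>x. of_nat r * X h x) g"
        using eq h g Y[OF h] X(1)[OF h] by (intro ip_cong_AE) (auto simp: op_eq_def intro!: H2perp_L2 H2perp_cmult)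
      then show "(\<Sum>i\<in>UNIV. ip \<mu> (X (zbmul i h)) (zbmul i g)) = of_nat r * ip \<mu> (X h) g"
        using ipY[OF h g] by (simp add: ip_cmult_left)
    qed
  next
    assume eq: "\<forall>h\<in>H2perp \<mu>. \<forall>g\<in>H2perp \<mu>. (\<Sum>i\<in>UNIV. ip \<mu> (X (zbmul i h)) (zbmul i g)) = of_nat r * ip \<mu> (X h) g"
    show "op_eq \<mu> ?Y (\<lambda>h x. of_nat r * X h x)" unfolding op_eq_def
    proof
      fix h assume h: "h \<in> H2perp \<mu>"
      show "AE x in \<mu>. ?Y h x = of_nat r * X h x"
        using Y[OF h] X(1)[OF h] eq h by (intro H2perp_eq_AE_I H2perp_cmult) (auto simp: ipY ip_cmult_left)
    qed
  qed
qed

text \<open>In pairings with elements of the complement the projection in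
  \<open>dualT \<mu> \<phi>\<close> disappears, and multiplication by \<open>\<phi>\<close> commutes
  with \<open>zbmul i\<close>; the sphere identity does the rest.\<close>

lemma dual_toeplitz_imp_equation:
  assumes X: "bounded_op \<mu> X" and phi: "\<phi> \<in> Linf \<mu>" and eq: "op_eq \<mu> X (dualT \<mu> \<phi>)"
    and h: "h \<in> H2perp \<mu>" and g: "g \<in> H2perp \<mu>"
  shows "(\<Sum>i\<in>UNIV. ip \<mu> (X (zbmul i h)) (zbmul i g)) = of_nat r * ip \<mu> (X h) g"
proof -
  obtain C where C: "AE x in \<mu>. cmod (\<phi> x) \<le> C" and phim[measurable]: "\<phi> \<in> borel_measurable \<mu>"
    using phi by (auto simp: Linf_def)
  have phiL: "(\<lambda>x. \<phi> x * f x) \<in> L2 \<mu>" if f: "f \<in> L2 \<mu>" for f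
  proof -
    have [measurable]: "f \<in> borel_measurable \<mu>" using f by (rule L2_measurable)
    have "integrable \<mu> (\<lambda>x. (cmod (\<phi> x * f x))\<^sup>2)"
    proof (rule Bochner_Integration.integrable_bound)
      show "integrable \<mu> (\<lambda>x. C\<^sup>2 * (cmod (f x))\<^sup>2)" using L2_integrable[OF f] by simp
      show "AE x in \<mu>. norm ((cmod (\<phi> x * f x))\<^sup>2) \<le> norm (C\<^sup>2 * (cmod (f x))\<^sup>2)"
        using C by eventually_elim (auto simp: norm_mult power_mult_distrib intro!: mult_right_mono power_mono)
    qed measurable
    then show ?thesis by (simp add: L2_def)
  qed
  have ipX: "ip \<mu> (X h) g = ip \<mu> (\<lambda>x. \<phi> x * h x) g" if h: "h \<in> H2perp \<mu>" and g: "g \<in> H2perp \<mu>" for h g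
  proof -
    have "ip \<mu> (X h) g = ip \<mu> (Qproj \<mu> (\<lambda>x. \<phi> x * h x)) g"
      using eq h g bounded_opD(1)[OF X h]
      by (intro ip_cong_AE) (auto simp: op_eq_def dualT_def intro!: H2perp_L2 Qproj_H2perp phiL)
    then show ?thesis using h g by (simp add: ip_Qproj_left phiL H2perp_L2)
  qed
  have "(\<Sum>i\<in>UNIV. ip \<mu> (X (zbmul i h)) (zbmul i g)) = (\<Sum>i\<in>UNIV. ip \<mu> (zbmul i (\<lambda>x. \<phi> x * h x)) (zbmul i g))"
    using h g by (intro sum.cong refl) (simp add: ipX H2perp_zbmul, simp add: zbmul_def mult.left_commute)
  also have "\<dots> = of_nat r * ip \<mu> (\<lambda>x. \<phi> x * h x) g"
    using h g by (intro sum_ip_zbmul phiL H2perp_L2)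
  finally show ?thesis using h g by (simp add: ipX)
qed

end

section \<open>Fixed points of the averaging map\<close>

text \<open>In an uncountable product a cluster point need not be the limit of a subsequence. Limits
  of continuous expressions still pass to it: along the meet of the two filters, which is proper,
  \<open>D\<close> tends to both \<open>D B\<close> and \<open>l\<close>.\<close>

lemma cluster_point_tendsto_unique:
  fixes D :: "'a::topological_space \<Rightarrow> 'b::t2_space" and A :: "nat \<Rightarrow> 'a"
  assumes "inf (nhds B) (filtermap A sequentially) \<noteq> bot"
    and DB: "(D \<longlongrightarrow> D B) (nhds B)" and "(\<lambda>n. D (A n)) \<longlonglongrightarrow> l"
  shows "D B = l"
proof (rule tendsto_unique[OF assms(1)])
  from DB show "(D \<longlongrightarrow> D B) (inf (nhds B) (filtermap A sequentially))"
    by (rule filterlim_mono) auto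
  have "filterlim D (nhds l) (filtermap A sequentially)"
    using assms(3) by (simp add: filterlim_filtermap)
  then show "(D \<longlongrightarrow> l) (inf (nhds B) (filtermap A sequentially))"
    by (rule filterlim_mono) auto
qed

lemma compact_function_cballs: "compact (Pi UNIV (\<lambda>p. cball (0::complex) (R p)))"
proof -
  have "compactin (product_topology (\<lambda>_. euclidean) UNIV) (PiE UNIV (\<lambda>p. cball (0::complex) (R p)))"
    by (simp add: compactin_PiE)
  then show ?thesis
    by (simp add: euclidean_product_topology PiE_def extensional_def)
qed

context sphere_space begin

section \<open>Bounded sesquilinear forms and the averaging map\<close>

text \<open>Bounded operators on \<open>L2\<close> are represented by their forms, so that weak
  compactness concerns only complex values in discs. Since the arguments are functions and not
  classes, it is the bound that forces equality almost everywhere to be respected.\<close>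

definition sesq :: "real \<Rightarrow> ('d fn \<Rightarrow> 'd fn \<Rightarrow> complex) \<Rightarrow> bool" where
  "sesq C B \<longleftrightarrow> 0 \<le> C \<and>
    (\<forall>f\<in>L2 \<mu>. \<forall>f'\<in>L2 \<mu>. \<forall>g\<in>L2 \<mu>. B (\<lambda>x. f x + f' x) g = B f g + B f' g) \<and>
    (\<forall>c. \<forall>f\<in>L2 \<mu>. \<forall>g\<in>L2 \<mu>. B (\<lambda>x. c * f x) g = c * B f g) \<and>
    (\<forall>f\<in>L2 \<mu>. \<forall>g\<in>L2 \<mu>. \<forall>g'\<in>L2 \<mu>. B f (\<lambda>x. g x + g' x) = B f g + B f g') \<and>
    (\<forall>c. \<forall>f\<in>L2 \<mu>. \<forall>g\<in>L2 \<mu>. B f (\<lambda>x. c * g x) = cnj c * B f g) \<and>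
    (\<forall>f\<in>L2 \<mu>. \<forall>g\<in>L2 \<mu>. cmod (B f g) \<le> C * (l2norm \<mu> f * l2norm \<mu> g))"

lemma sesqI:
  assumes "0 \<le> C"
    and "\<And>f f' g. f \<in> L2 \<mu> \<Longrightarrow> f' \<in> L2 \<mu> \<Longrightarrow> g \<in> L2 \<mu> \<Longrightarrow> B (\<lambda>x. f x + f' x) g = B f g + B f' g"
    and "\<And>c f g. f \<in> L2 \<mu> \<Longrightarrow> g \<in> L2 \<mu> \<Longrightarrow> B (\<lambda>x. c * f x) g = c * B f g"
    and "\<And>f g g'. f \<in> L2 \<mu> \<Longrightarrow> g \<in> L2 \<mu> \<Longrightarrow> g' \<in> L2 \<mu> \<Longrightarrow> B f (\<lambda>x. g x + g' x) = B f g + B f g'"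
    and "\<And>c f g. f \<in> L2 \<mu> \<Longrightarrow> g \<in> L2 \<mu> \<Longrightarrow> B f (\<lambda>x. c * g x) = cnj c * B f g"
    and "\<And>f g. f \<in> L2 \<mu> \<Longrightarrow> g \<in> L2 \<mu> \<Longrightarrow> cmod (B f g) \<le> C * (l2norm \<mu> f * l2norm \<mu> g)"
  shows "sesq C B"
  unfolding sesq_def using assms by (intro conjI ballI allI)

lemma sesqD:
  assumes "sesq C B"
  shows "0 \<le> C"
    and "\<And>f f' g. f \<in> L2 \<mu> \<Longrightarrow> f' \<in> L2 \<mu> \<Longrightarrow> g \<in> L2 \<mu> \<Longrightarrow> B (\<lambda>x. f x + f' x) g = B f g + B f' g"
    and "\<And>c f g. f \<in> L2 \<mu> \<Longrightarrow> g \<in> L2 \<mu> \<Longrightarrow> B (\<lambda>x. c * f x) g = c * B f g"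
    and "\<And>f g g'. f \<in> L2 \<mu> \<Longrightarrow> g \<in> L2 \<mu> \<Longrightarrow> g' \<in> L2 \<mu> \<Longrightarrow> B f (\<lambda>x. g x + g' x) = B f g + B f g'"
    and "\<And>c f g. f \<in> L2 \<mu> \<Longrightarrow> g \<in> L2 \<mu> \<Longrightarrow> B f (\<lambda>x. c * g x) = cnj c * B f g"
    and "\<And>f g. f \<in> L2 \<mu> \<Longrightarrow> g \<in> L2 \<mu> \<Longrightarrow> cmod (B f g) \<le> C * (l2norm \<mu> f * l2norm \<mu> g)"
  using assms[unfolded sesq_def] by simp_all

lemma sesq_diff_left:
  assumes "sesq C B" "f \<in> L2 \<mu>" "f' \<in> L2 \<mu>" "g \<in> L2 \<mu>"
  shows "B (\<lambda>x. f x - f' x) g = B f g - B f' g"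
  using sesqD(2)[OF assms(1,2) L2_cmult[OF assms(3), of "-1"] assms(4)] sesqD(3)[OF assms(1,3,4), of "-1"] by simp

lemma sesq_cnj: "sesq C B \<Longrightarrow> sesq C (\<lambda>f g. cnj (B g f))"
  by (rule sesqI) (auto simp: sesqD(1-5), metis sesqD(6) mult.commute)

text \<open>If \<open>B f g\<close> is the pairing of \<open>T f\<close> with \<open>g\<close>, this
  is the form of \<open>(1 / r) \<Sum> z\<^sub>i T cnj z\<^sub>i\<close>, a positive map that fixes
  the identity operator.\<close>

definition Phi :: "('d fn \<Rightarrow> 'd fn \<Rightarrow> complex) \<Rightarrow> 'd fn \<Rightarrow> 'd fn \<Rightarrow> complex" where
  "Phi B f g = (\<Sum>i\<in>UNIV. B (zbmul i f) (zbmul i g)) / of_nat r"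

lemma sesq_Phi:
  assumes B: "sesq C B" shows "sesq C (Phi B)"
proof (rule sesqI)
  note D = sesqD[OF B]
  fix f g assume f: "f \<in> L2 \<mu>" and g: "g \<in> L2 \<mu>"
  have "cmod (Phi B f g) = cmod (\<Sum>i\<in>UNIV. B (zbmul i f) (zbmul i g)) / r"
    by (simp add: Phi_def norm_divide)
  also have "\<dots> \<le> (\<Sum>i\<in>UNIV. C * (l2norm \<mu> (zbmul i f) * l2norm \<mu> (zbmul i g))) / r"
    using f g by (intro divide_right_mono sum_norm_le D zbmul_L2) auto
  also have "\<dots> = C * (\<Sum>i\<in>UNIV. l2norm \<mu> (zbmul i f) * l2norm \<mu> (zbmul i g)) / r"
    by (simp add: sum_distrib_left)
  also have "\<dots> \<le> C * (r * (l2norm \<mu> f * l2norm \<mu> g)) / r"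
    using f g D(1) by (intro divide_right_mono mult_left_mono sum_l2norm_zbmul2) auto
  also have "\<dots> = C * (l2norm \<mu> f * l2norm \<mu> g)" using r_pos by simp
  finally show "cmod (Phi B f g) \<le> C * (l2norm \<mu> f * l2norm \<mu> g)" .
qed (auto simp: Phi_def zbmul_add zbmul_cmult sesqD(1-5)[OF B] zbmul_L2 sum.distrib add_divide_distrib
    sum_distrib_left mult.assoc)

lemma sesq_funpow_Phi: "sesq C B \<Longrightarrow> sesq C ((Phi ^^ n) B)"
  by (induction n) (auto intro: sesq_Phi)

lemma Phi_sum: "Phi (\<lambda>f g. (\<Sum>k\<in>K. F k f g) / c) f g = (\<Sum>k\<in>K. Phi (F k) f g) / c"
proof -
  have "(\<Sum>i\<in>UNIV. (\<Sum>k\<in>K. F k (zbmul i f) (zbmul i g)) / c) = (\<Sum>k\<in>K. \<Sum>i\<in>UNIV. F k (zbmul i f) (zbmul i g)) / c"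
    by (subst sum.swap) (simp add: sum_divide_distrib)
  then show ?thesis by (simp add: Phi_def sum_divide_distrib mult.commute)
qed

text \<open>The fixed point is a cluster point of the Cesaro means of the iterates of \<^term>\<open>Phi\<close>,
  obtained from Tychonoff's theorem.\<close>
lemma Phi_fixed_point_exists:
  assumes B0: "sesq C B0"
  shows "\<exists>B. sesq C B \<and> (\<forall>f\<in>L2 \<mu>. \<forall>g\<in>L2 \<mu>. Phi B f g = B f g) \<and>
    (\<forall>f\<in>L2 \<mu>. \<forall>g\<in>L2 \<mu>. (\<forall>n. (Phi ^^ n) B0 f g = B0 f g) \<longrightarrow> B f g = B0 f g)"
proof -
  define A where "A n = (\<lambda>f g. (\<Sum>k\<le>n. (Phi ^^ k) B0 f g) / of_nat (Suc n))" for n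
  have A: "sesq C (A n)" for n
  proof (rule sesqI)
    note D = sesqD[OF sesq_funpow_Phi[OF B0]]
    fix f g assume f: "f \<in> L2 \<mu>" and g: "g \<in> L2 \<mu>"
    have "cmod (A n f g) = cmod (\<Sum>k\<le>n. (Phi ^^ k) B0 f g) / real (Suc n)"
      unfolding A_def norm_divide norm_of_nat ..
    also have "\<dots> \<le> (\<Sum>k\<le>n. C * (l2norm \<mu> f * l2norm \<mu> g)) / real (Suc n)"
      using f g by (intro divide_right_mono sum_norm_le D) auto
    also have "\<dots> = C * (l2norm \<mu> f * l2norm \<mu> g)" by simp
    finally show "cmod (A n f g) \<le> C * (l2norm \<mu> f * l2norm \<mu> g)" .
  qed (auto simp: A_def sesqD(1)[OF B0] sesqD(2-5)[OF sesq_funpow_Phi[OF B0]] sum.distrib add_divide_distrib sum_distrib_left)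
  define R where "R p = C * (l2norm \<mu> (fst p) * l2norm \<mu> (snd p))" for p :: "'d fn \<times> 'd fn"
  \<comment> \<open>Off \<open>L2\<close> the means carry no bound, so they are set to 0 there; this
    places all of them in one compact product of discs.\<close>
  define A' where "A' n = (\<lambda>p. if fst p \<in> L2 \<mu> \<and> snd p \<in> L2 \<mu> then A n (fst p) (snd p) else 0)" for n
  let ?K = "Pi UNIV (\<lambda>p. cball (0::complex) (R p))"
  have Rp: "0 \<le> R p" for p using sesqD(1)[OF B0] by (simp add: R_def)
  have mem: "A' n \<in> ?K" for n
    using sesqD(6)[OF A[of n]] Rp by (auto simp: A'_def R_def)
  have "\<exists>B\<in>?K. inf (nhds B) (filtermap A' sequentially) \<noteq> bot"
  proof -
    have "filtermap A' sequentially \<noteq> bot" by (simp add: filtermap_bot_iff)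
    moreover have "eventually (\<lambda>x. x \<in> ?K) (filtermap A' sequentially)"
      using mem by (simp add: eventually_filtermap)
    ultimately show ?thesis
      using compact_function_cballs[of R] unfolding compact_filter by blast
  qed
  then obtain B where BK: "B \<in> ?K" and cl: "inf (nhds B) (filtermap A' sequentially) \<noteq> bot" by blast
  note lim = cluster_point_tendsto_unique[OF cl]
  have ev: "((\<lambda>F. F p) \<longlongrightarrow> B p) (nhds B)" for p
  proof -
    have "continuous_on UNIV (\<lambda>F::'d fn \<times> 'd fn \<Rightarrow> complex. F p)"
      by (rule continuous_on_product_coordinates)
    then have "((\<lambda>F. F p) \<longlongrightarrow> B p) (at B)" unfolding continuous_on_def by simp
    then show ?thesis by (rule tendsto_at_iff_tendsto_nhds[THEN iffD1])
  qed
  define Bc where "Bc = (\<lambda>f g. B (f, g))"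
  have A'eq: "A' n (f, g) = A n f g" if "f \<in> L2 \<mu>" "g \<in> L2 \<mu>" for n f g using that by (simp add: A'_def)
  have sB: "sesq C Bc"
  proof (rule sesqI)
    show "0 \<le> C" by (rule sesqD(1)[OF B0])
    fix f f' g assume fg: "f \<in> L2 \<mu>" "f' \<in> L2 \<mu>" "g \<in> L2 \<mu>"
    have "B (\<lambda>x. f x + f' x, g) - (B (f, g) + B (f', g)) = 0"
    proof (rule lim[where D="\<lambda>F. F (\<lambda>x. f x + f' x, g) - (F (f, g) + F (f', g))"])
      have "A' n (\<lambda>x. f x + f' x, g) - (A' n (f, g) + A' n (f', g)) = 0" for n
        using fg by (simp add: A'eq L2_add sesqD(2)[OF A])
      then show "(\<lambda>n. A' n (\<lambda>x. f x + f' x, g) - (A' n (f, g) + A' n (f', g))) \<longlonglongrightarrow> 0" by simp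
    qed (intro tendsto_intros ev)
    then show "Bc (\<lambda>x. f x + f' x) g = Bc f g + Bc f' g" by (simp add: Bc_def)
  next
    fix c f g assume fg: "f \<in> L2 \<mu>" "g \<in> L2 \<mu>"
    have "B (\<lambda>x. c * f x, g) - c * B (f, g) = 0"
    proof (rule lim[where D="\<lambda>F. F (\<lambda>x. c * f x, g) - c * F (f, g)"])
      have "A' n (\<lambda>x. c * f x, g) - c * A' n (f, g) = 0" for n
        using fg by (simp add: A'eq L2_cmult sesqD(3)[OF A])
      then show "(\<lambda>n. A' n (\<lambda>x. c * f x, g) - c * A' n (f, g)) \<longlonglongrightarrow> 0" by simp
    qed (intro tendsto_intros ev)
    then show "Bc (\<lambda>x. c * f x) g = c * Bc f g" by (simp add: Bc_def)
  next
    fix f g g' assume fg: "f \<in> L2 \<mu>" "g \<in> L2 \<mu>" "g' \<in> L2 \<mu>"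
    have "B (f, \<lambda>x. g x + g' x) - (B (f, g) + B (f, g')) = 0"
    proof (rule lim[where D="\<lambda>F. F (f, \<lambda>x. g x + g' x) - (F (f, g) + F (f, g'))"])
      have "A' n (f, \<lambda>x. g x + g' x) - (A' n (f, g) + A' n (f, g')) = 0" for n
        using fg by (simp add: A'eq L2_add sesqD(4)[OF A])
      then show "(\<lambda>n. A' n (f, \<lambda>x. g x + g' x) - (A' n (f, g) + A' n (f, g'))) \<longlonglongrightarrow> 0" by simp
    qed (intro tendsto_intros ev)
    then show "Bc f (\<lambda>x. g x + g' x) = Bc f g + Bc f g'" by (simp add: Bc_def)
  next
    fix c f g assume fg: "f \<in> L2 \<mu>" "g \<in> L2 \<mu>"
    have "B (f, \<lambda>x. c * g x) - cnj c * B (f, g) = 0"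
    proof (rule lim[where D="\<lambda>F. F (f, \<lambda>x. c * g x) - cnj c * F (f, g)"])
      have "A' n (f, \<lambda>x. c * g x) - cnj c * A' n (f, g) = 0" for n
        using fg by (simp add: A'eq L2_cmult sesqD(5)[OF A])
      then show "(\<lambda>n. A' n (f, \<lambda>x. c * g x) - cnj c * A' n (f, g)) \<longlonglongrightarrow> 0" by simp
    qed (intro tendsto_intros ev)
    then show "Bc f (\<lambda>x. c * g x) = cnj c * Bc f g" by (simp add: Bc_def)
  next
    fix f g
    have "B (f, g) \<in> cball 0 (R (f, g))" using BK by auto
    then show "cmod (Bc f g) \<le> C * (l2norm \<mu> f * l2norm \<mu> g)" by (simp add: Bc_def R_def)
  qed
  have fixp: "Phi Bc f g = Bc f g" if fg: "f \<in> L2 \<mu>" "g \<in> L2 \<mu>" for f g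
  proof -
    have "(\<Sum>i\<in>UNIV. B (zbmul i f, zbmul i g)) / of_nat r - B (f, g) = 0"
    proof (rule lim[where D="\<lambda>F. (\<Sum>i\<in>UNIV. F (zbmul i f, zbmul i g)) / of_nat r - F (f, g)"])
      show "((\<lambda>F. (\<Sum>i\<in>UNIV. F (zbmul i f, zbmul i g)) / of_nat r - F (f, g)) \<longlongrightarrow>
          (\<Sum>i\<in>UNIV. B (zbmul i f, zbmul i g)) / of_nat r - B (f, g)) (nhds B)"
        using r_pos by (intro tendsto_intros ev) auto
      \<comment> \<open>The means telescope: applying \<open>Phi\<close> to the mean
        \<open>A n\<close> changes it by \<open>((Phi ^^ Suc n) B0 - B0) / (n + 1)\<close>, which
        tends to 0 at each pair because all iterates share the bound \<open>C\<close>.\<close>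
      have eq: "(\<Sum>i\<in>UNIV. A' n (zbmul i f, zbmul i g)) / of_nat r - A' n (f, g)
         = ((Phi ^^ Suc n) B0 f g - B0 f g) / of_nat (Suc n)" for n
      proof -
        have "(\<Sum>i\<in>UNIV. A' n (zbmul i f, zbmul i g)) / of_nat r - A' n (f, g) = Phi (A n) f g - A n f g"
          using fg by (simp add: A'eq zbmul_L2 Phi_def)
        also have "\<dots> = ((\<Sum>k\<le>n. (Phi ^^ Suc k) B0 f g) - (\<Sum>k\<le>n. (Phi ^^ k) B0 f g)) / of_nat (Suc n)"
          unfolding A_def Phi_sum by (simp only: funpow.simps comp_apply diff_divide_distrib)
        also have "(\<Sum>k\<le>n. (Phi ^^ Suc k) B0 f g) - (\<Sum>k\<le>n. (Phi ^^ k) B0 f g) = (Phi ^^ Suc n) B0 f g - B0 f g"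
          unfolding sum_subtractf[symmetric] using sum_telescope[of "\<lambda>k. - ((Phi ^^ k) B0 f g)" n] by (simp del: funpow.simps(2))
        finally show ?thesis .
      qed
      have bd: "cmod (((Phi ^^ Suc n) B0 f g - B0 f g) / of_nat (Suc n)) \<le> (2 * C * (l2norm \<mu> f * l2norm \<mu> g)) * inverse (real (Suc n))" for n
      proof -
        have "cmod ((Phi ^^ Suc n) B0 f g - B0 f g) \<le> cmod ((Phi ^^ Suc n) B0 f g) + cmod (B0 f g)"
          by (rule norm_triangle_ineq4)
        also have "\<dots> \<le> 2 * C * (l2norm \<mu> f * l2norm \<mu> g)"
          using sesqD(6)[OF sesq_funpow_Phi[OF B0, of "Suc n"] fg] sesqD(6)[OF B0 fg] by simp
        finally have "cmod ((Phi ^^ Suc n) B0 f g - B0 f g) * inverse (real (Suc n)) \<le> (2 * C * (l2norm \<mu> f * l2norm \<mu> g)) * inverse (real (Suc n))"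
          by (rule mult_right_mono) simp
        then show ?thesis by (simp only: norm_divide norm_of_nat divide_inverse[of "cmod _"])
      qed
      have "(\<lambda>n. ((Phi ^^ Suc n) B0 f g - B0 f g) / of_nat (Suc n)) \<longlonglongrightarrow> 0"
      proof (rule Lim_null_comparison)
        show "\<forall>\<^sub>F n in sequentially. cmod (((Phi ^^ Suc n) B0 f g - B0 f g) / of_nat (Suc n)) \<le> (2 * C * (l2norm \<mu> f * l2norm \<mu> g)) * inverse (real (Suc n))"
          using bd by (intro always_eventually allI)
        show "(\<lambda>n. (2 * C * (l2norm \<mu> f * l2norm \<mu> g)) * inverse (real (Suc n))) \<longlonglongrightarrow> 0"
          by (rule tendsto_mult_right_zero[OF LIMSEQ_inverse_real_of_nat])
      qed
      then show "(\<lambda>n. (\<Sum>i\<in>UNIV. A' n (zbmul i f, zbmul i g)) / of_nat r - A' n (f, g)) \<longlonglongrightarrow> 0"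
        unfolding eq .
    qed
    then show ?thesis by (simp add: Bc_def Phi_def)
  qed
  \<comment> \<open>Where all iterates agree with \<open>B0\<close> the means are constant, so the
    cluster point takes that value too.\<close>
  have ext: "Bc f g = B0 f g" if fg: "f \<in> L2 \<mu>" "g \<in> L2 \<mu>" and n: "\<And>n. (Phi ^^ n) B0 f g = B0 f g" for f g
    unfolding Bc_def
  proof (rule lim[OF ev])
    have "A' n (f, g) = B0 f g" for n
      using fg n by (simp add: A'eq A_def del: of_nat_Suc)
    then show "(\<lambda>n. A' n (f, g)) \<longlonglongrightarrow> B0 f g" by simp
  qed
  show ?thesis using sB fixp ext by blast
qed

section \<open>Commutators of fixed points with the coordinates\<close>

text \<open>The operator \<open>T\<close> whose form is \<open>B\<close>; the vector comes from the
  Riesz representation of the linear functional \<open>g \<mapsto> cnj (B f g)\<close>.\<close>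

definition rep :: "('d fn \<Rightarrow> 'd fn \<Rightarrow> complex) \<Rightarrow> 'd fn \<Rightarrow> 'd fn" where
  "rep B f = (SOME k. k \<in> L2 \<mu> \<and> (\<forall>g\<in>L2 \<mu>. B f g = ip \<mu> k g))"

lemma rep:
  assumes B: "sesq C B" and f: "f \<in> L2 \<mu>"
  shows rep_L2: "rep B f \<in> L2 \<mu>" and ip_rep: "\<And>g. g \<in> L2 \<mu> \<Longrightarrow> ip \<mu> (rep B f) g = B f g"
proof -
  have "\<exists>k\<in>L2 \<mu>. \<forall>g\<in>L2 \<mu>. cnj (B f g) = ip \<mu> g k"
  proof (rule Riesz_representation)
    fix g assume "g \<in> L2 \<mu>"
    then show "cmod (cnj (B f g)) \<le> (C * l2norm \<mu> f) * l2norm \<mu> g" using sesqD(6)[OF B f] by (simp add: mult.assoc)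
  qed (simp_all add: sesqD(4,5)[OF B f])
  then obtain k where k: "k \<in> L2 \<mu>" "\<And>g. g \<in> L2 \<mu> \<Longrightarrow> cnj (B f g) = ip \<mu> g k" by blast
  have "B f g = ip \<mu> k g" if "g \<in> L2 \<mu>" for g
    using k(2)[OF that] by (metis ip_cnj complex_cnj_cnj)
  then have "k \<in> L2 \<mu> \<and> (\<forall>g\<in>L2 \<mu>. B f g = ip \<mu> k g)" using k(1) by blast
  then have "rep B f \<in> L2 \<mu> \<and> (\<forall>g\<in>L2 \<mu>. B f g = ip \<mu> (rep B f) g)"
    unfolding rep_def by (rule someI[of "\<lambda>k. k \<in> L2 \<mu> \<and> (\<forall>g\<in>L2 \<mu>. B f g = ip \<mu> k g)"])
  then show "rep B f \<in> L2 \<mu>" "\<And>g. g \<in> L2 \<mu> \<Longrightarrow> ip \<mu> (rep B f) g = B f g" by auto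
qed

lemma l2norm_rep:
  assumes B: "sesq C B" and f: "f \<in> L2 \<mu>" shows "l2norm \<mu> (rep B f) \<le> C * l2norm \<mu> f"
proof -
  let ?k = "rep B f"
  have "(l2norm \<mu> ?k)\<^sup>2 = cmod (ip \<mu> ?k ?k)" by (simp add: ip_self norm_power)
  also have "\<dots> \<le> C * (l2norm \<mu> f * l2norm \<mu> ?k)"
    using ip_rep[OF B f rep_L2[OF B f]] sesqD(6)[OF B f rep_L2[OF B f]] by simp
  finally have *: "l2norm \<mu> ?k * l2norm \<mu> ?k \<le> (C * l2norm \<mu> f) * l2norm \<mu> ?k" by (simp add: power2_eq_square mult.assoc)
  show ?thesis
  proof (cases "l2norm \<mu> ?k = 0")
    case True
    then show ?thesis using sesqD(1)[OF B] by simp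
  next
    case False
    then have "l2norm \<mu> ?k > 0" using l2norm_nonneg[of ?k] by linarith
    then show ?thesis using * by (simp only: mult_le_cancel_right_pos)
  qed
qed

text \<open>The quadratic form of \<open>T\<^sup>* T\<close>, where \<open>T\<close> is the operator
  of \<open>B\<close>.\<close>

definition nsq :: "('d fn \<Rightarrow> 'd fn \<Rightarrow> complex) \<Rightarrow> 'd fn \<Rightarrow> real" where
  "nsq B f = (l2norm \<mu> (rep B f))\<^sup>2"

text \<open>The form of the commutator of the operator of \<open>B\<close> with multiplication by
  \<open>cnj z\<^sub>i\<close>; in the second term that multiplication has been moved to its
  adjoint.\<close>

definition Ecomm :: "('d fn \<Rightarrow> 'd fn \<Rightarrow> complex) \<Rightarrow> 'd \<Rightarrow> 'd fn \<Rightarrow> 'd fn \<Rightarrow> complex" where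
  "Ecomm B i f g = B (zbmul i f) g - B f (zmul i g)"

lemma sesq_Ecomm:
  assumes B: "sesq C B" shows "sesq (2 * C * sqrt r) (Ecomm B i)"
proof (rule sesqI)
  show "0 \<le> 2 * C * sqrt r" using sesqD(1)[OF B] by simp
  fix f g assume f: "f \<in> L2 \<mu>" and g: "g \<in> L2 \<mu>"
  have "cmod (Ecomm B i f g) \<le> cmod (B (zbmul i f) g) + cmod (B f (zmul i g))"
    unfolding Ecomm_def by (rule norm_triangle_ineq4)
  also have "\<dots> \<le> C * (l2norm \<mu> (zbmul i f) * l2norm \<mu> g) + C * (l2norm \<mu> f * l2norm \<mu> (zmul i g))"
    using f g by (intro add_mono sesqD(6)[OF B] zbmul_L2 zmul_L2)
  also have "\<dots> \<le> C * (sqrt r * l2norm \<mu> f * l2norm \<mu> g) + C * (l2norm \<mu> f * (sqrt r * l2norm \<mu> g))"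
    using f g sesqD(1)[OF B] by (intro add_mono mult_left_mono mult_right_mono l2norm_zbmul l2norm_zmul) auto
  also have "\<dots> = 2 * C * sqrt r * (l2norm \<mu> f * l2norm \<mu> g)" by (simp add: algebra_simps)
  finally show "cmod (Ecomm B i f g) \<le> 2 * C * sqrt r * (l2norm \<mu> f * l2norm \<mu> g)" .
qed (auto simp: Ecomm_def zbmul_add zbmul_cmult zmul_add zmul_cmult sesqD(2-5)[OF B] zbmul_L2 zmul_L2 algebra_simps)

text \<open>The multiplications commute with each other, so taking the commutator with one of them
  commutes with \<open>Phi\<close>.\<close>

lemma Phi_Ecomm:
  assumes fixp: "\<And>f g. f \<in> L2 \<mu> \<Longrightarrow> g \<in> L2 \<mu> \<Longrightarrow> Phi B f g = B f g" and f: "f \<in> L2 \<mu>" and g: "g \<in> L2 \<mu>"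
  shows "Phi (Ecomm B j) f g = Ecomm B j f g"
proof -
  have "Phi (Ecomm B j) f g = Phi B (zbmul j f) g - Phi B f (zmul j g)"
    by (simp add: Phi_def Ecomm_def zbmul_commute[of _ j] zbmul_zmul sum_subtractf diff_divide_distrib)
  then show ?thesis using f g by (simp add: fixp zbmul_L2 zmul_L2 Ecomm_def)
qed

text \<open>Expand the squared norm of \<open>T (cnj z\<^sub>i f) - cnj z\<^sub>i T f\<close> and
  sum over \<open>i\<close>. By the fixed point equation the inner products in the cross terms add
  up to \<open>r\<close> times the squared norm of \<open>T f\<close>, and by the sphere identity so
  do the last terms.\<close>

lemma nsq_identity:
  assumes B: "sesq C B" and fixp: "\<And>f g. f \<in> L2 \<mu> \<Longrightarrow> g \<in> L2 \<mu> \<Longrightarrow> Phi B f g = B f g" and f: "f \<in> L2 \<mu>"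
  shows "(\<Sum>i\<in>UNIV. nsq B (zbmul i f)) = r * nsq B f + (\<Sum>i\<in>UNIV. nsq (Ecomm B i) f)"
proof -
  define w where "w = rep B f"
  have w: "w \<in> L2 \<mu>" unfolding w_def by (rule rep_L2[OF B f])
  define u where "u i = rep B (zbmul i f)" for i
  have u: "u i \<in> L2 \<mu>" for i unfolding u_def by (rule rep_L2[OF B zbmul_L2[OF f]])
  have E: "nsq (Ecomm B i) f = (l2norm \<mu> (\<lambda>x. u i x - zbmul i w x))\<^sup>2" for i
  proof -
    have d: "(\<lambda>x. u i x - zbmul i w x) \<in> L2 \<mu>" using u w by (intro L2_diff zbmul_L2)
    have "AE x in \<mu>. rep (Ecomm B i) f x = u i x - zbmul i w x"
    proof (rule L2_eq_AE_I[OF rep_L2[OF sesq_Ecomm[OF B] f] d])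
      fix k assume k: "k \<in> L2 \<mu>"
      have "ip \<mu> (\<lambda>x. u i x - zbmul i w x) k = ip \<mu> (u i) k - ip \<mu> w (zmul i k)"
        using u w k by (simp add: ip_diff_left zbmul_L2 ip_zbmul_left)
      also have "\<dots> = Ecomm B i f k"
        unfolding u_def w_def Ecomm_def using f k by (simp add: ip_rep[OF B] zbmul_L2 zmul_L2)
      finally show "ip \<mu> (rep (Ecomm B i) f) k = ip \<mu> (\<lambda>x. u i x - zbmul i w x) k"
        using ip_rep[OF sesq_Ecomm[OF B] f k] by simp
    qed
    then show ?thesis unfolding nsq_def using l2norm_cong_AE[OF rep_L2[OF sesq_Ecomm[OF B] f] d] by simp
  qed
  have "(\<Sum>i\<in>UNIV. nsq (Ecomm B i) f) = (\<Sum>i\<in>UNIV. (l2norm \<mu> (u i))\<^sup>2 - 2 * Re (ip \<mu> (u i) (zbmul i w)) + (l2norm \<mu> (zbmul i w))\<^sup>2)"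
    unfolding E by (intro sum.cong refl l2norm_diff_expand u zbmul_L2 w)
  also have "\<dots> = (\<Sum>i\<in>UNIV. nsq B (zbmul i f)) - 2 * Re (\<Sum>i\<in>UNIV. ip \<mu> (u i) (zbmul i w)) + r * (l2norm \<mu> w)\<^sup>2"
    using sum_l2norm_zbmul[OF w] by (simp add: sum.distrib sum_subtractf nsq_def u_def sum_distrib_left)
  also have "(\<Sum>i\<in>UNIV. ip \<mu> (u i) (zbmul i w)) = (\<Sum>i\<in>UNIV. B (zbmul i f) (zbmul i w))"
    unfolding u_def by (intro sum.cong refl ip_rep[OF B] zbmul_L2 f w)
  also have "\<dots> = of_nat r * Phi B f w" using r_pos by (simp add: Phi_def)
  also have "Phi B f w = ip \<mu> w w" using fixp[OF f w] ip_rep[OF B f w] by (simp add: w_def)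
  also have "Re (of_nat r * ip \<mu> w w) = r * (l2norm \<mu> w)\<^sup>2" by (simp add: ip_self del: of_real_power)
  finally show ?thesis by (simp add: nsq_def w_def)
qed

text \<open>For the positive map \<^term>\<open>Phi\<close> the square sum of commutators of a fixed point \<open>T\<close> with the coordinates
  is \<open>Phi (T\<^sup>* T) - T\<^sup>* T\<close>; commutators are again fixed points, so the iterates of \<^term>\<open>Phi\<close> on \<open>T\<^sup>* T\<close>
  grow at least linearly unless the commutators vanish, while they are bounded.\<close>
lemma Phi_fixed_commutes:
  assumes B: "sesq C B" and fixp: "\<And>f g. f \<in> L2 \<mu> \<Longrightarrow> g \<in> L2 \<mu> \<Longrightarrow> Phi B f g = B f g"
    and f: "f \<in> L2 \<mu>" and g: "g \<in> L2 \<mu>"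
  shows "B (zbmul i f) g = B f (zmul i g)"
proof -
  \<comment> \<open>The action of \<open>Phi\<close> on the diagonal values of a form, extended to
    arbitrary real functions such as \<open>nsq B\<close>.\<close>
  define P where "P a = (\<lambda>f. (\<Sum>i\<in>UNIV. a (zbmul i f)) / real r)" for a :: "'d fn \<Rightarrow> real"
  define d where "d f = (\<Sum>i\<in>UNIV. nsq (Ecomm B i) f)" for f
  have r: "real r > 0" using r_pos by simp
  \<comment> \<open>The commutators \<open>Ecomm B j\<close> are themselves fixed by
    \<open>Phi\<close>, so \<open>nsq_identity\<close> applies to them and shows that their
    quadratic forms do not decrease under \<open>P\<close>.\<close>
  have Pd: "d f \<le> P d f" if f: "f \<in> L2 \<mu>" for f
  proof -
    have "r * nsq (Ecomm B j) f \<le> (\<Sum>i\<in>UNIV. nsq (Ecomm B j) (zbmul i f))" for j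
    proof -
      have "(\<Sum>i\<in>UNIV. nsq (Ecomm B j) (zbmul i f)) = r * nsq (Ecomm B j) f + (\<Sum>i\<in>UNIV. nsq (Ecomm (Ecomm B j) i) f)"
        by (rule nsq_identity[OF sesq_Ecomm[OF B] _ f]) (rule Phi_Ecomm[OF fixp])
      moreover have "0 \<le> (\<Sum>i\<in>UNIV. nsq (Ecomm (Ecomm B j) i) f)"
        by (intro sum_nonneg) (simp add: nsq_def)
      ultimately show ?thesis by simp
    qed
    then have "(\<Sum>j\<in>UNIV. r * nsq (Ecomm B j) f) \<le> (\<Sum>j\<in>UNIV. \<Sum>i\<in>UNIV. nsq (Ecomm B j) (zbmul i f))"
      by (intro sum_mono)
    also have "\<dots> = (\<Sum>i\<in>UNIV. d (zbmul i f))" unfolding d_def by (rule sum.swap)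
    finally show ?thesis using r by (simp add: P_def d_def pos_le_divide_eq sum_distrib_left mult.commute)
  qed
  have P1: "P (nsq B) f = nsq B f + d f / r" if f: "f \<in> L2 \<mu>" for f
    using nsq_identity[OF B fixp f] r by (simp add: P_def d_def field_simps)
  \<comment> \<open>Each application of \<open>P\<close> adds at least \<open>d f / r\<close>, since
    \<open>d\<close> itself does not decrease.\<close>
  have lower: "nsq B f + n * (d f / r) \<le> (P ^^ n) (nsq B) f" if f: "f \<in> L2 \<mu>" for n f
    using f
  proof (induction n arbitrary: f)
    case (Suc n)
    have "nsq B f + real (Suc n) * (d f / r) = P (nsq B) f + real n * d f / r"
      using P1[OF Suc.prems] by (simp add: add_divide_distrib algebra_simps)
    also have "\<dots> \<le> P (nsq B) f + real n * P d f / r"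
      using Pd[OF Suc.prems] by (intro add_left_mono divide_right_mono mult_left_mono) auto
    also have "\<dots> = (\<Sum>i\<in>UNIV. nsq B (zbmul i f) + real n * (d (zbmul i f) / r)) / r"
      by (simp add: P_def sum.distrib add_divide_distrib sum_distrib_left sum_divide_distrib)
    also have "\<dots> \<le> (\<Sum>i\<in>UNIV. (P ^^ n) (nsq B) (zbmul i f)) / r"
      using Suc by (intro divide_right_mono sum_mono Suc.IH zbmul_L2) auto
    finally show ?case unfolding funpow.simps comp_apply P_def[of "(P ^^ n) (nsq B)"] .
  qed simp
  have upper: "(P ^^ n) (nsq B) f \<le> C\<^sup>2 * (l2norm \<mu> f)\<^sup>2" if f: "f \<in> L2 \<mu>" for n f
    using f
  proof (induction n arbitrary: f)
    case 0
    then show ?case using power_mono[OF l2norm_rep[OF B 0] l2norm_nonneg, of 2] by (simp add: nsq_def power_mult_distrib)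
  next
    case (Suc n)
    have "(P ^^ Suc n) (nsq B) f \<le> (\<Sum>i\<in>UNIV. C\<^sup>2 * (l2norm \<mu> (zbmul i f))\<^sup>2) / r"
      unfolding funpow.simps comp_apply P_def[of "(P ^^ n) (nsq B)"]
      using Suc by (intro divide_right_mono sum_mono Suc.IH zbmul_L2) auto
    also have "\<dots> = C\<^sup>2 * (l2norm \<mu> f)\<^sup>2"
      using r sum_l2norm_zbmul[OF Suc.prems] by (simp flip: sum_distrib_left)
    finally show ?case .
  qed
  have d0: "0 \<le> d f" unfolding d_def nsq_def by (intro sum_nonneg) auto
  have "d f = 0"
  proof (rule ccontr)
    assume "d f \<noteq> 0"
    then have pos: "d f / r > 0" using d0 r by simp
    then obtain n where "C\<^sup>2 * (l2norm \<mu> f)\<^sup>2 < real n * (d f / r)" using reals_Archimedean3 by blast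
    moreover have "0 \<le> nsq B f" by (simp add: nsq_def)
    ultimately show False using lower[OF f, of n] upper[OF f, of n] by linarith
  qed
  then have "\<forall>i\<in>UNIV. nsq (Ecomm B i) f = 0"
    unfolding d_def by (subst (asm) sum_nonneg_eq_0_iff) (auto simp: nsq_def)
  then have "l2norm \<mu> (rep (Ecomm B i) f) = 0" by (simp add: nsq_def)
  moreover have "cmod (ip \<mu> (rep (Ecomm B i) f) g) \<le> l2norm \<mu> (rep (Ecomm B i) f) * l2norm \<mu> g"
    by (rule Cauchy_Schwarz_ip[OF rep_L2[OF sesq_Ecomm[OF B] f] g])
  ultimately have "Ecomm B i f g = 0" using ip_rep[OF sesq_Ecomm[OF B] f g, of i] by simp
  then show ?thesis by (simp add: Ecomm_def)
qed

text \<open>The adjoint form is again a fixed point, and its commutation relation is the conjugate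
  of the one wanted here.\<close>

lemma Phi_fixed_commutes':
  assumes B: "sesq C B" and fixp: "\<And>f g. f \<in> L2 \<mu> \<Longrightarrow> g \<in> L2 \<mu> \<Longrightarrow> Phi B f g = B f g"
    and f: "f \<in> L2 \<mu>" and g: "g \<in> L2 \<mu>"
  shows "B (zmul i f) g = B f (zbmul i g)"
proof -
  have "Phi (\<lambda>f g. cnj (B g f)) f g = cnj (B g f)" if "f \<in> L2 \<mu>" "g \<in> L2 \<mu>" for f g
  proof -
    have "Phi (\<lambda>f g. cnj (B g f)) f g = cnj (Phi B g f)" by (simp add: Phi_def)
    then show ?thesis using fixp that by simp
  qed
  from Phi_fixed_commutes[OF sesq_cnj[OF B] this g f, of i] show ?thesis by simp
qed

end

section \<open>From commuting with coordinates to multiplication operators\<close>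

context sphere_space begin

text \<open>Multiplication by the bounded function \<open>m\<close> commutes with the operator of
  \<open>B\<close>. These functions form an algebra closed under bounded pointwise limits, which is
  enlarged step by step from the coordinates to all bounded measurable functions.\<close>

definition multiplier :: "('d fn \<Rightarrow> 'd fn \<Rightarrow> complex) \<Rightarrow> 'd fn \<Rightarrow> bool" where
  "multiplier B m \<longleftrightarrow> m \<in> borel_measurable \<mu> \<and> (\<exists>c. \<forall>x\<in>S. cmod (m x) \<le> c) \<and>
    (\<forall>f\<in>L2 \<mu>. \<forall>g\<in>L2 \<mu>. B (\<lambda>x. m x * f x) g = B f (\<lambda>x. cnj (m x) * g x))"

lemma multiplierD:
  assumes "multiplier B m"
  shows "m \<in> borel_measurable \<mu>" "\<exists>c. \<forall>x\<in>S. cmod (m x) \<le> c"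
    "\<And>f g. f \<in> L2 \<mu> \<Longrightarrow> g \<in> L2 \<mu> \<Longrightarrow> B (\<lambda>x. m x * f x) g = B f (\<lambda>x. cnj (m x) * g x)"
  using assms unfolding multiplier_def by auto

lemma multiplier_L2:
  assumes "multiplier B m" "f \<in> L2 \<mu>"
  shows "(\<lambda>x. m x * f x) \<in> L2 \<mu>" "(\<lambda>x. cnj (m x) * f x) \<in> L2 \<mu>"
proof -
  obtain c where c: "\<And>x. x \<in> S \<Longrightarrow> cmod (m x) \<le> c" using multiplierD(2)[OF assms(1)] by auto
  note m[measurable] = multiplierD(1)[OF assms(1)]
  show "(\<lambda>x. m x * f x) \<in> L2 \<mu>" by (rule L2_mult[OF assms(2) m c])
  show "(\<lambda>x. cnj (m x) * f x) \<in> L2 \<mu>" by (rule L2_mult[OF assms(2), of _ c]) (use c in auto)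
qed

lemma multiplier_const: assumes "sesq C B" shows "multiplier B (\<lambda>x. c)"
  unfolding multiplier_def using sesqD(3,5)[OF assms] by auto

lemma multiplier_add:
  assumes B: "sesq C B" and m: "multiplier B m" and n: "multiplier B n"
  shows "multiplier B (\<lambda>x. m x + n x)"
  unfolding multiplier_def
proof (intro conjI ballI)
  show "(\<lambda>x. m x + n x) \<in> borel_measurable \<mu>"
    using multiplierD(1)[OF m] multiplierD(1)[OF n] by (rule borel_measurable_add)
  obtain c d where "\<And>x. x \<in> S \<Longrightarrow> cmod (m x) \<le> c" "\<And>x. x \<in> S \<Longrightarrow> cmod (n x) \<le> d"
    using multiplierD(2)[OF m] multiplierD(2)[OF n] by auto
  then show "\<exists>c. \<forall>x\<in>S. cmod (m x + n x) \<le> c" by (intro exI[of _ "c + d"]) (blast intro: norm_triangle_mono)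
  fix f g assume fg: "f \<in> L2 \<mu>" "g \<in> L2 \<mu>"
  then show "B (\<lambda>x. (m x + n x) * f x) g = B f (\<lambda>x. cnj (m x + n x) * g x)"
    by (simp add: distrib_right sesqD(2,4)[OF B] multiplier_L2[OF m] multiplier_L2[OF n] multiplierD(3)[OF m] multiplierD(3)[OF n])
qed

lemma multiplier_mult:
  assumes m: "multiplier B m" and n: "multiplier B n"
  shows "multiplier B (\<lambda>x. m x * n x)"
  unfolding multiplier_def
proof (intro conjI ballI)
  show "(\<lambda>x. m x * n x) \<in> borel_measurable \<mu>"
    using multiplierD(1)[OF m] multiplierD(1)[OF n] by (rule borel_measurable_times)
  obtain c d where cd: "\<And>x. x \<in> S \<Longrightarrow> cmod (m x) \<le> c" "\<And>x. x \<in> S \<Longrightarrow> cmod (n x) \<le> d"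
    using multiplierD(2)[OF m] multiplierD(2)[OF n] by auto
  have "cmod (m x * n x) \<le> c * d" if "x \<in> S" for x
    unfolding norm_mult using cd[OF that] by (intro mult_mono') auto
  then show "\<exists>c. \<forall>x\<in>S. cmod (m x * n x) \<le> c" by blast
  fix f g assume fg: "f \<in> L2 \<mu>" "g \<in> L2 \<mu>"
  have "B (\<lambda>x. m x * (n x * f x)) g = B (\<lambda>x. n x * f x) (\<lambda>x. cnj (m x) * g x)"
    using fg by (intro multiplierD(3)[OF m] multiplier_L2[OF n])
  also have "\<dots> = B f (\<lambda>x. cnj (n x) * (cnj (m x) * g x))"
    using fg by (intro multiplierD(3)[OF n] multiplier_L2[OF m])
  finally show "B (\<lambda>x. m x * n x * f x) g = B f (\<lambda>x. cnj (m x * n x) * g x)"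
    by (simp add: mult_ac)
qed

lemma multiplier_sum:
  assumes B: "sesq C B" and m: "\<And>i. i \<in> I \<Longrightarrow> multiplier B (m i)"
  shows "multiplier B (\<lambda>x. \<Sum>i\<in>I. m i x)"
  using m by (induction I rule: infinite_finite_induct) (auto intro: multiplier_const[OF B] multiplier_add[OF B])

lemma sesq_tendsto:
  assumes B: "sesq C B" and F: "\<And>n. F n \<in> L2 \<mu>" "f \<in> L2 \<mu>" and g: "g \<in> L2 \<mu>"
    and lim: "(\<lambda>n. l2norm \<mu> (\<lambda>x. F n x - f x)) \<longlonglongrightarrow> 0"
  shows "(\<lambda>n. B (F n) g) \<longlonglongrightarrow> B f g"
proof (rule LIM_zero_cancel, rule Lim_null_comparison)
  show "\<forall>\<^sub>F n in sequentially. norm (B (F n) g - B f g) \<le> C * (l2norm \<mu> (\<lambda>x. F n x - f x) * l2norm \<mu> g)"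
  proof (intro always_eventually allI)
    fix n
    have "B (F n) g - B f g = B (\<lambda>x. F n x - f x) g" using sesq_diff_left[OF B F(1) F(2) g] by simp
    then show "norm (B (F n) g - B f g) \<le> C * (l2norm \<mu> (\<lambda>x. F n x - f x) * l2norm \<mu> g)"
      using sesqD(6)[OF B L2_diff[OF F(1) F(2)] g] by simp
  qed
  show "(\<lambda>n. C * (l2norm \<mu> (\<lambda>x. F n x - f x) * l2norm \<mu> g)) \<longlonglongrightarrow> 0"
    by (rule tendsto_mult_right_zero[OF tendsto_mult_left_zero[OF lim]])
qed

lemma l2norm_dominated_limit:
  assumes m: "\<And>n. m n \<in> borel_measurable \<mu>" "m' \<in> borel_measurable \<mu>"
    and c: "\<And>n x. x \<in> S \<Longrightarrow> cmod (m n x) \<le> c"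
    and lim: "\<And>x. x \<in> S \<Longrightarrow> (\<lambda>n. m n x) \<longlonglongrightarrow> m' x"
    and f: "f \<in> L2 \<mu>"
  shows "(\<lambda>n. l2norm \<mu> (\<lambda>x. m n x * f x - m' x * f x)) \<longlonglongrightarrow> 0"
proof -
  note [measurable] = m L2_measurable[OF f]
  have c': "cmod (m' x) \<le> c" if "x \<in> S" for x
    by (rule LIMSEQ_le_const2[OF tendsto_norm[OF lim[OF that]]]) (use c[OF that] in auto)
  have "(\<lambda>n. \<integral>x. (cmod (m n x * f x - m' x * f x))\<^sup>2 \<partial>\<mu>) \<longlonglongrightarrow> (\<integral>x. 0 \<partial>\<mu>)"
  proof (rule integral_dominated_convergence)
    show "integrable \<mu> (\<lambda>x. (2 * c)\<^sup>2 * (cmod (f x))\<^sup>2)" using L2_integrable[OF f] by simp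
    show "AE x in \<mu>. (\<lambda>n. (cmod (m n x * f x - m' x * f x))\<^sup>2) \<longlonglongrightarrow> 0"
    proof (rule AE_I2)
      fix x assume "x \<in> space \<mu>"
      then have x: "x \<in> S" by (simp add: space_mu)
      have "(\<lambda>n. (cmod (m n x * f x - m' x * f x))\<^sup>2) \<longlonglongrightarrow> (cmod (m' x * f x - m' x * f x))\<^sup>2"
        by (intro tendsto_intros lim x)
      then show "(\<lambda>n. (cmod (m n x * f x - m' x * f x))\<^sup>2) \<longlonglongrightarrow> 0" by simp
    qed
    fix n
    show "AE x in \<mu>. norm ((cmod (m n x * f x - m' x * f x))\<^sup>2) \<le> (2 * c)\<^sup>2 * (cmod (f x))\<^sup>2"
    proof (rule AE_I2)
      fix x assume "x \<in> space \<mu>"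
      then have x: "x \<in> S" by (simp add: space_mu)
      have "cmod (m n x * f x - m' x * f x) = cmod (m n x - m' x) * cmod (f x)"
        by (simp add: norm_mult flip: left_diff_distrib)
      also have "\<dots> \<le> (2 * c) * cmod (f x)"
        using norm_triangle_ineq4[of "m n x" "m' x"] c[OF x, of n] c'[OF x] by (intro mult_right_mono) auto
      finally have "(cmod (m n x * f x - m' x * f x))\<^sup>2 \<le> ((2 * c) * cmod (f x))\<^sup>2"
        by (rule power_mono) simp
      then show "norm ((cmod (m n x * f x - m' x * f x))\<^sup>2) \<le> (2 * c)\<^sup>2 * (cmod (f x))\<^sup>2"
        by (simp add: power_mult_distrib)
    qed
  qed measurable
  then have "(\<lambda>n. sqrt (\<integral>x. (cmod (m n x * f x - m' x * f x))\<^sup>2 \<partial>\<mu>)) \<longlonglongrightarrow> sqrt 0"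
    by (intro tendsto_intros) simp
  then show ?thesis by (simp add: l2norm_def)
qed

text \<open>By dominated convergence multiplication by \<open>m n\<close> and by its conjugate both
  converge strongly, and a bounded form is continuous in each argument. So both sides of the
  commutation relation pass to the limit.\<close>

lemma multiplier_limit:
  assumes B: "sesq C B" and m: "\<And>n. multiplier B (m n)" and m': "m' \<in> borel_measurable \<mu>"
    and c: "\<And>n x. x \<in> S \<Longrightarrow> cmod (m n x) \<le> c"
    and lim: "\<And>x. x \<in> S \<Longrightarrow> (\<lambda>n. m n x) \<longlonglongrightarrow> m' x"
  shows "multiplier B m'"
  unfolding multiplier_def
proof (intro conjI ballI m')
  have c': "cmod (m' x) \<le> c" if "x \<in> S" for x
    by (rule LIMSEQ_le_const2[OF tendsto_norm[OF lim[OF that]]]) (use c[OF that] in auto)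
  then show "\<exists>c. \<forall>x\<in>S. cmod (m' x) \<le> c" by blast
  fix f g assume f: "f \<in> L2 \<mu>" and g: "g \<in> L2 \<mu>"
  have mf: "(\<lambda>x. m' x * f x) \<in> L2 \<mu>" by (rule L2_mult[OF f m' c'])
  have cm: "(\<lambda>x. cnj (m n x)) \<in> borel_measurable \<mu>" "(\<lambda>x. cnj (m' x)) \<in> borel_measurable \<mu>" for n
    using multiplierD(1)[OF m] m' by measurable
  have mg: "(\<lambda>x. cnj (m' x) * g x) \<in> L2 \<mu>" by (rule L2_mult[OF g cm(2), of c]) (simp add: c')
  have 1: "(\<lambda>n. B (\<lambda>x. m n x * f x) g) \<longlonglongrightarrow> B (\<lambda>x. m' x * f x) g"
    by (rule sesq_tendsto[OF B multiplier_L2(1)[OF m f] mf g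
          l2norm_dominated_limit[OF multiplierD(1)[OF m] m' c lim f]])
  \<comment> \<open>Continuity in the second argument is continuity of the adjoint form in the
    first.\<close>
  have "(\<lambda>n. cnj (B f (\<lambda>x. cnj (m n x) * g x))) \<longlonglongrightarrow> cnj (B f (\<lambda>x. cnj (m' x) * g x))"
    by (rule sesq_tendsto[OF sesq_cnj[OF B] multiplier_L2(2)[OF m g] mg f])
      (rule l2norm_dominated_limit[OF cm _ _ g, where c=c], simp_all add: c lim tendsto_cnj)
  then have "(\<lambda>n. B f (\<lambda>x. cnj (m n x) * g x)) \<longlonglongrightarrow> B f (\<lambda>x. cnj (m' x) * g x)"
    using tendsto_cnj by force
  then have 2: "(\<lambda>n. B (\<lambda>x. m n x * f x) g) \<longlonglongrightarrow> B f (\<lambda>x. cnj (m' x) * g x)"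
    using multiplierD(3)[OF m f g] by simp
  show "B (\<lambda>x. m' x * f x) g = B f (\<lambda>x. cnj (m' x) * g x)"
    by (rule LIMSEQ_unique[OF 1 2])
qed

lemma coordinate_form_commutes:
  assumes B: "sesq C B" and fixp: "\<And>f g. f \<in> L2 \<mu> \<Longrightarrow> g \<in> L2 \<mu> \<Longrightarrow> Phi B f g = B f g"
  shows "multiplier B (\<lambda>x. x $ i)" "multiplier B (\<lambda>x. cnj (x $ i))"
  unfolding multiplier_def
  using Phi_fixed_commutes[OF B fixp, of _ _ i] Phi_fixed_commutes'[OF B fixp, of _ _ i] coord_bound[of _ i]
  by (auto simp: zmul_def zbmul_def intro!: exI[of _ "sqrt (real r)"])

context
  fixes B C
  assumes B: "sesq C B" and coord: "\<And>i. multiplier B (\<lambda>x. x $ i)" "\<And>i. multiplier B (\<lambda>x. cnj (x $ i))"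
begin

text \<open>A real linear functional is a combination of real and imaginary parts of coordinates,
  and these are combinations of \<open>x $ i\<close> and its conjugate; the algebra rules cover the
  rest.\<close>

lemma multiplier_real_polynomial:
  assumes "real_polynomial_function p"
  shows "multiplier B (\<lambda>x. complex_of_real (p x))"
  using assms
proof induction
  case (linear f)
  have re: "multiplier B (\<lambda>x. of_real (Re (x $ i)))" for i
  proof -
    have "multiplier B (\<lambda>x. (1/2) * (x $ i + cnj (x $ i)))"
      by (intro multiplier_mult multiplier_add[OF B] multiplier_const[OF B] coord)
    then show ?thesis by (simp add: complex_add_cnj)
  qed
  have im: "multiplier B (\<lambda>x. of_real (Im (x $ i)))" for i
  proof -
    have "multiplier B (\<lambda>x. (- \<i> / 2) * (x $ i + (-1) * cnj (x $ i)))"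
      by (intro multiplier_mult multiplier_add[OF B] multiplier_const[OF B] coord)
    moreover have "(- \<i> / 2) * (x $ i + (-1) * cnj (x $ i)) = of_real (Im (x $ i))" for x :: "complex^'d"
      by (simp add: complex_eq_iff)
    ultimately show ?thesis by simp
  qed
  have b: "multiplier B (\<lambda>x. of_real (x \<bullet> b))" if bB: "b \<in> Basis" for b :: "complex^'d"
  proof -
    obtain i u where "b = axis i u" "u = 1 \<or> u = \<i>" using bB by (auto simp: Basis_vec_def Basis_complex_def)
    then show ?thesis using re im by (auto simp: inner_axis inner_complex_def)
  qed
  have feq: "f x = (\<Sum>b\<in>Basis. (x \<bullet> b) * f b)" for x
  proof -
    have "f x = f (\<Sum>b\<in>Basis. (x \<bullet> b) *\<^sub>R b)" by (simp add: euclidean_representation)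
    also have "\<dots> = (\<Sum>b\<in>Basis. f ((x \<bullet> b) *\<^sub>R b))"
      by (rule linear_sum[OF bounded_linear.linear[OF linear]])
    also have "\<dots> = (\<Sum>b\<in>Basis. (x \<bullet> b) * f b)"
      using linear_scale[OF bounded_linear.linear[OF linear]] by simp
    finally show ?thesis .
  qed
  have "multiplier B (\<lambda>x. \<Sum>b\<in>Basis. of_real (x \<bullet> b) * of_real (f b))"
    by (rule multiplier_sum[OF B], rule multiplier_mult[OF b multiplier_const[OF B]])
  then have M: "multiplier B (\<lambda>x. of_real (\<Sum>b\<in>Basis. (x \<bullet> b) * f b))" by (simp only: of_real_sum of_real_mult)
  have "(\<lambda>x. complex_of_real (f x)) = (\<lambda>x. of_real (\<Sum>b\<in>Basis. (x \<bullet> b) * f b))"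
    by (rule ext) (rule arg_cong[OF feq])
  from arg_cong[where f="multiplier B", OF this] M show ?case by (rule iffD2)
next
  case (const c)
  show ?case by (rule multiplier_const[OF B])
next
  case (add p q)
  then show ?case using multiplier_add[OF B] by simp
next
  case (mult p q)
  then show ?case using multiplier_mult by simp
qed

lemma multiplier_continuous:
  fixes h :: "complex^'d \<Rightarrow> real"
  assumes h: "continuous_on UNIV h"
  shows "multiplier B (\<lambda>x. complex_of_real (h x))"
proof -
  have hS: "continuous_on S h" using h continuous_on_subset by blast
  have "\<exists>p. real_polynomial_function p \<and> (\<forall>x\<in>S. \<bar>h x - p x\<bar> < inverse (real (Suc n)))" for n
  proof -
    obtain p where "real_polynomial_function p" "\<And>x. x \<in> S \<Longrightarrow> \<bar>h x - p x\<bar> < inverse (real (Suc n))"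
      by (rule Stone_Weierstrass_real_polynomial_function[OF compact_S hS, of "inverse (real (Suc n))"]) simp_all
    then show ?thesis by (intro exI[of _ p]) simp
  qed
  then have ex: "\<forall>n. \<exists>p. real_polynomial_function p \<and> (\<forall>x\<in>S. \<bar>h x - p x\<bar> < inverse (real (Suc n)))" by (rule allI)
  from choice[OF this] obtain p where "\<forall>n. real_polynomial_function (p n) \<and> (\<forall>x\<in>S. \<bar>h x - p n x\<bar> < inverse (real (Suc n)))" ..
  then have p: "\<And>n. real_polynomial_function (p n)" "\<And>n x. x \<in> S \<Longrightarrow> \<bar>h x - p n x\<bar> < inverse (real (Suc n))"
    by simp_all
  have "bounded (h ` S)" by (rule compact_imp_bounded[OF compact_continuous_image[OF hS compact_S]])
  then obtain c where "\<forall>y\<in>h ` S. norm y \<le> c" unfolding bounded_iff by blast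
  then have c: "\<And>x. x \<in> S \<Longrightarrow> \<bar>h x\<bar> \<le> c" by simp
  show ?thesis
  proof (rule multiplier_limit[OF B multiplier_real_polynomial[OF p(1)], where c="c + 1"])
    show "(\<lambda>x. complex_of_real (h x)) \<in> borel_measurable \<mu>"
      using h by (intro borel_measurable_mu borel_measurable_continuous_onI continuous_on_of_real)
    fix n x assume x: "x \<in> S"
    have "inverse (real (Suc n)) \<le> 1" by (simp add: field_simps)
    then show "cmod (of_real (p n x)) \<le> c + 1" using p(2)[OF x, of n] c[OF x] by simp
  next
    fix x assume x: "x \<in> S"
    have "(\<lambda>n. p n x) \<longlonglongrightarrow> h x"
    proof (rule LIM_zero_cancel, rule Lim_null_comparison[OF always_eventually LIMSEQ_inverse_real_of_nat], rule allI)
      fix n show "norm (p n x - h x) \<le> inverse (real (Suc n))" using p(2)[OF x, of n] by simp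
    qed
    then show "(\<lambda>n. complex_of_real (p n x)) \<longlonglongrightarrow> of_real (h x)" by (rule tendsto_of_real)
  qed
qed

lemma multiplier_indicator_closed:
  assumes A: "closed A" shows "multiplier B (indicator A)"
proof (cases "A = {}")
  case True
  have "indicator {} = (\<lambda>x::complex^'d. 0 :: complex)" by (simp add: fun_eq_iff)
  then show ?thesis using True multiplier_const[OF B, of 0] by simp
next
  case False
  \<comment> \<open>Continuous cut-offs decreasing to the indicator of \<open>A\<close>. The empty
    set is treated apart because \<open>infdist x {}\<close> is 0 by convention, so the cut-offs
    would not tend to 0.\<close>
  define h where "h n x = max 0 (1 - real n * infdist x A)" for n and x :: "complex^'d"
  show ?thesis
  proof (rule multiplier_limit[OF B, where m="\<lambda>n x. of_real (h n x)" and c=1])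
    show "multiplier B (\<lambda>x. complex_of_real (h n x))" for n
      unfolding h_def by (intro multiplier_continuous continuous_intros)
    show "indicator A \<in> borel_measurable \<mu>"
      using A by (intro borel_measurable_mu borel_measurable_indicator) auto
    show "cmod (of_real (h n x)) \<le> 1" for n x
      by (simp add: h_def infdist_nonneg)
    fix x
    show "(\<lambda>n. complex_of_real (h n x)) \<longlonglongrightarrow> indicator A x"
    proof (cases "x \<in> A")
      case True
      then show ?thesis by (simp add: h_def)
    next
      case xA: False
      then have pos: "infdist x A > 0"
        using in_closed_iff_infdist_zero[OF A False, of x] infdist_nonneg[of x A] by linarith
      then obtain N :: nat where N: "1 < real N * infdist x A" using reals_Archimedean3 by blast
      have "h n x = 0" if "n \<ge> N" for n
      proof -
        have "real N * infdist x A \<le> real n * infdist x A" using that pos by (intro mult_right_mono) auto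
        then show ?thesis using N by (simp add: h_def)
      qed
      then have "eventually (\<lambda>n. complex_of_real (h n x) = 0) sequentially"
        by (auto simp: eventually_sequentially)
      then show ?thesis using xA by (simp add: tendsto_eventually)
    qed
  qed
qed

text \<open>The sets with this property form a Dynkin system that contains the intersection-stable
  family of closed sets.\<close>

lemma multiplier_indicator_borel:
  assumes "A \<in> sets borel" shows "multiplier B (indicator A)"
proof -
  have "A \<in> sigma_sets UNIV (Collect closed)" using assms by (simp add: borel_eq_closed)
  then show ?thesis
  proof (rule sigma_sets_induct_disjoint[rotated 2])
    show "Int_stable (Collect closed :: (complex^'d) set set)" by (auto simp: Int_stable_def)
    show "Collect closed \<subseteq> Pow (UNIV :: (complex^'d) set)" by simp
    fix A :: "(complex^'d) set" assume "A \<in> Collect closed"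
    then show "multiplier B (indicator A)" by (simp add: multiplier_indicator_closed)
  next
    show "multiplier B (indicator {})" by (rule multiplier_indicator_closed) simp
  next
    fix A :: "(complex^'d) set" assume "multiplier B (indicator A)"
    then have "multiplier B (\<lambda>x. 1 + (-1) * indicator A x)"
      by (intro multiplier_add[OF B] multiplier_mult multiplier_const[OF B])
    moreover have "(\<lambda>x. 1 + (-1) * indicator A x) = (indicator (UNIV - A) :: 'd fn)"
      by (auto simp: fun_eq_iff indicator_def)
    ultimately show "multiplier B (indicator (UNIV - A))" by simp
  next
    fix F :: "nat \<Rightarrow> (complex^'d) set"
    assume disj: "disjoint_family F" and rF: "range F \<subseteq> sigma_sets UNIV (Collect closed)"
      and F: "\<And>i. multiplier B (indicator (F i))"
    have FB: "F i \<in> sets borel" for i using rF by (auto simp: borel_eq_closed)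
    have sum: "(\<Sum>i<n. indicator (F i) x) = (indicator (\<Union>i<n. F i) x :: complex)" for n x
      using disj by (subst indicator_UN_disjoint) (auto simp: disjoint_family_on_def)
    show "multiplier B (indicator (\<Union>i. F i))"
    proof (rule multiplier_limit[OF B multiplier_sum[OF B F], where c=1])
      show "indicator (\<Union>i. F i) \<in> borel_measurable \<mu>"
        using FB by (intro borel_measurable_mu borel_measurable_indicator sets.countable_UN) auto
      show "cmod (\<Sum>i<n. indicator (F i) x) \<le> 1" for n x
        unfolding sum by (simp add: indicator_def)
      show "(\<lambda>n. \<Sum>i<n. indicator (F i) x) \<longlonglongrightarrow> (indicator (\<Union>i. F i) x :: complex)" for x
      proof (cases "x \<in> (\<Union>i. F i)")
        case True
        then obtain i where i: "x \<in> F i" by auto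
        have "(indicator (\<Union>i<n. F i) x :: complex) = 1" if "n > i" for n using i that by (auto simp: indicator_def)
        then have "eventually (\<lambda>n. (indicator (\<Union>i<n. F i) x :: complex) = 1) sequentially"
          by (rule eventually_mono[OF eventually_gt_at_top[of i]])
        then show ?thesis unfolding sum using True by (simp add: tendsto_eventually)
      qed (auto simp: indicator_def)
    qed
  qed
qed

lemma multiplier_bounded:
  assumes m: "m \<in> borel_measurable \<mu>" and c: "\<And>x. cmod (m x) \<le> c"
  shows "multiplier B m"
proof -
  have ind: "multiplier B (indicator A)" if A: "A \<in> sets \<mu>" for A
  proof -
    have "A \<in> sets (restrict_space borel S)" using A sets_mu by simp
    then obtain A' where A': "A' \<in> sets borel" "A = S \<inter> A'" by (auto simp: sets_restrict_space)
    show ?thesis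
    proof (rule multiplier_limit[OF B multiplier_indicator_borel[OF A'(1)], where c=1])
      show "indicator A \<in> borel_measurable \<mu>" using A by (rule borel_measurable_indicator)
      show "(\<lambda>n. indicator A' x) \<longlonglongrightarrow> (indicator A x :: complex)" if "x \<in> S" for x
        using that A' by (simp add: indicator_def)
    qed (simp add: indicator_def)
  qed
  obtain F where F: "\<And>i. simple_function \<mu> (F i)" "\<And>x. x \<in> space \<mu> \<Longrightarrow> (\<lambda>i. F i x) \<longlonglongrightarrow> m x"
    "\<And>i x. x \<in> space \<mu> \<Longrightarrow> dist (F i x) 0 \<le> 2 * dist (m x) 0"
    using borel_measurable_implies_sequence_metric[OF m, of 0] by blast
  \<comment> \<open>The simple function is rewritten as a finite combination of indicators, to which
    the algebra rules apply; the two need agree only on the space of the measure.\<close>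
  define G where "G i x = (\<Sum>y\<in>F i ` space \<mu>. y * indicator (F i -` {y} \<inter> space \<mu>) x)" for i x
  have GF: "G i x = F i x" if x: "x \<in> space \<mu>" for i x
  proof -
    have "G i x = (\<Sum>y\<in>F i ` space \<mu>. if y = F i x then y else 0)"
      unfolding G_def using x by (intro sum.cong) (auto simp: indicator_def)
    then show ?thesis using simple_functionD(1)[OF F(1)] x by simp
  qed
  have multG: "multiplier B (G i)" for i
    unfolding G_def[abs_def]
    by (intro multiplier_sum[OF B] multiplier_mult multiplier_const[OF B] ind simple_functionD(2)[OF F(1)])
  show ?thesis
  proof (rule multiplier_limit[OF B multG m, where c="2 * c"])
    fix n x assume x: "x \<in> S"
    then have "cmod (F n x) \<le> 2 * cmod (m x)" using F(3)[of x n] by (simp add: space_mu)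
    then show "cmod (G n x) \<le> 2 * c" using c[of x] GF[of x n] x by (simp add: space_mu)
  next
    fix x assume "x \<in> S"
    then show "(\<lambda>n. G n x) \<longlonglongrightarrow> m x" using F(2)[of x] GF[of x] by (simp add: space_mu)
  qed
qed

text \<open>An operator commuting with all bounded functions is multiplication by the image
  \<open>\<phi>\<close> of the constant 1. For bounded functions this is immediate; a general
  \<open>f\<close> is first damped by a bounded positive factor.\<close>

lemma multiplier_form_is_multiplication:
  shows "\<exists>\<phi>\<in>Linf \<mu>. \<forall>f\<in>L2 \<mu>. (\<lambda>x. \<phi> x * f x) \<in> L2 \<mu> \<and> (\<forall>g\<in>L2 \<mu>. B f g = ip \<mu> (\<lambda>x. \<phi> x * f x) g)"
proof -
  define \<phi> where "\<phi> = rep B (\<lambda>x. 1)"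
  have phiL: "\<phi> \<in> L2 \<mu>" unfolding \<phi>_def by (rule rep_L2[OF B L2_const])
  note [measurable] = L2_measurable[OF phiL]
  have ip_phi: "ip \<mu> \<phi> g = B (\<lambda>x. 1) g" if "g \<in> L2 \<mu>" for g
    unfolding \<phi>_def by (rule ip_rep[OF B L2_const that])
  have key: "AE x in \<mu>. rep B (\<lambda>x. m x * f x) x = m x * rep B f x" if m: "multiplier B m" and f: "f \<in> L2 \<mu>" for m f
  proof (rule L2_eq_AE_I[OF rep_L2[OF B multiplier_L2(1)[OF m f]] multiplier_L2(1)[OF m rep_L2[OF B f]]])
    fix k assume k: "k \<in> L2 \<mu>"
    show "ip \<mu> (rep B (\<lambda>x. m x * f x)) k = ip \<mu> (\<lambda>x. m x * rep B f x) k"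
      using ip_rep[OF B multiplier_L2(1)[OF m f] k] multiplierD(3)[OF m f k]
        ip_rep[OF B f multiplier_L2(2)[OF m k]] by (simp add: ip_mult_shift)
  qed
  have key1: "AE x in \<mu>. rep B m x = m x * \<phi> x" if m: "multiplier B m" for m
    using key[OF m L2_const[of 1]] by (simp add: \<phi>_def)
  have all: "AE x in \<mu>. rep B f x = \<phi> x * f x" if f: "f \<in> L2 \<mu>" for f
  proof -
    note [measurable] = L2_measurable[OF f]
    \<comment> \<open>Both \<open>b\<close> and \<open>b * f\<close> are bounded, so
      \<open>b * T f = T (b * f) = b * f * \<phi>\<close> for the operator \<open>T\<close> of
      \<open>B\<close>, and \<open>b\<close> cancels because it vanishes nowhere.\<close>
    define b where "b x = complex_of_real (1 / (1 + cmod (f x)))" for x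
    have pos: "1 + cmod (f x) > 0" for x by (rule add_pos_nonneg) auto
    have bm: "multiplier B b"
    proof (rule multiplier_bounded[where c=1])
      show "b \<in> borel_measurable \<mu>" unfolding b_def[abs_def] by measurable
      show "cmod (b x) \<le> 1" for x
        unfolding b_def norm_of_real using pos[of x] by simp
    qed
    have am: "multiplier B (\<lambda>x. b x * f x)"
    proof (rule multiplier_bounded[where c=1])
      show "(\<lambda>x. b x * f x) \<in> borel_measurable \<mu>" unfolding b_def[abs_def] by measurable
      show "cmod (b x * f x) \<le> 1" for x
        unfolding b_def norm_mult norm_of_real using pos[of x] by (simp add: field_simps)
    qed
    show ?thesis using key[OF bm f] key1[OF am]
    proof eventually_elim
      case (elim x)
      have "b x * rep B f x = (b x * f x) * \<phi> x" by (rule trans[OF elim(1)[symmetric] elim(2)])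
      then have "b x * rep B f x = b x * (\<phi> x * f x)" by (simp only: mult_ac)
      moreover have "b x \<noteq> 0" unfolding b_def of_real_eq_0_iff using pos[of x] by simp
      ultimately show ?case by simp
    qed
  qed
  have phi_f: "(\<lambda>x. \<phi> x * f x) \<in> L2 \<mu>" if f: "f \<in> L2 \<mu>" for f
  proof -
    note [measurable] = L2_measurable[OF f] L2_measurable[OF rep_L2[OF B f]]
    have "integrable \<mu> (\<lambda>x. (cmod (\<phi> x * f x))\<^sup>2)"
      by (rule integrable_cong_AE_imp[OF L2_integrable[OF rep_L2[OF B f]]])
        (use all[OF f] in \<open>auto elim: eventually_mono\<close>)
    then show ?thesis by (simp add: L2_def)
  qed
  have rep_eq: "B f g = ip \<mu> (\<lambda>x. \<phi> x * f x) g" if f: "f \<in> L2 \<mu>" and g: "g \<in> L2 \<mu>" for f g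
    using ip_rep[OF B f g] ip_cong_AE[OF rep_L2[OF B f] phi_f[OF f] g g all[OF f]] by simp
  \<comment> \<open>Testing the norm bound on the indicator of the set where \<open>|\<phi>|\<close>
    exceeds \<open>C\<close> shows that this set is null.\<close>
  define E where "E = {x \<in> space \<mu>. C < cmod (\<phi> x)}"
  have Em[measurable]: "E \<in> sets \<mu>" unfolding E_def by measurable
  have EL: "indicator E \<in> L2 \<mu>" by (rule L2_bound[OF L2_const[of 1], of _ 1]) (auto simp: indicator_def)
  have "(l2norm \<mu> (\<lambda>x. \<phi> x * indicator E x))\<^sup>2 = (l2norm \<mu> (rep B (indicator E)))\<^sup>2"
    using l2norm_cong_AE[OF rep_L2[OF B EL] phi_f[OF EL] all[OF EL]] by simp
  also have "\<dots> \<le> (C * l2norm \<mu> (indicator E))\<^sup>2"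
    by (intro power_mono l2norm_rep[OF B EL]) simp
  finally have le: "(\<integral>x. (cmod (\<phi> x * indicator E x))\<^sup>2 \<partial>\<mu>) \<le> (\<integral>x. C\<^sup>2 * (cmod (indicator E x))\<^sup>2 \<partial>\<mu>)"
    by (simp add: l2norm_sq power_mult_distrib)
  have C0: "0 \<le> C" by (rule sesqD(1)[OF B])
  have i1: "integrable \<mu> (\<lambda>x. (cmod (\<phi> x * indicator E x))\<^sup>2)" by (rule L2_integrable[OF phi_f[OF EL]])
  have i2: "integrable \<mu> (\<lambda>x. C\<^sup>2 * (cmod (indicator E x))\<^sup>2)" using L2_integrable[OF EL] by simp
  have nn: "0 \<le> (cmod (\<phi> x * indicator E x))\<^sup>2 - C\<^sup>2 * (cmod (indicator E x))\<^sup>2" for x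
    using C0 power_mono[of C "cmod (\<phi> x)" 2] by (auto simp: indicator_def E_def)
  have "(\<integral>x. (cmod (\<phi> x * indicator E x))\<^sup>2 - C\<^sup>2 * (cmod (indicator E x))\<^sup>2 \<partial>\<mu>) \<le> 0"
    using le i1 i2 by simp
  moreover have "0 \<le> (\<integral>x. (cmod (\<phi> x * indicator E x))\<^sup>2 - C\<^sup>2 * (cmod (indicator E x))\<^sup>2 \<partial>\<mu>)"
    using nn by (intro integral_nonneg_AE) auto
  ultimately have "(\<integral>x. (cmod (\<phi> x * indicator E x))\<^sup>2 - C\<^sup>2 * (cmod (indicator E x))\<^sup>2 \<partial>\<mu>) = 0" by linarith
  then have ae0: "AE x in \<mu>. (cmod (\<phi> x * indicator E x))\<^sup>2 - C\<^sup>2 * (cmod (indicator E x))\<^sup>2 = 0"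
    using i1 i2 nn by (subst (asm) integral_nonneg_eq_0_iff_AE) auto
  have "AE x in \<mu>. cmod (\<phi> x) \<le> C"
  proof (use ae0 AE_space in eventually_elim)
    case (elim x)
    show ?case
    proof (rule ccontr)
      assume n: "\<not> cmod (\<phi> x) \<le> C"
      then have "x \<in> E" using elim(2) by (simp add: E_def)
      then have "(cmod (\<phi> x))\<^sup>2 = C\<^sup>2" using elim(1) by simp
      then show False using n C0 by (simp add: power2_eq_iff)
    qed
  qed
  then have "\<phi> \<in> Linf \<mu>" by (auto simp: Linf_def)
  then show ?thesis using phi_f rep_eq by blast
qed

end

section \<open>Lifting a solution from the complement to the whole space\<close>

lemma equation_imp_dual_toeplitz:
  assumes X: "bounded_op \<mu> X"
    and eq: "\<And>h g. h \<in> H2perp \<mu> \<Longrightarrow> g \<in> H2perp \<mu> \<Longrightarrow>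
      (\<Sum>i\<in>UNIV. ip \<mu> (X (zbmul i h)) (zbmul i g)) = of_nat r * ip \<mu> (X h) g"
  shows "\<exists>\<phi>\<in>Linf \<mu>. op_eq \<mu> X (dualT \<mu> \<phi>)"
proof -
  note XD = bounded_opD[OF X]
  obtain C0 where C0: "\<And>h. h \<in> H2perp \<mu> \<Longrightarrow> l2norm \<mu> (X h) \<le> C0 * l2norm \<mu> h"
    using X unfolding bounded_op_def by blast
  define C where "C = max C0 0"
  have C: "l2norm \<mu> (X h) \<le> C * l2norm \<mu> h" if "h \<in> H2perp \<mu>" for h
    using order_trans[OF C0[OF that] mult_right_mono[of C0 C]] by (simp add: C_def)
  \<comment> \<open>\<open>X\<close> is extended by 0 across the Hardy space. This gives a bounded
    form on all of \<open>L2\<close>, though in general not one fixed by \<open>Phi\<close>; the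
    averaging replaces it by a fixed one.\<close>
  define B0 where "B0 f g = ip \<mu> (X (Qproj \<mu> f)) (Qproj \<mu> g)" for f g
  have XQ: "X (Qproj \<mu> f) \<in> H2perp \<mu>" if "f \<in> L2 \<mu>" for f by (rule XD(1)[OF Qproj_H2perp[OF that]])
  have B0': "B0 f g = ip \<mu> (X (Qproj \<mu> f)) g" if "f \<in> L2 \<mu>" "g \<in> L2 \<mu>" for f g
    unfolding B0_def by (rule ip_Qproj_right[OF that(2) XQ[OF that(1)]])
  have sB0: "sesq C B0"
  proof (rule sesqI)
    show "0 \<le> C" by (simp add: C_def)
    fix f f' g assume f: "f \<in> L2 \<mu>" and f': "f' \<in> L2 \<mu>" and g: "g \<in> L2 \<mu>"
    have "AE x in \<mu>. X (Qproj \<mu> (\<lambda>x. f x + f' x)) x = X (\<lambda>x. Qproj \<mu> f x + Qproj \<mu> f' x) x"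
      by (rule XD(2)[OF Qproj_H2perp[OF L2_add[OF f f']] H2perp_add[OF Qproj_H2perp[OF f] Qproj_H2perp[OF f']] Qproj_add[OF f f']])
    with XD(3)[OF Qproj_H2perp[OF f] Qproj_H2perp[OF f']]
    have "AE x in \<mu>. X (Qproj \<mu> (\<lambda>x. f x + f' x)) x = X (Qproj \<mu> f) x + X (Qproj \<mu> f') x"
      by eventually_elim simp
    then have "B0 (\<lambda>x. f x + f' x) g = ip \<mu> (\<lambda>x. X (Qproj \<mu> f) x + X (Qproj \<mu> f') x) g"
      unfolding B0'[OF L2_add[OF f f'] g]
      by (intro ip_cong_AE) (auto intro: H2perp_L2[OF XQ] L2_add f f' g)
    then show "B0 (\<lambda>x. f x + f' x) g = B0 f g + B0 f' g"
      using f f' g by (simp add: B0' ip_add_left H2perp_L2[OF XQ])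
  next
    fix c f g assume f: "f \<in> L2 \<mu>" and g: "g \<in> L2 \<mu>"
    have "AE x in \<mu>. X (Qproj \<mu> (\<lambda>x. c * f x)) x = X (\<lambda>x. c * Qproj \<mu> f x) x"
      by (rule XD(2)[OF Qproj_H2perp[OF L2_cmult[OF f]] H2perp_cmult[OF Qproj_H2perp[OF f]] Qproj_cmult[OF f]])
    with XD(4)[OF Qproj_H2perp[OF f], of c]
    have "AE x in \<mu>. X (Qproj \<mu> (\<lambda>x. c * f x)) x = c * X (Qproj \<mu> f) x"
      by eventually_elim simp
    then have "B0 (\<lambda>x. c * f x) g = ip \<mu> (\<lambda>x. c * X (Qproj \<mu> f) x) g"
      unfolding B0'[OF L2_cmult[OF f] g]
      by (intro ip_cong_AE) (auto intro: H2perp_L2[OF XQ] L2_cmult f g)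
    then show "B0 (\<lambda>x. c * f x) g = c * B0 f g" using f g by (simp add: B0' ip_cmult_left)
  next
    fix f g g' assume "f \<in> L2 \<mu>" "g \<in> L2 \<mu>" "g' \<in> L2 \<mu>"
    then show "B0 f (\<lambda>x. g x + g' x) = B0 f g + B0 f g'" by (simp add: B0' L2_add ip_add_right H2perp_L2[OF XQ])
  next
    fix c f g assume "f \<in> L2 \<mu>" "g \<in> L2 \<mu>"
    then show "B0 f (\<lambda>x. c * g x) = cnj c * B0 f g" by (simp add: B0' L2_cmult ip_cmult_right)
  next
    fix f g assume f: "f \<in> L2 \<mu>" and g: "g \<in> L2 \<mu>"
    have "cmod (B0 f g) \<le> l2norm \<mu> (X (Qproj \<mu> f)) * l2norm \<mu> g"
      unfolding B0'[OF f g] by (rule Cauchy_Schwarz_ip[OF H2perp_L2[OF XQ[OF f]] g])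
    also have "\<dots> \<le> (C * l2norm \<mu> (Qproj \<mu> f)) * l2norm \<mu> g"
      by (intro mult_right_mono C Qproj_H2perp f) simp
    also have "\<dots> \<le> (C * l2norm \<mu> f) * l2norm \<mu> g"
      by (intro mult_right_mono mult_left_mono l2norm_Qproj f) (auto simp: C_def)
    finally show "cmod (B0 f g) \<le> C * (l2norm \<mu> f * l2norm \<mu> g)" by (simp add: mult.assoc)
  qed
  have B0X: "B0 h g = ip \<mu> (X h) g" if h: "h \<in> H2perp \<mu>" and g: "g \<in> H2perp \<mu>" for h g
    unfolding B0_def
    by (intro ip_cong_AE H2perp_L2 XD(1) Qproj_H2perp XD(2) Qproj_H2perp_id h g H2perp_L2[OF h] H2perp_L2[OF g])
  \<comment> \<open>\<open>zbmul i\<close> maps the complement into itself, so there the iterates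
    see only values of \<open>B0\<close> on the complement, which the equation keeps fixed. Hence
    the averaged form still restricts to the form of \<open>X\<close>.\<close>
  have pow: "(Phi ^^ n) B0 h g = B0 h g" if h: "h \<in> H2perp \<mu>" and g: "g \<in> H2perp \<mu>" for n h g
    using h g
  proof (induction n arbitrary: h g)
    case (Suc n)
    have "(Phi ^^ Suc n) B0 h g = (\<Sum>i\<in>UNIV. ip \<mu> (X (zbmul i h)) (zbmul i g)) / of_nat r"
      using Suc by (simp add: Phi_def[of "(Phi ^^ n) B0"] H2perp_zbmul B0X)
    then show ?case using r_pos Suc.prems by (simp add: eq B0X)
  qed simp
  obtain B where B: "sesq C B" "\<And>f g. f \<in> L2 \<mu> \<Longrightarrow> g \<in> L2 \<mu> \<Longrightarrow> Phi B f g = B f g"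
    and BB0: "\<And>f g. f \<in> L2 \<mu> \<Longrightarrow> g \<in> L2 \<mu> \<Longrightarrow> (\<And>n. (Phi ^^ n) B0 f g = B0 f g) \<Longrightarrow> B f g = B0 f g"
    using Phi_fixed_point_exists[OF sB0] by blast
  obtain \<phi> where phi: "\<phi> \<in> Linf \<mu>" "\<And>f. f \<in> L2 \<mu> \<Longrightarrow> (\<lambda>x. \<phi> x * f x) \<in> L2 \<mu>"
    "\<And>f g. f \<in> L2 \<mu> \<Longrightarrow> g \<in> L2 \<mu> \<Longrightarrow> B f g = ip \<mu> (\<lambda>x. \<phi> x * f x) g"
    using multiplier_form_is_multiplication[OF B(1) coordinate_form_commutes[OF B]] by blast
  have "op_eq \<mu> X (dualT \<mu> \<phi>)" unfolding op_eq_def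
  proof
    fix h assume h: "h \<in> H2perp \<mu>"
    note hL = H2perp_L2[OF h]
    show "AE x in \<mu>. X h x = dualT \<mu> \<phi> h x" unfolding dualT_def
    proof (rule H2perp_eq_AE_I[OF XD(1)[OF h] Qproj_H2perp[OF phi(2)[OF hL]]])
      fix k assume k: "k \<in> H2perp \<mu>"
      have "ip \<mu> (X h) k = B h k"
        using BB0[OF hL H2perp_L2[OF k] pow[OF h k]] B0X[OF h k] by simp
      then show "ip \<mu> (X h) k = ip \<mu> (Qproj \<mu> (\<lambda>x. \<phi> x * h x)) k"
        using phi(3)[OF hL H2perp_L2[OF k]] ip_Qproj_left[OF phi(2)[OF hL] k] by simp
    qed
  qed
  then show ?thesis using phi(1) by blast
qed

theorem dual_toeplitz_characterization:
  assumes X: "bounded_op \<mu> X"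
  shows "(\<exists>\<phi>\<in>Linf \<mu>. op_eq \<mu> X (dualT \<mu> \<phi>)) \<longleftrightarrow>
    op_eq \<mu> (\<lambda>h x. \<Sum>i\<in>UNIV. adj \<mu> (dualT \<mu> (\<lambda>z. cnj (z $ i))) (X (dualT \<mu> (\<lambda>z. cnj (z $ i)) h)) x)
      (\<lambda>h x. of_nat r * X h x)"
  unfolding dual_toeplitz_equation_iff[OF X]
  using dual_toeplitz_imp_equation[OF X] equation_imp_dual_toeplitz[OF X] by blast

end

section \<open>Circled domains and their Shilov boundary\<close>

definition cip :: "complex^'d \<Rightarrow> complex^'d::finite \<Rightarrow> complex" where
  "cip z w = (\<Sum>i\<in>UNIV. z $ i * cnj (w $ i))"

lemma cip_add_left: "cip (x + y) w = cip x w + cip y w"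
  by (simp add: cip_def distrib_right sum.distrib)

lemma cip_scale_left: "cip (c *s x) w = c * cip x w"
  by (simp add: cip_def sum_distrib_left mult.assoc)

lemma cip_scale_right: "cip x (c *s w) = cnj c * cip x w"
  by (simp add: cip_def sum_distrib_left mult.left_commute)

lemma norm_sq_vec: "(norm (z :: complex^'d::finite))\<^sup>2 = (\<Sum>i\<in>UNIV. (cmod (z $ i))\<^sup>2)"
  by (simp add: norm_vec_def L2_set_def sum_nonneg)

lemma cip_self: "cip z z = of_real ((norm z)\<^sup>2)"
  by (simp add: cip_def norm_sq_vec complex_norm_square flip: of_real_sum del: of_real_power) (simp add: complex_norm_square flip: of_real_power)

lemma Re_cip: "Re (cip z w) = z \<bullet> w"
  by (simp add: cip_def inner_vec_def inner_complex_def)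

lemma norm_cscale: "norm (c *s (z :: complex^'d::finite)) = cmod c * norm z"
proof -
  have "(norm (c *s z))\<^sup>2 = (cmod c * norm z)\<^sup>2"
    by (simp add: norm_sq_vec norm_mult power_mult_distrib sum_distrib_left)
  then show ?thesis by (simp add: power2_eq_iff_nonneg)
qed

lemma scaleR_eq_cscale: "a *\<^sub>R (z :: complex^'d::finite) = of_real a *s z"
  by (simp add: vec_eq_iff) (simp add: scaleR_conv_of_real)

lemma cmod_phase: "\<exists>u. cmod u = 1 \<and> u * z = of_real (cmod z)"
proof (cases "z = 0")
  case False
  then have "cmod (cnj z / of_real (cmod z)) = 1" by (simp add: norm_divide)
  moreover have "cnj z / of_real (cmod z) * z = of_real (cmod z)"
    using False by (simp add: complex_norm_square[symmetric] mult.commute field_simps power2_eq_square)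
  ultimately show ?thesis by blast
qed (auto intro: exI[of _ 1])

lemma cmod_cip_le: "cmod (cip z w) \<le> norm z * norm w"
proof -
  obtain u where u: "cmod u = 1" "u * cip z w = of_real (cmod (cip z w))" using cmod_phase by blast
  have "cmod (cip z w) = Re (cip (u *s z) w)" using u by (simp add: cip_scale_left)
  also have "\<dots> \<le> norm (u *s z) * norm w" unfolding Re_cip by (rule norm_cauchy_schwarz)
  finally show ?thesis using u by (simp add: norm_cscale)
qed

lemma norm_diff_sq_cip: "(norm (z - w))\<^sup>2 = (norm z)\<^sup>2 - 2 * Re (cip z w) + (norm w)\<^sup>2"
  by (simp add: Re_cip power2_norm_eq_inner inner_diff_left inner_diff_right inner_commute)

text \<open>\<open>linear\<close> on \<open>complex^'d\<close> means real linearity, so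
  compatibility with complex scalars is demanded here.\<close>

definition clin :: "(complex^'d::finite \<Rightarrow> complex^'d) \<Rightarrow> bool" where
  "clin L \<longleftrightarrow> (\<forall>x y. L (x + y) = L x + L y) \<and> (\<forall>c x. L (c *s x) = c *s L x)"

lemma clinD: "clin L \<Longrightarrow> L (x + y) = L x + L y" "clin L \<Longrightarrow> L (c *s x) = c *s L x"
  by (simp_all add: clin_def)

lemma clin_linear: "clin L \<Longrightarrow> linear L"
  by (rule linearI) (simp_all add: clinD scaleR_eq_cscale)

lemma clin_bounded_linear: "clin L \<Longrightarrow> bounded_linear L"
  by (rule linear_conv_bounded_linear[THEN iffD1]) (rule clin_linear)

lemma clin_continuous: "clin L \<Longrightarrow> continuous_on A L"
  by (rule linear_continuous_on) (rule clin_bounded_linear)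

lemma clin_comp: "clin L \<Longrightarrow> clin M \<Longrightarrow> clin (\<lambda>x. L (M x))"
  by (simp add: clin_def)

lemma clin_isometry_bij:
  assumes "clin L" "\<And>z. norm (L z) = norm z" shows "bij L"
proof -
  have "inj L" using linear_injective_0[OF clin_linear[OF assms(1)]] assms(2) by (metis norm_eq_zero)
  then show ?thesis using linear_injective_imp_surjective[OF clin_linear[OF assms(1)]] by (simp add: bij_def)
qed

lemma clin_inv: assumes "clin L" "bij L" shows "clin (inv L)"
proof -
  have s: "L (inv L y) = y" for y using assms(2) by (simp add: bij_is_surj surj_f_inv_f)
  have i: "inv L (L y) = y" for y using assms(2) by (simp add: bij_is_inj)
  show ?thesis unfolding clin_def
  proof (intro conjI allI)
    fix x y show "inv L (x + y) = inv L x + inv L y"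
      using i[of "inv L x + inv L y"] by (simp add: clinD[OF assms(1)] s)
  next
    fix c x show "inv L (c *s x) = c *s inv L x"
      using i[of "c *s inv L x"] by (simp add: clinD[OF assms(1)] s)
  qed
qed

lemma has_derivative_clin_functional:
  fixes \<psi> :: "complex^'d::finite \<Rightarrow> complex"
  assumes "\<And>x y. \<psi> (x + y) = \<psi> x + \<psi> y" "\<And>c x. \<psi> (c *s x) = c * \<psi> x"
  shows "(\<psi> has_derivative \<psi>) F"
proof (rule bounded_linear_imp_has_derivative)
  have "linear \<psi>" by (rule linearI) (simp_all add: assms scaleR_eq_cscale scaleR_conv_of_real)
  then show "bounded_linear \<psi>" by (rule linear_conv_bounded_linear[THEN iffD1])
qed

lemma holo_on_functional:
  fixes \<psi> :: "complex^'d::finite \<Rightarrow> complex"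
  assumes "\<And>x y. \<psi> (x + y) = \<psi> x + \<psi> y" "\<And>c x. \<psi> (c *s x) = c * \<psi> x"
  shows "holo_on A (\<lambda>z. \<psi> z + a)"
  unfolding holo_on_def
proof
  fix x
  have "((\<lambda>z. \<psi> z + a) has_derivative (\<lambda>z. \<psi> z + 0)) (at x)"
    by (intro derivative_intros has_derivative_clin_functional assms)
  then show "\<exists>L. ((\<lambda>z. \<psi> z + a) has_derivative L) (at x) \<and> (\<forall>c v. L (c *s v) = c * L v)"
    using assms(2) by auto
qed

lemma clin_has_derivative: "clin L \<Longrightarrow> (L has_derivative L) F"
  by (rule bounded_linear_imp_has_derivative) (rule clin_bounded_linear)

lemma holo_on_comp_clin:
  assumes "holo_on A f" "clin L" "L ` B \<subseteq> A"
  shows "holo_on B (\<lambda>z. f (L z))"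
  unfolding holo_on_def
proof
  fix x assume "x \<in> B"
  then obtain D where D: "(f has_derivative D) (at (L x))" "\<And>c v. D (c *s v) = c * D v"
    using assms(1,3) unfolding holo_on_def by blast
  have "((\<lambda>z. f (L z)) has_derivative (\<lambda>h. D (L h))) (at x)"
    using has_derivative_compose[OF clin_has_derivative[OF assms(2)] D(1)] .
  then show "\<exists>D. ((\<lambda>z. f (L z)) has_derivative D) (at x) \<and> (\<forall>c v. D (c *s v) = c * D v)"
    using D(2) by (auto simp: clinD[OF assms(2)])
qed

text \<open>Restriction to a complex line reduces \<open>holo_on\<close> to holomorphy in one
  variable: complex homogeneity of \<open>D\<close> turns the derivative into multiplication by the
  number \<open>D b\<close>.\<close>

lemma holo_on_slice_deriv:
  fixes f :: "complex^'d::finite \<Rightarrow> complex"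
  assumes "(f has_derivative D) (at (a + l *s b))" "\<And>c v. D (c *s v) = c * D v"
  shows "((\<lambda>l. f (a + l *s b)) has_field_derivative D b) (at l)"
proof -
  have "((\<lambda>l. l *s b) has_derivative (\<lambda>h. h *s b)) (at l)"
  proof (rule bounded_linear_imp_has_derivative)
    have "linear (\<lambda>h. h *s b)"
      by (rule linearI) (simp_all add: vec_eq_iff distrib_right)
    then show "bounded_linear (\<lambda>h. h *s b)" by (rule linear_conv_bounded_linear[THEN iffD1])
  qed
  then have "((\<lambda>l. a + l *s b) has_derivative (\<lambda>h. 0 + h *s b)) (at l)"
    by (intro derivative_intros)
  then have "((\<lambda>l. f (a + l *s b)) has_derivative (\<lambda>h. D (0 + h *s b))) (at l)"
    using assms(1) by (rule has_derivative_compose)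
  moreover have "(\<lambda>h. D (0 + h *s b)) = (*) (D b)" by (simp add: fun_eq_iff assms(2))
  ultimately show ?thesis by (simp only: has_field_derivative_def)
qed

lemma holo_on_slice:
  assumes "holo_on A f" "open U" "\<And>l. l \<in> U \<Longrightarrow> a + l *s b \<in> A"
  shows "(\<lambda>l. f (a + l *s b)) holomorphic_on U"
proof -
  have "\<exists>D. ((\<lambda>l. f (a + l *s b)) has_field_derivative D) (at l)" if "l \<in> U" for l
    using assms(1,3) that holo_on_slice_deriv unfolding holo_on_def by blast
  then show ?thesis using assms(2) by (auto simp: holomorphic_on_open)
qed

lemma clin_continuous_cscale: "continuous_on A (\<lambda>p. fst p *s (snd p :: complex^'d::finite))"
  by (rule continuous_on_vec_lambda[where f="\<lambda>i p. fst p * vec_nth (snd p) i", unfolded vector_scalar_mult_def[symmetric]])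
    (intro continuous_intros)

section \<open>Linear isometric symmetries joined to the identity\<close>

text \<open>The path is part of the definition because \<open>stabK\<close> refers to the identity
  component, and the isometry is required because uniqueness of the measure is proved by comparing
  balls.\<close>

definition rot :: "(complex^'d::finite) set \<Rightarrow> (complex^'d \<Rightarrow> complex^'d) set" where
  "rot \<Omega> = {L. \<exists>H. (\<forall>t\<in>{0..1::real}. clin (H t) \<and> (\<forall>z. norm (H t z) = norm z) \<and> H t ` \<Omega> = \<Omega>) \<and>
     continuous_on ({0..1} \<times> UNIV) (\<lambda>(t, z). H t z) \<and> (\<forall>z. H 0 z = z) \<and> (\<forall>z. H 1 z = L z)}"

lemma rotD:
  assumes "L \<in> rot \<Omega>"
  shows "clin L" "norm (L z) = norm z" "L ` \<Omega> = \<Omega>" "bij L"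
proof -
  obtain H where H: "\<And>t. t \<in> {0..1::real} \<Longrightarrow> clin (H t) \<and> (\<forall>z. norm (H t z) = norm z) \<and> H t ` \<Omega> = \<Omega>"
    "\<And>z. H 1 z = L z" using assms unfolding rot_def by blast
  have "H 1 = L" using H(2) by (rule ext)
  then have *: "clin L \<and> (\<forall>z. norm (L z) = norm z) \<and> L ` \<Omega> = \<Omega>" using H(1)[of 1] by simp
  then show "clin L" "norm (L z) = norm z" "L ` \<Omega> = \<Omega>" by auto
  show "bij L" using * by (intro clin_isometry_bij) auto
qed

lemma rotI:
  assumes "\<And>t. t \<in> {0..1::real} \<Longrightarrow> clin (H t)" "\<And>t z. t \<in> {0..1::real} \<Longrightarrow> norm (H t z) = norm z"
    "\<And>t. t \<in> {0..1::real} \<Longrightarrow> H t ` \<Omega> = \<Omega>"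
    "continuous_on ({0..1} \<times> UNIV) (\<lambda>(t, z). H t z)" "\<And>z. H 0 z = z" "\<And>z. H 1 z = L z"
  shows "L \<in> rot \<Omega>"
  unfolding rot_def using assms by blast

lemma rot_id: "(\<lambda>z. z) \<in> rot \<Omega>"
proof (rule rotI[where H="\<lambda>t z. z"])
  show "continuous_on ({0..1} \<times> UNIV) (\<lambda>(t::real, z::complex^'a). z)"
    unfolding case_prod_beta by (intro continuous_intros)
qed (auto simp: clin_def)

lemma rot_comp:
  assumes "L \<in> rot \<Omega>" "M \<in> rot \<Omega>" shows "(\<lambda>z. L (M z)) \<in> rot \<Omega>"
proof -
  obtain H where H: "\<And>t. t \<in> {0..1::real} \<Longrightarrow> clin (H t) \<and> (\<forall>z. norm (H t z) = norm z) \<and> H t ` \<Omega> = \<Omega>"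
    "continuous_on ({0..1} \<times> UNIV) (\<lambda>(t, z). H t z)" "\<And>z. H 0 z = z" "\<And>z. H 1 z = L z"
    using assms(1) unfolding rot_def by blast
  obtain K where K: "\<And>t. t \<in> {0..1::real} \<Longrightarrow> clin (K t) \<and> (\<forall>z. norm (K t z) = norm z) \<and> K t ` \<Omega> = \<Omega>"
    "continuous_on ({0..1} \<times> UNIV) (\<lambda>(t, z). K t z)" "\<And>z. K 0 z = z" "\<And>z. K 1 z = M z"
    using assms(2) unfolding rot_def by blast
  show ?thesis
  proof (rule rotI[where H="\<lambda>t z. H t (K t z)"])
    fix t :: real assume t: "t \<in> {0..1}"
    show "clin (\<lambda>z. H t (K t z))" using H(1)[OF t] K(1)[OF t] by (simp add: clin_comp)
    show "norm (H t (K t z)) = norm z" for z using H(1)[OF t] K(1)[OF t] by simp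
    have "(\<lambda>z. H t (K t z)) ` \<Omega> = H t ` (K t ` \<Omega>)" by (simp add: image_image)
    then show "(\<lambda>z. H t (K t z)) ` \<Omega> = \<Omega>" using H(1)[OF t] K(1)[OF t] by simp
  next
    have "continuous_on ({0..1} \<times> UNIV) (\<lambda>p. (fst p, K (fst p) (snd p)))"
      using K(2) by (intro continuous_intros) (simp add: case_prod_beta)
    then have "continuous_on ({0..1} \<times> UNIV) (\<lambda>p. (\<lambda>(t, z). H t z) (fst p, K (fst p) (snd p)))"
      by (rule continuous_on_compose2[OF H(2)]) auto
    then show "continuous_on ({0..1} \<times> UNIV) (\<lambda>(t, z). H t (K t z))" by (simp add: case_prod_beta)
  qed (simp_all add: H K)
qed

lemma rot_inv:
  assumes "L \<in> rot \<Omega>" shows "inv L \<in> rot \<Omega>"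
proof -
  obtain H where H: "\<And>t. t \<in> {0..1::real} \<Longrightarrow> clin (H t) \<and> (\<forall>z. norm (H t z) = norm z) \<and> H t ` \<Omega> = \<Omega>"
    "continuous_on ({0..1} \<times> UNIV) (\<lambda>(t, z). H t z)" "\<And>z. H 0 z = z" "\<And>z. H 1 z = L z"
    using assms unfolding rot_def by blast
  note L = rotD[OF assms]
  have s: "L (inv L y) = y" for y using L(4) by (simp add: bij_is_surj surj_f_inv_f)
  have i: "inv L (L y) = y" for y using L(4) by (simp add: bij_is_inj)
  have ci: "clin (inv L)" by (rule clin_inv[OF L(1,4)])
  show ?thesis
  proof (rule rotI[where H="\<lambda>t z. inv L (H (1 - t) z)"])
    fix t :: real assume t: "t \<in> {0..1}"
    then have t': "1 - t \<in> {0..1}" by simp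
    show "clin (\<lambda>z. inv L (H (1 - t) z))" using H(1)[OF t'] ci by (simp add: clin_comp)
    show "norm (inv L (H (1 - t) z)) = norm z" for z
      using H(1)[OF t'] L(2)[of "inv L (H (1 - t) z)"] by (simp add: s)
    have "(\<lambda>z. inv L (H (1 - t) z)) ` \<Omega> = inv L ` (H (1 - t) ` \<Omega>)" by (simp add: image_image)
    also have "\<dots> = inv L ` (L ` \<Omega>)" using H(1)[OF t'] L(3) by simp
    also have "\<dots> = \<Omega>" by (simp add: image_image i)
    finally show "(\<lambda>z. inv L (H (1 - t) z)) ` \<Omega> = \<Omega>" .
  next
    have "continuous_on ({0..1} \<times> UNIV) (\<lambda>p. (\<lambda>(t, z). H t z) (1 - fst p, snd p :: complex^'a))"
      by (rule continuous_on_compose2[OF H(2)]) (auto intro!: continuous_intros)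
    then have "continuous_on ({0..1} \<times> UNIV) (\<lambda>p. inv L ((\<lambda>(t, z). H t z) (1 - fst p, snd p)))"
      by (rule continuous_on_compose2[OF clin_continuous[OF ci, of UNIV]]) auto
    then show "continuous_on ({0..1} \<times> UNIV) (\<lambda>(t, z). inv L (H (1 - t) z))" by (simp add: case_prod_beta)
  qed (simp_all add: H i)
qed

section \<open>The maximum modulus principle and the Shilov boundary\<close>

text \<open>These are the facts to be verified separately for the four types. \<open>shrink\<close>
  says that the domain is circled and that strict dilation moves the closure inside; it makes
  approximation from within uniform.\<close>

locale cartan_domain =
  fixes \<Omega> :: "(complex^'d::finite) set" and r :: nat
  assumes open_Om: "open \<Omega>" and zero_in: "0 \<in> \<Omega>" and r_pos: "0 < r"
    and shrink: "\<And>z c. z \<in> closure \<Omega> \<Longrightarrow> cmod c < 1 \<Longrightarrow> c *s z \<in> \<Omega>"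
    and bound: "\<And>z. z \<in> closure \<Omega> \<Longrightarrow> (norm z)\<^sup>2 \<le> r"
    and disc: "\<And>z. z \<in> closure \<Omega> \<Longrightarrow> (norm z)\<^sup>2 < r \<Longrightarrow> \<exists>v. v \<noteq> 0 \<and> (\<forall>l. cmod l \<le> 1 \<longrightarrow> z + l *s v \<in> closure \<Omega>)"
    and trans: "\<And>x y. x \<in> closure \<Omega> \<Longrightarrow> y \<in> closure \<Omega> \<Longrightarrow> (norm x)\<^sup>2 = r \<Longrightarrow> (norm y)\<^sup>2 = r \<Longrightarrow> \<exists>L\<in>rot \<Omega>. L x = y"
begin

definition "S = {z \<in> closure \<Omega>. (norm z)\<^sup>2 = r}"

lemma norm_closure: "z \<in> closure \<Omega> \<Longrightarrow> norm z \<le> sqrt r"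
  using bound real_le_rsqrt by blast

lemma compact_closure: "compact (closure \<Omega>)"
proof -
  have "bounded (closure \<Omega>)" using norm_closure by (auto simp: bounded_iff)
  then show ?thesis by (simp add: compact_eq_bounded_closed)
qed

lemma S_subset: "S \<subseteq> closure \<Omega>" by (auto simp: S_def)

lemma closed_S: "closed S"
proof -
  have "S = closure \<Omega> \<inter> {z. (norm z)\<^sup>2 = r}" by (auto simp: S_def)
  moreover have "closed {z :: complex^'d. (norm z)\<^sup>2 = r}"
    by (intro closed_Collect_eq continuous_intros)
  ultimately show ?thesis by auto
qed

lemma compact_S: "compact S"
  using compact_closure closed_S S_subset by (metis compact_Int_closed inf.absorb_iff2)

lemma circle_closure:
  assumes z: "z \<in> closure \<Omega>" and c: "cmod c \<le> 1" shows "c *s z \<in> closure \<Omega>"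
proof -
  have "(\<lambda>n. of_real (1 - inverse (real (Suc n))) *s (c *s z)) \<longlonglongrightarrow> c *s z"
  proof -
    have "(\<lambda>n. (1 - inverse (real (Suc n))) *\<^sub>R (c *s z)) \<longlonglongrightarrow> (1 - 0) *\<^sub>R (c *s z)"
      by (intro tendsto_intros LIMSEQ_inverse_real_of_nat)
    then show ?thesis by (simp add: scaleR_eq_cscale)
  qed
  moreover have "of_real (1 - inverse (real (Suc n))) *s (c *s z) \<in> \<Omega>" for n
  proof -
    have pos: "0 \<le> 1 - inverse (real (Suc n))" "1 - inverse (real (Suc n)) < 1" by (auto simp: field_simps)
    have "cmod (of_real (1 - inverse (real (Suc n))) * c) < 1"
      unfolding norm_mult norm_of_real using pos c by (smt (verit) mult_left_le norm_ge_zero)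
    then show ?thesis using shrink[OF z] by (simp add: vector_smult_assoc)
  qed
  ultimately show ?thesis unfolding closure_sequential
    by (intro exI[of _ "\<lambda>n. of_real (1 - inverse (real (Suc n))) *s (c *s z)"] conjI allI)
qed

lemma circle_S: "z \<in> S \<Longrightarrow> cmod c = 1 \<Longrightarrow> c *s z \<in> S"
  by (auto simp: S_def norm_cscale intro: circle_closure)

text \<open>The disc lies only in the closure, while \<open>f\<close> is holomorphic only on
  \<open>\<Omega>\<close>. Dilation by \<open>t n < 1\<close> moves it inside; the dilated slices
  converge uniformly, so the limit is holomorphic on the open disc and the maximum principle
  applies.\<close>

lemma max_modulus_on_disc:
  assumes f: "continuous_on (closure \<Omega>) f" "holo_on \<Omega> f"
    and v: "\<And>l. cmod l \<le> 1 \<Longrightarrow> z + l *s v \<in> closure \<Omega>"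
    and max: "\<And>w. w \<in> closure \<Omega> \<Longrightarrow> cmod (f w) \<le> cmod (f z)"
    and l: "cmod l \<le> 1"
  shows "f (z + l *s v) = f z"
proof -
  define G where "G l = f (z + l *s v)" for l
  define t where "t n = 1 - inverse (real (Suc (Suc n)))" for n
  have t: "0 \<le> t n" "t n < 1" for n by (auto simp: t_def field_simps)
  define Gn where "Gn n l = f (of_real (t n) *s z + l *s (of_real (t n) *s v))" for n l
  have Gn_eq: "Gn n l = f (of_real (t n) *s (z + l *s v))" for n l
    by (simp add: Gn_def vector_add_ldistrib vector_smult_assoc mult.commute)
  have inO: "of_real (t n) *s (z + l *s v) \<in> \<Omega>" if "cmod l \<le> 1" for n l
    using shrink[OF v[OF that]] t[of n] by simp
  have contG: "continuous_on (cball 0 1) G" unfolding G_def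
  proof (rule continuous_on_compose2[OF f(1)])
    have "continuous_on (cball 0 1) (\<lambda>l. fst (l, v) *s snd (l, v))"
      by (rule continuous_on_compose2[OF clin_continuous_cscale[of UNIV]]) (auto intro!: continuous_intros)
    then show "continuous_on (cball 0 1) (\<lambda>l. z + l *s v)" by (intro continuous_intros) simp
    show "(\<lambda>l. z + l *s v) ` cball 0 1 \<subseteq> closure \<Omega>" using v by auto
  qed
  have holGn: "Gn n holomorphic_on ball 0 1" for n unfolding Gn_def
  proof (rule holo_on_slice[OF f(2) open_ball])
    fix l :: complex assume "l \<in> ball 0 1"
    then have "cmod l \<le> 1" by simp
    from inO[OF this, of n] show "of_real (t n) *s z + l *s (of_real (t n) *s v) \<in> \<Omega>"
      by (simp add: vector_add_ldistrib vector_smult_assoc mult.commute)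
  qed
  have unif: "uniform_limit (cball 0 1) Gn G sequentially"
  proof (rule uniform_limitI)
    fix e :: real assume e: "e > 0"
    have "uniformly_continuous_on (closure \<Omega>) f" using f(1) compact_closure by (rule compact_uniformly_continuous)
    then obtain d where d: "d > 0" "\<And>x y. x \<in> closure \<Omega> \<Longrightarrow> y \<in> closure \<Omega> \<Longrightarrow> dist x y < d \<Longrightarrow> dist (f x) (f y) < e"
      using e unfolding uniformly_continuous_on_def by metis
    have r0: "sqrt (real r) > 0" using r_pos by simp
    have "(\<lambda>n. inverse (real (Suc (Suc n)))) \<longlonglongrightarrow> 0" by (rule LIMSEQ_Suc[OF LIMSEQ_inverse_real_of_nat])
    moreover have "0 < d / sqrt r" using d r0 by simp
    ultimately have "\<forall>\<^sub>F n in sequentially. inverse (real (Suc (Suc n))) < d / sqrt r"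
      by (rule order_tendstoD(2))
    then show "\<forall>\<^sub>F n in sequentially. \<forall>l\<in>cball 0 1. dist (Gn n l) (G l) < e"
    proof eventually_elim
      case (elim n)
      show ?case
      proof
        fix l :: complex assume "l \<in> cball 0 1"
        then have l: "cmod l \<le> 1" by simp
        let ?w = "z + l *s v"
        have "of_real (t n) *s ?w - ?w = of_real (t n - 1) *s ?w" by (simp add: vec_eq_iff algebra_simps)
        then have "dist (of_real (t n) *s ?w) ?w = \<bar>t n - 1\<bar> * norm ?w"
          unfolding dist_norm by (simp only: norm_cscale norm_of_real)
        also have "\<bar>t n - 1\<bar> = inverse (real (Suc (Suc n)))" by (simp add: t_def)
        also have "inverse (real (Suc (Suc n))) * norm ?w \<le> inverse (real (Suc (Suc n))) * sqrt r"
          using norm_closure[OF v[OF l]] by (intro mult_left_mono) auto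
        also have "\<dots> < d" using elim r0 by (simp add: pos_less_divide_eq)
        finally have "dist (of_real (t n) *s ?w) ?w < d" .
        then show "dist (Gn n l) (G l) < e" unfolding Gn_eq G_def
          using v[OF l] inO[OF l, of n] closure_subset by (intro d(2)) auto
      qed
    qed
  qed
  have hol: "G holomorphic_on ball 0 1"
  proof (rule holomorphic_uniform_sequence[OF open_ball holGn])
    fix x :: complex assume "x \<in> ball 0 1"
    then obtain e where e: "e > 0" "cball x e \<subseteq> ball 0 1"
      using open_contains_cball[of "ball (0::complex) 1"] open_ball by blast
    have "cball x e \<subseteq> cball 0 1" by (rule order_trans[OF e(2) ball_subset_cball])
    then show "\<exists>d>0. cball x d \<subseteq> ball 0 1 \<and> uniform_limit (cball x d) Gn G sequentially"
      using e uniform_limit_on_subset[OF unif] by blast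
  qed
  have "G constant_on ball 0 1"
  proof (rule maximum_modulus_principle[OF hol open_ball connected_ball open_ball order_refl])
    show "(0::complex) \<in> ball 0 1" by simp
    fix l :: complex assume "l \<in> ball 0 1"
    then have "cmod l \<le> 1" by simp
    from max[OF v[OF this]] show "cmod (G l) \<le> cmod (G 0)" by (simp add: G_def)
  qed
  then obtain a where a: "\<And>l. l \<in> ball 0 1 \<Longrightarrow> G l = a" unfolding constant_on_def by (elim exE) simp
  have c: "G l = G 0" if "l \<in> ball 0 1" for l using a[OF that] a[of 0] by simp
  have "G l = G 0"
  proof (rule continuous_constant_on_closure[of "ball 0 1" G])
    show "continuous_on (closure (ball 0 1)) G" using contG by simp
    show "l \<in> closure (ball 0 1)" using l by simp
  qed (rule c)
  then show ?thesis by (simp add: G_def)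
qed

text \<open>Among the points where \<open>|f|\<close> is maximal take one of largest norm. If its
  squared norm were below \<open>r\<close>, \<open>f\<close> would be constant on a disc centred
  there, and a point of that disc would be a maximum of larger norm.\<close>

lemma max_modulus_S: "max_modulus_set \<Omega> S"
  unfolding max_modulus_set_def
proof (intro allI impI ballI)
  fix f z0 assume f: "continuous_on (closure \<Omega>) f \<and> holo_on \<Omega> f" and z0: "z0 \<in> closure \<Omega>"
  have contf: "continuous_on (closure \<Omega>) (\<lambda>z. cmod (f z))" using f by (intro continuous_intros) auto
  have "closure \<Omega> \<noteq> {}" using z0 by (metis empty_iff)
  from continuous_attains_sup[OF compact_closure this contf]
  obtain z1 where z1: "z1 \<in> closure \<Omega>" "\<And>w. w \<in> closure \<Omega> \<Longrightarrow> cmod (f w) \<le> cmod (f z1)"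
    by (elim bexE) simp
  define F where "F = {z \<in> closure \<Omega>. cmod (f z) = cmod (f z1)}"
  have "closed F" unfolding F_def using contf by (intro continuous_closed_preimage_constant) auto
  then have "compact F" using compact_closure by (metis (no_types, lifting) F_def compact_Int_closed inf.absorb_iff2 mem_Collect_eq subsetI)
  moreover have "z1 \<in> F" using z1 by (simp add: F_def)
  moreover have "continuous_on F norm" by (intro continuous_intros)
  ultimately obtain z2 where z2: "z2 \<in> F" "\<And>w. w \<in> F \<Longrightarrow> norm w \<le> norm z2"
    using continuous_attains_sup[of F norm] by blast
  have z2': "z2 \<in> closure \<Omega>" "cmod (f z2) = cmod (f z1)" using z2 by (auto simp: F_def)
  have "(norm z2)\<^sup>2 = r"
  proof (rule ccontr)
    assume "(norm z2)\<^sup>2 \<noteq> r"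
    then have "(norm z2)\<^sup>2 < r" using bound[OF z2'(1)] by simp
    then obtain v where v: "v \<noteq> 0" "\<And>l. cmod l \<le> 1 \<Longrightarrow> z2 + l *s v \<in> closure \<Omega>" using disc[OF z2'(1)] by blast
    \<comment> \<open>The sign makes the inner product with \<open>z2\<close> nonnegative, so the
      squared norm grows by at least \<open>(norm v)\<^sup>2\<close>.\<close>
    define l :: complex where "l = (if z2 \<bullet> v \<ge> 0 then 1 else -1)"
    have l: "cmod l \<le> 1" by (simp add: l_def)
    have "f (z2 + l *s v) = f z2"
      using f z1 z2' by (intro max_modulus_on_disc v l) auto
    then have "z2 + l *s v \<in> F" using v(2)[OF l] z2' by (simp add: F_def)
    then have "norm (z2 + l *s v) \<le> norm z2" by (rule z2(2))
    then have "(norm (z2 + l *s v))\<^sup>2 \<le> (norm z2)\<^sup>2" by (rule power_mono) simp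
    moreover have "(norm (z2 + l *s v))\<^sup>2 = (norm z2)\<^sup>2 + 2 * \<bar>z2 \<bullet> v\<bar> + (norm v)\<^sup>2"
      unfolding l_def by (simp add: power2_norm_eq_inner inner_add_left inner_add_right inner_diff_left inner_diff_right inner_commute)
    moreover have "(norm v)\<^sup>2 > 0" using v by simp
    ultimately show False by linarith
  qed
  then show "\<exists>w\<in>S. cmod (f z0) \<le> cmod (f w)"
    using z1(2)[OF z0] z2' by (intro bexI[of _ z2]) (auto simp: S_def)
qed

lemma S_ne: "S \<noteq> {}"
proof -
  have "0 \<in> closure \<Omega>" using zero_in closure_subset by auto
  moreover have "holo_on \<Omega> (\<lambda>z. 0 + (0::complex))"
    by (rule holo_on_functional[where \<psi>="\<lambda>_. 0"]) simp_all
  moreover have "continuous_on (closure \<Omega>) (\<lambda>z. 0 + (0::complex))" by (intro continuous_intros)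
  ultimately show ?thesis using max_modulus_S unfolding max_modulus_set_def by blast
qed

lemma cip_eq_imp_eq:
  assumes "(norm w)\<^sup>2 \<le> a" "(norm s)\<^sup>2 \<le> a" "a \<le> Re (cip w s)" shows "w = s"
proof -
  have "(norm (w - s))\<^sup>2 \<le> 0" using assms norm_diff_sq_cip[of w s] by linarith
  then show ?thesis by simp
qed

text \<open>Each \<open>s\<close> in \<open>S\<close> is a peak point: \<open>cip z s + r\<close>
  attains its maximal modulus \<open>2 * r\<close> on the closure only at \<open>s\<close>. The
  summand \<open>r\<close> separates \<open>s\<close> from its multiples by phases, on which
  \<open>|cip z s|\<close> is equally large.\<close>

lemma S_minimal:
  assumes S': "closed S'" "S' \<subseteq> closure \<Omega>" "max_modulus_set \<Omega> S'" shows "S \<subseteq> S'"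
proof
  fix s assume s: "s \<in> S"
  then have sc: "s \<in> closure \<Omega>" and ns: "(norm s)\<^sup>2 = r" by (auto simp: S_def)
  let ?f = "\<lambda>z. cip z s + of_nat r"
  have "holo_on \<Omega> ?f" by (rule holo_on_functional) (auto simp: cip_add_left cip_scale_left)
  moreover have "continuous_on (closure \<Omega>) ?f" unfolding cip_def by (intro continuous_intros)
  ultimately obtain w where w: "w \<in> S'" "cmod (?f s) \<le> cmod (?f w)"
    using S'(3) sc unfolding max_modulus_set_def by blast
  have nw: "(norm w)\<^sup>2 \<le> r" using w S' bound by auto
  have "cmod (?f s) = 2 * r"
  proof -
    have "?f s = of_real (2 * r)" by (simp add: cip_self ns)
    then show ?thesis by (simp only: norm_of_real)
  qed
  then have le: "(2 * real r)\<^sup>2 \<le> (cmod (cip w s + of_nat r))\<^sup>2" using w(2) by (intro power_mono) auto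
  have "cmod (cip w s) \<le> norm w * norm s" by (rule cmod_cip_le)
  then have "(cmod (cip w s))\<^sup>2 \<le> (norm w)\<^sup>2 * (norm s)\<^sup>2" by (simp add: power_mono flip: power_mult_distrib)
  also have "\<dots> \<le> real r * real r" unfolding ns using nw by (intro mult_right_mono) auto
  finally have c: "(cmod (cip w s))\<^sup>2 \<le> (real r)\<^sup>2" by (simp add: power2_eq_square)
  have "(cmod (cip w s + of_nat r))\<^sup>2 = (cmod (cip w s))\<^sup>2 + 2 * r * Re (cip w s) + (real r)\<^sup>2"
    unfolding cmod_power2 by (simp add: power2_eq_square algebra_simps)
  moreover have "(2 * real r)\<^sup>2 = 4 * (real r)\<^sup>2" by (simp add: power_mult_distrib)
  ultimately have "2 * (real r)\<^sup>2 \<le> 2 * r * Re (cip w s)" using le c by linarith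
  then have "real r \<le> Re (cip w s)" using r_pos by (simp add: power2_eq_square)
  then have "w = s" using nw ns by (intro cip_eq_imp_eq[of w r]) auto
  then show "s \<in> S'" using w by simp
qed

lemma shilov_eq: "shilov \<Omega> = S"
  unfolding shilov_def
proof (rule the_equality)
  show "closed S \<and> S \<subseteq> closure \<Omega> \<and> max_modulus_set \<Omega> S \<and>
      (\<forall>S'. closed S' \<and> S' \<subseteq> closure \<Omega> \<and> max_modulus_set \<Omega> S' \<longrightarrow> S \<subseteq> S')"
    using closed_S S_subset max_modulus_S S_minimal by blast
  fix T assume "closed T \<and> T \<subseteq> closure \<Omega> \<and> max_modulus_set \<Omega> T \<and>
      (\<forall>S'. closed S' \<and> S' \<subseteq> closure \<Omega> \<and> max_modulus_set \<Omega> S' \<longrightarrow> T \<subseteq> S')"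
  then show "T = S" using closed_S S_subset max_modulus_S S_minimal[of T] by blast
qed

end

section \<open>Linearity of the stabilizer of the origin\<close>

lemma vec_inner_axis: "(z :: complex^'d::finite) \<bullet> axis i u = (vec_nth z i) \<bullet> u"
  by (simp add: inner_axis)

lemma holo_map_has_derivative:
  fixes g :: "complex^'d::finite \<Rightarrow> complex^'d"
  assumes "holo_map_on A g" "x \<in> A"
  shows "\<exists>L. clin L \<and> (g has_derivative L) (at x)"
proof -
  have "\<forall>i. \<exists>D. ((\<lambda>z. vec_nth (g z) i) has_derivative D) (at x) \<and> (\<forall>(c::complex) v. D (c *s v) = c * D v)"
    using assms unfolding holo_map_on_def holo_on_def by blast
  from choice[OF this] obtain D where D: "\<And>i. ((\<lambda>z. vec_nth (g z) i) has_derivative D i) (at x)"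
    "\<And>i (c::complex) v. D i (c *s v) = c * D i v" by auto
  define L where "L v = (\<chi> i. D i v)" for v
  have lin: "linear (D i)" for i using has_derivative_linear[OF D(1)] .
  have "clin L" unfolding clin_def L_def
    using D(2) lin by (simp add: vec_eq_iff linear_add)
  moreover have "(g has_derivative L) (at x)"
  proof (subst has_derivative_componentwise_within, intro ballI)
    fix b :: "complex^'d" assume "b \<in> Basis"
    then obtain i u where b: "b = axis i u" by (auto simp: Basis_vec_def)
    have "((\<lambda>z. vec_nth (g z) i \<bullet> u) has_derivative (\<lambda>v. D i v \<bullet> u)) (at x)"
      by (intro derivative_intros D)
    then show "((\<lambda>z. g z \<bullet> b) has_derivative (\<lambda>v. L v \<bullet> b)) (at x)"
      by (simp add: b vec_inner_axis L_def)
  qed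
  ultimately show ?thesis by blast
qed

context cartan_domain begin

lemma cscale_enlarge:
  assumes w: "w \<in> \<Omega>" shows "\<exists>t>1. of_real t *s w \<in> \<Omega>"
proof -
  have "continuous (at 1) (\<lambda>t::real. t *\<^sub>R w)" by (intro continuous_intros)
  then have "((\<lambda>t::real. t *\<^sub>R w) \<longlongrightarrow> 1 *\<^sub>R w) (at 1)" by (simp add: continuous_at)
  then have "\<forall>\<^sub>F t in at 1. t *\<^sub>R w \<in> \<Omega>" using open_Om w by (intro topological_tendstoD) auto
  then obtain d where d: "d > 0" "\<And>t. t \<noteq> 1 \<Longrightarrow> dist t 1 < d \<Longrightarrow> t *\<^sub>R w \<in> \<Omega>"
    unfolding eventually_at by auto
  have "(1 + d/2) *\<^sub>R w \<in> \<Omega>" using d by (intro d(2)) (auto simp: dist_real_def)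
  then show ?thesis using d by (intro exI[of _ "1 + d/2"]) (simp only: scaleR_eq_cscale, simp)
qed

text \<open>The polar of the domain in the complex dual. The Schwarz lemma is applied to functionals
  from it, which dispenses with a norm whose unit ball is \<open>\<Omega>\<close>.\<close>

definition dual_ball :: "(complex^'d \<Rightarrow> complex) set" where
  "dual_ball = {\<psi>. (\<forall>x y. \<psi> (x + y) = \<psi> x + \<psi> y) \<and> (\<forall>c x. \<psi> (c *s x) = c * \<psi> x) \<and> (\<forall>w\<in>\<Omega>. cmod (\<psi> w) \<le> 1)}"

text \<open>Openness allows \<open>w\<close> to be stretched slightly. The strict bound is the form
  in which the Schwarz lemma takes its hypothesis.\<close>

lemma dual_ball_strict:
  assumes "\<psi> \<in> dual_ball" "w \<in> \<Omega>" shows "cmod (\<psi> w) < 1"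
proof -
  obtain t where t: "t > 1" "of_real t *s w \<in> \<Omega>" using cscale_enlarge[OF assms(2)] by auto
  have "\<forall>w\<in>\<Omega>. cmod (\<psi> w) \<le> 1" using assms(1) by (simp add: dual_ball_def)
  then have "cmod (\<psi> (of_real t *s w)) \<le> 1" using t(2) by (rule bspec)
  also have "\<psi> (of_real t *s w) = of_real t * \<psi> w" using assms(1) by (simp add: dual_ball_def)
  finally have le: "t * cmod (\<psi> w) \<le> 1" using t by (simp add: norm_mult)
  show ?thesis
  proof (rule ccontr)
    assume "\<not> cmod (\<psi> w) < 1"
    then have "1 * cmod (\<psi> w) < t * cmod (\<psi> w)" using t by (intro mult_strict_right_mono) auto
    then show False using le \<open>\<not> cmod (\<psi> w) < 1\<close> by simp
  qed
qed

lemma dual_ball_slice: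
  assumes psi: "\<psi> \<in> dual_ball" and g: "holo_map_on \<Omega> g" "g ` \<Omega> \<subseteq> \<Omega>" "g 0 = 0"
    and L: "(g has_derivative L) (at 0)" "clin L" and w: "\<And>l. cmod l < 1 \<Longrightarrow> l *s w \<in> \<Omega>"
  defines "u \<equiv> \<lambda>l. \<psi> (g (l *s w))"
  shows "u holomorphic_on ball 0 1" "u 0 = 0" "\<And>l. cmod l < 1 \<Longrightarrow> cmod (u l) < 1" "deriv u 0 = \<psi> (L w)"
proof -
  have lin: "\<And>x y. \<psi> (x + y) = \<psi> x + \<psi> y" "\<And>c x. \<psi> (c *s x) = c * \<psi> x"
    using psi by (auto simp: dual_ball_def)
  have psi': "(\<psi> has_derivative \<psi>) F" for F by (rule has_derivative_clin_functional[OF lin])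
  have comp: "holo_on \<Omega> (\<lambda>z. \<psi> (g z))" unfolding holo_on_def
  proof
    fix x assume "x \<in> \<Omega>"
    then obtain K where K: "clin K" "(g has_derivative K) (at x)" using holo_map_has_derivative[OF g(1)] by blast
    have "((\<lambda>z. \<psi> (g z)) has_derivative (\<lambda>v. \<psi> (K v))) (at x)"
      by (rule has_derivative_compose[OF K(2) psi'])
    then show "\<exists>D. ((\<lambda>z. \<psi> (g z)) has_derivative D) (at x) \<and> (\<forall>c v. D (c *s v) = c * D v)"
      using clinD(2)[OF K(1)] lin(2) by (intro exI[of _ "\<lambda>v. \<psi> (K v)"]) simp
  qed
  have "(\<lambda>l. \<psi> (g (0 + l *s w))) holomorphic_on ball 0 1"
    by (rule holo_on_slice[OF comp open_ball]) (use w in simp)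
  then show "u holomorphic_on ball 0 1" by (simp add: u_def)
  show u0: "u 0 = 0" using g(3) lin(2)[of 0 0] by (simp add: u_def)
  show "cmod (u l) < 1" if "cmod l < 1" for l
    unfolding u_def using dual_ball_strict[OF psi, of "g (l *s w)"] w[OF that] g(2) by blast
  have "((\<lambda>z. \<psi> (g z)) has_derivative (\<lambda>v. \<psi> (L v))) (at (0 + 0 *s w))"
    using has_derivative_compose[OF L(1) psi'] by simp
  then have "((\<lambda>l. \<psi> (g (0 + l *s w))) has_field_derivative \<psi> (L w)) (at 0)"
    by (rule holo_on_slice_deriv) (simp add: clinD[OF L(2)] lin)
  then show "deriv u 0 = \<psi> (L w)" by (simp add: u_def DERIV_imp_deriv)
qed

text \<open>Schwarz lemma on the disc through \<open>w\<close>: the derivative at 0 of a self-map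
  fixing 0 pulls the polar back into itself.\<close>

lemma dual_ball_deriv:
  assumes psi: "\<psi> \<in> dual_ball" and g: "holo_map_on \<Omega> g" "g ` \<Omega> \<subseteq> \<Omega>" "g 0 = 0"
    and L: "(g has_derivative L) (at 0)" "clin L"
  shows "(\<lambda>w. \<psi> (L w)) \<in> dual_ball"
proof -
  have lin: "\<And>x y. \<psi> (x + y) = \<psi> x + \<psi> y" "\<And>c x. \<psi> (c *s x) = c * \<psi> x"
    using psi by (auto simp: dual_ball_def)
  have "cmod (\<psi> (L w)) \<le> 1" if "w \<in> \<Omega>" for w
  proof -
    have w: "l *s w \<in> \<Omega>" if "cmod l < 1" for l using shrink[OF _ that] \<open>w \<in> \<Omega>\<close> closure_subset by blast
    note u = dual_ball_slice[OF psi g L w]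
    show ?thesis using Schwarz_Lemma(2)[OF u(1-3), of 0] u(4) by simp
  qed
  then show ?thesis using lin clinD[OF L(2)] by (simp add: dual_ball_def)
qed

lemma cip_dual_ball:
  assumes "norm v \<le> 1 / sqrt r" shows "(\<lambda>z. cip z v) \<in> dual_ball"
proof -
  have "cmod (cip w v) \<le> 1" if "w \<in> \<Omega>" for w
  proof -
    have r0: "sqrt (real r) > 0" using r_pos by simp
    have "cmod (cip w v) \<le> norm w * norm v" by (rule cmod_cip_le)
    also have "\<dots> \<le> sqrt r * (1 / sqrt r)"
      using assms that closure_subset by (intro mult_mono norm_closure) auto
    finally show ?thesis using r0 by simp
  qed
  then show ?thesis by (simp add: dual_ball_def cip_add_left cip_scale_left)
qed

text \<open>Cartan's linearity theorem: by the Schwarz lemma and maximality of the norm on \<open>S\<close>, the map \<open>g\<close> is linear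
  on the complex lines through \<open>S\<close>, and \<open>S\<close> determines holomorphic functions.\<close>
lemma stabK_linear:
  assumes "g \<in> stabK \<Omega>"
  shows "\<exists>L. clin L \<and> bij L \<and> L ` \<Omega> = \<Omega> \<and> (\<forall>z\<in>\<Omega>. g z = L z)"
proof -
  define k where "k = inv_into \<Omega> g"
  have g: "g ` \<Omega> = \<Omega>" "inj_on g \<Omega>" "holo_map_on \<Omega> g" "holo_map_on \<Omega> k" "g 0 = 0"
    using assms by (auto simp: stabK_def aut_def k_def)
  have kg: "k (g z) = z" if "z \<in> \<Omega>" for z using that g(2) by (simp add: k_def)
  have gk: "g (k z) = z" if "z \<in> \<Omega>" for z using that g(1) by (simp add: k_def f_inv_into_f)
  have kO: "k ` \<Omega> \<subseteq> \<Omega>" using g(1) inv_into_into[of _ g \<Omega>] by (auto simp: k_def)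
  have k0: "k 0 = 0" using kg[OF zero_in] g(5) by simp
  obtain L where L: "clin L" "(g has_derivative L) (at 0)" using holo_map_has_derivative[OF g(3) zero_in] by blast
  obtain M where M: "clin M" "(k has_derivative M) (at 0)" using holo_map_has_derivative[OF g(4) zero_in] by blast
  have der_id: "K = (\<lambda>x. x)" if "((\<lambda>x. a (b x)) has_derivative K) (at 0)" "\<And>x. x \<in> \<Omega> \<Longrightarrow> a (b x) = x"
    for a b :: "complex^'d \<Rightarrow> complex^'d" and K
  proof -
    have "((\<lambda>x. x) has_derivative K) (at 0)"
      by (rule has_derivative_transform_within_open[OF that(1) open_Om zero_in that(2)])
    then show ?thesis using has_derivative_unique[OF _ has_derivative_ident] by blast
  qed
  have "((\<lambda>x. k (g x)) has_derivative (\<lambda>x. M (L x))) (at 0)"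
    using has_derivative_compose[OF L(2), of k M] M(2) g(5) by simp
  from der_id[of k g, OF this kg] have MLx: "M (L x) = x" for x by (rule fun_cong)
  have "((\<lambda>x. g (k x)) has_derivative (\<lambda>x. L (M x))) (at 0)"
    using has_derivative_compose[OF M(2), of g L] L(2) k0 by simp
  from der_id[of g k, OF this gk] have LMx: "L (M x) = x" for x by (rule fun_cong)
  have bij: "bij L" using MLx LMx by (intro bij_betw_byWitness[where f'=M]) auto
  have r0: "sqrt (real r) > 0" using r_pos by simp
  have gls: "g (l *s s) = L (l *s s)" if s: "s \<in> S" and l: "cmod l < 1" for s l
  proof -
    have lsO: "l *s s \<in> \<Omega>" if "cmod l < 1" for l using shrink[OF _ that] s S_subset by blast
    have ns: "(norm s)\<^sup>2 = r" using s by (simp add: S_def)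
    have ns': "norm s = sqrt r" using ns real_sqrt_unique[of "norm s" "real r"] by simp
    \<comment> \<open>Applying \<open>M\<close>, the inverse of the derivative, turns the claim into
      \<open>P = l *s s\<close>, a statement about a map with identity derivative at 0.\<close>
    define P where "P = M (g (l *s s))"
    have u: "u holomorphic_on ball 0 1" "u 0 = 0" "\<And>l. cmod l < 1 \<Longrightarrow> cmod (u l) < 1" "deriv u 0 = cip s v"
      if v: "norm v \<le> 1 / sqrt r" and ud: "u = (\<lambda>l. cip (M (g (l *s s))) v)" for u v
    proof -
      have psi: "(\<lambda>w. cip (M w) v) \<in> dual_ball"
        using dual_ball_deriv[OF cip_dual_ball[OF v] g(4) kO k0 M(2,1)] .
      have "g ` \<Omega> \<subseteq> \<Omega>" using g(1) by simp
      from dual_ball_slice[OF psi g(3) this g(5) L(2,1) lsO]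
      show "u holomorphic_on ball 0 1" "u 0 = 0" "\<And>l. cmod l < 1 \<Longrightarrow> cmod (u l) < 1" "deriv u 0 = cip s v"
        unfolding ud by (auto simp: MLx)
    qed
    \<comment> \<open>The functional belonging to \<open>s / r\<close> gives a function on the disc
      with derivative 1 at 0. This is the equality case of the Schwarz lemma, so that function is
      the identity.\<close>
    have ls: "cip P s = of_nat r * l"
    proof -
      let ?v = "of_real (1 / r) *s s"
      have v: "norm ?v \<le> 1 / sqrt r"
      proof -
        have "\<bar>1 / real r\<bar> * sqrt r = 1 / sqrt r" using r0 by (simp add: field_simps)
        then show ?thesis by (simp only: norm_cscale norm_of_real ns' order_refl)
      qed
      define u where "u = (\<lambda>l. cip (M (g (l *s s))) ?v)"
      note uu = u[OF v u_def]
      have cs: "cip x ?v = cip x s / of_nat r" for x by (simp add: cip_scale_right)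
      have "deriv u 0 = cip s s / of_nat r" using uu(4) unfolding cs .
      then have d1: "deriv u 0 = 1" using r_pos by (simp add: cip_self ns)
      obtain a where a: "\<And>z. cmod z < 1 \<Longrightarrow> u z = a * z"
        using Schwarz_Lemma(3)[OF uu(1-3), of 0] d1 by auto
      have "deriv u 0 = a"
      proof (rule DERIV_imp_deriv)
        have "((\<lambda>z. a * z) has_field_derivative a) (at 0)" by (auto intro!: derivative_eq_intros)
        then show "(u has_field_derivative a) (at 0)"
          by (rule has_field_derivative_transform_within_open[of _ _ _ "ball 0 1"]) (use a in auto)
      qed
      then have "u l = l" using a[OF l] d1 by simp
      then have "cip P s / of_nat r = l" unfolding u_def cs P_def .
      then show ?thesis using r_pos by (simp add: field_simps)
    qed
    \<comment> \<open>The functional in the direction of \<open>P\<close> itself bounds the norm of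
      \<open>P\<close>. Together with the known value of \<open>cip P s\<close> this is the equality
      case of Cauchy-Schwarz.\<close>
    have nP: "norm P \<le> cmod l * sqrt r"
    proof (cases "P = 0")
      case False
      let ?v = "of_real (1 / (sqrt r * norm P)) *s P"
      have v: "norm ?v \<le> 1 / sqrt r" unfolding norm_cscale using r0 False by (simp add: norm_mult norm_divide)
      have "cmod (cip P ?v) \<le> cmod l"
        using Schwarz_Lemma(1)[OF u(1-3)[OF v refl] l] by (simp add: P_def)
      moreover have "cip P ?v = of_real (norm P / sqrt r)"
      proof -
        have "cip P ?v = of_real (1 / (sqrt r * norm P)) * of_real ((norm P)\<^sup>2)"
          unfolding cip_scale_right cip_self complex_cnj_complex_of_real ..
        also have "\<dots> = of_real (1 / (sqrt r * norm P) * (norm P)\<^sup>2)" by (simp only: of_real_mult)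
        also have "1 / (sqrt r * norm P) * (norm P)\<^sup>2 = norm P / sqrt r" using False r0 by (simp add: power2_eq_square)
        finally show ?thesis .
      qed
      ultimately have "norm P / sqrt r \<le> cmod l" by (simp only: norm_of_real)
      then show ?thesis using r0 by (simp add: pos_divide_le_eq)
    qed simp
    have "P = l *s s"
    proof (rule cip_eq_imp_eq[where a="(cmod l)\<^sup>2 * r"])
      have "(norm P)\<^sup>2 \<le> (cmod l * sqrt r)\<^sup>2" using nP by (rule power_mono) simp
      then show "(norm P)\<^sup>2 \<le> (cmod l)\<^sup>2 * r" by (simp add: power_mult_distrib)
      show "(norm (l *s s))\<^sup>2 \<le> (cmod l)\<^sup>2 * r" by (simp add: norm_cscale power_mult_distrib ns)
      have "cip P (l *s s) = of_real ((cmod l)\<^sup>2 * r)"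
        unfolding cip_scale_right ls by (simp add: complex_norm_square mult_ac del: of_real_power)
      then show "(cmod l)\<^sup>2 * r \<le> Re (cip P (l *s s))" by (simp only: Re_complex_of_real)
    qed
    then show ?thesis using LMx[of "g (l *s s)"] by (simp add: P_def)
  qed
  have contg: "continuous_on \<Omega> g"
    unfolding continuous_on_eq_continuous_within
    using holo_map_has_derivative[OF g(3)] has_derivative_continuous continuous_at_imp_continuous_within by blast
  have scaled: "g (of_real t *s z) = L (of_real t *s z)" if t: "0 \<le> t" "t < 1" and z: "z \<in> closure \<Omega>" for t z
  proof -
    let ?m = "\<lambda>z. of_real t *s z :: complex^'d"
    have mO: "?m z \<in> \<Omega>" if "z \<in> closure \<Omega>" for z using shrink[OF that] t by simp
    have cm: "clin ?m" by (simp add: clin_def vector_add_ldistrib vector_smult_assoc mult.commute)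
    have "vec_nth (g (?m z)) i - vec_nth (L (?m z)) i = 0" for i
    proof -
      define f where "f z = vec_nth (g (?m z)) i - vec_nth (L (?m z)) i" for z
      have cont: "continuous_on (closure \<Omega>) f" unfolding f_def
      proof (intro continuous_intros)
        have "continuous_on (closure \<Omega>) (\<lambda>z. g (?m z))"
          by (rule continuous_on_compose2[OF contg clin_continuous[OF cm]]) (use mO in auto)
        then show "continuous_on (closure \<Omega>) (\<lambda>z. g (?m z))" .
        show "continuous_on (closure \<Omega>) (\<lambda>z. L (?m z))" using clin_continuous[OF clin_comp[OF L(1) cm]] .
      qed
      have "holo_on \<Omega> f" unfolding holo_on_def
      proof
        fix x assume "x \<in> \<Omega>"
        then have "?m x \<in> \<Omega>" using mO closure_subset by blast
        then obtain K where K: "clin K" "(g has_derivative K) (at (?m x))" using holo_map_has_derivative[OF g(3)] by blast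
        have 1: "((\<lambda>z. g (?m z)) has_derivative (\<lambda>v. K (?m v))) (at x)"
          by (rule has_derivative_compose[OF clin_has_derivative[OF cm] K(2)])
        have 2: "((\<lambda>z. L (?m z)) has_derivative (\<lambda>v. L (?m v))) (at x)"
          by (rule clin_has_derivative[OF clin_comp[OF L(1) cm]])
        have nth: "bounded_linear (\<lambda>x::complex^'d. vec_nth x i)" by (rule bounded_linear_vec_nth)
        have "(f has_derivative (\<lambda>v. vec_nth (K (?m v)) i - vec_nth (L (?m v)) i)) (at x)" unfolding f_def
          by (intro derivative_intros bounded_linear.has_derivative[OF nth] 1 2)
        then show "\<exists>D. (f has_derivative D) (at x) \<and> (\<forall>c v. D (c *s v) = c * D v)"
          using clinD(2)[OF clin_comp[OF K(1) cm]] clinD(2)[OF clin_comp[OF L(1) cm]]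
          by (intro exI[of _ "\<lambda>v. vec_nth (K (?m v)) i - vec_nth (L (?m v)) i"]) (simp add: right_diff_distrib)
      qed
      then obtain w where w: "w \<in> S" "cmod (f z) \<le> cmod (f w)"
        using max_modulus_S cont z unfolding max_modulus_set_def by blast
      have "f w = 0" using gls[OF w(1), of "of_real t"] t by (simp add: f_def)
      then show ?thesis using w(2) by (simp add: f_def)
    qed
    then show ?thesis by (simp add: vec_eq_iff)
  qed
  have gL: "g z = L z" if z: "z \<in> \<Omega>" for z
  proof -
    obtain t where t: "t > 1" "of_real t *s z \<in> \<Omega>" using cscale_enlarge[OF z] by auto
    have "of_real (1/t) *s (of_real t *s z) = z" using t by (simp add: vector_smult_assoc)
    moreover have "of_real t *s z \<in> closure \<Omega>" using t closure_subset by blast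
    ultimately show ?thesis using scaled[of "1/t" "of_real t *s z"] t by simp
  qed
  then have "L ` \<Omega> = \<Omega>" using g(1) by (metis image_cong)
  then show ?thesis using L(1) bij gL by blast
qed

end

section \<open>Existence and uniqueness of the invariant measure\<close>

context cartan_domain begin

lemma linear_automorphism_closure:
  assumes L: "clin L" "bij L" "L ` \<Omega> = \<Omega>" shows "L ` closure \<Omega> = closure \<Omega>"
proof -
  have "L ` closure \<Omega> = closure (L ` \<Omega>)"
    by (rule closure_injective_linear_image[OF clin_linear[OF L(1)] bij_is_inj[OF L(2)]])
  then show ?thesis using L(3) by simp
qed

text \<open>Composition with \<open>L\<close> preserves the functions to be tested, so the image of
  \<open>S\<close> is again a closed maximum modulus set, and \<open>S\<close> is the smallest
  one.\<close>

lemma S_subset_linear_automorphism: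
  assumes L: "clin L" "bij L" "L ` \<Omega> = \<Omega>" shows "S \<subseteq> L ` S"
proof (rule S_minimal)
  show "closed (L ` S)"
    using compact_S clin_continuous[OF L(1)] compact_continuous_image compact_imp_closed by blast
  show "L ` S \<subseteq> closure \<Omega>" using linear_automorphism_closure[OF L] S_subset by blast
  show "max_modulus_set \<Omega> (L ` S)" unfolding max_modulus_set_def
  proof (intro allI impI ballI)
    fix f z assume f: "continuous_on (closure \<Omega>) f \<and> holo_on \<Omega> f" and z: "z \<in> closure \<Omega>"
    have "z \<in> L ` closure \<Omega>" using z linear_automorphism_closure[OF L] by simp
    then obtain w where w: "w \<in> closure \<Omega>" "z = L w" by (elim imageE)
    have c: "continuous_on (closure \<Omega>) (\<lambda>x. f (L x))"
      by (rule continuous_on_compose2[OF conjunct1[OF f] clin_continuous[OF L(1)] eq_refl[OF linear_automorphism_closure[OF L]]])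
    have "holo_on \<Omega> (\<lambda>x. f (L x))" by (rule holo_on_comp_clin[OF conjunct2[OF f] L(1) eq_refl[OF L(3)]])
    from max_modulus_S[unfolded max_modulus_set_def, THEN spec, THEN mp, OF conjI, OF c this, THEN bspec, OF w(1)]
    obtain x where "x \<in> S" "cmod (f (L w)) \<le> cmod (f (L x))" ..
    then show "\<exists>w\<in>L ` S. cmod (f z) \<le> cmod (f w)" using w(2) by blast
  qed
qed

lemma linear_automorphism_S:
  assumes L: "clin L" "bij L" "L ` \<Omega> = \<Omega>" shows "L ` S = S"
proof
  show "S \<subseteq> L ` S" by (rule S_subset_linear_automorphism[OF L])
  have "inv L ` \<Omega> = \<Omega>" using L(2,3) by (metis bij_is_inj image_inv_f_f)
  then have "S \<subseteq> inv L ` S" using L by (intro S_subset_linear_automorphism clin_inv bij_imp_bij_inv)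
  then have "L ` S \<subseteq> L ` (inv L ` S)" by (rule image_mono)
  then show "L ` S \<subseteq> S" using L(2) by (simp add: bij_is_surj image_f_inv_f)
qed

lemma holo_map_clin: "clin L \<Longrightarrow> holo_map_on A L"
  unfolding holo_map_on_def
proof
  fix i assume L: "clin L"
  have "holo_on A (\<lambda>z. vec_nth (L z) i + 0)"
    by (rule holo_on_functional) (simp_all add: clinD[OF L])
  then show "holo_on A (\<lambda>z. vec_nth (L z) i)" by simp
qed

lemma holo_map_on_cong:
  assumes "holo_map_on \<Omega> f" "\<And>z. z \<in> \<Omega> \<Longrightarrow> f z = g z" shows "holo_map_on \<Omega> g"
  unfolding holo_map_on_def holo_on_def
proof (intro allI ballI)
  fix i x assume x: "x \<in> \<Omega>"
  obtain D where D: "((\<lambda>z. vec_nth (f z) i) has_derivative D) (at x)" "\<forall>(c::complex) v. D (c *s v) = c * D v"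
    using assms(1)[unfolded holo_map_on_def holo_on_def, THEN spec[of _ i], THEN bspec, OF x] by (elim exE conjE)
  have "((\<lambda>z. vec_nth (g z) i) has_derivative D) (at x)"
    by (rule has_derivative_transform_within_open[OF D(1) open_Om x]) (simp add: assms(2))
  then show "\<exists>L. ((\<lambda>z. vec_nth (g z) i) has_derivative L) (at x) \<and> (\<forall>(c::complex) v. L (c *s v) = c * L v)"
    using D(2) by blast
qed

lemma clin_aut:
  assumes L: "clin L" "bij L" "L ` \<Omega> = \<Omega>" shows "L \<in> aut \<Omega>"
proof -
  have inj: "inj_on L \<Omega>" using L(2) by (meson bij_is_inj inj_on_subset subset_UNIV)
  have "inv L z = inv_into \<Omega> L z" if "z \<in> \<Omega>" for z
  proof -
    have "z \<in> L ` \<Omega>" using that L(3) by simp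
    then obtain w where w: "w \<in> \<Omega>" "z = L w" by (elim imageE)
    then show ?thesis using inj bij_is_inj[OF L(2)] by simp
  qed
  then have "holo_map_on \<Omega> (inv_into \<Omega> L)"
    by (rule holo_map_on_cong[OF holo_map_clin[OF clin_inv[OF L(1,2)]]])
  then show ?thesis using L(3) inj holo_map_clin[OF L(1)] by (simp add: aut_def)
qed

lemma rot_stabK: assumes "L \<in> rot \<Omega>" shows "L \<in> stabK \<Omega>"
proof -
  note L = rotD[OF assms]
  obtain H where H: "\<And>t. t \<in> {0..1::real} \<Longrightarrow> clin (H t) \<and> (\<forall>z. norm (H t z) = norm z) \<and> H t ` \<Omega> = \<Omega>"
    "continuous_on ({0..1} \<times> UNIV) (\<lambda>(t, z). H t z)" "\<And>z. H 0 z = z" "\<And>z. H 1 z = L z"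
    using assms unfolding rot_def by blast
  have "in_id_comp \<Omega> L" unfolding in_id_comp_def
  proof (intro exI[of _ H] conjI ballI)
    show "continuous_on ({0..1} \<times> \<Omega>) (\<lambda>(t, z). H t z)"
      using H(2) by (rule continuous_on_subset) auto
    fix t :: real assume "t \<in> {0..1}"
    then show "H t \<in> aut \<Omega>" using H(1)[of t] by (intro clin_aut clin_isometry_bij) auto
  qed (simp_all add: H)
  moreover have "L 0 = 0" using clinD(2)[OF L(1), of 0 0] by simp
  ultimately show ?thesis using clin_aut[OF L(1,4,3)] by (simp add: stabK_def)
qed

text \<open>\<open>K_invariant\<close> provides some continuous extension to the closure; density of
  the domain identifies it with the linear map.\<close>

lemma extension_unique:
  assumes "clin L" "continuous_on (closure \<Omega>) gh" "\<And>z. z \<in> \<Omega> \<Longrightarrow> gh z = L z" "z \<in> closure \<Omega>"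
  shows "gh z = L z"
proof -
  have "continuous_on (closure \<Omega>) (\<lambda>z. gh z - L z)"
    by (intro continuous_on_diff assms(2) clin_continuous[OF assms(1)])
  then have "gh z - L z = 0" by (rule continuous_constant_on_closure) (use assms in auto)
  then show ?thesis by simp
qed

definition invariant_measure :: "(complex^'d) measure \<Rightarrow> bool" where
  "invariant_measure \<mu> \<longleftrightarrow> space \<mu> = shilov \<Omega> \<and> sets \<mu> = sets (restrict_space borel (shilov \<Omega>)) \<and>
      prob_space \<mu> \<and> K_invariant \<Omega> \<mu>"

lemma S_borel [measurable]: "S \<in> sets borel" using closed_S by simp

text \<open>By the maximum modulus property a complex linear functional on a small ball inside the
  domain is bounded by its modulus on \<open>S\<close>, and since \<open>S\<close> is circled, a
  bound for real parts on \<open>S\<close> bounds moduli.\<close>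

lemma bounded_polar: "bounded {z. \<forall>s\<in>S. s \<bullet> z \<le> 1}"
proof -
  obtain d where d: "d > 0" "ball 0 d \<subseteq> \<Omega>" using open_Om zero_in open_contains_ball by blast
  have "norm z \<le> 2 / d" if z: "\<And>s. s \<in> S \<Longrightarrow> s \<bullet> z \<le> 1" for z
  proof (cases "z = 0")
    case False
    define w where "w = of_real (d / (2 * norm z)) *s z"
    have "norm w = d / 2" unfolding w_def norm_cscale norm_of_real using False d by simp
    then have "w \<in> \<Omega>" using d by (auto simp: subset_iff)
    then have wc: "w \<in> closure \<Omega>" using closure_subset by blast
    have "holo_on \<Omega> (\<lambda>x. cip x z + 0)" by (rule holo_on_functional) (auto simp: cip_add_left cip_scale_left)
    moreover have "continuous_on (closure \<Omega>) (\<lambda>x. cip x z + 0)" unfolding cip_def by (intro continuous_intros)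
    ultimately obtain s where s: "s \<in> S" "cmod (cip w z + 0) \<le> cmod (cip s z + 0)"
      using max_modulus_S wc unfolding max_modulus_set_def by blast
    obtain u where u: "cmod u = 1" "u * cip s z = of_real (cmod (cip s z))" using cmod_phase by blast
    have "cmod (cip s z) = Re (cip (u *s s) z)" using u by (simp add: cip_scale_left)
    also have "\<dots> \<le> 1" unfolding Re_cip using z[OF circle_S[OF s(1) u(1)]] .
    finally have "cmod (cip w z) \<le> 1" using s(2) by simp
    moreover have "cip w z = of_real (d / 2 * norm z)"
    proof -
      have "cip w z = of_real (d / (2 * norm z) * (norm z)\<^sup>2)"
        unfolding w_def cip_scale_left cip_self by (simp only: of_real_mult)
      also have "d / (2 * norm z) * (norm z)\<^sup>2 = d / 2 * norm z" using False by (simp add: power2_eq_square)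
      finally show ?thesis .
    qed
    ultimately have "d / 2 * norm z \<le> 1" using d by (simp only: norm_of_real)
    then show ?thesis using d by (simp add: field_simps)
  qed (use d in simp)
  then show ?thesis unfolding bounded_iff by blast
qed

text \<open>The maximizer construction yields a measure on the whole space that is invariant under
  linear symmetries of \<open>S\<close>. The stabilizer acts through such maps, so restricting the
  measure to \<open>S\<close> is enough.\<close>

lemma invariant_measure_exists: "\<exists>\<mu>. invariant_measure \<mu>"
proof -
  have sym: "uminus ` S = S"
  proof -
    have "- z \<in> S" if "z \<in> S" for z using circle_S[OF that, of "-1"] by simp
    then show ?thesis by (force simp: image_iff)
  qed
  obtain \<mu>0 where mu0: "prob_space \<mu>0" "sets \<mu>0 = sets borel" "emeasure \<mu>0 S = 1"
    "\<And>L. linear L \<Longrightarrow> bij L \<Longrightarrow> L ` S = S \<Longrightarrow> distr \<mu>0 borel L = \<mu>0"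
    using exists_linear_invariant_measure[OF compact_S S_ne sym bounded_polar] by blast
  have sp0: "space \<mu>0 = UNIV" using sets_eq_imp_space_eq[OF mu0(2)] by simp
  define \<mu> where "\<mu> = restrict_space \<mu>0 S"
  have S0: "S \<in> sets \<mu>0" using mu0(2) S_borel by simp
  have sp: "space \<mu> = S" by (simp add: \<mu>_def space_restrict_space sp0)
  have st: "sets \<mu> = sets (restrict_space borel S)" unfolding \<mu>_def by (rule sets_restrict_space_cong[OF mu0(2)])
  have em: "emeasure \<mu> A = emeasure \<mu>0 A" if "A \<subseteq> S" for A
    unfolding \<mu>_def by (rule emeasure_restrict_space) (use S0 sp0 that in auto)
  have "K_invariant \<Omega> \<mu>" unfolding K_invariant_def
  proof
    fix g assume "g \<in> stabK \<Omega>"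
    then obtain L where L: "clin L" "bij L" "L ` \<Omega> = \<Omega>" "\<And>z. z \<in> \<Omega> \<Longrightarrow> g z = L z" using stabK_linear by blast
    have LS: "L ` S = S" by (rule linear_automorphism_S[OF L(1-3)])
    have Lb[measurable]: "L \<in> borel_measurable borel" using clin_continuous[OF L(1)] by (rule borel_measurable_continuous_onI)
    have d0: "distr \<mu>0 borel L = \<mu>0" by (rule mu0(4)[OF clin_linear[OF L(1)] L(2) LS])
    have meas: "L \<in> \<mu> \<rightarrow>\<^sub>M \<mu>"
    proof -
      have "L \<in> restrict_space borel S \<rightarrow>\<^sub>M restrict_space borel S"
        using LS by (intro measurable_restrict_space2 measurable_restrict_space1 Lb) (auto simp: space_restrict_space)
      then show ?thesis using measurable_cong_sets[OF st st] by simp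
    qed
    have "distr \<mu> \<mu> L = \<mu>"
    proof (rule measure_eqI)
      fix A assume "A \<in> sets (distr \<mu> \<mu> L)"
      then have A: "A \<in> sets \<mu>" by simp
      have AS: "A \<subseteq> S" using sets.sets_into_space[OF A] sp by simp
      have AB: "A \<in> sets borel" using A st S_borel by (auto simp: sets_restrict_space_iff)
      have pre: "L -` A \<subseteq> S"
      proof
        fix x assume "x \<in> L -` A"
        then have "L x \<in> L ` S" using AS LS by auto
        then show "x \<in> S" using bij_is_inj[OF L(2)] by (auto simp: inj_eq)
      qed
      have "emeasure (distr \<mu> \<mu> L) A = emeasure \<mu> (L -` A \<inter> space \<mu>)" by (rule emeasure_distr[OF meas A])
      also have "L -` A \<inter> space \<mu> = L -` A" using pre sp by auto
      also have "emeasure \<mu> (L -` A) = emeasure \<mu>0 (L -` A)" by (rule em[OF pre])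
      also have "\<dots> = emeasure (distr \<mu>0 borel L) A"
      proof -
        have "L \<in> \<mu>0 \<rightarrow>\<^sub>M borel" using measurable_cong_sets[OF mu0(2) refl] Lb by blast
        then show ?thesis using emeasure_distr[of L \<mu>0 borel A] AB by (simp add: sp0)
      qed
      also have "\<dots> = emeasure \<mu>0 A" by (simp only: d0)
      finally show "emeasure (distr \<mu> \<mu> L) A = emeasure \<mu> A" using em[OF AS] by simp
    qed simp
    then show "\<exists>gh. continuous_on (closure \<Omega>) gh \<and> (\<forall>z\<in>\<Omega>. gh z = g z) \<and> gh \<in> \<mu> \<rightarrow>\<^sub>M \<mu> \<and> distr \<mu> \<mu> gh = \<mu>"
      using L(4) meas clin_continuous[OF L(1)] by (intro exI[of _ L]) simp
  qed
  moreover have "prob_space \<mu>" unfolding \<mu>_def by (rule prob_space_restrict_space[OF S0 mu0(3)])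
  ultimately have "invariant_measure \<mu>" unfolding invariant_measure_def shilov_eq using sp st by simp
  then show ?thesis by blast
qed

text \<open>Transport to the whole space puts the measure into the setting of uniformly distributed
  measures: an element of \<open>rot\<close> taking \<open>x\<close> to \<open>y\<close> is an
  isometry preserving it, and so matches the balls around \<open>x\<close> and
  \<open>y\<close>.\<close>

lemma invariant_measure_extend:
  assumes "invariant_measure \<mu>"
  defines "N \<equiv> distr \<mu> borel (\<lambda>x. x)"
  shows "prob_space N" "emeasure N S = 1" "\<And>A. A \<in> sets \<mu> \<Longrightarrow> emeasure N A = emeasure \<mu> A"
    "\<And>e x y. x \<in> S \<Longrightarrow> y \<in> S \<Longrightarrow> emeasure N (ball x e) = emeasure N (ball y e)"
proof -
  have mu: "space \<mu> = S" "sets \<mu> = sets (restrict_space borel S)" "prob_space \<mu>" "K_invariant \<Omega> \<mu>"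
    using assms(1) by (auto simp: invariant_measure_def shilov_eq)
  interpret prob_space \<mu> by (rule mu(3))
  have idm: "(\<lambda>x. x) \<in> \<mu> \<rightarrow>\<^sub>M borel"
    unfolding measurable_cong_sets[OF mu(2) refl] by (rule measurable_restrict_space1) simp
  show "prob_space N" unfolding N_def by (rule prob_space_distr[OF idm])
  have eN: "emeasure N A = emeasure \<mu> (A \<inter> S)" if "A \<in> sets borel" for A
    unfolding N_def using emeasure_distr[OF idm that] mu(1) by simp
  have "emeasure \<mu> S = 1" using emeasure_space_1 mu(1) by simp
  then show "emeasure N S = 1" using eN[OF S_borel] by simp
  show "emeasure N A = emeasure \<mu> A" if A: "A \<in> sets \<mu>" for A
  proof -
    have "A \<in> sets borel" "A \<subseteq> S" using A mu(2) S_borel by (auto simp: sets_restrict_space_iff)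
    then show ?thesis using eN by (simp add: inf_absorb1)
  qed
  fix e x y assume x: "x \<in> S" and y: "y \<in> S"
  obtain L where Lr: "L \<in> rot \<Omega>" and Lxy: "L x = y" using trans[of x y] x y by (auto simp: S_def)
  note L = rotD[OF Lr]
  obtain gh where gh: "continuous_on (closure \<Omega>) gh" "\<And>z. z \<in> \<Omega> \<Longrightarrow> gh z = L z" "gh \<in> \<mu> \<rightarrow>\<^sub>M \<mu>" "distr \<mu> \<mu> gh = \<mu>"
    using mu(4) rot_stabK[OF Lr] unfolding K_invariant_def by blast
  have ghL: "gh z = L z" if "z \<in> S" for z
    using extension_unique[OF L(1) gh(1,2)] that S_subset by blast
  have LS: "L z \<in> S" if "z \<in> S" for z using linear_automorphism_S[OF L(1,4,3)] that by blast
  have bm: "ball y e \<inter> S \<in> sets \<mu>" using mu(2) S_borel by (auto simp: sets_restrict_space_iff)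
  have "emeasure N (ball y e) = emeasure \<mu> (ball y e \<inter> S)" by (rule eN) simp
  also have "\<dots> = emeasure (distr \<mu> \<mu> gh) (ball y e \<inter> S)" by (simp only: gh(4))
  also have "\<dots> = emeasure \<mu> (gh -` (ball y e \<inter> S) \<inter> space \<mu>)" by (rule emeasure_distr[OF gh(3) bm])
  also have "gh -` (ball y e \<inter> S) \<inter> space \<mu> = ball x e \<inter> S"
  proof -
    have "dist y (L z) = dist x z" for z
    proof -
      have "y - L z = L (x - z)" using linear_diff[OF clin_linear[OF L(1)]] Lxy by simp
      then show ?thesis by (simp add: dist_norm L(2))
    qed
    then show ?thesis using ghL LS mu(1) by auto
  qed
  also have "emeasure \<mu> (ball x e \<inter> S) = emeasure N (ball x e)" by (rule eN[symmetric]) simp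
  finally show "emeasure N (ball x e) = emeasure N (ball y e)" by simp
qed

lemma invariant_measure_unique:
  assumes "invariant_measure \<mu>" "invariant_measure \<nu>" shows "\<mu> = \<nu>"
proof (rule measure_eqI)
  note M = invariant_measure_extend[OF assms(1)] and N = invariant_measure_extend[OF assms(2)]
  have eq: "distr \<mu> borel (\<lambda>x. x) = distr \<nu> borel (\<lambda>x. x)"
    by (rule uniformly_distributed_unique[OF M(1) _ N(1) _ M(2) N(2) compact_S M(4) N(4)]) simp_all
  show st: "sets \<mu> = sets \<nu>" using assms by (simp add: invariant_measure_def)
  fix A assume A: "A \<in> sets \<mu>"
  then have "A \<in> sets \<nu>" using st by simp
  then show "emeasure \<mu> A = emeasure \<nu> A" using M(3)[OF A] N(3) eq by simp
qed

lemma dz_invariant: "invariant_measure (dz \<Omega>)"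
proof -
  have "\<exists>!\<mu>. invariant_measure \<mu>" using invariant_measure_exists invariant_measure_unique by blast
  then have "invariant_measure (THE \<mu>. invariant_measure \<mu>)" by (rule theI')
  then show ?thesis by (simp add: dz_def invariant_measure_def)
qed

lemma sphere_space_dz: "sphere_space (dz \<Omega>) S r"
proof -
  have mu: "space (dz \<Omega>) = S" "sets (dz \<Omega>) = sets (restrict_space borel S)" "prob_space (dz \<Omega>)"
    using dz_invariant by (auto simp: invariant_measure_def shilov_eq)
  interpret prob_space "dz \<Omega>" by (rule mu(3))
  show ?thesis
  proof
    show "(\<Sum>i\<in>UNIV. (cmod (vec_nth z i))\<^sup>2) = real r" if "z \<in> S" for z
      using that norm_sq_vec[of z] by (simp add: S_def)
  qed (use mu compact_S r_pos in auto)
qed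

end

section \<open>Contractive matrices\<close>

text \<open>Vectors and matrices are functions on \<open>nat\<close> of which only the entries below
  the given sizes are read; this keeps the sizes out of the types.\<close>

definition nip :: "nat \<Rightarrow> (nat \<Rightarrow> complex) \<Rightarrow> (nat \<Rightarrow> complex) \<Rightarrow> complex" where
  "nip n x y = (\<Sum>i<n. x i * cnj (y i))"

text \<open>The squared norm, so that contractivity is an inequality between plain sums.\<close>

definition vn :: "nat \<Rightarrow> (nat \<Rightarrow> complex) \<Rightarrow> real" where
  "vn n x = (\<Sum>i<n. (cmod (x i))\<^sup>2)"

definition mv :: "nat \<Rightarrow> (nat \<Rightarrow> nat \<Rightarrow> complex) \<Rightarrow> (nat \<Rightarrow> complex) \<Rightarrow> nat \<Rightarrow> complex" where
  "mv m Z v = (\<lambda>i. \<Sum>j<m. Z i j * v j)"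

definition madj :: "(nat \<Rightarrow> nat \<Rightarrow> complex) \<Rightarrow> nat \<Rightarrow> nat \<Rightarrow> complex" where
  "madj Z = (\<lambda>i j. cnj (Z j i))"

definition contr :: "nat \<Rightarrow> nat \<Rightarrow> (nat \<Rightarrow> nat \<Rightarrow> complex) \<Rightarrow> bool" where
  "contr n m Z \<longleftrightarrow> (\<forall>v. vn n (mv m Z v) \<le> vn m v)"

definition uvec :: "nat \<Rightarrow> nat \<Rightarrow> complex" where "uvec i = (\<lambda>k. if k = i then 1 else 0)"

lemma vn_nonneg [simp]: "0 \<le> vn n x" by (simp add: vn_def sum_nonneg)

lemma vn_eq_0: "vn n x = 0 \<longleftrightarrow> (\<forall>i<n. x i = 0)"
  by (simp add: vn_def sum_nonneg_eq_0_iff Ball_def)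

lemma vn_pos: "0 < vn n x \<longleftrightarrow> (\<exists>i<n. x i \<noteq> 0)"
  using vn_eq_0[of n x] vn_nonneg[of n x] by (auto simp: less_le)

lemma vn_cong: "(\<And>i. i < n \<Longrightarrow> x i = y i) \<Longrightarrow> vn n x = vn n y" by (simp add: vn_def)

lemma nip_cong: "(\<And>i. i < n \<Longrightarrow> x i = x' i) \<Longrightarrow> (\<And>i. i < n \<Longrightarrow> y i = y' i) \<Longrightarrow> nip n x y = nip n x' y'"
  by (simp add: nip_def)

lemma mv_cong: "(\<And>j. j < m \<Longrightarrow> Z i j = Z' i j) \<Longrightarrow> (\<And>j. j < m \<Longrightarrow> v j = v' j) \<Longrightarrow> mv m Z v i = mv m Z' v' i"
  by (simp add: mv_def)

lemma nip_self: "nip n x x = of_real (vn n x)"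
  unfolding nip_def vn_def of_real_sum by (intro sum.cong refl) (simp only: complex_norm_square)

lemma cnj_nip: "cnj (nip n x y) = nip n y x" by (simp add: nip_def mult.commute)

lemma nip_add_left: "nip n (\<lambda>i. x i + y i) z = nip n x z + nip n y z"
  by (simp add: nip_def sum.distrib distrib_right)

lemma nip_add_right: "nip n z (\<lambda>i. x i + y i) = nip n z x + nip n z y"
  by (simp add: nip_def sum.distrib distrib_left)

lemma nip_diff_left: "nip n (\<lambda>i. x i - y i) z = nip n x z - nip n y z"
  by (simp add: nip_def sum_subtractf left_diff_distrib)

lemma nip_diff_right: "nip n z (\<lambda>i. x i - y i) = nip n z x - nip n z y"
  by (simp add: nip_def sum_subtractf right_diff_distrib)

lemma nip_scale_left: "nip n (\<lambda>i. c * x i) y = c * nip n x y"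
  by (simp add: nip_def sum_distrib_left mult.assoc)

lemma nip_scale_right: "nip n x (\<lambda>i. c * y i) = cnj c * nip n x y"
  by (simp add: nip_def sum_distrib_left mult.left_commute)

lemma nip_ev_right: "i < n \<Longrightarrow> nip n x (uvec i) = x i"
  by (simp add: nip_def uvec_def if_distrib[of cnj] if_distrib[of "\<lambda>y. _ * y"] cong: if_cong)

lemma nip_ev_left: "i < n \<Longrightarrow> nip n (uvec i) x = cnj (x i)"
  by (simp add: nip_def uvec_def if_distrib[of "\<lambda>y. y * _"] cong: if_cong)

lemma vn_ev: "i < n \<Longrightarrow> vn n (uvec i) = 1"
  using nip_self[of n "uvec i"] nip_ev_right[of i n "uvec i"] by (simp add: uvec_def[of i])

lemma mv_ev: "j < m \<Longrightarrow> mv m Z (uvec j) i = Z i j"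
  by (simp add: mv_def uvec_def if_distrib[of "\<lambda>y. _ * y"] cong: if_cong)

lemma vn_scale: "vn n (\<lambda>i. c * x i) = (cmod c)\<^sup>2 * vn n x"
  by (simp add: vn_def norm_mult power_mult_distrib sum_distrib_left)

lemma mv_scale: "mv m Z (\<lambda>j. c * v j) i = c * mv m Z v i"
  by (simp add: mv_def sum_distrib_left mult.left_commute)

lemma vn_add: "vn n (\<lambda>i. x i + y i) = vn n x + 2 * Re (nip n x y) + vn n y"
proof -
  have "complex_of_real (vn n (\<lambda>i. x i + y i)) = nip n x x + nip n x y + cnj (nip n x y) + nip n y y"
    by (simp add: nip_self[symmetric] nip_add_left nip_add_right cnj_nip)
  then have "Re (complex_of_real (vn n (\<lambda>i. x i + y i))) = Re (nip n x x + nip n x y + cnj (nip n x y) + nip n y y)"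
    by (rule arg_cong)
  then show ?thesis by (simp add: nip_self)
qed

lemma vn_diff: "vn n (\<lambda>i. x i - y i) = vn n x - 2 * Re (nip n x y) + vn n y"
  using vn_add[of n x "\<lambda>i. -1 * y i"] vn_scale[of n "-1" y] nip_scale_right[of n x "-1" y] by simp

lemma nip_Cauchy_Schwarz: "cmod (nip n x y) \<le> sqrt (vn n x) * sqrt (vn n y)"
proof -
  have "cmod (nip n x y) \<le> (\<Sum>i<n. \<bar>cmod (x i)\<bar> * \<bar>cmod (y i)\<bar>)"
    unfolding nip_def by (rule order_trans[OF norm_sum]) (simp add: norm_mult)
  also have "\<dots> \<le> L2_set (\<lambda>i. cmod (x i)) {..<n} * L2_set (\<lambda>i. cmod (y i)) {..<n}"
    by (rule L2_set_mult_ineq)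
  finally show ?thesis by (simp add: L2_set_def vn_def)
qed

lemma nip_Cauchy_Schwarz_sq: "(cmod (nip n x y))\<^sup>2 \<le> vn n x * vn n y"
  using power_mono[OF nip_Cauchy_Schwarz norm_ge_zero, of n x y 2] by (simp add: power_mult_distrib)

lemma nip_mv: "nip n (mv m Z v) w = nip m v (mv n (madj Z) w)"
proof -
  have "nip n (mv m Z v) w = (\<Sum>i<n. \<Sum>j<m. Z i j * v j * cnj (w i))"
    by (simp add: nip_def mv_def sum_distrib_right)
  also have "\<dots> = (\<Sum>j<m. \<Sum>i<n. Z i j * v j * cnj (w i))" by (rule sum.swap)
  finally show ?thesis by (simp add: nip_def mv_def madj_def sum_distrib_left mult_ac)
qed

lemma madj_madj [simp]: "madj (madj Z) = Z" by (simp add: madj_def)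

text \<open>\<open>|Z\<^sup>* w|\<^sup>2\<close> is the inner product of
  \<open>Z Z\<^sup>* w\<close> with \<open>w\<close>; after Cauchy-Schwarz and contractivity of
  \<open>Z\<close> a factor \<open>|Z\<^sup>* w|\<^sup>2\<close> cancels.\<close>

lemma contr_madj: assumes Z: "contr n m Z" shows "contr m n (madj Z)"
  unfolding contr_def
proof
  fix w
  let ?a = "vn m (mv n (madj Z) w)"
  have "nip n (mv m Z (mv n (madj Z) w)) w = of_real ?a" unfolding nip_mv nip_self ..
  then have "?a\<^sup>2 = (cmod (nip n (mv m Z (mv n (madj Z) w)) w))\<^sup>2" by simp
  also have "\<dots> \<le> vn n (mv m Z (mv n (madj Z) w)) * vn n w" by (rule nip_Cauchy_Schwarz_sq)
  also have "\<dots> \<le> ?a * vn n w" using Z by (intro mult_right_mono) (auto simp: contr_def)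
  finally have "?a * ?a \<le> ?a * vn n w" by (simp add: power2_eq_square)
  then show "?a \<le> vn n w"
    using vn_nonneg[of m "mv n (madj Z) w"] vn_nonneg[of n w] by (cases "?a = 0") (simp_all add: less_le)
qed

section \<open>Defect operators and rank one perturbations\<close>

text \<open>The operator \<open>I - Z Z\<^sup>*\<close>; with \<open>madj Z\<close> and exchanged
  sizes it becomes \<open>I - Z\<^sup>* Z\<close>.\<close>

definition defect :: "nat \<Rightarrow> nat \<Rightarrow> (nat \<Rightarrow> nat \<Rightarrow> complex) \<Rightarrow> (nat \<Rightarrow> complex) \<Rightarrow> nat \<Rightarrow> complex" where
  "defect n m Z x = (\<lambda>i. x i - mv m Z (mv n (madj Z) x) i)"

lemma nip_defect: "nip n (defect n m Z x) y = nip n x (defect n m Z y)"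
  unfolding defect_def by (simp add: nip_diff_left nip_diff_right nip_mv[of n m Z])
    (simp add: nip_mv[of m n "madj Z", simplified])

lemma vn_defect: assumes "contr n m Z" shows "vn n (defect n m Z x) \<le> vn n x - vn m (mv n (madj Z) x)"
proof -
  let ?w = "mv n (madj Z) x"
  have "nip n x (mv m Z ?w) = cnj (nip n (mv m Z ?w) x)" by (rule cnj_nip[symmetric])
  also have "\<dots> = of_real (vn m ?w)" unfolding nip_mv nip_self by simp
  finally have "vn n (defect n m Z x) = vn n x - 2 * vn m ?w + vn n (mv m Z ?w)"
    unfolding defect_def vn_diff by simp
  moreover have "vn n (mv m Z ?w) \<le> vn m ?w" using assms by (simp add: contr_def)
  ultimately show ?thesis by simp
qed

text \<open>Intertwining of the two defects: \<open>Z\<^sup>* - Z\<^sup>* Z Z\<^sup>*\<close>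
  factors through either of them.\<close>

lemma nip_mv_defect: "nip n (mv m Z v) (defect n m Z x) = nip m (defect m n (madj Z) v) (mv n (madj Z) x)"
proof -
  have "nip n (mv m Z v) (mv m Z (mv n (madj Z) x)) = nip m (mv n (madj Z) (mv m Z v)) (mv n (madj Z) x)"
    using nip_mv[of m n "madj Z" "mv m Z v" "mv n (madj Z) x"] by simp
  then show ?thesis
    unfolding defect_def by (simp add: nip_diff_left nip_diff_right nip_mv[of n m Z v x])
qed

text \<open>With \<open>A = I - Z Z\<^sup>*\<close> and \<open>B = I - Z\<^sup>* Z\<close>, perturbations in the directions \<open>A x (B y)\<^sup>*\<close> keep a contraction contractive.\<close>
lemma contr_rank_one_perturbation:
  assumes Z: "contr n m Z"
  shows "\<exists>\<epsilon>>0. \<forall>l. cmod l \<le> \<epsilon> \<longrightarrow>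
    contr n m (\<lambda>i j. Z i j + l * (defect n m Z x i * cnj (defect m n (madj Z) y j)))"
proof -
  define K where "K = sqrt (vn n x) * sqrt (vn m y)"
  have K: "K \<ge> 0" by (simp add: K_def)
  \<comment> \<open>With \<open>\<epsilon> * K \<le> 1/3\<close> the perturbation costs at most
    \<open>2/3 + 1/9 < 1\<close> times \<open>b\<close>, and \<open>b\<close> is at most the slack
    \<open>|v|\<^sup>2 - |Z v|\<^sup>2\<close>.\<close>
  define \<epsilon> where "\<epsilon> = 1 / (3 * (K + 1))"
  have eps: "\<epsilon> > 0" "\<epsilon> * K \<le> 1/3" using K by (auto simp: \<epsilon>_def field_simps)
  have "contr n m (\<lambda>i j. Z i j + l * (defect n m Z x i * cnj (defect m n (madj Z) y j)))" if l: "cmod l \<le> \<epsilon>" for l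
    unfolding contr_def
  proof
    fix v
    let ?p = "defect n m Z x" and ?q = "defect m n (madj Z) y"
    define b where "b = vn m (defect m n (madj Z) v)"
    have b0: "0 \<le> b" by (simp add: b_def)
    have b: "b \<le> vn m v - vn n (mv m Z v)"
      using vn_defect[OF contr_madj[OF Z], of v] by (simp add: b_def)
    \<comment> \<open>Because the directions are in the range of the defects, a defect can be moved
      onto \<open>v\<close>. Every inner product is then controlled by \<open>sqrt b\<close>, so it
      is small wherever the slack is small.\<close>
    have vq: "cmod (nip m v ?q) \<le> sqrt b * sqrt (vn m y)"
      unfolding nip_defect[symmetric] b_def by (rule nip_Cauchy_Schwarz)
    have "cmod (nip n (mv m Z v) ?p) \<le> sqrt b * sqrt (vn m (mv n (madj Z) x))"
      unfolding nip_mv_defect b_def by (rule nip_Cauchy_Schwarz)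
    also have "\<dots> \<le> sqrt b * sqrt (vn n x)"
      using contr_madj[OF Z] b0 by (intro mult_left_mono) (auto simp: contr_def)
    finally have vp: "cmod (nip n (mv m Z v) ?p) \<le> sqrt b * sqrt (vn n x)" .
    have pp: "vn n ?p \<le> vn n x" using vn_defect[OF Z, of x] vn_nonneg[of m "mv n (madj Z) x"] by linarith
    define c where "c = l * nip m v ?q"
    have c: "cmod c \<le> \<epsilon> * (sqrt b * sqrt (vn m y))"
      unfolding c_def norm_mult using l vq eps by (intro mult_mono) auto
    have "mv m (\<lambda>i j. Z i j + l * (?p i * cnj (?q j))) v = (\<lambda>i. mv m Z v i + c * ?p i)"
    proof
      fix i
      have "mv m (\<lambda>i j. Z i j + l * (?p i * cnj (?q j))) v i = (\<Sum>j<m. Z i j * v j + l * ?p i * (v j * cnj (?q j)))"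
        unfolding mv_def by (intro sum.cong refl) (simp add: algebra_simps)
      also have "\<dots> = mv m Z v i + c * ?p i"
        unfolding sum.distrib sum_distrib_left[symmetric] mv_def c_def nip_def by (simp add: mult_ac)
      finally show "mv m (\<lambda>i j. Z i j + l * (?p i * cnj (?q j))) v i = mv m Z v i + c * ?p i" .
    qed
    then have "vn n (mv m (\<lambda>i j. Z i j + l * (?p i * cnj (?q j))) v)
       = vn n (mv m Z v) + 2 * Re (cnj c * nip n (mv m Z v) ?p) + (cmod c)\<^sup>2 * vn n ?p"
      by (simp add: vn_add nip_scale_right vn_scale)
    also have "\<dots> \<le> vn n (mv m Z v) + 2 * (\<epsilon> * K * b) + (\<epsilon> * K)\<^sup>2 * b"
    proof -
      have "Re (cnj c * nip n (mv m Z v) ?p) \<le> cmod c * cmod (nip n (mv m Z v) ?p)"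
        using complex_Re_le_cmod[of "cnj c * nip n (mv m Z v) ?p"] by (simp add: norm_mult)
      also have "\<dots> \<le> (\<epsilon> * (sqrt b * sqrt (vn m y))) * (sqrt b * sqrt (vn n x))"
        using c vp eps b0 by (intro mult_mono) auto
      also have "\<dots> = \<epsilon> * K * b" using b0 by (simp add: K_def mult_ac flip: real_sqrt_mult) (simp add: real_sqrt_mult mult_ac)
      finally have 1: "Re (cnj c * nip n (mv m Z v) ?p) \<le> \<epsilon> * K * b" .
      have "(cmod c)\<^sup>2 * vn n ?p \<le> (\<epsilon> * (sqrt b * sqrt (vn m y)))\<^sup>2 * vn n x"
        using c pp by (intro mult_mono power_mono) auto
      also have "\<dots> = (\<epsilon> * K)\<^sup>2 * b" using b0 by (simp add: K_def power_mult_distrib mult_ac)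
      finally show ?thesis using 1 by simp
    qed
    also have "\<dots> \<le> vn n (mv m Z v) + b"
    proof -
      have "(\<epsilon> * K)\<^sup>2 \<le> (1/3)\<^sup>2" using eps K by (intro power_mono) auto
      then have "(2 * (\<epsilon> * K) + (\<epsilon> * K)\<^sup>2) * b \<le> 1 * b"
        using eps b0 by (intro mult_right_mono) (auto simp: power2_eq_square)
      then show ?thesis by (simp add: algebra_simps)
    qed
    also have "\<dots> \<le> vn m v" using b by simp
    finally show "vn n (mv m (\<lambda>i j. Z i j + l * (?p i * cnj (?q j))) v) \<le> vn m v" .
  qed
  then show ?thesis using eps by blast
qed

lemma contr_cong: "(\<And>i j. i < n \<Longrightarrow> j < m \<Longrightarrow> Z i j = Z' i j) \<Longrightarrow> contr n m Z \<longleftrightarrow> contr n m Z'"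
  by (simp add: contr_def vn_def mv_def)

lemma mat_contr_iff: "mat_contr n m Z \<longleftrightarrow> (\<forall>v. (\<exists>j<m. v j \<noteq> 0) \<longrightarrow> vn n (mv m Z v) < vn m v)"
  by (simp add: mat_contr_def vn_def mv_def)

lemma mat_contr_cong: "(\<And>i j. i < n \<Longrightarrow> j < m \<Longrightarrow> Z i j = Z' i j) \<Longrightarrow> mat_contr n m Z \<longleftrightarrow> mat_contr n m Z'"
  by (simp add: mat_contr_def)

lemma mat_contr_imp_contr: assumes "mat_contr n m Z" shows "contr n m Z"
  unfolding contr_def
proof
  fix v
  show "vn n (mv m Z v) \<le> vn m v"
  proof (cases "\<exists>j<m. v j \<noteq> 0")
    case True
    then show ?thesis using assms by (simp add: mat_contr_iff less_imp_le)
  next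
    case False
    then have "mv m Z v = (\<lambda>i. 0)" by (simp add: mv_def fun_eq_iff)
    then show ?thesis by (simp add: vn_def sum_nonneg)
  qed
qed

lemma contr_shrink: assumes "contr n m Z" "cmod c < 1" shows "mat_contr n m (\<lambda>i j. c * Z i j)"
  unfolding mat_contr_iff
proof (intro allI impI)
  fix v assume v: "\<exists>j<m. v j \<noteq> (0::complex)"
  have "mv m (\<lambda>i j. c * Z i j) v = (\<lambda>i. c * mv m Z v i)"
    by (simp add: mv_def sum_distrib_left mult.assoc fun_eq_iff)
  then have "vn n (mv m (\<lambda>i j. c * Z i j) v) = (cmod c)\<^sup>2 * vn n (mv m Z v)" by (simp add: vn_scale)
  also have "\<dots> \<le> (cmod c)\<^sup>2 * vn m v" using assms(1) by (intro mult_left_mono) (auto simp: contr_def)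
  also have "\<dots> < 1 * vn m v"
    using v assms(2) vn_pos[of m v] by (intro mult_strict_right_mono) (auto simp: power_less_one_iff abs_square_less_1)
  finally show "vn n (mv m (\<lambda>i j. c * Z i j) v) < vn m v" by simp
qed

lemma contr_average:
  assumes "contr n m Z" "contr n m W" shows "contr n m (\<lambda>i j. (Z i j + W i j) / 2)"
  unfolding contr_def
proof
  fix v
  let ?x = "mv m Z v" and ?y = "mv m W v"
  have "mv m (\<lambda>i j. (Z i j + W i j) / 2) v = (\<lambda>i. (1/2) * (?x i + ?y i))"
    by (simp add: mv_def fun_eq_iff sum.distrib sum_divide_distrib add_divide_distrib distrib_right)
  then have "vn n (mv m (\<lambda>i j. (Z i j + W i j) / 2) v) = vn n (\<lambda>i. ?x i + ?y i) / 4"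
    by (simp only: vn_scale) (simp add: power2_eq_square)
  also have "\<dots> \<le> (2 * vn n ?x + 2 * vn n ?y) / 4"
    using vn_add[of n ?x ?y] vn_diff[of n ?x ?y] vn_nonneg[of n "\<lambda>i. ?x i - ?y i"] by simp
  also have "\<dots> \<le> vn m v"
  proof -
    have "vn n ?x \<le> vn m v" "vn n ?y \<le> vn m v" using assms by (auto simp: contr_def)
    then have "(2 * vn n ?x + 2 * vn n ?y) / 4 \<le> (2 * vn m v + 2 * vn m v) / 4"
      by (intro divide_right_mono add_mono mult_left_mono) auto
    then show ?thesis by simp
  qed
  finally show "vn n (mv m (\<lambda>i j. (Z i j + W i j) / 2) v) \<le> vn m v" .
qed

definition fro :: "nat \<Rightarrow> nat \<Rightarrow> (nat \<Rightarrow> nat \<Rightarrow> complex) \<Rightarrow> real" where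
  "fro n m Z = (\<Sum>i<n. vn m (Z i))"

lemma vn_mv_fro: "vn n (mv m Z v) \<le> fro n m Z * vn m v"
proof -
  have "vn n (mv m Z v) \<le> (\<Sum>i<n. vn m (Z i) * vn m v)" unfolding vn_def[of n]
  proof (rule sum_mono)
    fix i
    have "mv m Z v i = nip m (Z i) (\<lambda>j. cnj (v j))" by (simp add: mv_def nip_def)
    then have "(cmod (mv m Z v i))\<^sup>2 \<le> vn m (Z i) * vn m (\<lambda>j. cnj (v j))" using nip_Cauchy_Schwarz_sq by simp
    then show "(cmod (mv m Z v i))\<^sup>2 \<le> vn m (Z i) * vn m v" by (simp add: vn_def)
  qed
  then show ?thesis by (simp add: fro_def sum_distrib_right)
qed

lemma row_madj: "i < n \<Longrightarrow> mv n (madj Z) (uvec i) j = cnj (Z i j)"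
  by (simp add: mv_ev madj_def)

lemma contr_row: assumes "contr n m Z" "i < n" shows "vn m (Z i) \<le> 1"
proof -
  have "vn m (mv n (madj Z) (uvec i)) \<le> vn n (uvec i)" using contr_madj[OF assms(1)] by (simp add: contr_def)
  moreover have "vn m (mv n (madj Z) (uvec i)) = vn m (Z i)" using assms(2) by (simp add: vn_def row_madj)
  ultimately show ?thesis using assms(2) by (simp add: vn_ev)
qed

lemma defect_ev: "i < n \<Longrightarrow> defect n m Z (uvec i) k = (if k = i then 1 else 0) - nip m (Z k) (Z i)"
  by (simp add: defect_def row_madj mv_def[of m] nip_def) (simp add: uvec_def)

text \<open>A unit row leaves no room in \<open>vn_defect\<close>, so the defect of
  \<open>uvec i\<close> vanishes; its entries are the claimed relations.\<close>

lemma contr_unit_row_orthogonal: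
  assumes Z: "contr n m Z" and i: "i < n" "vn m (Z i) = 1" and k: "k < n"
  shows "nip m (Z k) (Z i) = (if k = i then 1 else 0)"
proof -
  have "vn m (mv n (madj Z) (uvec i)) = vn m (Z i)" using i by (simp add: vn_def row_madj)
  then have "vn n (defect n m Z (uvec i)) \<le> 0" using vn_defect[OF Z, of "uvec i"] i by (simp add: vn_ev)
  then have "vn n (defect n m Z (uvec i)) = 0" using vn_nonneg by (intro antisym) auto
  then have "defect n m Z (uvec i) k = 0" using k by (simp add: vn_eq_0)
  then show ?thesis using i by (simp add: defect_ev)
qed

lemma fro_columns: "fro n m Z = (\<Sum>j<m. vn n (mv m Z (uvec j)))"
  unfolding fro_def vn_def by (subst sum.swap) (simp add: mv_ev)

section \<open>Complex reflections\<close>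

text \<open>For a unit vector \<open>u\<close> and \<open>|w| = 1\<close> this is the unitary map
  \<open>I + (w - 1) u u\<^sup>*\<close>. Moving \<open>w\<close> along the circle to 1 joins it to
  the identity.\<close>

definition reflect :: "nat \<Rightarrow> (nat \<Rightarrow> complex) \<Rightarrow> complex \<Rightarrow> (nat \<Rightarrow> complex) \<Rightarrow> nat \<Rightarrow> complex" where
  "reflect n u w x = (\<lambda>i. x i + (w - 1) * nip n x u * u i)"

lemma nip_refl:
  assumes "vn n u = 1" "cmod w = 1"
  shows "nip n (reflect n u w x) (reflect n u w y) = nip n x y"
proof -
  have uu: "nip n u u = 1" using assms by (simp add: nip_self)
  have ww: "w * cnj w = 1" using assms by (simp add: complex_norm_square[symmetric])
  define a where "a = nip n x u"
  define b where "b = nip n u y"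
  have b': "nip n y u = cnj b" unfolding b_def by (rule cnj_nip[symmetric])
  have "nip n (reflect n u w x) (reflect n u w y) = nip n x y + (w - 1) * a * b + cnj (w - 1) * b * a + (w - 1) * cnj (w - 1) * a * b"
    unfolding reflect_def nip_add_left nip_add_right nip_scale_left nip_scale_right b' a_def[symmetric] b_def[symmetric]
    by (simp add: uu algebra_simps)
  also have "\<dots> = nip n x y + (w * cnj w - 1) * a * b" by (simp add: algebra_simps)
  finally show ?thesis by (simp add: ww)
qed

lemma vn_refl: assumes "vn n u = 1" "cmod w = 1" shows "vn n (reflect n u w x) = vn n x"
  using nip_refl[OF assms, of x x] by (simp add: nip_self)

lemma refl_inverse:
  assumes "vn n u = 1" "w * w' = 1" shows "reflect n u w (reflect n u w' x) = x"
proof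
  fix i
  have uu: "nip n u u = 1" using assms by (simp add: nip_self)
  define a where "a = nip n x u"
  have "nip n (reflect n u w' x) u = a + (w' - 1) * a"
    by (simp add: reflect_def nip_add_left nip_scale_left uu a_def)
  then have "nip n (reflect n u w' x) u = w' * a" by (simp add: algebra_simps)
  then have "reflect n u w (reflect n u w' x) i = x i + (w' - 1) * a * u i + (w - 1) * (w' * a) * u i"
    by (simp add: reflect_def[of n u w] ) (simp add: reflect_def a_def)
  also have "\<dots> = x i + (w * w' - 1) * a * u i" by (simp add: algebra_simps)
  finally show "reflect n u w (reflect n u w' x) i = x i" by (simp add: assms)
qed

text \<open>Reflect in the direction \<open>x - y\<close>. Since \<open>nip n x y\<close> need not
  be real, the factor \<open>-1\<close> of a real reflection is replaced by a phase. The last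
  conjunct keeps coordinates that already agree out of the reflection, which protects parts already
  in normal form.\<close>

lemma refl_transitive:
  assumes x: "vn n x = 1" and y: "vn n y = 1" and ne: "\<exists>i<n. x i \<noteq> y i"
  shows "\<exists>u w. vn n u = 1 \<and> cmod w = 1 \<and> (\<forall>i<n. reflect n u w x i = y i) \<and> (\<forall>i. x i = y i \<longrightarrow> u i = 0)"
proof -
  define d where "d = (\<lambda>i. x i - y i)"
  define D where "D = vn n d"
  have D: "D > 0" unfolding D_def d_def vn_pos using ne by auto
  define a where "a = nip n x y"
  have Da: "D = 2 - 2 * Re a" unfolding D_def d_def vn_diff by (simp add: x y a_def)
  have a1: "1 - a \<noteq> 0" using D Da by (auto simp: complex_eq_iff)
  have xd: "nip n x d = 1 - a" unfolding d_def nip_diff_right by (simp add: nip_self x a_def)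
  define u where "u = (\<lambda>i. of_real (1 / sqrt D) * d i)"
  \<comment> \<open>Solves \<open>(w - 1) * nip n x u * u = y - x\<close>. That \<open>w\<close> has
    modulus 1 follows from \<open>D = (1 - a) + (1 - cnj a)\<close>.\<close>
  define w where "w = 1 - of_real D / (1 - a)"
  have u1: "vn n u = 1" unfolding u_def vn_scale D_def[symmetric] using D by (simp add: power_divide norm_divide)
  have "of_real D = (1 - a) + (1 - cnj a)" unfolding Da by (simp add: complex_eq_iff)
  then have "w = - ((1 - cnj a) / (1 - a))" unfolding w_def using a1 by (simp only: add_divide_distrib) simp
  then have "cmod w = cmod (cnj (1 - a)) / cmod (1 - a)" by (simp add: norm_divide)
  then have w1: "cmod w = 1" unfolding complex_mod_cnj using a1 by simp
  have "reflect n u w x i = y i" for i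
  proof -
    have "nip n x u = of_real (1 / sqrt D) * (1 - a)" unfolding u_def nip_scale_right xd by simp
    then have "(w - 1) * nip n x u * u i = - (of_real D / (1 - a)) * (of_real (1 / sqrt D) * (1 - a)) * (of_real (1 / sqrt D) * d i)"
      by (simp only: w_def u_def) simp
    also have "\<dots> = - (of_real D * of_real (1 / sqrt D) * of_real (1 / sqrt D)) * d i" using a1 by simp
    also have "of_real D * of_real (1 / sqrt D) * of_real (1 / sqrt D) = complex_of_real (D * (1 / sqrt D) * (1 / sqrt D))"
      by (simp only: of_real_mult)
    also have "D * (1 / sqrt D) * (1 / sqrt D) = 1" using D by simp
    finally show ?thesis by (simp add: reflect_def d_def)
  qed
  moreover have "u i = 0" if "x i = y i" for i using that by (simp add: u_def d_def)
  ultimately show ?thesis using u1 w1 by blast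
qed

definition rgt :: "nat \<Rightarrow> (nat \<Rightarrow> complex) \<Rightarrow> complex \<Rightarrow> (nat \<Rightarrow> nat \<Rightarrow> complex) \<Rightarrow> nat \<Rightarrow> nat \<Rightarrow> complex" where
  "rgt m u w Z = (\<lambda>i. reflect m u w (Z i))"

definition lft :: "nat \<Rightarrow> (nat \<Rightarrow> complex) \<Rightarrow> complex \<Rightarrow> (nat \<Rightarrow> nat \<Rightarrow> complex) \<Rightarrow> nat \<Rightarrow> nat \<Rightarrow> complex" where
  "lft n u w Z = (\<lambda>i j. reflect n u w (\<lambda>k. Z k j) i)"

text \<open>Reflecting the rows is multiplication on the right by the transposed reflection, which
  is the one with conjugated \<open>u\<close>.\<close>

lemma mv_rgt: "mv m (rgt m u w Z) v = mv m Z (reflect m (\<lambda>i. cnj (u i)) w v)"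
proof
  fix i
  have "mv m (rgt m u w Z) v i = (\<Sum>j<m. Z i j * v j + (w - 1) * nip m (Z i) u * (v j * u j))"
    unfolding mv_def rgt_def reflect_def by (intro sum.cong refl) (simp add: algebra_simps)
  also have "\<dots> = mv m Z v i + (w - 1) * nip m (Z i) u * nip m v (\<lambda>i. cnj (u i))"
    by (simp add: sum.distrib mv_def nip_def[of m v] flip: sum_distrib_left)
  also have "\<dots> = (\<Sum>j<m. Z i j * v j + (w - 1) * nip m v (\<lambda>i. cnj (u i)) * (Z i j * cnj (u j)))"
    unfolding sum.distrib sum_distrib_left[symmetric] mv_def nip_def[of m "Z i"] by (simp add: mult_ac)
  also have "\<dots> = mv m Z (reflect m (\<lambda>i. cnj (u i)) w v) i"
    unfolding mv_def reflect_def by (intro sum.cong refl) (simp add: algebra_simps)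
  finally show "mv m (rgt m u w Z) v i = mv m Z (reflect m (\<lambda>i. cnj (u i)) w v) i" .
qed

lemma mv_lft: "mv m (lft n u w Z) v = reflect n u w (mv m Z v)"
proof
  fix i
  have "mv m (lft n u w Z) v i = mv m Z v i + (\<Sum>j<m. (w - 1) * nip n (\<lambda>k. Z k j) u * u i * v j)"
    by (simp add: mv_def lft_def reflect_def sum.distrib distrib_right)
  also have "(\<Sum>j<m. (w - 1) * nip n (\<lambda>k. Z k j) u * u i * v j) = (w - 1) * (\<Sum>j<m. \<Sum>k<n. Z k j * cnj (u k) * v j) * u i"
    by (simp add: nip_def sum_distrib_left sum_distrib_right mult_ac)
  also have "(\<Sum>j<m. \<Sum>k<n. Z k j * cnj (u k) * v j) = nip n (mv m Z v) u"
    by (subst sum.swap) (simp add: nip_def mv_def sum_distrib_left sum_distrib_right mult_ac)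
  finally show "mv m (lft n u w Z) v i = reflect n u w (mv m Z v) i" by (simp add: reflect_def)
qed

lemma fro_rgt: "vn m u = 1 \<Longrightarrow> cmod w = 1 \<Longrightarrow> fro n m (rgt m u w Z) = fro n m Z"
  by (simp add: fro_def rgt_def vn_refl)

lemma fro_lft: "vn n u = 1 \<Longrightarrow> cmod w = 1 \<Longrightarrow> fro n m (lft n u w Z) = fro n m Z"
  by (simp add: fro_columns mv_lft vn_refl)

lemma vn_cnj: "vn n (\<lambda>i. cnj (u i)) = vn n u" by (simp add: vn_def)

lemma mat_contr_rgt:
  assumes "vn m u = 1" "cmod w = 1" shows "mat_contr n m (rgt m u w Z) \<longleftrightarrow> mat_contr n m Z"
proof -
  let ?u = "\<lambda>i. cnj (u i)"
  have u: "vn m ?u = 1" using assms by (simp add: vn_cnj)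
  have ww: "w * cnj w = 1" using assms by (simp add: complex_norm_square[symmetric])
  have eq: "vn m (reflect m ?u w v) = vn m v" for v by (rule vn_refl[OF u assms(2)])
  show ?thesis unfolding mat_contr_iff vn_pos[symmetric] mv_rgt
  proof (intro iffI allI impI)
    fix v assume *: "\<forall>v. 0 < vn m v \<longrightarrow> vn n (mv m Z (reflect m ?u w v)) < vn m v" and v: "0 < vn m v"
    have r: "reflect m ?u w (reflect m ?u (cnj w) v) = v" by (rule refl_inverse[OF u ww])
    then have "vn m (reflect m ?u (cnj w) v) = vn m v" using eq[of "reflect m ?u (cnj w) v"] by simp
    then show "vn n (mv m Z v) < vn m v" using *[rule_format, of "reflect m ?u (cnj w) v"] v r by simp
  next
    fix v assume *: "\<forall>v. 0 < vn m v \<longrightarrow> vn n (mv m Z v) < vn m v" and v: "0 < vn m v"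
    then show "vn n (mv m Z (reflect m ?u w v)) < vn m v" using *[rule_format, of "reflect m ?u w v"] eq[of v] by simp
  qed
qed

lemma mat_contr_lft:
  assumes "vn n u = 1" "cmod w = 1" shows "mat_contr n m (lft n u w Z) \<longleftrightarrow> mat_contr n m Z"
  by (simp add: mat_contr_iff mv_lft vn_refl[OF assms])

text \<open>An alternating matrix of odd size is singular; the induction eliminates two indices at a time.\<close>
lemma odd_alternating_singular:
  fixes Z :: "nat \<Rightarrow> nat \<Rightarrow> complex"
  assumes "finite I" "odd (card I)" "\<And>i j. i \<in> I \<Longrightarrow> j \<in> I \<Longrightarrow> Z i j = - Z j i"
  shows "\<exists>x. (\<exists>i\<in>I. x i \<noteq> 0) \<and> (\<forall>i\<in>I. (\<Sum>j\<in>I. Z i j * x j) = 0)"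
  using assms
proof (induction "card I" arbitrary: I Z rule: less_induct)
  case less
  show ?case
  proof (cases "\<forall>i\<in>I. \<forall>j\<in>I. Z i j = 0")
    case True
    have "I \<noteq> {}" using less.prems by auto
    then show ?thesis using True by (intro exI[of _ "\<lambda>_. 1"]) auto
  next
    case False
    then obtain a b where ab: "a \<in> I" "b \<in> I" "Z a b \<noteq> 0" by blast
    have diag: "Z i i = 0" if "i \<in> I" for i
    proof -
      have "Z i i = - Z i i" by (rule less.prems(3)[OF that that])
      then show ?thesis by simp
    qed
    have ne: "a \<noteq> b" using ab diag by auto
    define d where "d = Z a b"
    have d: "d \<noteq> 0" "Z b a = - d" using ab less.prems(3)[of b a] by (auto simp: d_def)
    define J where "J = I - {a, b}"
    have I: "I = insert a (insert b J)" "a \<notin> J" "b \<notin> J" "finite J" using ab less.prems(1) by (auto simp: J_def)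
    have card: "card I = Suc (Suc (card J))" using I ne by simp
    \<comment> \<open>The Schur complement of the invertible alternating block on \<open>a\<close>
      and \<open>b\<close>; it is alternating again.\<close>
    define Y where "Y i j = Z i j + Z i a * Z b j / d - Z i b * Z a j / d" for i j
    have Yalt: "Y i j = - Y j i" if "i \<in> J" "j \<in> J" for i j
    proof -
      have "Z i j = - Z j i" "Z i a = - Z a i" "Z b j = - Z j b" "Z i b = - Z b i" "Z a j = - Z j a"
        using that ab I by (intro less.prems(3); auto)+
      then show ?thesis by (simp add: Y_def mult_ac)
    qed
    have "card J < card I" "odd (card J)" using card less.prems(2) by simp_all
    then have "\<exists>x. (\<exists>i\<in>J. x i \<noteq> 0) \<and> (\<forall>i\<in>J. (\<Sum>j\<in>J. Y i j * x j) = 0)"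
      by (rule less.hyps[of J Y, OF _ I(4)]) (rule Yalt)
    then obtain x where x: "\<exists>i\<in>J. x i \<noteq> 0" "\<And>i. i \<in> J \<Longrightarrow> (\<Sum>j\<in>J. Y i j * x j) = 0"
      by (elim exE conjE) simp
    define xa where "xa = (\<Sum>j\<in>J. Z b j * x j) / d"
    define xb where "xb = - (\<Sum>j\<in>J. Z a j * x j) / d"
    define x' where "x' = x(a := xa, b := xb)"
    have sum: "(\<Sum>j\<in>I. Z i j * x' j) = Z i a * xa + Z i b * xb + (\<Sum>j\<in>J. Z i j * x j)" for i
    proof -
      have "(\<Sum>j\<in>J. Z i j * x' j) = (\<Sum>j\<in>J. Z i j * x j)"
        using I by (intro sum.cong) (auto simp: x'_def)
      then show ?thesis using I ne by (simp add: x'_def)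
    qed
    have "(\<Sum>j\<in>I. Z i j * x' j) = 0" if "i \<in> I" for i
    proof -
      consider "i = a" | "i = b" | "i \<in> J" using \<open>i \<in> I\<close> I(1) by blast
      then show ?thesis
      proof cases
        case 1
        then show ?thesis using d diag[OF ab(1)] by (simp add: sum xb_def d_def)
      next
        case 2
        then show ?thesis using d diag[OF ab(2)] by (simp add: sum xa_def)
      next
        case 3
        have "(\<Sum>j\<in>J. Y i j * x j) = (\<Sum>j\<in>J. Z i j * x j + Z i a * (Z b j * x j / d) - Z i b * (Z a j * x j / d))"
          by (intro sum.cong refl) (simp add: Y_def algebra_simps)
        also have "\<dots> = (\<Sum>j\<in>J. Z i j * x j) + Z i a * xa + Z i b * xb"
          by (simp add: sum.distrib sum_subtractf xa_def xb_def sum_distrib_left sum_divide_distrib)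
        finally show ?thesis using x(2)[OF 3] by (simp add: sum add_ac)
      qed
    qed
    moreover have "\<exists>i\<in>I. x' i \<noteq> 0" using x(1) I by (auto simp: x'_def)
    ultimately show ?thesis by blast
  qed
qed

section \<open>Domains of contractive matrices\<close>

text \<open>Compactness of the unit sphere improves strictness for each vector to a uniform factor
  \<open>\<rho> < 1\<close>, and a perturbation of small Frobenius norm cannot use up the
  gap.\<close>

lemma mat_contr_open:
  assumes Z: "mat_contr n m Z"
  shows "\<exists>\<eta>>0. \<forall>D. fro n m D < \<eta> \<longrightarrow> mat_contr n m (\<lambda>i j. Z i j + D i j)"
proof (cases "m = 0")
  case True
  then show ?thesis by (intro exI[of _ 1]) (simp add: mat_contr_def)
next
  case False
  \<comment> \<open>Entries from \<open>m\<close> on are set to 0: the inequality does not see them,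
    and the sphere in the function space would not be compact otherwise.\<close>
  define K where "K = {v :: nat \<Rightarrow> complex. (\<forall>j\<ge>m. v j = 0) \<and> vn m v = 1}"
  have c: "continuous_on UNIV (\<lambda>v :: nat \<Rightarrow> complex. v j)" for j by (rule continuous_on_product_coordinates)
  have "closed ((\<Inter>j\<in>{m..}. {v :: nat \<Rightarrow> complex. v j = 0}) \<inter> {v. vn m v = 1})"
    unfolding vn_def by (intro closed_Int closed_INT ballI closed_Collect_eq continuous_intros c)
  also have "(\<Inter>j\<in>{m..}. {v :: nat \<Rightarrow> complex. v j = 0}) \<inter> {v. vn m v = 1} = K" by (auto simp: K_def)
  finally have closed: "closed K" .
  have "K \<subseteq> Pi UNIV (\<lambda>j. cball 0 1)"
  proof (intro subsetI Pi_I)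
    fix v j assume v: "v \<in> K"
    show "v j \<in> cball 0 1"
    proof (cases "j < m")
      case True
      then have "(cmod (v j))\<^sup>2 \<le> vn m v" unfolding vn_def by (intro member_le_sum) auto
      then show ?thesis using v by (simp add: K_def abs_square_le_1)
    next
      case False
      then show ?thesis using v by (simp add: K_def)
    qed
  qed
  then have "compact K" using compact_function_cballs[of "\<lambda>_. 1"] closed by (metis compact_Int_closed inf.absorb_iff2)
  moreover have "uvec 0 \<in> K" using False vn_ev[of 0 m] by (simp add: K_def uvec_def)
  moreover have "continuous_on K (\<lambda>v. vn n (mv m Z v))"
    unfolding vn_def mv_def by (intro continuous_intros continuous_on_subset[OF c]) auto
  ultimately obtain v0 where v0: "v0 \<in> K" "\<And>v. v \<in> K \<Longrightarrow> vn n (mv m Z v) \<le> vn n (mv m Z v0)"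
    using continuous_attains_sup[of K "\<lambda>v. vn n (mv m Z v)"] by blast
  define \<rho> where "\<rho> = vn n (mv m Z v0)"
  have "0 < vn m v0" using v0(1) by (simp add: K_def)
  then have rho: "\<rho> < 1" "0 \<le> \<rho>"
    using Z[unfolded mat_contr_iff vn_pos[symmetric], THEN spec, THEN mp, OF \<open>0 < vn m v0\<close>] v0(1)
    by (auto simp: \<rho>_def K_def)
  have le: "vn n (mv m Z v) \<le> \<rho> * vn m v" for v
  proof (cases "vn m v = 0")
    case True
    then show ?thesis using mat_contr_imp_contr[OF Z, unfolded contr_def, THEN spec, of v] by simp
  next
    case False
    define a where "a = vn m v"
    have a: "a > 0" using False vn_nonneg[of m v] unfolding a_def by linarith
    define v' where "v' j = (if j < m then of_real (1 / sqrt a) * v j else 0)" for j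
    have "vn m v' = vn m (\<lambda>j. of_real (1 / sqrt a) * v j)" by (rule vn_cong) (simp add: v'_def)
    also have "\<dots> = 1" unfolding vn_scale a_def[symmetric] norm_of_real using a by (simp add: power_divide)
    finally have "v' \<in> K" by (simp add: K_def v'_def)
    then have "vn n (mv m Z v') \<le> \<rho>" unfolding \<rho>_def by (rule v0(2))
    moreover have "vn n (mv m Z v') = vn n (mv m Z v) / a"
    proof -
      have "mv m Z v' i = of_real (1 / sqrt a) * mv m Z v i" for i
        unfolding mv_scale[symmetric] by (rule mv_cong) (simp_all add: v'_def)
      then have "vn n (mv m Z v') = vn n (\<lambda>i. of_real (1 / sqrt a) * mv m Z v i)" by (intro vn_cong) simp
      then show ?thesis unfolding vn_scale norm_of_real using a by (simp add: power_divide)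
    qed
    ultimately show ?thesis using a by (simp add: a_def pos_divide_le_eq mult.commute)
  qed
  \<comment> \<open>Half of the gap \<open>1 - \<rho>\<close>. In \<open>|x + y|\<^sup>2 \<le> (1 +
    s) |x|\<^sup>2 + (1 + 1/s) |y|\<^sup>2\<close> the first term uses at most \<open>1 - s\<close>,
    and \<open>\<eta>\<close> is chosen so that the second stays below \<open>s\<close>.\<close>
  define s where "s = (1 - \<rho>) / 2"
  have s: "s > 0" "(1 + s) * \<rho> \<le> 1 - s"
  proof -
    show "s > 0" using rho by (simp add: s_def)
    have "s * \<rho> \<le> s * 1" using rho \<open>s > 0\<close> by (intro mult_left_mono) auto
    moreover have "\<rho> = 1 - 2 * s" by (simp add: s_def field_simps)
    ultimately show "(1 + s) * \<rho> \<le> 1 - s" by (simp add: distrib_right)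
  qed
  define \<eta> where "\<eta> = s / (1 + 1 / s)"
  have pos: "1 + 1 / s > 0" using s by (simp add: add_pos_pos)
  have "\<eta> > 0" using s pos by (simp add: \<eta>_def)
  moreover have "mat_contr n m (\<lambda>i j. Z i j + D i j)" if D: "fro n m D < \<eta>" for D
    unfolding mat_contr_iff vn_pos[symmetric]
  proof (intro allI impI)
    fix v assume v: "0 < vn m v"
    let ?x = "mv m Z v" and ?y = "mv m D v"
    have "mv m (\<lambda>i j. Z i j + D i j) v = (\<lambda>i. ?x i + ?y i)"
      by (simp add: mv_def fun_eq_iff sum.distrib distrib_right)
    then have "vn n (mv m (\<lambda>i j. Z i j + D i j) v) = vn n ?x + 2 * Re (nip n ?x ?y) + vn n ?y"
      by (simp add: vn_add)
    also have "\<dots> \<le> (1 + s) * vn n ?x + (1 + 1/s) * vn n ?y"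
    proof -
      have "0 \<le> vn n (\<lambda>i. of_real (sqrt s) * ?x i - of_real (1 / sqrt s) * ?y i)" by simp
      also have "\<dots> = s * vn n ?x - 2 * Re (nip n ?x ?y) + vn n ?y / s"
        unfolding vn_diff vn_scale nip_scale_left nip_scale_right norm_of_real complex_cnj_complex_of_real
        using s(1) by (simp add: power_divide flip: mult.assoc of_real_mult)
      finally show ?thesis by (simp add: distrib_right)
    qed
    also have "\<dots> \<le> (1 + s) * (\<rho> * vn m v) + (1 + 1/s) * (fro n m D * vn m v)"
      using s pos by (intro add_mono mult_left_mono le vn_mv_fro) auto
    also have "\<dots> < (1 - s) * vn m v + s * vn m v"
    proof (rule add_le_less_mono)
      show "(1 + s) * (\<rho> * vn m v) \<le> (1 - s) * vn m v"
        unfolding mult.assoc[symmetric] using s(2) by (intro mult_right_mono) auto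
      have "(1 + 1/s) * fro n m D < s" using D pos by (simp add: \<eta>_def pos_less_divide_eq mult.commute)
      then show "(1 + 1/s) * (fro n m D * vn m v) < s * vn m v"
        unfolding mult.assoc[symmetric] using v by (intro mult_strict_right_mono)
    qed
    also have "\<dots> = vn m v" by (simp add: algebra_simps)
    finally show "vn n (mv m (\<lambda>i j. Z i j + D i j) v) < vn m v" .
  qed
  ultimately show ?thesis by blast
qed

text \<open>\<open>E\<close> embeds the coordinates as the matrices satisfying \<open>Cl\<close>, scaling squared norms by \<open>\<kappa>\<close>; coordinate \<open>k\<close> is read off
  the entry at \<open>(a k, b k)\<close> with the factor \<open>c k\<close>.\<close>
locale matrix_domain =
  fixes n m :: nat and E :: "complex^'d::finite \<Rightarrow> nat \<Rightarrow> nat \<Rightarrow> complex" and \<kappa> :: real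
    and Cl :: "(nat \<Rightarrow> nat \<Rightarrow> complex) \<Rightarrow> bool"
    and a b :: "'d \<Rightarrow> nat" and c :: "'d \<Rightarrow> complex" and \<Omega> :: "(complex^'d) set"
  assumes E_add: "\<And>z w i j. E (z + w) i j = E z i j + E w i j"
    and E_scale: "\<And>k z i j. E (k *s z) i j = k * E z i j"
    and E_fro: "\<And>z. fro n m (E z) = \<kappa> * (norm z)\<^sup>2" and kappa: "\<kappa> > 0"
    and E_Cl: "\<And>z. Cl (E z)"
    and ab: "\<And>k. a k < n" "\<And>k. b k < m"
    and E_inv: "\<And>z k. c k * E z (a k) (b k) = vec_nth z k"
    and E_surj: "\<And>Z i j. Cl Z \<Longrightarrow> i < n \<Longrightarrow> j < m \<Longrightarrow> E (\<chi> k. c k * Z (a k) (b k)) i j = Z i j"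
    and Om: "\<Omega> = {z. mat_contr n m (E z)}"
begin

definition "Einv Z = (\<chi> k. c k * Z (a k) (b k))"

lemma Einv_E: "Einv (E z) = z" by (simp add: Einv_def E_inv vec_eq_iff)

lemma E_Einv: "Cl Z \<Longrightarrow> i < n \<Longrightarrow> j < m \<Longrightarrow> E (Einv Z) i j = Z i j"
  by (simp add: Einv_def E_surj)

lemma Einv_cong: "(\<And>i j. i < n \<Longrightarrow> j < m \<Longrightarrow> Z i j = Z' i j) \<Longrightarrow> Einv Z = Einv Z'"
  by (simp add: Einv_def ab)

lemma continuous_E: "continuous_on UNIV (\<lambda>z. E z i j)"
proof (rule linear_continuous_on, rule linear_conv_bounded_linear[THEN iffD1])
  show "linear (\<lambda>z. E z i j)"
    by (rule linearI) (simp_all add: E_add scaleR_eq_cscale E_scale scaleR_conv_of_real)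
qed

lemma open_domain: "open \<Omega>"
  unfolding open_dist
proof
  fix z assume "z \<in> \<Omega>"
  then obtain \<eta> where eta: "\<eta> > 0" "\<And>D. fro n m D < \<eta> \<Longrightarrow> mat_contr n m (\<lambda>i j. E z i j + D i j)"
    using mat_contr_open[of n m "E z"] by (auto simp: Om)
  have "w \<in> \<Omega>" if w: "dist w z < sqrt (\<eta> / \<kappa>)" for w
  proof -
    have "(norm (w - z))\<^sup>2 < (sqrt (\<eta> / \<kappa>))\<^sup>2" using w by (intro power_strict_mono) (auto simp: dist_norm)
    then have "fro n m (E (w - z)) < \<eta>" using kappa eta by (simp add: E_fro pos_less_divide_eq mult.commute)
    from eta(2)[OF this] have "mat_contr n m (E (z + (w - z)))" by (simp add: E_add[symmetric, abs_def] E_add)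
    then show ?thesis by (simp add: Om)
  qed
  then show "\<exists>e>0. \<forall>y. dist y z < e \<longrightarrow> y \<in> \<Omega>" using eta kappa by (intro exI[of _ "sqrt (\<eta> / \<kappa>)"]) auto
qed

lemma zero_in_domain: "0 \<in> \<Omega>"
proof -
  have "E 0 i j = 0" for i j using E_scale[of 0 0 i j] by simp
  then show ?thesis by (simp add: Om mat_contr_iff mv_def vn_def[of n]) (simp add: vn_pos)
qed

lemma closure_contr: assumes "z \<in> closure \<Omega>" shows "contr n m (E z)"
proof -
  have "closed {z. contr n m (E z)}"
  proof -
    have "{z. contr n m (E z)} = (\<Inter>v. {z. vn n (mv m (E z) v) \<le> vn m v})" by (auto simp: contr_def)
    also have "closed \<dots>" unfolding vn_def[of n] mv_def
      by (intro closed_INT ballI closed_Collect_le continuous_intros continuous_E)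
    finally show ?thesis .
  qed
  moreover have "\<Omega> \<subseteq> {z. contr n m (E z)}" by (auto simp: Om mat_contr_imp_contr)
  ultimately have "closure \<Omega> \<subseteq> {z. contr n m (E z)}" by (rule closure_minimal[rotated])
  then show ?thesis using assms by auto
qed

lemma shrink_domain: assumes "contr n m (E z)" "cmod k < 1" shows "k *s z \<in> \<Omega>"
  using contr_shrink[OF assms] by (simp add: Om E_scale[abs_def])

lemma contr_closure: assumes "contr n m (E z)" shows "z \<in> closure \<Omega>"
proof -
  have "(\<lambda>k. (1 - inverse (real (Suc k))) *\<^sub>R z) \<longlonglongrightarrow> (1 - 0) *\<^sub>R z"
    by (intro tendsto_intros LIMSEQ_inverse_real_of_nat)
  moreover have "(1 - inverse (real (Suc k))) *\<^sub>R z \<in> \<Omega>" for k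
  proof -
    have "0 \<le> 1 - inverse (real (Suc k))" "1 - inverse (real (Suc k)) < 1" by (auto simp: field_simps)
    then have "cmod (of_real (1 - inverse (real (Suc k)))) < 1" unfolding norm_of_real by simp
    then show ?thesis unfolding scaleR_eq_cscale by (rule shrink_domain[OF assms])
  qed
  ultimately show ?thesis unfolding closure_sequential
    by (intro exI[of _ "\<lambda>k. (1 - inverse (real (Suc k))) *\<^sub>R z"]) simp
qed

lemma disc_domain:
  assumes V: "Cl V" "i < n" "j < m" "V i j \<noteq> 0"
    and eps: "\<epsilon> > 0" "\<And>l. cmod l \<le> \<epsilon> \<Longrightarrow> contr n m (\<lambda>i j. E z i j + l * V i j)"
  shows "\<exists>v. v \<noteq> 0 \<and> (\<forall>l. cmod l \<le> 1 \<longrightarrow> z + l *s v \<in> closure \<Omega>)"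
proof (intro exI conjI allI impI)
  let ?v = "of_real \<epsilon> *s Einv V"
  have "E ?v i j = of_real \<epsilon> * V i j" using V by (simp add: E_scale E_Einv)
  then have "E ?v i j \<noteq> 0" using V eps by simp
  moreover have "E 0 i j = 0" using E_scale[of 0 0 i j] by simp
  ultimately show "?v \<noteq> 0" by metis
  fix l :: complex assume l: "cmod l \<le> 1"
  have "cmod (l * of_real \<epsilon>) \<le> \<epsilon>" using l eps(1) by (simp add: norm_mult mult_left_le_one_le)
  from eps(2)[OF this] have "contr n m (E (z + l *s ?v))"
    by (rule contr_cong[THEN iffD1, rotated]) (simp add: E_add E_scale E_Einv V)
  then show "z + l *s ?v \<in> closure \<Omega>" by (rule contr_closure)
qed

text \<open>The path \<open>T t\<close> on matrices is conjugated by \<open>E\<close> to a path on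
  coordinates. Preservation of \<open>Cl\<close> makes this possible, invariance of the Frobenius
  norm makes it isometric, and invariance of strict contractivity keeps it inside the symmetries of
  the domain.\<close>

lemma rot_matrix:
  assumes Cl: "\<And>t Z. t \<in> {0..1} \<Longrightarrow> Cl Z \<Longrightarrow> Cl (T t Z)"
    and cong: "\<And>t Z Z' i j. t \<in> {0..1} \<Longrightarrow> (\<And>i j. i < n \<Longrightarrow> j < m \<Longrightarrow> Z i j = Z' i j) \<Longrightarrow> i < n \<Longrightarrow> j < m \<Longrightarrow> T t Z i j = T t Z' i j"
    and add: "\<And>t Z W i j. t \<in> {0..1} \<Longrightarrow> T t (\<lambda>i j. Z i j + W i j) i j = T t Z i j + T t W i j"
    and scale: "\<And>t k Z i j. t \<in> {0..1} \<Longrightarrow> T t (\<lambda>i j. k * Z i j) i j = k * T t Z i j"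
    and fro: "\<And>t Z. t \<in> {0..1} \<Longrightarrow> fro n m (T t Z) = fro n m Z"
    and mc: "\<And>t Z. t \<in> {0..1} \<Longrightarrow> mat_contr n m (T t Z) \<longleftrightarrow> mat_contr n m Z"
    and cont: "\<And>i j. continuous_on ({0..1} \<times> UNIV) (\<lambda>p. T (fst p) (E (snd p)) i j)"
    and T0: "\<And>Z i j. T 0 Z i j = Z i j"
  shows "\<exists>L\<in>rot \<Omega>. \<forall>z i j. i < n \<longrightarrow> j < m \<longrightarrow> E (L z) i j = T (1::real) (E z) i j"
proof -
  define H where "H t z = Einv (T t (E z))" for t z
  have EH: "E (H t z) i j = T t (E z) i j" if "t \<in> {0..1}" "i < n" "j < m" for t z i j
    unfolding H_def using that by (intro E_Einv Cl E_Cl)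
  have "H 1 \<in> rot \<Omega>"
  proof (rule rotI[where H=H])
    fix t :: real assume t: "t \<in> {0..1}"
    show cl: "clin (H t)" unfolding clin_def
    proof (intro conjI allI)
      fix x y show "H t (x + y) = H t x + H t y"
        unfolding H_def E_add[abs_def] using add[OF t] by (simp add: Einv_def vec_eq_iff distrib_left E_add[abs_def])
    next
      fix k x show "H t (k *s x) = k *s H t x"
        unfolding H_def using scale[OF t] by (simp add: Einv_def vec_eq_iff E_scale[abs_def] mult.left_commute)
    qed
    show nm: "norm (H t z) = norm z" for z
    proof -
      have "fro n m (E (H t z)) = fro n m (T t (E z))" unfolding fro_def vn_def using EH[OF t] by (intro sum.cong refl) simp
      then have "\<kappa> * (norm (H t z))\<^sup>2 = \<kappa> * (norm z)\<^sup>2" by (simp only: fro[OF t] E_fro)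
      then show ?thesis using kappa by (simp add: power2_eq_iff_nonneg)
    qed
    have iff: "H t z \<in> \<Omega> \<longleftrightarrow> z \<in> \<Omega>" for z
    proof -
      have "mat_contr n m (E (H t z)) \<longleftrightarrow> mat_contr n m (T t (E z))" by (rule mat_contr_cong) (rule EH[OF t])
      then show ?thesis using mc[OF t] by (simp add: Om)
    qed
    have "bij (H t)" using cl nm by (rule clin_isometry_bij)
    then show "H t ` \<Omega> = \<Omega>" using iff by (auto simp: image_iff) (metis bij_pointE)
  next
    have "continuous_on ({0..1} \<times> UNIV) (\<lambda>p. H (fst p) (snd p))" unfolding H_def Einv_def
      by (intro continuous_on_vec_lambda continuous_intros cont)
    then show "continuous_on ({0..1} \<times> UNIV) (\<lambda>(t, z). H t z)" by (simp add: case_prod_beta)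
    show "H 0 z = z" for z
    proof -
      have "T 0 (E z) = E z" by (intro ext) (rule T0)
      then show ?thesis by (simp add: H_def Einv_E)
    qed
  qed simp
  then show ?thesis using EH[of 1] by (intro bexI[of _ "H 1"]) auto
qed

lemma rot_closure: assumes "L \<in> rot \<Omega>" "z \<in> closure \<Omega>" shows "L z \<in> closure \<Omega>"
proof -
  note L = rotD[OF assms(1)]
  have "L ` closure \<Omega> \<subseteq> closure \<Omega>"
    by (rule image_closure_subset[OF clin_continuous[OF L(1)] closed_closure]) (use L(3) closure_subset in auto)
  then show ?thesis using assms(2) by blast
qed

text \<open>It is enough to bring every point to one fixed \<open>z0\<close>, since
  \<open>rot\<close> is closed under composition and inverses.\<close>

lemma trans_domain:
  assumes std: "\<And>z. z \<in> closure \<Omega> \<Longrightarrow> (norm z)\<^sup>2 = r \<Longrightarrow> \<exists>L\<in>rot \<Omega>. L z = z0"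
    and x: "x \<in> closure \<Omega>" "(norm x)\<^sup>2 = r" and y: "y \<in> closure \<Omega>" "(norm y)\<^sup>2 = r"
  shows "\<exists>L\<in>rot \<Omega>. L x = y"
proof -
  from std[OF x] obtain L where L: "L \<in> rot \<Omega>" "L x = z0" by (elim bexE)
  from std[OF y] obtain M where M: "M \<in> rot \<Omega>" "M y = z0" by (elim bexE)
  note LM = L M
  have "inv M (L x) = y" using LM rotD(4)[OF LM(3)] by (metis bij_inv_eq_iff)
  then show ?thesis using rot_comp[OF rot_inv[OF LM(3)] LM(1)] by (intro bexI[of _ "\<lambda>z. inv M (L z)"])
qed

lemma cartan_domainI:
  fixes r :: nat
  assumes "0 < r" and "\<And>z. contr n m (E z) \<Longrightarrow> (norm z)\<^sup>2 \<le> r"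
    and "\<And>z. contr n m (E z) \<Longrightarrow> (norm z)\<^sup>2 < r \<Longrightarrow> \<exists>V i j \<epsilon>. Cl V \<and> i < n \<and> j < m \<and> V i j \<noteq> 0 \<and> \<epsilon> > 0 \<and>
       (\<forall>l. cmod l \<le> \<epsilon> \<longrightarrow> contr n m (\<lambda>i j. E z i j + l * V i j))"
    and "\<And>z. contr n m (E z) \<Longrightarrow> (norm z)\<^sup>2 = r \<Longrightarrow> \<exists>L\<in>rot \<Omega>. L z = z0"
  shows "cartan_domain \<Omega> r"
proof
  fix z assume z: "z \<in> closure \<Omega>"
  show "(norm z)\<^sup>2 \<le> r" using assms(2)[OF closure_contr[OF z]] .
  show "k *s z \<in> \<Omega>" if "cmod k < 1" for k by (rule shrink_domain[OF closure_contr[OF z] that])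
  show "\<exists>v. v \<noteq> 0 \<and> (\<forall>l. cmod l \<le> 1 \<longrightarrow> z + l *s v \<in> closure \<Omega>)" if lt: "(norm z)\<^sup>2 < r"
  proof -
    from assms(3)[OF closure_contr[OF z] lt]
    obtain V i j \<epsilon> where V: "Cl V \<and> i < n \<and> j < m \<and> V i j \<noteq> 0 \<and> \<epsilon> > 0 \<and>
       (\<forall>l. cmod l \<le> \<epsilon> \<longrightarrow> contr n m (\<lambda>i j. E z i j + l * V i j))" by (elim exE)
    show ?thesis by (rule disc_domain[of V i j \<epsilon>]) (use V in simp_all)
  qed
next
  fix x y assume xy: "x \<in> closure \<Omega>" "y \<in> closure \<Omega>" "(norm x)\<^sup>2 = real r" "(norm y)\<^sup>2 = real r"
  show "\<exists>L\<in>rot \<Omega>. L x = y"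
    by (rule trans_domain[of "real r" z0]) (use xy assms(4) closure_contr in auto)
qed (use open_domain zero_in_domain assms(1) in auto)

end

section \<open>Reflections acting on matrix domains and reduction to normal form\<close>

lemma unimodular_cis: assumes "cmod w = 1" shows "\<exists>\<alpha>. w = cis \<alpha>"
  using rcis_cmod_Arg[of w] assms by (auto simp: rcis_def intro: exI[of _ "Arg w"])

lemma rgt_add: "rgt m u w (\<lambda>i j. Z i j + W i j) i j = rgt m u w Z i j + rgt m u w W i j"
  by (simp add: rgt_def reflect_def nip_add_left algebra_simps)

lemma rgt_scale: "rgt m u w (\<lambda>i j. k * Z i j) i j = k * rgt m u w Z i j"
  by (simp add: rgt_def reflect_def nip_scale_left algebra_simps)

lemma lft_add: "lft n u w (\<lambda>i j. Z i j + W i j) i j = lft n u w Z i j + lft n u w W i j"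
  by (simp add: lft_def reflect_def nip_add_left algebra_simps)

lemma lft_scale: "lft n u w (\<lambda>i j. k * Z i j) i j = k * lft n u w Z i j"
  by (simp add: lft_def reflect_def nip_scale_left algebra_simps)

lemma rgt_cong: "(\<And>i j. i < n \<Longrightarrow> j < m \<Longrightarrow> Z i j = Z' i j) \<Longrightarrow> i < n \<Longrightarrow> j < m \<Longrightarrow> rgt m u w Z i j = rgt m u w Z' i j"
  by (simp add: rgt_def reflect_def nip_def)

lemma lft_cong: "(\<And>i j. i < n \<Longrightarrow> j < m \<Longrightarrow> Z i j = Z' i j) \<Longrightarrow> i < n \<Longrightarrow> j < m \<Longrightarrow> lft n u w Z i j = lft n u w Z' i j"
  by (simp add: lft_def reflect_def nip_def)

lemma rgt_1: "rgt m u 1 Z = Z" by (simp add: rgt_def reflect_def)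

lemma lft_1: "lft n u 1 Z = Z" by (simp add: lft_def reflect_def)

lemma congruence_expand:
  "lft n u w (rgt n u w Z) i j = Z i j + (w - 1) * nip n (Z i) u * u j + (w - 1) * nip n (\<lambda>k. Z k j) u * u i
     + (w - 1)\<^sup>2 * nip n (\<lambda>k. nip n (Z k) u) u * u i * u j"
proof -
  have "nip n (\<lambda>k. Z k j + (w - 1) * nip n (Z k) u * u j) u
      = nip n (\<lambda>k. Z k j) u + (w - 1) * u j * nip n (\<lambda>k. nip n (Z k) u) u"
    unfolding nip_add_left using nip_scale_left[of n "(w - 1) * u j" "\<lambda>k. nip n (Z k) u" u] by (simp add: mult_ac)
  then show ?thesis unfolding lft_def rgt_def reflect_def by (simp only:) (simp add: algebra_simps power2_eq_square)
qed

text \<open>The same reflection on both sides is a congruence \<open>R Z R\<^sup>T\<close>. It keeps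
  symmetric matrices (\<open>s = 1\<close>) and alternating matrices (\<open>s = -1\<close>) in
  their class.\<close>

lemma congruence_transpose:
  assumes "\<And>i j. i < n \<Longrightarrow> j < n \<Longrightarrow> Z i j = s * Z j i" "i < n" "j < n"
  shows "lft n u w (rgt n u w Z) i j = s * lft n u w (rgt n u w Z) j i"
proof -
  have 1: "nip n (\<lambda>k. Z k p) u = s * nip n (Z p) u" if "p < n" for p
    unfolding nip_scale_left[symmetric] by (rule nip_cong) (rule assms(1)[OF _ that], assumption, rule refl)
  have 2: "nip n (Z p) u = s * nip n (\<lambda>k. Z k p) u" if "p < n" for p
    unfolding nip_scale_left[symmetric] by (rule nip_cong) (rule assms(1)[OF that], assumption, rule refl)
  define a where "a = nip n (\<lambda>k. nip n (Z k) u) u"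
  have "a = (\<Sum>k<n. \<Sum>l<n. Z k l * cnj (u l) * cnj (u k))"
    by (simp add: a_def nip_def sum_distrib_right)
  also have "\<dots> = (\<Sum>k<n. \<Sum>l<n. s * (Z l k * cnj (u k) * cnj (u l)))"
  proof (intro sum.cong refl)
    fix k l assume "k \<in> {..<n}" "l \<in> {..<n}"
    then have "Z k l = s * Z l k" by (intro assms(1)) auto
    then show "Z k l * cnj (u l) * cnj (u k) = s * (Z l k * cnj (u k) * cnj (u l))" by (simp only: mult_ac)
  qed
  also have "\<dots> = s * (\<Sum>l<n. \<Sum>k<n. Z l k * cnj (u k) * cnj (u l))"
    by (subst sum.swap) (simp add: sum_distrib_left)
  also have "\<dots> = s * a" by (simp add: a_def nip_def sum_distrib_right)
  finally have 3: "a = s * a" .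
  have "lft n u w (rgt n u w Z) i j = s * Z j i + (w - 1) * (s * nip n (\<lambda>k. Z k i) u) * u j
      + (w - 1) * (s * nip n (Z j) u) * u i + (w - 1)\<^sup>2 * (s * a) * u i * u j"
    unfolding congruence_expand a_def[symmetric]
    by (simp only: assms(1)[OF assms(2,3)] 2[OF assms(2)] 1[OF assms(3)] 3[symmetric])
  also have "\<dots> = s * lft n u w (rgt n u w Z) j i"
    unfolding congruence_expand a_def[symmetric] by (simp add: algebra_simps)
  finally show ?thesis .
qed

context matrix_domain begin

lemma continuous_E_snd: "continuous_on A (\<lambda>p. E (snd p) i j)"
  by (rule continuous_on_compose2[OF continuous_E]) (auto intro!: continuous_intros)

lemma rot_rgt:
  assumes Cl: "\<And>w Z. cmod w = 1 \<Longrightarrow> Cl Z \<Longrightarrow> Cl (rgt m u w Z)" and u: "vn m u = 1" and w: "cmod w = 1"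
  shows "\<exists>L\<in>rot \<Omega>. \<forall>z i j. i < n \<longrightarrow> j < m \<longrightarrow> E (L z) i j = rgt m u w (E z) i j"
proof -
  \<comment> \<open>Writing \<open>w\<close> as \<open>cis \<alpha>\<close> provides the path
    \<open>cis (t * \<alpha>)\<close> from 1 to \<open>w\<close>.\<close>
  obtain \<alpha> where al: "w = cis \<alpha>" using unimodular_cis[OF w] by blast
  have "\<exists>L\<in>rot \<Omega>. \<forall>z i j. i < n \<longrightarrow> j < m \<longrightarrow> E (L z) i j = (\<lambda>t. rgt m u (cis (t * \<alpha>))) 1 (E z) i j"
  proof (rule rot_matrix)
    show "continuous_on ({0..1} \<times> UNIV) (\<lambda>p. rgt m u (cis (fst p * \<alpha>)) (E (snd p)) i j)" for i j
      unfolding rgt_def reflect_def nip_def by (intro continuous_intros continuous_E_snd)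
    show "rgt m u (cis (t * \<alpha>)) Z i j = rgt m u (cis (t * \<alpha>)) Z' i j"
      if "\<And>i j. i < n \<Longrightarrow> j < m \<Longrightarrow> Z i j = Z' i j" "i < n" "j < m" for t Z Z' i j
      using that by (rule rgt_cong)
  qed (simp_all add: Cl u rgt_add rgt_scale fro_rgt mat_contr_rgt rgt_1)
  then show ?thesis by (simp add: al)
qed

lemma rot_congruence:
  assumes nm: "m = n"
    and Cl: "\<And>w Z. cmod w = 1 \<Longrightarrow> Cl Z \<Longrightarrow> Cl (lft n u w (rgt n u w Z))" and u: "vn n u = 1" and w: "cmod w = 1"
  shows "\<exists>L\<in>rot \<Omega>. \<forall>z i j. i < n \<longrightarrow> j < n \<longrightarrow> E (L z) i j = lft n u w (rgt n u w (E z)) i j"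
proof -
  obtain \<alpha> where al: "w = cis \<alpha>" using unimodular_cis[OF w] by blast
  have "\<exists>L\<in>rot \<Omega>. \<forall>z i j. i < n \<longrightarrow> j < m \<longrightarrow>
      E (L z) i j = (\<lambda>t Z. lft n u (cis (t * \<alpha>)) (rgt n u (cis (t * \<alpha>)) Z)) 1 (E z) i j"
  proof (rule rot_matrix)
    show "continuous_on ({0..1} \<times> UNIV) (\<lambda>p. lft n u (cis (fst p * \<alpha>)) (rgt n u (cis (fst p * \<alpha>)) (E (snd p))) i j)" for i j
      unfolding rgt_def lft_def reflect_def nip_def by (intro continuous_intros continuous_E_snd)
    show "lft n u (cis (t * \<alpha>)) (rgt n u (cis (t * \<alpha>)) Z) i j = lft n u (cis (t * \<alpha>)) (rgt n u (cis (t * \<alpha>)) Z') i j"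
      if "\<And>i j. i < n \<Longrightarrow> j < m \<Longrightarrow> Z i j = Z' i j" "i < n" "j < m" for t Z Z' i j
      using that unfolding nm by (intro lft_cong[of n n] rgt_cong[of n n])
    show "lft n u (cis (t * \<alpha>)) (rgt n u (cis (t * \<alpha>)) (\<lambda>i j. Z i j + W i j)) i j =
      lft n u (cis (t * \<alpha>)) (rgt n u (cis (t * \<alpha>)) Z) i j + lft n u (cis (t * \<alpha>)) (rgt n u (cis (t * \<alpha>)) W) i j" for t Z W i j
      unfolding rgt_add[abs_def] by (rule lft_add)
    show "lft n u (cis (t * \<alpha>)) (rgt n u (cis (t * \<alpha>)) (\<lambda>i j. k * Z i j)) i j =
      k * lft n u (cis (t * \<alpha>)) (rgt n u (cis (t * \<alpha>)) Z) i j" for t k Z i j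
      unfolding rgt_scale[abs_def] by (rule lft_scale)
  qed (simp_all add: Cl u nm fro_rgt fro_lft mat_contr_rgt mat_contr_lft rgt_1 lft_1)
  then show ?thesis by (simp add: al nm)
qed

text \<open>\<open>P k\<close> is meant to say that the first \<open>k\<close> stages of the normal
  form are reached. Contractivity and norm persist because every stage applies an element of
  \<open>rot\<close>.\<close>

lemma std_form_induct:
  assumes base: "\<And>z. contr n m (E z) \<Longrightarrow> (norm z)\<^sup>2 = r \<Longrightarrow> \<exists>L\<in>rot \<Omega>. P 0 (E (L z))"
    and step: "\<And>k z. k < N \<Longrightarrow> contr n m (E z) \<Longrightarrow> (norm z)\<^sup>2 = r \<Longrightarrow> P k (E z) \<Longrightarrow> \<exists>L\<in>rot \<Omega>. P (Suc k) (E (L z))"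
    and fin: "\<And>z. P N (E z) \<Longrightarrow> z = z0"
    and z: "contr n m (E z)" "(norm z)\<^sup>2 = r"
  shows "\<exists>L\<in>rot \<Omega>. L z = z0"
proof -
  have "\<exists>L\<in>rot \<Omega>. P k (E (L z))" if "k \<le> N" for k
    using that
  proof (induction k)
    case 0
    show ?case by (rule base[OF z])
  next
    case (Suc k)
    then obtain L where L: "L \<in> rot \<Omega>" "P k (E (L z))" by auto
    have c: "contr n m (E (L z))" by (rule closure_contr[OF rot_closure[OF L(1) contr_closure[OF z(1)]]])
    have "(norm (L z))\<^sup>2 = r" using rotD(2)[OF L(1)] z(2) by simp
    from step[OF _ c this L(2)] Suc.prems obtain M where M: "M \<in> rot \<Omega>" "P (Suc k) (E (M (L z)))" by auto
    then show ?case using rot_comp[OF M(1) L(1)] by (intro bexI[of _ "\<lambda>z. M (L z)"])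
  qed
  then obtain L where L: "L \<in> rot \<Omega>" "P N (E (L z))" by auto
  then show ?thesis using fin by blast
qed

end

section \<open>Rectangular matrices\<close>

lemma contr_fro_le: assumes "contr n m Z" shows "fro n m Z \<le> n"
proof -
  have "fro n m Z \<le> (\<Sum>i<n. 1)" unfolding fro_def using contr_row[OF assms] by (intro sum_mono) auto
  then show ?thesis by simp
qed

lemma sum_le_1_eq_card:
  fixes g :: "nat \<Rightarrow> real"
  assumes "\<And>i. i < n \<Longrightarrow> g i \<le> 1" "(\<Sum>i<n. g i) = n" "i < n" shows "g i = 1"
proof -
  have "(\<Sum>i<n. 1 - g i) = 0" using assms(2) by (simp add: sum_subtractf)
  then have "\<forall>i\<in>{..<n}. 1 - g i = 0" using assms(1) by (subst (asm) sum_nonneg_eq_0_iff) auto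
  then show ?thesis using assms(3) by simp
qed

lemma exists_less_of_sum_less:
  fixes g :: "nat \<Rightarrow> real"
  assumes "(\<Sum>i<n. g i) < n" shows "\<exists>i<n. g i < 1"
proof (rule ccontr)
  assume "\<not> ?thesis"
  then have "(\<Sum>i<n. 1) \<le> (\<Sum>i<n. g i)" by (intro sum_mono) (meson lessThan_iff not_less)
  then show False using assms by simp
qed

lemma unit_vector_with_unit_coord:
  assumes "vn n x \<le> 1" "p < n" "cmod (x p) = 1" "i < n" "i \<noteq> p" shows "x i = 0"
proof -
  have "vn n x = (cmod (x p))\<^sup>2 + (\<Sum>i\<in>{..<n} - {p}. (cmod (x i))\<^sup>2)"
    unfolding vn_def using assms(2) by (subst sum.remove[of _ p]) auto
  then have "(\<Sum>i\<in>{..<n} - {p}. (cmod (x i))\<^sup>2) \<le> 0" using assms by simp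
  then have "(\<Sum>i\<in>{..<n} - {p}. (cmod (x i))\<^sup>2) = 0" by (intro antisym sum_nonneg) auto
  then show ?thesis using assms by (subst (asm) sum_nonneg_eq_0_iff) auto
qed

text \<open>Squared norm \<open>r\<close> makes every row a unit vector, so the rows are
  orthonormal, and reflections from the right bring them one after another to coordinate vectors.
  Below \<open>r\<close> some row and, as \<open>n \<le> m\<close>, some column is shorter than 1,
  which gives a nonvanishing diagonal entry of each defect.\<close>

theorem cartan_domain_I: assumes "cartan_I \<Omega> r" shows "cartan_domain \<Omega> r"
proof -
  obtain n m and f :: "nat \<times> nat \<Rightarrow> 'a" where
    nm: "1 \<le> n" "n \<le> m" and f: "bij_betw f ({..<n} \<times> {..<m}) UNIV" and r: "r = n"
    and Om: "\<Omega> = {z. mat_contr n m (\<lambda>i j. z $ f (i, j))}"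
    using assms unfolding cartan_I_def by blast
  let ?X = "{..<n} \<times> {..<m}"
  define E where "E z i j = vec_nth z (f (i, j))" for z :: "complex^'a" and i j
  define g where "g = inv_into ?X f"
  have g: "g k \<in> ?X" "f (g k) = k" for k
    unfolding g_def using f by (auto simp: bij_betw_def inv_into_into f_inv_into_f)
  have gf: "g (f p) = p" if "p \<in> ?X" for p
    unfolding g_def using f that by (simp add: bij_betw_def)
  interpret matrix_domain n m E 1 "\<lambda>_. True" "\<lambda>k. fst (g k)" "\<lambda>k. snd (g k)" "\<lambda>_. 1" \<Omega>
  proof
    fix z :: "complex^'a"
    have "fro n m (E z) = (\<Sum>p\<in>?X. (cmod (vec_nth z (f p)))\<^sup>2)"
      unfolding fro_def vn_def E_def by (simp add: sum.cartesian_product)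
    also have "\<dots> = (\<Sum>k\<in>UNIV. (cmod (vec_nth z k))\<^sup>2)" by (rule sum.reindex_bij_betw[OF f])
    finally show "fro n m (E z) = 1 * (norm z)\<^sup>2" by (simp add: norm_sq_vec)
  next
    fix k
    show "fst (g k) < n" "snd (g k) < m" using g(1)[of k] by (auto simp: mem_Times_iff)
    show "1 * E z (fst (g k)) (snd (g k)) = vec_nth z k" for z by (simp add: E_def g)
  next
    fix Z :: "nat \<Rightarrow> nat \<Rightarrow> complex" and i j
    assume "i < n" "j < m"
    then show "E (\<chi> k. 1 * Z (fst (g k)) (snd (g k))) i j = Z i j" by (simp add: E_def gf)
  next
    show "\<Omega> = {z. mat_contr n m (E z)}" unfolding Om E_def ..
  qed (simp_all add: E_def)
  show ?thesis
  proof (rule cartan_domainI[where ?z0.0="Einv (\<lambda>i j. if i = j then 1 else 0)"])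
    show "0 < r" using nm r by simp
    show "(norm z)\<^sup>2 \<le> r" if "contr n m (E z)" for z using contr_fro_le[OF that] by (simp add: E_fro r)
  next
    fix z assume c: "contr n m (E z)" and lt: "(norm z)\<^sup>2 < real r"
    have "(\<Sum>i<n. vn m (E z i)) < n" using lt E_fro[of z] by (simp add: r fro_def)
    then obtain i where i: "i < n" "vn m (E z i) < 1" using exists_less_of_sum_less by blast
    have "(\<Sum>j<m. vn n (mv m (E z) (uvec j))) < m" using lt E_fro[of z] nm by (simp add: r fro_columns)
    then obtain j where j: "j < m" "vn n (mv m (E z) (uvec j)) < 1" using exists_less_of_sum_less by blast
    let ?A = "defect n m (E z) (uvec i)" and ?B = "defect m n (madj (E z)) (uvec j)"
    have "?A i = 1 - of_real (vn m (E z i))" using i(1) by (simp add: defect_ev nip_self)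
    then have A: "?A i \<noteq> 0" using i(2) by (metis eq_iff_diff_eq_0 of_real_1 of_real_eq_iff less_irrefl)
    have "vn n (madj (E z) j) = vn n (mv m (E z) (uvec j))" using j(1) by (simp add: vn_def madj_def mv_ev)
    then have "?B j = 1 - of_real (vn n (mv m (E z) (uvec j)))" using j(1) by (simp add: defect_ev nip_self)
    then have B: "?B j \<noteq> 0" using j(2) by (metis eq_iff_diff_eq_0 of_real_1 of_real_eq_iff less_irrefl)
    obtain \<epsilon> where eps: "\<epsilon> > 0" "\<forall>l. cmod l \<le> \<epsilon> \<longrightarrow> contr n m (\<lambda>i j. E z i j + l * (?A i * cnj (?B j)))"
      using contr_rank_one_perturbation[OF c, of "uvec i" "uvec j"] by (elim exE conjE)
    show "\<exists>V i j \<epsilon>. True \<and> i < n \<and> j < m \<and> V i j \<noteq> 0 \<and> \<epsilon> > 0 \<and>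
       (\<forall>l. cmod l \<le> \<epsilon> \<longrightarrow> contr n m (\<lambda>i j. E z i j + l * V i j))"
      by (rule exI[of _ "\<lambda>i j. ?A i * cnj (?B j)"], rule exI[of _ i], rule exI[of _ j], rule exI[of _ \<epsilon>])
        (use i(1) j(1) A B eps in simp)
  next
    fix z assume z: "contr n m (E z)" "(norm z)\<^sup>2 = real r"
    define P where "P k Z \<longleftrightarrow> (\<forall>i<k. \<forall>j<m. Z i j = (if i = j then 1 else 0))" for k and Z :: "nat \<Rightarrow> nat \<Rightarrow> complex"
    show "\<exists>L\<in>rot \<Omega>. L z = Einv (\<lambda>i j. if i = j then 1 else 0)"
    proof (rule std_form_induct[where P=P and N=n and r=r])
      show "\<exists>L\<in>rot \<Omega>. P 0 (E (L z))" for z using rot_id by (intro bexI[of _ "\<lambda>z. z"]) (auto simp: P_def)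
      show "z = Einv (\<lambda>i j. if i = j then 1 else 0)" if "P n (E z)" for z
        using Einv_cong[of "E z" "\<lambda>i j. if i = j then 1 else 0"] that by (simp add: P_def Einv_E)
    next
      fix k z assume k: "k < n" and c: "contr n m (E z)" and nz: "(norm z)\<^sup>2 = real r" and P: "P k (E z)"
      have km: "k < m" using k nm by simp
      have row1: "vn m (E z k) = 1"
        by (rule sum_le_1_eq_card[where n=n]) (use contr_row[OF c] E_fro[of z] nz k in \<open>auto simp: fro_def r\<close>)
      \<comment> \<open>Rows before \<open>k\<close> are already coordinate vectors, and
        orthogonality to them clears the first \<open>k\<close> entries of row \<open>k\<close>.
        Hence the reflection for row \<open>k\<close> leaves those rows alone.\<close>
      have low: "E z k i = 0" if "i < k" for i
      proof -
        have i: "i < n" "i < m" using that k km by auto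
        have ei: "E z i j = uvec i j" if "j < m" for j using P \<open>i < k\<close> that by (auto simp: P_def uvec_def)
        have "vn m (E z i) = vn m (uvec i)" by (rule vn_cong) (rule ei)
        then have "nip m (E z k) (E z i) = 0"
          using contr_unit_row_orthogonal[OF c i(1) _ k] vn_ev[OF i(2)] that by simp
        moreover have "nip m (E z k) (E z i) = nip m (E z k) (uvec i)" by (rule nip_cong) (simp_all add: ei)
        ultimately show ?thesis using nip_ev_right[OF i(2)] by simp
      qed
      show "\<exists>L\<in>rot \<Omega>. P (Suc k) (E (L z))"
      proof (cases "\<exists>j<m. E z k j \<noteq> uvec k j")
        case False
        then have "P (Suc k) (E z)" using P by (auto simp: P_def less_Suc_eq uvec_def)
        then show ?thesis using rot_id by (intro bexI[of _ "\<lambda>z. z"])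
      next
        case True
        from refl_transitive[OF row1 vn_ev[OF km] True]
        obtain u w where uw: "vn m u = 1 \<and> cmod w = 1 \<and> (\<forall>j<m. reflect m u w (E z k) j = uvec k j) \<and>
          (\<forall>j. E z k j = uvec k j \<longrightarrow> u j = 0)" by (elim exE)
        then have u: "vn m u = 1" "cmod w = 1" "\<And>j. j < m \<Longrightarrow> reflect m u w (E z k) j = uvec k j"
          "\<And>j. E z k j = uvec k j \<Longrightarrow> u j = 0" by simp_all
        have u0: "u i = 0" if "i < k" for i by (rule u(4)) (use low that in \<open>simp add: uvec_def\<close>)
        obtain L where L: "L \<in> rot \<Omega>" "\<forall>z i j. i < n \<longrightarrow> j < m \<longrightarrow> E (L z) i j = rgt m u w (E z) i j"
          by (rule bexE[OF rot_rgt[OF _ u(1,2)]]) simp_all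
        have "P (Suc k) (E (L z))" unfolding P_def
        proof (intro allI impI)
          fix i j assume i: "i < Suc k" and j: "j < m"
          then have iN: "i < n" using k by simp
          show "E (L z) i j = (if i = j then 1 else 0)"
          proof (cases "i = k")
            case True
            then show ?thesis using L(2)[rule_format, OF iN j] u(3)[OF j] by (auto simp: rgt_def uvec_def)
          next
            case False
            then have ik: "i < k" using i by simp
            have ei: "E z i j = uvec i j" if "j < m" for j using P ik that by (auto simp: P_def uvec_def)
            have "nip m (E z i) u = nip m (uvec i) u" by (rule nip_cong) (simp_all add: ei)
            also have "\<dots> = cnj (u i)" by (rule nip_ev_left[OF less_le_trans[OF iN nm(2)]])
            also have "\<dots> = 0" using u0[OF ik] by simp
            finally show ?thesis using L(2)[rule_format, OF iN j] ei[OF j] by (auto simp: rgt_def reflect_def uvec_def)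
          qed
        qed
        then show ?thesis using L(1) by blast
      qed
    qed (rule z)+
  qed
qed

section \<open>Symmetric matrices\<close>

lemma sum_symmetric_square:
  fixes g :: "nat \<Rightarrow> nat \<Rightarrow> real"
  assumes "\<And>i j. g i j = g j i"
  shows "(\<Sum>i<n. \<Sum>j<n. g i j) = (\<Sum>i<n. g i i) + 2 * (\<Sum>(i, j)\<in>{(i, j). i < j \<and> j < n}. g i j)"
proof -
  let ?U = "{(i, j). i < j \<and> j < n}" and ?L = "{(i, j). j < i \<and> i < n}" and ?D = "(\<lambda>i. (i, i)) ` {..<n}"
  have fin: "finite ?U" "finite ?L" "finite ?D"
    by (rule finite_subset[of _ "{..<n} \<times> {..<n}"], auto)+
  have "{..<n} \<times> {..<n} = ?D \<union> (?U \<union> ?L)" by auto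
  moreover have "(\<Sum>p\<in>?D \<union> (?U \<union> ?L). case p of (i, j) \<Rightarrow> g i j)
      = (\<Sum>p\<in>?D. case p of (i, j) \<Rightarrow> g i j) + ((\<Sum>p\<in>?U. case p of (i, j) \<Rightarrow> g i j) + (\<Sum>p\<in>?L. case p of (i, j) \<Rightarrow> g i j))"
    using fin by (subst sum.union_disjoint; (subst sum.union_disjoint)?) auto
  moreover have "(\<Sum>p\<in>?D. case p of (i, j) \<Rightarrow> g i j) = (\<Sum>i<n. g i i)"
    by (subst sum.reindex) (auto simp: inj_on_def)
  moreover have "(\<Sum>p\<in>?L. case p of (i, j) \<Rightarrow> g i j) = (\<Sum>p\<in>?U. case p of (i, j) \<Rightarrow> g i j)"
    by (rule sum.reindex_bij_witness[of _ prod.swap prod.swap]) (auto simp: assms)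
  ultimately show ?thesis by (simp add: sum.cartesian_product)
qed

text \<open>The reflection is unitary and takes \<open>u0\<close> to \<open>uvec p\<close>, so
  coordinate \<open>p\<close> of an image is the inner product with \<open>u0\<close>.\<close>

lemma refl_coord:
  assumes "vn n u = 1" "cmod w = 1" "p < n" "\<And>j. j < n \<Longrightarrow> reflect n u w u0 j = uvec p j"
  shows "reflect n u w x p = nip n x u0"
proof -
  have "reflect n u w x p = nip n (reflect n u w x) (uvec p)" using assms(3) by (simp add: nip_ev_right)
  also have "\<dots> = nip n (reflect n u w x) (reflect n u w u0)" by (rule nip_cong) (simp_all add: assms(4))
  finally show ?thesis by (simp add: nip_refl[OF assms(1,2)])
qed

lemma refl_transitiveE:
  assumes "vn n x = 1" "vn n y = 1" "\<exists>i<n. x i \<noteq> y i"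
  obtains u w where "vn n u = 1" "cmod w = 1" "\<And>i. i < n \<Longrightarrow> reflect n u w x i = y i" "\<And>i. x i = y i \<Longrightarrow> u i = 0"
proof -
  from refl_transitive[OF assms] obtain u w where
    "vn n u = 1 \<and> cmod w = 1 \<and> (\<forall>i<n. reflect n u w x i = y i) \<and> (\<forall>i. x i = y i \<longrightarrow> u i = 0)" by (elim exE)
  then show ?thesis by (intro that[of u w]) simp_all
qed

text \<open>The factor \<open>sqrt 2\<close> off the diagonal makes the Frobenius norm equal to the
  norm of the coordinates. The normal form is Takagi's factorization: at squared norm
  \<open>r\<close> the antilinear map \<open>x \<mapsto> Z cnj x\<close> is an involution, and
  moving a fixed unit vector of it to \<open>uvec k\<close> by a congruence produces the diagonal
  entry 1.\<close>

theorem cartan_domain_III: assumes "cartan_III \<Omega> r" shows "cartan_domain \<Omega> r"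
proof -
  obtain n and f :: "nat \<times> nat \<Rightarrow> 'a" where
    n1: "1 \<le> n" and f: "bij_betw f {(i, j). i \<le> j \<and> j < n} UNIV" and r: "r = n"
    and Om: "\<Omega> = {z. mat_contr n n (\<lambda>i j. if i = j then z $ f (i, i)
                 else if i < j then z $ f (i, j) / complex_of_real (sqrt 2)
                 else z $ f (j, i) / complex_of_real (sqrt 2))}"
    using assms unfolding cartan_III_def by blast
  let ?X = "{(i, j). i \<le> j \<and> j < n}"
  define E where "E z i j = (if i = j then vec_nth z (f (i, i))
      else if i < j then vec_nth z (f (i, j)) / complex_of_real (sqrt 2)
      else vec_nth z (f (j, i)) / complex_of_real (sqrt 2))" for z :: "complex^'a" and i j
  define g where "g = inv_into ?X f"
  have "k \<in> f ` ?X" for k using bij_betw_imp_surj_on[OF f] by simp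
  then have g: "g k \<in> ?X" "f (g k) = k" for k
    unfolding g_def by (rule inv_into_into, rule f_inv_into_f)
  have gf: "g (f (i, j)) = (i, j)" if "i \<le> j" "j < n" for i j
    unfolding g_def using f that by (simp add: bij_betw_def)
  define c where "c k = (if fst (g k) = snd (g k) then 1 else complex_of_real (sqrt 2))" for k
  define Cl where "Cl Z \<longleftrightarrow> (\<forall>i j. i < n \<longrightarrow> j < n \<longrightarrow> Z i j = 1 * Z j i)" for Z :: "nat \<Rightarrow> nat \<Rightarrow> complex"
  interpret matrix_domain n n E 1 Cl "\<lambda>k. fst (g k)" "\<lambda>k. snd (g k)" c \<Omega>
  proof
    fix z :: "complex^'a"
    let ?h = "\<lambda>i j. (cmod (E z i j))\<^sup>2"
    have "fro n n (E z) = (\<Sum>i<n. ?h i i) + 2 * (\<Sum>(i, j)\<in>{(i, j). i < j \<and> j < n}. ?h i j)"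
      unfolding fro_def vn_def by (rule sum_symmetric_square) (simp add: E_def)
    also have "(\<Sum>i<n. ?h i i) = (\<Sum>p\<in>(\<lambda>i. (i, i)) ` {..<n}. (cmod (vec_nth z (f p)))\<^sup>2)"
      by (subst sum.reindex) (auto simp: inj_on_def E_def)
    also have "2 * (\<Sum>(i, j)\<in>{(i, j). i < j \<and> j < n}. ?h i j) = (\<Sum>p\<in>{(i, j). i < j \<and> j < n}. (cmod (vec_nth z (f p)))\<^sup>2)"
      unfolding sum_distrib_left by (intro sum.cong refl) (auto simp: E_def norm_divide power_divide)
    also have "(\<Sum>p\<in>(\<lambda>i. (i, i)) ` {..<n}. (cmod (vec_nth z (f p)))\<^sup>2) + \<dots> = (\<Sum>p\<in>?X. (cmod (vec_nth z (f p)))\<^sup>2)"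
    proof -
      have "finite {(i, j). i < j \<and> j < n}" by (rule finite_subset[of _ "{..<n} \<times> {..<n}"]) auto
      moreover have "?X = (\<lambda>i. (i, i)) ` {..<n} \<union> {(i, j). i < j \<and> j < n}" by auto
      ultimately show ?thesis by (simp only:) (subst sum.union_disjoint, auto)
    qed
    also have "\<dots> = (\<Sum>k\<in>UNIV. (cmod (vec_nth z k))\<^sup>2)" by (rule sum.reindex_bij_betw[OF f])
    finally show "fro n n (E z) = 1 * (norm z)\<^sup>2" by (simp add: norm_sq_vec)
  next
    fix k
    have gk: "fst (g k) \<le> snd (g k)" "snd (g k) < n" using g(1)[of k] by (auto simp: case_prod_beta)
    then show "fst (g k) < n" "snd (g k) < n" by auto
    show "c k * E z (fst (g k)) (snd (g k)) = vec_nth z k" for z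
    proof (cases "fst (g k) = snd (g k)")
      case True
      then have "g k = (fst (g k), fst (g k))" by (simp add: prod_eq_iff)
      then have "f (fst (g k), fst (g k)) = k" using g(2)[of k] by simp
      then show ?thesis using True by (simp add: E_def c_def)
    next
      case False
      then show ?thesis using gk g(2)[of k] by (simp add: E_def c_def)
    qed
  next
    fix Z :: "nat \<Rightarrow> nat \<Rightarrow> complex" and i j
    assume Cl: "Cl Z" and ij: "i < n" "j < n"
    have "Z i j = Z j i" using Cl ij by (simp add: Cl_def)
    then show "E (\<chi> k. c k * Z (fst (g k)) (snd (g k))) i j = Z i j" using ij by (auto simp: E_def gf c_def)
  next
    show "\<Omega> = {z. mat_contr n n (E z)}" unfolding Om E_def ..
  next
    show "Cl (E z)" for z by (auto simp: Cl_def E_def)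
  qed (auto simp: E_def add_divide_distrib)
  have symE: "E z i j = E z j i" for z i j by (auto simp: E_def)
  have Clpres: "Cl (lft n u w (rgt n u w Z))" if "Cl Z" for u w Z
    using that unfolding Cl_def by (intro allI impI congruence_transpose) auto
  show ?thesis
  proof (rule cartan_domainI[where ?z0.0="Einv (\<lambda>i j. if i = j then 1 else 0)"])
    show "0 < r" using n1 r by simp
    show "(norm z)\<^sup>2 \<le> r" if "contr n n (E z)" for z using contr_fro_le[OF that] by (simp add: E_fro r)
  next
    fix z assume c: "contr n n (E z)" and lt: "(norm z)\<^sup>2 < real r"
    have "(\<Sum>i<n. vn n (E z i)) < n" using lt E_fro[of z] by (simp add: r fro_def)
    then obtain i where i: "i < n" "vn n (E z i) < 1" using exists_less_of_sum_less by blast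
    let ?A = "defect n n (E z) (uvec i)" and ?B = "defect n n (madj (E z)) (uvec i)"
    have "?A i = 1 - of_real (vn n (E z i))" using i(1) by (simp add: defect_ev nip_self)
    then have A: "?A i \<noteq> 0" using i(2) by (metis eq_iff_diff_eq_0 of_real_1 of_real_eq_iff less_irrefl)
    \<comment> \<open>By symmetry \<open>I - Z\<^sup>* Z\<close> is the conjugate of
      \<open>I - Z Z\<^sup>*\<close>, so the perturbation direction is itself symmetric.\<close>
    have AB: "cnj (?B j) = ?A j" for j
    proof -
      have "nip n (madj (E z) j) (madj (E z) i) = cnj (nip n (E z j) (E z i))"
        unfolding nip_def madj_def by (simp add: symE[of z _ i] symE[of z _ j])
      then show ?thesis using i(1) by (simp add: defect_ev)
    qed
    obtain \<epsilon> where eps: "\<epsilon> > 0" "\<forall>l. cmod l \<le> \<epsilon> \<longrightarrow> contr n n (\<lambda>i j. E z i j + l * (?A i * cnj (?B j)))"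
      using contr_rank_one_perturbation[OF c, of "uvec i" "uvec i"] by (elim exE conjE)
    show "\<exists>V i j \<epsilon>. Cl V \<and> i < n \<and> j < n \<and> V i j \<noteq> 0 \<and> \<epsilon> > 0 \<and>
       (\<forall>l. cmod l \<le> \<epsilon> \<longrightarrow> contr n n (\<lambda>i j. E z i j + l * V i j))"
      by (rule exI[of _ "\<lambda>i j. ?A i * ?A j"], rule exI[of _ i], rule exI[of _ i], rule exI[of _ \<epsilon>])
        (use i(1) A eps[unfolded AB] in \<open>simp add: Cl_def mult.commute\<close>)
  next
    fix z assume z: "contr n n (E z)" "(norm z)\<^sup>2 = real r"
    define P where "P k Z \<longleftrightarrow> (\<forall>i<n. \<forall>j<n. i < k \<or> j < k \<longrightarrow> Z i j = (if i = j then 1 else 0))" for k and Z :: "nat \<Rightarrow> nat \<Rightarrow> complex"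
    have P_Suc: "P (Suc k) (E z)" if P: "P k (E z)" and k: "k < n" and row: "\<And>i. i < n \<Longrightarrow> E z i k = (if i = k then 1 else 0)" for k z
      unfolding P_def
    proof (intro allI impI)
      fix i j assume ij: "i < n" "j < n" and lt: "i < Suc k \<or> j < Suc k"
      consider "i < k \<or> j < k" | "j = k" | "i = k" using lt by linarith
      then show "E z i j = (if i = j then 1 else 0)"
      proof cases
        case 1
        then show ?thesis using P ij unfolding P_def by blast
      next
        case 2
        then show ?thesis using row[OF ij(1)] by simp
      next
        case 3
        then show ?thesis using row[OF ij(2)] symE[of z i j] by auto
      qed
    qed
    show "\<exists>L\<in>rot \<Omega>. L z = Einv (\<lambda>i j. if i = j then 1 else 0)"
    proof (rule std_form_induct[where P=P and N=n and r=r])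
      show "\<exists>L\<in>rot \<Omega>. P 0 (E (L z))" for z using rot_id by (intro bexI[of _ "\<lambda>z. z"]) (auto simp: P_def)
      show "z = Einv (\<lambda>i j. if i = j then 1 else 0)" if "P n (E z)" for z
        using Einv_cong[of "E z" "\<lambda>i j. if i = j then 1 else 0"] that by (simp add: P_def Einv_E)
    next
      fix k z assume k: "k < n" and c: "contr n n (E z)" and nz: "(norm z)\<^sup>2 = real r" and P: "P k (E z)"
      define y where "y = E z k"
      have row1: "vn n y = 1" unfolding y_def
        by (rule sum_le_1_eq_card[where n=n]) (use contr_row[OF c] E_fro[of z] nz k in \<open>auto simp: fro_def r\<close>)
      have low: "y i = 0" if "i < k" for i
        using P k that by (simp add: P_def y_def)
      have orth: "nip n (E z i) y = uvec k i" if "i < n" for i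
        using contr_unit_row_orthogonal[OF c k row1[unfolded y_def] that] by (simp add: y_def uvec_def)
      have col: "nip n (E z i) (uvec k) = y i" if "i < n" for i
        using nip_ev_right[OF k] symE[of z i k] by (simp add: y_def)
      \<comment> \<open>The antilinear involution exchanges \<open>y\<close> and
        \<open>uvec k\<close>, so their sum is fixed. If the sum vanishes, \<open>uvec k\<close> is
        mapped to its negative and \<open>\<i> * uvec k\<close> is fixed. Both candidates vanish
        below \<open>k\<close>, so finished rows are not disturbed.\<close>
      have "\<exists>u0. vn n u0 = 1 \<and> (\<forall>i<n. nip n (E z i) u0 = u0 i) \<and> (\<forall>i<k. u0 i = 0)"
      proof (cases "\<forall>j<n. y j = - uvec k j")
        case True
        have "vn n (\<lambda>j. \<i> * uvec k j) = 1" unfolding vn_scale vn_ev[OF k] by simp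
        moreover have "nip n (E z i) (\<lambda>j. \<i> * uvec k j) = \<i> * uvec k i" if "i < n" for i
          unfolding nip_scale_right col[OF that] using True that by simp
        moreover have "\<i> * uvec k i = 0" if "i < k" for i using that by (simp add: uvec_def)
        ultimately show ?thesis by (intro exI[of _ "\<lambda>j. \<i> * uvec k j"]) simp
      next
        case False
        let ?s = "\<lambda>j. uvec k j + y j"
        define D where "D = vn n ?s"
        have "\<exists>j<n. ?s j \<noteq> 0" using False by (metis add_eq_0_iff)
        then have D: "D > 0" unfolding D_def vn_pos .
        define u0 where "u0 = (\<lambda>j. of_real (1 / sqrt D) * ?s j)"
        have "vn n u0 = 1" unfolding u0_def vn_scale D_def[symmetric] norm_of_real using D by (simp add: power_divide)
        moreover have "nip n (E z i) u0 = u0 i" if "i < n" for i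
          unfolding u0_def nip_scale_right nip_add_right col[OF that] orth[OF that] by (simp add: add.commute)
        moreover have "u0 i = 0" if "i < k" for i using low[OF that] that by (simp add: u0_def uvec_def)
        ultimately show ?thesis by (intro exI[of _ u0]) simp
      qed
      then obtain u0 where "vn n u0 = 1 \<and> (\<forall>i<n. nip n (E z i) u0 = u0 i) \<and> (\<forall>i<k. u0 i = 0)" by (elim exE)
      then have u0: "vn n u0 = 1" "\<And>i. i < n \<Longrightarrow> nip n (E z i) u0 = u0 i" "\<And>i. i < k \<Longrightarrow> u0 i = 0" by simp_all
      show "\<exists>L\<in>rot \<Omega>. P (Suc k) (E (L z))"
      proof (cases "\<exists>j<n. u0 j \<noteq> uvec k j")
        case False
        have "E z i k = (if i = k then 1 else 0)" if "i < n" for i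
        proof -
          have "nip n (E z i) u0 = nip n (E z i) (uvec k)" by (rule nip_cong) (use False in auto)
          then show ?thesis using u0(2)[OF that] False that nip_ev_right[OF k] by (simp add: uvec_def)
        qed
        from P_Suc[OF P k this] show ?thesis using rot_id by (intro bexI[of _ "\<lambda>z. z"])
      next
        case True
        obtain u w where u: "vn n u = 1" "cmod w = 1" "\<And>j. j < n \<Longrightarrow> reflect n u w u0 j = uvec k j"
          "\<And>j. u0 j = uvec k j \<Longrightarrow> u j = 0"
          by (rule refl_transitiveE[OF u0(1) vn_ev[OF k] True]) (rule that; (assumption | simp))
        have uz: "u i = 0" if "i < k" for i by (rule u(4)) (use u0(3) that in \<open>simp add: uvec_def\<close>)
        obtain L where L: "L \<in> rot \<Omega>" "\<forall>z i j. i < n \<longrightarrow> j < n \<longrightarrow> E (L z) i j = lft n u w (rgt n u w (E z)) i j"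
          by (rule bexE[OF rot_congruence[OF refl Clpres u(1,2)]])
        let ?Z = "E (L z)"
        have cL: "contr n n ?Z" by (rule closure_contr[OF rot_closure[OF L(1) contr_closure[OF c]]])
        note coord = refl_coord[OF u(1,2) k u(3)]
        have "?Z k k = nip n (\<lambda>i. rgt n u w (E z) i k) u0"
          using L(2) k by (simp add: lft_def coord)
        also have "\<dots> = nip n u0 u0"
          by (rule nip_cong) (simp_all add: rgt_def coord u0(2))
        finally have kk: "?Z k k = 1" using u0(1) by (simp add: nip_self)
        have colk: "?Z i k = (if i = k then 1 else 0)" if "i < n" for i
          using kk unit_vector_with_unit_coord[OF contr_row[OF cL k] k _ that] symE[of "L z" i k] by auto
        have "P k ?Z"
        proof -
          have lo: "?Z i j = (if i = j then 1 else 0)" if "i < k" "j < n" for i j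
          proof -
            have iN: "i < n" using that k by simp
            have ei: "E z i l = uvec i l" if "l < n" for l using P iN \<open>i < k\<close> that by (auto simp: P_def uvec_def)
            have "nip n (E z i) u = nip n (uvec i) u" by (rule nip_cong) (simp_all add: ei)
            also have "\<dots> = 0" unfolding nip_ev_left[OF iN] uz[OF \<open>i < k\<close>] by simp
            finally have "rgt n u w (E z) i j = uvec i j" using ei[OF \<open>j < n\<close>] by (simp add: rgt_def reflect_def)
            then have "?Z i j = uvec i j" using L(2) iN \<open>j < n\<close> uz[OF \<open>i < k\<close>] by (simp add: lft_def reflect_def)
            then show ?thesis by (auto simp: uvec_def)
          qed
          show ?thesis unfolding P_def
          proof (intro allI impI)
            fix i j assume ij: "i < n" "j < n" "i < k \<or> j < k"
            then show "?Z i j = (if i = j then 1 else 0)"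
              using lo[of i j] lo[of j i] symE[of "L z" i j] by auto
          qed
        qed
        from P_Suc[OF this k colk] show ?thesis using L(1) by blast
      qed
    qed (rule z)+
  qed
qed

section \<open>Alternating matrices\<close>

lemma alternating_unit_kernel:
  assumes "odd n" "\<forall>i<n. \<forall>j<n. Z i j = - Z j i"
  obtains b where "vn n b = 1" "\<And>i. i < n \<Longrightarrow> mv n Z b i = 0"
proof -
  have "\<exists>x. (\<exists>i\<in>{..<n}. x i \<noteq> 0) \<and> (\<forall>i\<in>{..<n}. (\<Sum>j<n. Z i j * x j) = 0)"
  proof (rule odd_alternating_singular)
    show "odd (card {..<n})" using assms(1) by simp
    show "Z i j = - Z j i" if "i \<in> {..<n}" "j \<in> {..<n}" for i j using assms(2) that by blast
  qed simp
  then obtain x where x: "\<exists>i<n. x i \<noteq> 0" "\<And>i. i < n \<Longrightarrow> mv n Z x i = 0"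
    unfolding mv_def by (elim exE conjE) auto
  define D where "D = vn n x"
  have D: "D > 0" using x(1) unfolding D_def vn_pos .
  show ?thesis
  proof (rule that[of "\<lambda>i. of_real (1 / sqrt D) * x i"])
    show "vn n (\<lambda>i. of_real (1 / sqrt D) * x i) = 1"
      unfolding vn_scale D_def[symmetric] norm_of_real using D by (simp add: power_divide)
    show "mv n Z (\<lambda>i. of_real (1 / sqrt D) * x i) i = 0" if "i < n" for i
      unfolding mv_scale x(2)[OF that] by simp
  qed
qed

text \<open>For odd \<open>n\<close> there is a unit kernel vector \<open>b\<close>. Column
  \<open>j\<close> does not change when the component of \<open>uvec j\<close> along
  \<open>b\<close> is removed, which bounds its squared norm by
  \<open>1 - |b\<^sub>j|\<^sup>2\<close>; the losses add up to 1.\<close>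

lemma alternating_fro_le:
  assumes Z: "contr n n Z" and alt: "\<forall>i<n. \<forall>j<n. Z i j = - Z j i"
  shows "fro n n Z \<le> 2 * (n div 2)"
proof (cases "even n")
  case True
  then show ?thesis using contr_fro_le[OF Z] by simp
next
  case False
  obtain b where b: "vn n b = 1" "\<And>i. i < n \<Longrightarrow> mv n Z b i = 0"
    by (rule alternating_unit_kernel[OF False alt]) (rule that; (assumption | simp))
  have "vn n (mv n Z (uvec j)) \<le> 1 - (cmod (b j))\<^sup>2" if j: "j < n" for j
  proof -
    let ?v = "\<lambda>i. uvec j i - cnj (b j) * b i"
    have "mv n Z ?v i = mv n Z (uvec j) i - cnj (b j) * mv n Z b i" for i
      by (simp add: mv_def sum_subtractf right_diff_distrib sum_distrib_left mult.left_commute)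
    then have "vn n (mv n Z (uvec j)) = vn n (mv n Z ?v)" by (intro vn_cong) (simp add: b(2))
    also have "\<dots> \<le> vn n ?v" using Z by (simp add: contr_def)
    also have "\<dots> = 1 - (cmod (b j))\<^sup>2"
    proof -
      have "nip n (uvec j) (\<lambda>i. cnj (b j) * b i) = of_real ((cmod (b j))\<^sup>2)"
        unfolding nip_scale_right nip_ev_left[OF j] complex_norm_square by simp
      then show ?thesis unfolding vn_diff vn_scale vn_ev[OF j] b(1) by simp
    qed
    finally show ?thesis .
  qed
  then have "fro n n Z \<le> (\<Sum>j<n. 1 - (cmod (b j))\<^sup>2)" unfolding fro_columns by (intro sum_mono) simp
  also have "\<dots> = real n - 1" using b(1) by (simp add: sum_subtractf vn_def)
  finally show ?thesis using False by (elim oddE) simp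
qed

text \<open>For alternating \<open>Z\<close> the defect of the adjoint is the conjugate of the
  defect \<open>A\<close> of \<open>Z\<close>, so the rank one directions are products of two
  columns of \<open>A\<close>.\<close>

lemma alternating_perturbation:
  assumes Z: "contr n n Z" and alt: "\<forall>i<n. \<forall>j<n. Z i j = - Z j i"
    and kl: "k < n" "l < n"
    and A: "A = (\<lambda>i k. (if i = k then 1 else 0) - nip n (Z i) (Z k))"
  shows "\<exists>\<epsilon>>0. \<forall>c. cmod c \<le> \<epsilon> \<longrightarrow> contr n n (\<lambda>i j. Z i j + c * (A i k * A j l))"
proof -
  have 1: "defect n n Z (uvec k) i = A i k" for i using kl by (simp add: A defect_ev)
  have 2: "cnj (defect n n (madj Z) (uvec l) j) = A j l" if j: "j < n" for j
  proof -
    have "nip n (madj Z j) (madj Z l) = nip n (Z l) (Z j)"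
      unfolding nip_def
    proof (intro sum.cong refl)
      fix i assume "i \<in> {..<n}"
      then have "Z i j = - Z j i" "Z i l = - Z l i" using j kl alt by blast+
      then show "madj Z j i * cnj (madj Z l i) = Z l i * cnj (Z j i)" by (simp add: madj_def)
    qed
    then show ?thesis using kl by (simp add: A defect_ev cnj_nip)
  qed
  obtain \<epsilon> where eps: "\<epsilon> > 0" "\<forall>c. cmod c \<le> \<epsilon> \<longrightarrow>
      contr n n (\<lambda>i j. Z i j + c * (defect n n Z (uvec k) i * cnj (defect n n (madj Z) (uvec l) j)))"
    using contr_rank_one_perturbation[OF Z, of "uvec k" "uvec l"] by (elim exE conjE)
  have "contr n n (\<lambda>i j. Z i j + c * (A i k * A j l))" if "cmod c \<le> \<epsilon>" for c
    using eps(2)[rule_format, OF that] by (rule contr_cong[THEN iffD1, rotated]) (simp add: 1 2)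
  then show ?thesis using eps(1) by blast
qed

text \<open>The alternating direction comes from averaging two rank one perturbations with
  coefficients \<open>2 * c\<close> and \<open>- 2 * c\<close>, and an average of contractions is a
  contraction.\<close>

lemma alternating_perturbation':
  assumes Z: "contr n n Z" and alt: "\<forall>i<n. \<forall>j<n. Z i j = - Z j i"
    and kl: "k < n" "l < n"
    and A: "A = (\<lambda>i k. (if i = k then 1 else 0) - nip n (Z i) (Z k))"
  shows "\<exists>\<epsilon>>0. \<forall>c. cmod c \<le> \<epsilon> \<longrightarrow> contr n n (\<lambda>i j. Z i j + c * (A i k * A j l - A j k * A i l))"
proof -
  obtain e1 where e1: "e1 > 0" "\<forall>c. cmod c \<le> e1 \<longrightarrow> contr n n (\<lambda>i j. Z i j + c * (A i k * A j l))"
    using alternating_perturbation[OF Z alt kl A] by (elim exE conjE)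
  obtain e2 where e2: "e2 > 0" "\<forall>c. cmod c \<le> e2 \<longrightarrow> contr n n (\<lambda>i j. Z i j + c * (A i l * A j k))"
    using alternating_perturbation[OF Z alt kl(2,1) A] by (elim exE conjE)
  have "contr n n (\<lambda>i j. Z i j + c * (A i k * A j l - A j k * A i l))" if c: "cmod c \<le> min e1 e2 / 2" for c
  proof -
    have "cmod (2 * c) \<le> e1" "cmod (- 2 * c) \<le> e2" using c by (auto simp: norm_mult)
    then have "contr n n (\<lambda>i j. (Z i j + 2 * c * (A i k * A j l) + (Z i j + - 2 * c * (A i l * A j k))) / 2)"
      using e1(2) e2(2) by (intro contr_average) blast+
    then show ?thesis by (rule contr_cong[THEN iffD1, rotated]) (simp add: field_simps)
  qed
  then show ?thesis using e1(1) e2(1) by (intro exI[of _ "min e1 e2 / 2"]) simp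
qed

text \<open>If no alternating perturbation survives, \<open>A = I - Z Z\<^sup>*\<close> has rank one, so its trace is \<open>1\<close> and \<open>n\<close> is
  even; but then \<open>Z\<close> has a second kernel vector, found by deleting one row and column.\<close>
lemma alternating_defect_not_rank_one:
  assumes alt: "\<forall>i<n. \<forall>j<n. Z i j = - Z j i"
    and fro: "fro n n Z < 2 * (n div 2)"
    and A: "A = (\<lambda>i k. (if i = k then 1 else 0) - nip n (Z i) (Z k))"
  shows "\<exists>k<n. \<exists>l<n. \<exists>i<n. \<exists>j<n. A i k * A j l \<noteq> A j k * A i l"
proof (rule ccontr)
  assume "\<not> ?thesis"
  then have rank: "A i k * A j l = A j k * A i l" if "i < n" "j < n" "k < n" "l < n" for i j k l
    using that by blast
  have "(\<Sum>i<n. vn n (Z i)) < n" using fro unfolding fro_def by linarith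
  then obtain k where k: "k < n" "vn n (Z k) < 1" using exists_less_of_sum_less by blast
  \<comment> \<open>Rank one together with the positive diagonal entry \<open>\<tau>\<close> gives
    \<open>\<tau> A = a a\<^sup>*\<close>, where \<open>a\<close> is column
    \<open>k\<close>.\<close>
  define \<tau> where "\<tau> = 1 - vn n (Z k)"
  have tau: "\<tau> > 0" "A k k = of_real \<tau>" using k(2) by (simp_all add: \<tau>_def A nip_self)
  define a where "a i = A i k" for i
  have Akj: "A k j = cnj (a j)" for j by (simp add: a_def A cnj_nip)
  have Aij: "A i j * of_real \<tau> = a i * cnj (a j)" if "i < n" "j < n" for i j
    using rank[of i k j k] that k(1) unfolding Akj tau(2)[symmetric] a_def[symmetric] by (simp add: mult.commute)
  \<comment> \<open>The relation \<open>A Z = Z A\<^sup>T\<close>, which rests on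
    \<open>Z\<^sup>T = - Z\<close>.\<close>
  have comm: "(\<Sum>j<n. A i j * Z j p) = (\<Sum>q<n. Z i q * A p q)" if ip: "i < n" "p < n" for i p
  proof -
    have d1: "(\<Sum>j<n. (if i = j then 1 else 0) * Z j p) = Z i p"
      and d2: "(\<Sum>q<n. Z i q * (if p = q then 1 else 0)) = Z i p" using ip by (simp_all add: if_distrib[of "\<lambda>x. x * _"] if_distrib[of "\<lambda>x. _ * x"] cong: if_cong)
    have "(\<Sum>j<n. nip n (Z i) (Z j) * Z j p) = (\<Sum>j<n. \<Sum>q<n. Z i q * cnj (Z j q) * Z j p)"
      by (simp add: nip_def sum_distrib_right)
    also have "\<dots> = (\<Sum>q<n. \<Sum>j<n. Z i q * cnj (Z j q) * Z j p)" by (rule sum.swap)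
    also have "\<dots> = (\<Sum>q<n. \<Sum>j<n. Z i q * (Z p j * cnj (Z q j)))"
    proof (intro sum.cong refl)
      fix q j assume "q \<in> {..<n}" "j \<in> {..<n}"
      then have "Z j q = - Z q j" "Z j p = - Z p j" using ip alt by blast+
      then show "Z i q * cnj (Z j q) * Z j p = Z i q * (Z p j * cnj (Z q j))" by simp
    qed
    also have "\<dots> = (\<Sum>q<n. Z i q * nip n (Z p) (Z q))" by (simp add: nip_def sum_distrib_left)
    finally have "(\<Sum>j<n. nip n (Z i) (Z j) * Z j p) = (\<Sum>q<n. Z i q * nip n (Z p) (Z q))" .
    then show ?thesis unfolding A left_diff_distrib right_diff_distrib sum_subtractf d1 d2 by simp
  qed
  have kernel: "(\<Sum>q<n. A p q * cnj (x q)) = cnj (x p)" if x: "\<And>i. i < n \<Longrightarrow> mv n Z x i = 0" and p: "p < n" for x p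
  proof -
    have "(\<Sum>q<n. nip n (Z p) (Z q) * cnj (x q)) = (\<Sum>q<n. \<Sum>j<n. Z p j * cnj (Z q j) * cnj (x q))"
      by (simp add: nip_def sum_distrib_right)
    also have "\<dots> = (\<Sum>j<n. \<Sum>q<n. Z p j * cnj (Z q j) * cnj (x q))" by (rule sum.swap)
    also have "\<dots> = (\<Sum>j<n. \<Sum>q<n. - Z p j * cnj (Z j q * x q))"
    proof (intro sum.cong refl)
      fix q j assume "q \<in> {..<n}" "j \<in> {..<n}"
      then have "Z q j = - Z j q" using alt by blast
      then show "Z p j * cnj (Z q j) * cnj (x q) = - Z p j * cnj (Z j q * x q)" by simp
    qed
    also have "\<dots> = (\<Sum>j<n. - Z p j * cnj (mv n Z x j))" by (simp only: mv_def sum_distrib_left cnj_sum)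
    also have "\<dots> = 0" using x by simp
    finally have "(\<Sum>q<n. nip n (Z p) (Z q) * cnj (x q)) = 0" .
    moreover have "(\<Sum>q<n. (if p = q then 1 else 0) * cnj (x q)) = cnj (x p)"
      using p by (simp add: if_distrib[of "\<lambda>x. x * _"] cong: if_cong)
    ultimately show ?thesis unfolding A left_diff_distrib sum_subtractf by simp
  qed
  \<comment> \<open>Inserting the rank one form into \<open>A Z = Z A\<^sup>T\<close> makes
    \<open>a\<^sub>i t\<^sub>p\<close> antisymmetric in \<open>i\<close> and \<open>p\<close>; since
    \<open>a\<^sub>k\<close> is not 0, \<open>t\<close> vanishes. So \<open>cnj a\<close> lies in
    the kernel of \<open>Z\<close>, hence \<open>A a = a\<close>, and the trace of \<open>A\<close>
    is 1.\<close>
  define t where "t = mv n Z (\<lambda>j. cnj (a j))"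
  have ta: "- (a i * t p) = a p * t i" if ip: "i < n" "p < n" for i p
  proof -
    have "(\<Sum>j<n. A i j * Z j p) * of_real \<tau> = (\<Sum>j<n. - (a i * (Z p j * cnj (a j))))"
      unfolding sum_distrib_right
    proof (intro sum.cong refl)
      fix j assume "j \<in> {..<n}"
      then have "Z j p = - Z p j" "A i j * of_real \<tau> = a i * cnj (a j)" using ip alt Aij by blast+
      then show "A i j * Z j p * of_real \<tau> = - (a i * (Z p j * cnj (a j)))"
        by (metis mult.assoc mult.commute mult_minus_left)
    qed
    also have "\<dots> = - (a i * t p)" by (simp add: t_def mv_def sum_negf sum_distrib_left)
    finally have 1: "(\<Sum>j<n. A i j * Z j p) * of_real \<tau> = - (a i * t p)" .
    have "(\<Sum>q<n. Z i q * A p q) * of_real \<tau> = (\<Sum>q<n. a p * (Z i q * cnj (a q)))"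
      unfolding sum_distrib_right
    proof (intro sum.cong refl)
      fix q assume "q \<in> {..<n}"
      then have "A p q * of_real \<tau> = a p * cnj (a q)" using ip by (auto intro: Aij)
      then show "Z i q * A p q * of_real \<tau> = a p * (Z i q * cnj (a q))" by (metis mult.assoc mult.left_commute)
    qed
    then show ?thesis using 1 comm[OF ip] by (simp add: t_def mv_def sum_distrib_left)
  qed
  have ak: "a k = of_real \<tau>" "a k \<noteq> 0" using tau by (simp_all add: a_def)
  have tk: "t k = 0" using ta[OF k(1) k(1)] ak by simp
  have t0: "t p = 0" if "p < n" for p using ta[OF k(1) that] ak tk by simp
  have "(\<Sum>q<n. A k q * a q) = a k" using kernel[of "\<lambda>j. cnj (a j)" k] t0 k(1) by (simp add: t_def)
  moreover have "(\<Sum>q<n. A k q * a q) = of_real (vn n a)" unfolding Akj nip_self[symmetric] nip_def by (simp add: mult.commute)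
  ultimately have vna: "vn n a = \<tau>" using ak(1) by (metis of_real_eq_iff)
  have "(1 - vn n (Z i)) * \<tau> = (cmod (a i))\<^sup>2" if "i < n" for i
  proof -
    have "complex_of_real ((1 - vn n (Z i)) * \<tau>) = of_real ((cmod (a i))\<^sup>2)"
      using Aij[OF that that] unfolding complex_norm_square by (simp add: A nip_self)
    then show ?thesis by (simp only: of_real_eq_iff)
  qed
  then have "(\<Sum>i<n. (1 - vn n (Z i)) * \<tau>) = vn n a" by (simp add: vn_def)
  then have "(n - fro n n Z) * \<tau> = \<tau>" using vna by (simp add: fro_def sum_subtractf flip: sum_distrib_right)
  then have "fro n n Z = real n - 1" using tau by simp
  then have "real n < 2 * real (n div 2) + 1" using fro by simp
  then have "n < 2 * (n div 2) + 1" by linarith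
  then have ev: "even n" by presburger
  \<comment> \<open>Extended by 0 at \<open>k\<close>, a kernel vector of the reduced matrix is one
    of \<open>Z\<close>: the missing row follows from pairing with \<open>a\<close>, as
    \<open>cnj a\<close> is in the kernel and \<open>a\<^sub>k\<close> is not 0. Then
    \<open>A\<close> fixes its conjugate, which is therefore a multiple of \<open>a\<close> with
    entry 0 at \<open>k\<close>, that is, 0.\<close>
  let ?I = "{..<n} - {k}"
  have "\<exists>x. (\<exists>i\<in>?I. x i \<noteq> 0) \<and> (\<forall>i\<in>?I. (\<Sum>j\<in>?I. Z i j * x j) = 0)"
  proof (rule odd_alternating_singular)
    show "odd (card ?I)" using ev k(1) by simp
    show "Z i j = - Z j i" if "i \<in> ?I" "j \<in> ?I" for i j using alt that by blast
  qed simp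
  then obtain x where x: "\<exists>i\<in>?I. x i \<noteq> 0" "\<And>i. i \<in> ?I \<Longrightarrow> (\<Sum>j\<in>?I. Z i j * x j) = 0"
    by (elim exE conjE) auto
  define y where "y = x(k := 0)"
  have my: "mv n Z y i = (\<Sum>j\<in>?I. Z i j * x j)" for i
  proof -
    have "mv n Z y i = Z i k * y k + (\<Sum>j\<in>?I. Z i j * y j)" unfolding mv_def using k(1) by (subst sum.remove[of _ k]) auto
    also have "(\<Sum>j\<in>?I. Z i j * y j) = (\<Sum>j\<in>?I. Z i j * x j)" by (intro sum.cong refl) (simp add: y_def)
    also have "y k = 0" by (simp add: y_def)
    finally show ?thesis by simp
  qed
  have "(\<Sum>i<n. cnj (a i) * mv n Z y i) = (\<Sum>i<n. \<Sum>j<n. cnj (a i) * (Z i j * y j))"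
    by (simp add: mv_def sum_distrib_left)
  also have "\<dots> = (\<Sum>j<n. \<Sum>i<n. cnj (a i) * (Z i j * y j))" by (rule sum.swap)
  also have "\<dots> = (\<Sum>j<n. \<Sum>i<n. - y j * (Z j i * cnj (a i)))"
  proof (intro sum.cong refl)
    fix j i assume "j \<in> {..<n}" "i \<in> {..<n}"
    then have "Z i j = - Z j i" using alt by blast
    then show "cnj (a i) * (Z i j * y j) = - y j * (Z j i * cnj (a i))" by simp
  qed
  also have "\<dots> = (\<Sum>j<n. - y j * t j)" by (simp only: t_def mv_def sum_distrib_left)
  also have "\<dots> = 0" using t0 by simp
  finally have "(\<Sum>i<n. cnj (a i) * mv n Z y i) = 0" .
  moreover have "(\<Sum>i<n. cnj (a i) * mv n Z y i) = cnj (a k) * mv n Z y k + (\<Sum>i\<in>?I. cnj (a i) * mv n Z y i)"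
    using k(1) by (subst sum.remove[of _ k]) auto
  moreover have "(\<Sum>i\<in>?I. cnj (a i) * mv n Z y i) = 0" by (intro sum.neutral ballI) (simp add: my x(2))
  ultimately have "mv n Z y k = 0" using ak(2) by simp
  then have y0: "mv n Z y i = 0" if "i < n" for i using that my x(2)[of i] by (cases "i = k") auto
  define s where "s = (\<Sum>q<n. cnj (a q) * cnj (y q))"
  have ys: "a p * s = cnj (y p) * of_real \<tau>" if p: "p < n" for p
  proof -
    have "cnj (y p) * of_real \<tau> = (\<Sum>q<n. A p q * cnj (y q)) * of_real \<tau>" using kernel[OF y0 p] by simp
    also have "\<dots> = (\<Sum>q<n. a p * (cnj (a q) * cnj (y q)))" unfolding sum_distrib_right
    proof (intro sum.cong refl)
      fix q assume "q \<in> {..<n}"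
      then have "A p q * of_real \<tau> = a p * cnj (a q)" using p by (auto intro: Aij)
      then show "A p q * cnj (y q) * of_real \<tau> = a p * (cnj (a q) * cnj (y q))" by (metis mult.assoc mult.commute)
    qed
    finally show ?thesis by (simp add: s_def sum_distrib_left)
  qed
  have "s = 0" using ys[OF k(1)] ak(2) by (simp add: y_def)
  then have y: "y p = 0" if "p < n" for p using ys[OF that] tau by simp
  obtain i where "i \<in> ?I" "x i \<noteq> 0" using x(1) by (elim bexE)
  then show False using y[of i] by (simp add: y_def)
qed

text \<open>The normal form \<open>J\<close> consists of 2 by 2 blocks, plus a zero row and column
  for odd \<open>n\<close>. Each stage settles two indices: moving row \<open>2 * k\<close> to a
  coordinate vector puts \<open>-1\<close> into the next row by alternation, and the norm bound
  clears the rest of that row.\<close>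

theorem cartan_domain_II: assumes "cartan_II \<Omega> r" shows "cartan_domain \<Omega> r"
proof -
  obtain n and f :: "nat \<times> nat \<Rightarrow> 'a" where
    n2: "2 \<le> n" and f: "bij_betw f {(i, j). i < j \<and> j < n} UNIV" and r: "r = n div 2"
    and Om: "\<Omega> = {z. mat_contr n n (\<lambda>i j. if i < j then z $ f (i, j) else if j < i then - (z $ f (j, i)) else 0)}"
    using assms unfolding cartan_II_def by blast
  let ?X = "{(i, j). i < j \<and> j < n}"
  define N where "N = 2 * (n div 2)"
  have Nn: "N \<le> n" "n \<le> N + 1" "real N = 2 * real r" by (auto simp: N_def r)
  define E where "E z i j = (if i < j then vec_nth z (f (i, j)) else if j < i then - (vec_nth z (f (j, i))) else 0)"
    for z :: "complex^'a" and i j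
  define g where "g = inv_into ?X f"
  have "k \<in> f ` ?X" for k using bij_betw_imp_surj_on[OF f] by simp
  then have g: "g k \<in> ?X" "f (g k) = k" for k
    unfolding g_def by (rule inv_into_into, rule f_inv_into_f)
  have gf: "g (f (i, j)) = (i, j)" if "i < j" "j < n" for i j
    unfolding g_def using f that by (simp add: bij_betw_def)
  define Cl where "Cl Z \<longleftrightarrow> (\<forall>i j. i < n \<longrightarrow> j < n \<longrightarrow> Z i j = (- 1) * Z j i)" for Z :: "nat \<Rightarrow> nat \<Rightarrow> complex"
  interpret matrix_domain n n E 2 Cl "\<lambda>k. fst (g k)" "\<lambda>k. snd (g k)" "\<lambda>_. 1" \<Omega>
  proof
    fix z :: "complex^'a"
    let ?h = "\<lambda>i j. (cmod (E z i j))\<^sup>2"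
    have "fro n n (E z) = (\<Sum>i<n. ?h i i) + 2 * (\<Sum>(i, j)\<in>{(i, j). i < j \<and> j < n}. ?h i j)"
      unfolding fro_def vn_def by (rule sum_symmetric_square) (simp add: E_def)
    also have "(\<Sum>i<n. ?h i i) = 0" by (simp add: E_def)
    also have "(\<Sum>(i, j)\<in>{(i, j). i < j \<and> j < n}. ?h i j) = (\<Sum>p\<in>?X. (cmod (vec_nth z (f p)))\<^sup>2)"
      by (intro sum.cong refl) (auto simp: E_def)
    also have "\<dots> = (\<Sum>k\<in>UNIV. (cmod (vec_nth z k))\<^sup>2)" by (rule sum.reindex_bij_betw[OF f])
    finally show "fro n n (E z) = 2 * (norm z)\<^sup>2" by (simp add: norm_sq_vec)
  next
    fix k
    have gk: "fst (g k) < snd (g k)" "snd (g k) < n" using g(1)[of k] by (auto simp: case_prod_beta)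
    then show "fst (g k) < n" "snd (g k) < n" by auto
    show "1 * E z (fst (g k)) (snd (g k)) = vec_nth z k" for z
      using gk g(2)[of k] by (simp add: E_def)
  next
    fix Z :: "nat \<Rightarrow> nat \<Rightarrow> complex" and i j
    assume Cl: "Cl Z" and ij: "i < n" "j < n"
    have "Z i j = - 1 * Z j i" "Z i i = - 1 * Z i i" using Cl ij unfolding Cl_def by blast+
    then have Z: "- Z j i = Z i j" "Z i i = 0" by simp_all
    consider "i < j" | "j < i" | "i = j" by linarith
    then show "E (\<chi> k. 1 * Z (fst (g k)) (snd (g k))) i j = Z i j"
      by cases (use ij Z in \<open>simp_all add: E_def gf\<close>)
  next
    show "\<Omega> = {z. mat_contr n n (E z)}" unfolding Om E_def ..
  next
    show "Cl (E z)" for z by (auto simp: Cl_def E_def)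
  qed (auto simp: E_def)
  have alt: "E z i j = - E z j i" for z i j by (auto simp: E_def)
  have alt': "\<forall>i<n. \<forall>j<n. E z i j = - E z j i" for z using alt by blast
  have Clpres: "Cl (lft n u w (rgt n u w Z))" if "Cl Z" for u w Z
    using that unfolding Cl_def by (intro allI impI congruence_transpose) blast+
  define J :: "nat \<Rightarrow> nat \<Rightarrow> complex" where
    "J i j = (if j = Suc i \<and> even i then 1 else if i = Suc j \<and> even j then - 1 else 0)" for i j
  show ?thesis
  proof (rule cartan_domainI[where ?z0.0="Einv J"])
    show "0 < r" using n2 r by simp
    show "(norm z)\<^sup>2 \<le> r" if "contr n n (E z)" for z
      using alternating_fro_le[OF that alt'] by (simp add: E_fro r)
  next
    fix z assume c: "contr n n (E z)" and lt: "(norm z)\<^sup>2 < real r"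
    define A where "A = (\<lambda>i k. (if i = k then 1 else 0) - nip n (E z i) (E z k))"
    have "fro n n (E z) < 2 * (n div 2)" using lt E_fro[of z] by (simp add: r)
    from alternating_defect_not_rank_one[OF alt' this A_def] obtain k l i j where kl: "k < n" "l < n" "i < n" "j < n" "A i k * A j l \<noteq> A j k * A i l"
      by (elim exE conjE)
    obtain \<epsilon> where eps: "\<epsilon> > 0" "\<forall>c. cmod c \<le> \<epsilon> \<longrightarrow> contr n n (\<lambda>i j. E z i j + c * (A i k * A j l - A j k * A i l))"
      using alternating_perturbation'[OF c alt' kl(1,2) A_def] by (elim exE conjE)
    show "\<exists>V i j \<epsilon>. Cl V \<and> i < n \<and> j < n \<and> V i j \<noteq> 0 \<and> \<epsilon> > 0 \<and>
       (\<forall>l. cmod l \<le> \<epsilon> \<longrightarrow> contr n n (\<lambda>i j. E z i j + l * V i j))"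
      by (rule exI[of _ "\<lambda>i j. A i k * A j l - A j k * A i l"], rule exI[of _ i], rule exI[of _ j], rule exI[of _ \<epsilon>])
        (use kl eps in \<open>simp add: Cl_def\<close>)
  next
    fix z assume z: "contr n n (E z)" "(norm z)\<^sup>2 = real r"
    define P where "P k Z \<longleftrightarrow> (\<forall>i<n. \<forall>j<n. (N \<le> i \<longrightarrow> Z i j = 0) \<and> (i < 2 * k \<longrightarrow> Z i j = J i j))"
      for k and Z :: "nat \<Rightarrow> nat \<Rightarrow> complex"
    show "\<exists>L\<in>rot \<Omega>. L z = Einv J"
    proof (rule std_form_induct[where P=P and N="n div 2" and r=r])
      show "z = Einv J" if P: "P (n div 2) (E z)" for z
      proof -
        have "E z i j = J i j" if ij: "i < n" "j < n" for i j
        proof (cases "i < N")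
          case True
          then show ?thesis using P ij by (simp add: P_def N_def)
        next
          case False
          have "even N" by (simp add: N_def)
          then have "J i j = 0" using False ij Nn(2) unfolding J_def by (auto elim!: evenE) presburger
          then show ?thesis using P ij False by (simp add: P_def)
        qed
        then have "Einv (E z) = Einv J" by (rule Einv_cong)
        then show ?thesis by (simp add: Einv_E)
      qed
    next
      fix z assume c: "contr n n (E z)"
      show "\<exists>L\<in>rot \<Omega>. P 0 (E (L z))"
      proof (cases "even n")
        case True
        then show ?thesis using rot_id by (intro bexI[of _ "\<lambda>z. z"]) (auto simp: P_def N_def)
      next
        case False
        \<comment> \<open>For odd \<open>n\<close> a unit kernel vector is moved to the last
          coordinate, after which the last row and column vanish.\<close>
        define q where "q = n - 1"
        have q: "q < n" "\<And>i. N \<le> i \<Longrightarrow> i < n \<Longrightarrow> i = q" using n2 Nn by (auto simp: q_def)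
        have P0: "P 0 (E z)" if col: "\<And>i. i < n \<Longrightarrow> E z i q = 0" for z
          unfolding P_def using q(2) col alt[of z q] by auto
        obtain b where b: "vn n b = 1" "\<And>i. i < n \<Longrightarrow> mv n (E z) b i = 0"
          by (rule alternating_unit_kernel[OF False alt']) (rule that; (assumption | simp))
        let ?u0 = "\<lambda>i. cnj (b i)"
        have u0: "vn n ?u0 = 1" "\<And>i. i < n \<Longrightarrow> nip n (E z i) ?u0 = 0"
          using b by (simp_all add: vn_cnj nip_def mv_def)
        show ?thesis
        proof (cases "\<exists>j<n. ?u0 j \<noteq> uvec q j")
          case False
          have "E z i q = 0" if "i < n" for i
          proof -
            have "nip n (E z i) ?u0 = nip n (E z i) (uvec q)" by (rule nip_cong) (use False in auto)
            then show ?thesis using u0(2)[OF that] nip_ev_right[OF q(1)] by simp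
          qed
          from P0[OF this] show ?thesis using rot_id by (intro bexI[of _ "\<lambda>z. z"])
        next
          case True
          obtain u w where u: "vn n u = 1" "cmod w = 1" "\<And>j. j < n \<Longrightarrow> reflect n u w ?u0 j = uvec q j"
            by (rule refl_transitiveE[OF u0(1) vn_ev[OF q(1)] True]) (rule that; (assumption | simp))
          obtain L where L: "L \<in> rot \<Omega>" "\<forall>z i j. i < n \<longrightarrow> j < n \<longrightarrow> E (L z) i j = lft n u w (rgt n u w (E z)) i j"
            by (rule bexE[OF rot_congruence[OF refl Clpres u(1,2)]])
          have rg: "rgt n u w (E z) i q = 0" if "i < n" for i
            by (simp add: rgt_def refl_coord[OF u(1,2) q(1) u(3)] u0(2)[OF that])
          have "E (L z) i q = 0" if "i < n" for i
            using L(2) that q(1) rg by (simp add: lft_def reflect_def nip_def)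
          from P0[OF this] show ?thesis using L(1) by blast
        qed
      qed
    next
      fix k z assume k: "k < n div 2" and c: "contr n n (E z)" and nz: "(norm z)\<^sup>2 = real r" and P: "P k (E z)"
      define p where "p = 2 * k"
      have p: "even p" "Suc p < N" "p < n" "Suc p < n" using k Nn(1) by (auto simp: p_def N_def)
      define y where "y = E z p"
      \<comment> \<open>Only the first \<open>N\<close> rows can be nonzero. These are
        \<open>2 * r\<close> rows of squared norm at most 1, and the Frobenius norm, which counts
        each coordinate twice, makes the total \<open>2 * r\<close>.\<close>
      have "(\<Sum>i<n. vn n (E z i)) = (\<Sum>i<N. vn n (E z i))"
        by (rule sum.mono_neutral_right) (use Nn(1) P in \<open>auto simp: P_def vn_eq_0\<close>)
      then have "(\<Sum>i<N. vn n (E z i)) = N" using E_fro[of z] nz Nn(3) by (simp add: fro_def)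
      then have row1: "vn n y = 1" unfolding y_def
        by (rule sum_le_1_eq_card[where n=N, rotated]) (use contr_row[OF c] p Nn(1) in auto)
      have y0: "y i = 0" if i: "i \<le> p \<or> N \<le> i" "i < n" for i
      proof -
        consider "i < p" | "i = p" | "N \<le> i" using i(1) by linarith
        then have "E z i p = 0"
        proof cases
          case 1
          then have "E z i p = J i p" using P i(2) p(3) by (simp add: P_def p_def)
          also have "\<dots> = 0" using 1 p(1) by (auto simp: J_def)
          finally show ?thesis .
        next
          case 2
          then show ?thesis by (simp add: E_def)
        next
          case 3
          then show ?thesis using P i(2) p(3) by (simp add: P_def)
        qed
        then show ?thesis unfolding y_def alt[of z p i] by simp
      qed
      have P_Suc: "P (Suc k) Z" if Z: "\<And>i j. i < n \<Longrightarrow> j < n \<Longrightarrow> i < p \<or> N \<le> i \<Longrightarrow> Z i j = E z i j"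
        "\<And>j. j < n \<Longrightarrow> Z p j = uvec (Suc p) j" "Z (Suc p) p = - 1" "vn n (Z (Suc p)) \<le> 1" for Z
        unfolding P_def
      proof (intro allI impI conjI)
        fix i j assume ij: "i < n" "j < n"
        show "Z i j = 0" if "N \<le> i" using Z(1)[OF ij] that P ij by (simp add: P_def)
        assume "i < 2 * Suc k"
        then consider "i < p" | "i = p" | "i = Suc p" unfolding p_def by fastforce
        then show "Z i j = J i j"
        proof cases
          case 1
          then show ?thesis using Z(1)[OF ij] P ij by (simp add: P_def p_def)
        next
          case 2
          then show ?thesis using Z(2)[OF ij(2)] p(1) by (auto simp: J_def uvec_def)
        next
          case 3
          then show ?thesis using Z(3) unit_vector_with_unit_coord[OF Z(4) p(3) _ ij(2)] p(1)
            by (cases "j = p") (auto simp: J_def)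
        qed
      qed
      show "\<exists>L\<in>rot \<Omega>. P (Suc k) (E (L z))"
      proof (cases "\<exists>j<n. y j \<noteq> uvec (Suc p) j")
        case False
        have "P (Suc k) (E z)"
          by (rule P_Suc) (use False p(4) contr_row[OF c p(4)] in \<open>auto simp: y_def alt[of z "Suc p" p] uvec_def\<close>)
        then show ?thesis using rot_id by (intro bexI[of _ "\<lambda>z. z"])
      next
        case True
        obtain u w where u: "vn n u = 1" "cmod w = 1" "\<And>j. j < n \<Longrightarrow> reflect n u w y j = uvec (Suc p) j"
          "\<And>j. y j = uvec (Suc p) j \<Longrightarrow> u j = 0"
          by (rule refl_transitiveE[OF row1 vn_ev[OF p(4)] True]) (rule that; (assumption | simp))
        \<comment> \<open>The reflection vector is supported strictly between \<open>p\<close> and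
          \<open>N\<close>. So rows up to \<open>p\<close> feel only the action on rows, while
          finished rows and the zero row do not change at all.\<close>
        have uz: "u i = 0" if "i \<le> p \<or> N \<le> i" "i < n" for i
          by (rule u(4)) (use y0[OF that] that p(2) in \<open>auto simp: uvec_def\<close>)
        obtain L where L: "L \<in> rot \<Omega>" "\<forall>z i j. i < n \<longrightarrow> j < n \<longrightarrow> E (L z) i j = lft n u w (rgt n u w (E z)) i j"
          by (rule bexE[OF rot_congruence[OF refl Clpres u(1,2)]])
        let ?Z = "E (L z)"
        have cL: "contr n n ?Z" by (rule closure_contr[OF rot_closure[OF L(1) contr_closure[OF c]]])
        have lf: "?Z i j = reflect n u w (E z i) j" if "i \<le> p \<or> N \<le> i" "i < n" "j < n" for i j
          using L(2) that(2,3) uz[OF that(1,2)] by (simp add: lft_def rgt_def reflect_def[of _ _ _ "\<lambda>k. reflect n u w (E z k) j"])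
        have Zp: "?Z p j = uvec (Suc p) j" if "j < n" for j
          using lf[of p j] p(3) that u(3)[OF that] by (simp add: y_def)
        have "?Z i j = E z i j" if ij: "i < n" "j < n" "i < p \<or> N \<le> i" for i j
        proof -
          have "E z i l * cnj (u l) = 0" if l: "l < n" for l
          proof (cases "l \<le> p")
            case True
            then show ?thesis using uz[of l] l by simp
          next
            case False
            have "E z i l = 0"
            proof (cases "N \<le> i")
              case True
              then show ?thesis using P ij(1) l by (simp add: P_def)
            next
              case iN: False
              then have ip: "i < p" using ij(3) by simp
              then have "E z i l = J i l" using P ij(1) l by (simp add: P_def p_def)
              also have "\<dots> = 0" using ip False p(1) by (auto simp: J_def) 
              finally show ?thesis .
            qed
            then show ?thesis by simp
          qed
          then have "nip n (E z i) u = 0" unfolding nip_def by (intro sum.neutral) simp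
          then show ?thesis using lf[of i j] ij by (auto simp: reflect_def)
        qed
        from P_Suc[of ?Z, OF this Zp _ contr_row[OF cL p(4)]] have "P (Suc k) ?Z"
          using Zp[OF p(4)] alt[of "L z" "Suc p" p] by (simp add: uvec_def)
        then show ?thesis using L(1) by blast
      qed
    qed (rule z)+
  qed
qed

section \<open>The Lie ball\<close>

definition bl :: "complex^'d::finite \<Rightarrow> complex^'d \<Rightarrow> complex" where
  "bl z w = (\<Sum>i\<in>UNIV. vec_nth z i * vec_nth w i)"

definition vcnj :: "complex^'d::finite \<Rightarrow> complex^'d" where
  "vcnj z = (\<chi> i. cnj (vec_nth z i))"

definition cx :: "real^'d::finite \<Rightarrow> complex^'d" where
  "cx x = (\<chi> i. complex_of_real (vec_nth x i))"

text \<open>The generic norm of the Lie ball on the diagonal, in the scaling where the Shilov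
  boundary has squared norm 2.\<close>

definition lie_rho :: "complex^'d::finite \<Rightarrow> real" where
  "lie_rho z = 1 - (norm z)\<^sup>2 + (cmod (bl z z))\<^sup>2 / 4"

definition lie_ball :: "(complex^'d::finite) set" where
  "lie_ball = {z. (norm z)\<^sup>2 < 2 \<and> 0 < lie_rho z}"

lemma bl_commute: "bl z w = bl w z" by (simp add: bl_def mult.commute)

lemma bl_simps:
  "bl (x + y) w = bl x w + bl y w" "bl (x - y) w = bl x w - bl y w" "bl (c *s x) w = c * bl x w"
  "bl w (x + y) = bl w x + bl w y" "bl w (x - y) = bl w x - bl w y" "bl w (c *s x) = c * bl w x"
  by (simp_all add: bl_def algebra_simps sum.distrib sum_subtractf sum_distrib_left)

lemma bl_vcnj: "bl z (vcnj w) = cip z w" by (simp add: bl_def vcnj_def cip_def)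

lemma bl_vcnj_vcnj: "bl (vcnj z) (vcnj w) = cnj (bl z w)" by (simp add: bl_def vcnj_def)

lemma vcnj_simps: "vcnj (x + y) = vcnj x + vcnj y" "vcnj (x - y) = vcnj x - vcnj y"
  "vcnj (c *s x) = cnj c *s vcnj x" "vcnj (vcnj x) = x" "vcnj (cx a) = cx a"
  by (simp_all add: vcnj_def cx_def vec_eq_iff)

lemma norm_vcnj: "norm (vcnj z) = norm z"
  by (simp add: norm_vec_def vcnj_def)

lemma cmod_bl_le: "cmod (bl z w) \<le> norm z * norm w"
  using cmod_cip_le[of z "vcnj w"] by (simp add: bl_vcnj[symmetric] vcnj_simps norm_vcnj)

lemma bl_cx: "bl (cx x) (cx y) = of_real (x \<bullet> y)"
  by (simp add: bl_def cx_def inner_vec_def)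

lemma continuous_bl: "continuous_on A g \<Longrightarrow> continuous_on A h \<Longrightarrow> continuous_on A (\<lambda>z. bl (g z) (h z))"
  unfolding bl_def by (intro continuous_intros)

lemma open_lie_ball: "open lie_ball"
  unfolding lie_ball_def lie_rho_def
  by (intro open_Collect_conj open_Collect_less continuous_intros continuous_bl) auto

lemma closure_lie_ball:
  assumes "z \<in> closure lie_ball" shows "(norm z)\<^sup>2 \<le> 2" "0 \<le> lie_rho z"
proof -
  have "closed {z. (norm (z :: complex^'a))\<^sup>2 \<le> 2 \<and> 0 \<le> lie_rho z}"
    unfolding lie_rho_def by (intro closed_Collect_conj closed_Collect_le continuous_intros continuous_bl) auto
  moreover have "(lie_ball :: (complex^'a) set) \<subseteq> {z. (norm z)\<^sup>2 \<le> 2 \<and> 0 \<le> lie_rho z}" by (auto simp: lie_ball_def)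
  ultimately have "closure lie_ball \<subseteq> {z. (norm (z :: complex^'a))\<^sup>2 \<le> 2 \<and> 0 \<le> lie_rho z}" by (rule closure_minimal[rotated])
  then show "(norm z)\<^sup>2 \<le> 2" "0 \<le> lie_rho z" using assms by auto
qed

text \<open>At \<open>k *s z\<close> the defining quantity is a quadratic polynomial in
  \<open>s = |k|\<^sup>2\<close>. Expanded at \<open>s = 1\<close> it has nonnegative terms because
  \<open>B / 2 \<le> N\<close>, and they cannot all vanish.\<close>

lemma lie_ball_shrink:
  assumes N: "(norm z)\<^sup>2 \<le> 2" and rho: "0 \<le> lie_rho z" and k: "cmod k < 1"
  shows "k *s z \<in> lie_ball"
proof -
  define N where "N = (norm z)\<^sup>2"
  define B where "B = (cmod (bl z z))\<^sup>2"
  define s where "s = (cmod k)\<^sup>2"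
  have s: "0 \<le> s" "s < 1" using k by (auto simp: s_def abs_square_less_1)
  have N2: "0 \<le> N" "N \<le> 2" using N by (auto simp: N_def)
  have "cmod (bl z z) \<le> N" using cmod_bl_le[of z z] by (simp add: N_def power2_eq_square)
  then have "B \<le> N\<^sup>2" unfolding B_def by (intro power_mono) auto
  also have "\<dots> \<le> 2 * N" unfolding power2_eq_square using N2 by (intro mult_right_mono)
  finally have BN: "B / 2 \<le> N" by simp
  have B0: "0 \<le> B" by (simp add: B_def)
  have r: "0 \<le> 1 - N + B / 4" using rho by (simp add: lie_rho_def N_def B_def)
  have nk: "(norm (k *s z))\<^sup>2 = s * N" by (simp add: norm_cscale power_mult_distrib s_def N_def)
  have "s * N \<le> s * 2" using s N2 by (intro mult_left_mono)
  then have "s * N < 2" using s by linarith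
  moreover have "(cmod (bl (k *s z) (k *s z)))\<^sup>2 = s\<^sup>2 * B"
    by (simp add: bl_simps norm_mult power_mult_distrib s_def B_def power2_eq_square)
  moreover have "0 < 1 - s * N + s\<^sup>2 * B / 4"
  proof -
    have eq: "1 - s * N + s\<^sup>2 * B / 4 = (1 - N + B / 4) + (1 - s) * (N - B / 2) + (1 - s)\<^sup>2 * B / 4"
      by (simp add: field_simps power2_eq_square)
    have nn: "0 \<le> (1 - s) * (N - B / 2)" "0 \<le> (1 - s)\<^sup>2 * B / 4" using s BN B0 by simp_all
    consider "B > 0" | "B = 0" "N > 0" | "B = 0" "N = 0" using B0 N2 by linarith
    then show ?thesis
    proof cases
      case 1
      then have "0 < (1 - s)\<^sup>2 * B / 4" using s by simp
      then show ?thesis using eq r nn by linarith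
    next
      case 2
      then have "0 < (1 - s) * (N - B / 2)" using s by simp
      then show ?thesis using eq r nn by linarith
    qed simp
  qed
  ultimately show ?thesis by (simp add: lie_ball_def lie_rho_def nk)
qed

lemma lie_ball_closureI:
  assumes "(norm z)\<^sup>2 \<le> 2" "0 \<le> lie_rho z" shows "z \<in> closure lie_ball"
proof -
  have "(\<lambda>k. (1 - inverse (real (Suc k))) *\<^sub>R z) \<longlonglongrightarrow> (1 - 0) *\<^sub>R z"
    by (intro tendsto_intros LIMSEQ_inverse_real_of_nat)
  moreover have "(1 - inverse (real (Suc k))) *\<^sub>R z \<in> lie_ball" for k
  proof -
    have "0 \<le> 1 - inverse (real (Suc k))" "1 - inverse (real (Suc k)) < 1" by (auto simp: field_simps)
    then have "cmod (of_real (1 - inverse (real (Suc k)))) < 1" unfolding norm_of_real by simp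
    then show ?thesis unfolding scaleR_eq_cscale by (rule lie_ball_shrink[OF assms])
  qed
  ultimately show ?thesis unfolding closure_sequential
    by (intro exI[of _ "\<lambda>k. (1 - inverse (real (Suc k))) *\<^sub>R z"]) simp
qed

text \<open>On the smooth part of the boundary the complex tangent direction \<open>2 cnj z - cnj (bl z z) z\<close> is isotropic,
  and \<open>lie_rho\<close> is constant along it.\<close>
lemma lie_rho_direction:
  assumes rho: "lie_rho z = 0"
  defines "v \<equiv> 2 *s vcnj z - cnj (bl z z) *s z"
  shows "lie_rho (z + l *s v) = 0" "norm v = \<bar>2 - (cmod (bl z z))\<^sup>2 / 2\<bar>"
proof -
  define c where "c = bl z z"
  define B where "B = (cmod c)\<^sup>2"
  define s where "s = 1 - B / 4"
  have cc: "cnj c * c = of_real B" "c * cnj c = of_real B" unfolding B_def complex_norm_square by simp_all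
  have N: "(norm z)\<^sup>2 = 1 + B / 4" using rho by (simp add: lie_rho_def B_def c_def)
  have zz: "bl z (vcnj z) = of_real (1 + B / 4)" unfolding bl_vcnj cip_self N ..
  have zz': "bl (vcnj z) z = of_real (1 + B / 4)" unfolding bl_commute[of "vcnj z"] zz ..
  have vv: "bl (vcnj z) (vcnj z) = cnj c" by (simp add: bl_vcnj_vcnj c_def)
  have v: "v = 2 *s vcnj z - cnj c *s z" by (simp add: v_def c_def)
  have vc: "vcnj v = 2 *s z - c *s vcnj z" by (simp add: v vcnj_simps)
  have zv: "bl z v = of_real (2 * s)"
  proof -
    have "bl z v = 2 * of_real (1 + B / 4) - cnj c * c" by (simp add: v bl_simps zz flip: c_def)
    also have "\<dots> = of_real (2 * s)" by (simp add: cc s_def)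
    finally show ?thesis .
  qed
  have vv0: "bl v v = 0"
  proof -
    have "bl v v = 2 * (2 * cnj c) - 2 * (cnj c * of_real (1 + B / 4)) - (cnj c * (2 * of_real (1 + B / 4)) - cnj c * (cnj c * c))"
      by (simp add: v bl_simps zz zz' vv right_diff_distrib flip: c_def)
    also have "\<dots> = 0" by (simp add: cc algebra_simps)
    finally show ?thesis .
  qed
  have cz: "cip z v = c * of_real s"
  proof -
    have "cip z v = 2 * c - c * of_real (1 + B / 4)" unfolding bl_vcnj[symmetric] vc by (simp add: bl_simps zz flip: c_def)
    also have "\<dots> = c * of_real s" by (simp add: s_def algebra_simps)
    finally show ?thesis .
  qed
  have nv: "(norm v)\<^sup>2 = 4 * s\<^sup>2"
  proof -
    have "of_real ((norm v)\<^sup>2) = bl v (vcnj v)" unfolding bl_vcnj cip_self ..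
    also have "\<dots> = 2 * (2 * of_real (1 + B / 4)) - 2 * (c * cnj c) - (cnj c * (2 * c) - cnj c * (c * of_real (1 + B / 4)))"
      unfolding vc by (simp add: v bl_simps zz zz' vv right_diff_distrib flip: c_def)
    also have "\<dots> = 4 * of_real (1 + B / 4) - 4 * of_real B + of_real B * of_real (1 + B / 4)"
      using cc by (simp add: algebra_simps flip: mult.assoc)
    also have "\<dots> = complex_of_real (4 * s\<^sup>2)"
      by (simp add: s_def power2_eq_square algebra_simps)
    finally show ?thesis by (simp only: of_real_eq_iff)
  qed
  then have "(norm v)\<^sup>2 = \<bar>2 * s\<bar>\<^sup>2" by (simp add: power2_eq_square)
  then have "norm v = \<bar>2 * s\<bar>" by (metis power2_eq_iff_nonneg norm_ge_zero abs_ge_zero)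
  then show "norm v = \<bar>2 - (cmod (bl z z))\<^sup>2 / 2\<bar>" by (simp add: s_def B_def c_def)
  have "bl (z + l *s v) (z + l *s v) = c + 4 * (of_real s * l)"
    by (simp add: bl_simps zv vv0 bl_commute[of v z] flip: c_def) 
  then have 1: "(cmod (bl (z + l *s v) (z + l *s v)))\<^sup>2 = B + 8 * s * Re (c * cnj l) + 16 * s\<^sup>2 * (cmod l)\<^sup>2"
    by (simp only: B_def cmod_power2) (simp add: power2_eq_square algebra_simps)
  have "(norm (z + l *s v))\<^sup>2 = (norm z)\<^sup>2 + 2 * Re (cip z (l *s v)) + (norm (l *s v))\<^sup>2"
    unfolding Re_cip by (simp add: power2_norm_eq_inner inner_add_left inner_add_right inner_commute)
  also have "\<dots> = 1 + B / 4 + 2 * s * Re (c * cnj l) + 4 * s\<^sup>2 * (cmod l)\<^sup>2"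
    by (simp add: N cip_scale_right cz norm_cscale power_mult_distrib nv algebra_simps)
  finally show "lie_rho (z + l *s v) = 0" unfolding lie_rho_def 1 by (simp add: field_simps)
qed

text \<open>Interior points have small discs in any direction. At a boundary point of squared norm
  below 2 the isotropic direction keeps \<open>lie_rho\<close> at 0, so only the norm condition
  limits the radius of the disc.\<close>

lemma lie_ball_disc:
  assumes z: "z \<in> closure lie_ball" and N: "(norm z)\<^sup>2 < 2"
  shows "\<exists>v. v \<noteq> 0 \<and> (\<forall>l. cmod l \<le> 1 \<longrightarrow> z + l *s v \<in> closure lie_ball)"
proof (cases "lie_rho z = 0")
  case False
  then have "z \<in> lie_ball" using closure_lie_ball(2)[OF z] N by (simp add: lie_ball_def)
  then obtain e where e: "e > 0" "ball z e \<subseteq> lie_ball" using open_lie_ball open_contains_ball by blast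
  let ?v = "of_real (e / 2) *s axis (undefined :: 'a) (1 :: complex)"
  have nv: "norm ?v = e / 2" unfolding norm_cscale norm_of_real using e by simp
  have "z + l *s ?v \<in> closure lie_ball" if "cmod l \<le> 1" for l
  proof -
    have "norm (l *s ?v) \<le> 1 * (e / 2)" unfolding norm_cscale[of l] nv using that e by (intro mult_right_mono) auto
    then have "z + l *s ?v \<in> ball z e" using e by (simp add: dist_norm)
    then show ?thesis using e(2) closure_subset by blast
  qed
  moreover have "?v \<noteq> 0" using nv e by (metis half_gt_zero_iff less_irrefl norm_zero)
  ultimately show ?thesis by blast
next
  case True
  define v where "v = 2 *s vcnj z - cnj (bl z z) *s z"
  note dir = lie_rho_direction[OF True, folded v_def]
  have "(cmod (bl z z))\<^sup>2 / 4 < 1" using True N by (simp add: lie_rho_def)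
  then have nv: "norm v > 0" unfolding dir(2) by simp
  have nz: "norm z < sqrt 2" using N by (simp add: real_less_rsqrt)
  define \<delta> where "\<delta> = (sqrt 2 - norm z) / norm v"
  have d: "\<delta> > 0" "\<delta> * norm v = sqrt 2 - norm z" using nv nz by (simp_all add: \<delta>_def)
  have "z + l *s (of_real \<delta> *s v) \<in> closure lie_ball" if l: "cmod l \<le> 1" for l
  proof (rule lie_ball_closureI)
    have e: "z + l *s (of_real \<delta> *s v) = z + (l * of_real \<delta>) *s v" by simp
    show "0 \<le> lie_rho (z + l *s (of_real \<delta> *s v))" unfolding e dir(1) by simp
    have "norm (l *s (of_real \<delta> *s v)) \<le> 1 * (\<delta> * norm v)"
      unfolding norm_cscale norm_of_real using l d(1) by (intro mult_mono) auto
    then have "norm (z + l *s (of_real \<delta> *s v)) \<le> sqrt 2"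
      using norm_triangle_ineq[of z "l *s (of_real \<delta> *s v)"] d(2) by linarith
    then have "(norm (z + l *s (of_real \<delta> *s v)))\<^sup>2 \<le> (sqrt 2)\<^sup>2" by (intro power_mono) auto
    then show "(norm (z + l *s (of_real \<delta> *s v)))\<^sup>2 \<le> 2" by simp
  qed
  moreover have "of_real \<delta> *s v \<noteq> 0"
    using d(1) nv norm_cscale[of "of_real \<delta>" v] by (metis abs_of_pos mult_pos_pos norm_of_real norm_zero less_irrefl)
  ultimately show ?thesis by blast
qed

section \<open>Symmetries of the Lie ball\<close>

lemma lie_ball_image:
  assumes "clin L" "\<And>z. norm (L z) = norm z" "\<And>z. cmod (bl (L z) (L z)) = cmod (bl z z)"
  shows "L ` lie_ball = lie_ball"
proof -
  have iff: "L z \<in> lie_ball \<longleftrightarrow> z \<in> lie_ball" for z by (simp add: lie_ball_def lie_rho_def assms(2,3))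
  have "bij L" using assms(1,2) by (rule clin_isometry_bij)
  then show ?thesis using iff by (auto simp: image_iff) (metis bij_pointE)
qed

lemma rot_phase: "(\<lambda>z. cis \<alpha> *s z) \<in> rot lie_ball"
proof (rule rotI[where H="\<lambda>t z. cis (t * \<alpha>) *s z"])
  fix t :: real
  show "clin (\<lambda>z. cis (t * \<alpha>) *s z)" by (simp add: clin_def vec_eq_iff algebra_simps)
  then show "(\<lambda>z. cis (t * \<alpha>) *s z) ` lie_ball = lie_ball"
    by (rule lie_ball_image) (simp_all add: norm_cscale bl_simps norm_mult)
  show "norm (cis (t * \<alpha>) *s z) = norm z" for z :: "complex^'a" by (simp add: norm_cscale)
next
  have "continuous_on ({0..1} \<times> UNIV) (\<lambda>p. \<chi> i. cis (fst p * \<alpha>) * vec_nth (snd p :: complex^'a) i)"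
    by (intro continuous_on_vec_lambda continuous_intros)
  then show "continuous_on ({0..1} \<times> UNIV) (\<lambda>(t, z :: complex^'a). cis (t * \<alpha>) *s z)"
    by (simp add: case_prod_beta vector_scalar_mult_def)
qed simp_all

text \<open>The complex linear extension of the real reflection in \<open>u\<close>. Dividing by
  \<open>u \<bullet> u\<close> frees paths of directions from normalization.\<close>

definition crefl :: "real^'d::finite \<Rightarrow> complex^'d \<Rightarrow> complex^'d" where
  "crefl u z = z - (2 * bl z (cx u) / of_real (u \<bullet> u)) *s cx u"

lemma bl_crefl: assumes "u \<noteq> 0" shows "bl (crefl u z) (crefl u w) = bl z w"
proof -
  define q where "q = complex_of_real (u \<bullet> u)"
  have q: "q \<noteq> 0" using assms by (simp add: q_def)
  define a where "a = bl z (cx u)"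
  define b where "b = bl (cx u) w"
  have b': "bl w (cx u) = b" by (simp add: b_def bl_commute)
  have "bl (crefl u z) (crefl u w) = bl z w - (2 * a / q) * b - ((2 * b / q) * a - (2 * b / q) * ((2 * a / q) * q))"
    unfolding crefl_def b' by (simp add: bl_simps bl_cx flip: a_def b_def q_def)
  then show ?thesis using q by (simp add: field_simps)
qed

lemma vcnj_crefl: "vcnj (crefl u z) = crefl u (vcnj z)"
proof -
  have "cnj (bl z (cx u)) = bl (vcnj z) (cx u)" using bl_vcnj_vcnj[of z "cx u"] by (simp add: vcnj_simps)
  then show ?thesis by (simp add: crefl_def vcnj_simps)
qed

lemma norm_crefl: assumes "u \<noteq> 0" shows "norm (crefl u z) = norm z"
proof -
  have "complex_of_real ((norm (crefl u z))\<^sup>2) = of_real ((norm z)\<^sup>2)"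
    unfolding cip_self[symmetric] bl_vcnj[symmetric] vcnj_crefl bl_crefl[OF assms] ..
  then show ?thesis by (simp only: of_real_eq_iff power2_eq_iff_nonneg norm_ge_zero)
qed

lemma clin_crefl: "clin (crefl u)"
  by (simp add: clin_def crefl_def bl_simps vec_eq_iff algebra_simps add_divide_distrib)

lemma crefl_crefl: assumes "u \<noteq> 0" shows "crefl u (crefl u z) = z"
proof -
  have "bl (crefl u z) (cx u) = - bl z (cx u)"
    using assms by (simp add: crefl_def bl_simps bl_cx)
  then show ?thesis by (simp add: crefl_def[of u "crefl u z"]) (simp add: crefl_def)
qed

lemma crefl_orthogonal: "u \<bullet> x = 0 \<Longrightarrow> crefl u (cx x) = cx x"
  by (simp add: crefl_def bl_cx inner_commute)

lemma crefl_diff: assumes "norm x = norm y" "x \<noteq> y" shows "crefl (x - y) (cx x) = cx y"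
proof -
  have "x \<bullet> x = y \<bullet> y" using assms(1) by (simp add: norm_eq)
  then have "(x - y) \<bullet> (x - y) = 2 * (x \<bullet> (x - y))"
    by (simp add: inner_diff_left inner_diff_right inner_commute)
  moreover have "x \<bullet> (x - y) \<noteq> 0" using calculation assms(2) by auto
  ultimately have "2 * bl (cx x) (cx (x - y)) / of_real ((x - y) \<bullet> (x - y)) = 1"
    by (simp add: bl_cx)
  then show ?thesis by (simp add: crefl_def) (simp add: cx_def vec_eq_iff)
qed

text \<open>The reflection in \<open>x - y\<close> takes \<open>x\<close> to \<open>y\<close>, but a
  single reflection comes with no path to the identity. Preceding it by the reflection in some
  \<open>u0\<close> orthogonal to \<open>x\<close> keeps the effect on \<open>x\<close> and supplies
  a path: the direction of the outer reflection moves from \<open>u0\<close> to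
  \<open>x - y\<close>.\<close>

lemma rot_real:
  fixes x y :: "real^'d::finite"
  assumes card: "2 \<le> CARD('d)" and nrm: "norm x = norm y"
  shows "\<exists>L\<in>rot lie_ball. L (cx x) = cx y"
proof (cases "x = y")
  case True
  then show ?thesis using rot_id by (intro bexI[of _ "\<lambda>z. z"]) auto
next
  case False
  obtain u1 where u1: "u1 \<noteq> 0" "x \<bullet> u1 = 0"
    using orthogonal_to_vector_exists[of x] card by (auto simp: orthogonal_def)
  \<comment> \<open>The sign makes the inner product of \<open>u0\<close> with \<open>x - y\<close>
    nonnegative, so the segment from \<open>u0\<close> to \<open>x - y\<close> misses 0.\<close>
  define u0 where "u0 = (if u1 \<bullet> y \<le> 0 then u1 else - u1)"
  have u0: "u0 \<noteq> 0" "u0 \<bullet> x = 0" "u0 \<bullet> y \<le> 0" using u1 by (auto simp: u0_def inner_commute)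
  define u where "u t = (1 - t) *\<^sub>R u0 + t *\<^sub>R (x - y)" for t :: real
  have un: "u t \<noteq> 0" if t: "t \<in> {0..1}" for t
  proof
    assume "u t = 0"
    then have "u0 \<bullet> u t = 0" by simp
    then have "(1 - t) * (u0 \<bullet> u0) + t * - (u0 \<bullet> y) = 0"
      by (simp add: u_def inner_add_right inner_diff_right u0(2))
    moreover have "0 \<le> t * - (u0 \<bullet> y)" "0 \<le> (1 - t) * (u0 \<bullet> u0)" using t u0(3) by (auto simp: mult_nonneg_nonpos)
    ultimately have "(1 - t) * (u0 \<bullet> u0) = 0" by linarith
    then have "t = 1" using u0(1) by simp
    then show False using \<open>u t = 0\<close> False by (simp add: u_def)
  qed
  let ?L = "\<lambda>z. crefl (u 1) (crefl u0 z)"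
  have "?L \<in> rot lie_ball"
  proof (rule rotI[where H="\<lambda>t z. crefl (u t) (crefl u0 z)"])
    fix t :: real assume t: "t \<in> {0..1}"
    show cl: "clin (\<lambda>z. crefl (u t) (crefl u0 z))" by (rule clin_comp[OF clin_crefl clin_crefl])
    show nn: "norm (crefl (u t) (crefl u0 z)) = norm z" for z by (simp add: norm_crefl un[OF t] u0(1))
    show "(\<lambda>z. crefl (u t) (crefl u0 z)) ` lie_ball = lie_ball"
      by (rule lie_ball_image[OF cl nn]) (simp add: bl_crefl un[OF t] u0(1))
  next
    have "continuous_on ({0..1} \<times> UNIV) (\<lambda>p. \<chi> i. vec_nth (crefl u0 (snd p)) i
        - 2 * bl (crefl u0 (snd p)) (cx (u (fst p))) / of_real (u (fst p) \<bullet> u (fst p)) * of_real (vec_nth (u (fst p)) i))"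
    proof -
      have 1: "continuous_on ({0..1} \<times> UNIV) (\<lambda>p. crefl u0 (snd p))"
        by (rule continuous_on_compose2[OF clin_continuous[OF clin_crefl]]) (auto intro!: continuous_intros)
      have 2: "continuous_on ({0..1} \<times> UNIV) (\<lambda>p. u (fst p))" unfolding u_def by (intro continuous_intros)
      have 3: "continuous_on ({0..1} \<times> UNIV) (\<lambda>p. cx (u (fst p)))"
        unfolding cx_def by (intro continuous_on_vec_lambda continuous_intros 2)
      show ?thesis by (intro continuous_on_vec_lambda continuous_intros continuous_bl ballI 1 2 3) (use un in auto)
    qed
    then show "continuous_on ({0..1} \<times> UNIV) (\<lambda>(t, z). crefl (u t) (crefl u0 z))"
      by (simp add: case_prod_beta crefl_def[of "u _"] vector_scalar_mult_def vec_eq_iff cx_def vec_lambda_beta minus_vec_def)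
  next
    show "crefl (u 0) (crefl u0 z) = z" for z using crefl_crefl[OF u0(1)] by (simp add: u_def)
  qed simp
  moreover have "?L (cx x) = cx y"
  proof -
    have "u 1 = x - y" by (simp add: u_def)
    then show ?thesis by (simp only: crefl_orthogonal[OF u0(2)] crefl_diff[OF nrm False])
  qed
  ultimately show ?thesis by (intro bexI[where x="?L"])
qed

text \<open>At squared norm 2 the condition on \<open>lie_rho\<close> forces equality in
  \<open>|bl z z| \<le> |z|\<^sup>2\<close>. Once a phase has made \<open>bl z z\<close> positive,
  the difference of the two sides is twice the sum of the squared imaginary parts.\<close>

lemma lie_ball_real_form:
  assumes z: "z \<in> closure lie_ball" and N: "(norm z)\<^sup>2 = 2"
  shows "\<exists>\<alpha> x. cis \<alpha> *s z = cx x \<and> norm x = sqrt 2"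
proof -
  have le: "cmod (bl z z) \<le> 2" using cmod_bl_le[of z z] N by (simp add: power2_eq_square)
  have "2\<^sup>2 \<le> (cmod (bl z z))\<^sup>2" using closure_lie_ball(2)[OF z] N by (simp add: lie_rho_def)
  then have "2 \<le> cmod (bl z z)" by (rule power2_le_imp_le) simp
  then have b: "bl z z = 2 * cis (Arg (bl z z))" using le rcis_cmod_Arg[of "bl z z"] by (simp add: rcis_def)
  define \<alpha> where "\<alpha> = - Arg (bl z z) / 2"
  define z' where "z' = cis \<alpha> *s z"
  have "bl z' z' = cis \<alpha> * (cis \<alpha> * (2 * cis (Arg (bl z z))))" unfolding z'_def bl_simps b[symmetric] ..
  also have "\<dots> = 2 * cis (\<alpha> + \<alpha> + Arg (bl z z))" by (simp only: cis_mult[symmetric] mult_ac)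
  also have "\<dots> = 2" by (simp add: \<alpha>_def)
  finally have b': "bl z' z' = 2" .
  have n': "(norm z')\<^sup>2 = 2" by (simp add: z'_def norm_cscale N)
  have "(\<Sum>i\<in>UNIV. 2 * (Im (vec_nth z' i))\<^sup>2) = (\<Sum>i\<in>UNIV. (cmod (vec_nth z' i))\<^sup>2 - Re (vec_nth z' i * vec_nth z' i))"
    unfolding cmod_power2 by (intro sum.cong refl) (simp add: power2_eq_square)
  also have "\<dots> = (norm z')\<^sup>2 - Re (bl z' z')" by (simp add: sum_subtractf norm_sq_vec bl_def)
  also have "\<dots> = 0" by (simp add: n' b')
  finally have "\<forall>i\<in>UNIV. 2 * (Im (vec_nth z' i))\<^sup>2 = 0" by (subst (asm) sum_nonneg_eq_0_iff) auto
  then have im: "Im (vec_nth z' i) = 0" for i by simp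
  define x where "x = (\<chi> i. Re (vec_nth z' i))"
  have zx: "z' = cx x" by (simp add: x_def cx_def vec_eq_iff complex_eq_iff im)
  have "complex_of_real (x \<bullet> x) = 2" using b' unfolding zx bl_cx .
  then have "x \<bullet> x = 2" by (metis of_real_eq_iff of_real_numeral)
  then have "norm x = sqrt 2" by (simp add: norm_eq_sqrt_inner)
  then show ?thesis using zx unfolding z'_def by blast
qed

text \<open>For transitivity, two boundary points are made real by phases, and real vectors of equal
  norm are joined by a product of two reflections.\<close>

theorem cartan_domain_IV: assumes "cartan_IV \<Omega> r" shows "cartan_domain \<Omega> r"
proof -
  obtain n and f :: "nat \<Rightarrow> 'a" where n3: "3 \<le> n" and f: "bij_betw f {..<n} UNIV" and r: "r = 2"
    and Om: "\<Omega> = {z. (\<Sum>k<n. (cmod (z $ f k))\<^sup>2) < 2 \<and>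
               0 < 1 - (\<Sum>k<n. (cmod (z $ f k))\<^sup>2) + (cmod (\<Sum>k<n. (z $ f k)\<^sup>2))\<^sup>2 / 4}"
    using assms unfolding cartan_IV_def by blast
  have re1: "(\<Sum>k<n. (cmod (vec_nth z (f k)))\<^sup>2) = (norm z)\<^sup>2" for z :: "complex^'a"
    unfolding norm_sq_vec by (rule sum.reindex_bij_betw[OF f])
  have re2: "(\<Sum>k<n. (vec_nth z (f k))\<^sup>2) = bl z z" for z :: "complex^'a"
    unfolding bl_def power2_eq_square by (rule sum.reindex_bij_betw[OF f])
  have Om: "\<Omega> = lie_ball" unfolding Om re1 re2 lie_ball_def lie_rho_def ..
  have card: "2 \<le> CARD('a)" using bij_betw_same_card[OF f] n3 by simp
  show ?thesis unfolding Om r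
  proof
    show "open (lie_ball :: (complex^'a) set)" by (rule open_lie_ball)
    show "(0 :: complex^'a) \<in> lie_ball" by (simp add: lie_ball_def lie_rho_def bl_def)
  next
    fix z :: "complex^'a" assume z: "z \<in> closure lie_ball"
    show "k *s z \<in> lie_ball" if "cmod k < 1" for k by (rule lie_ball_shrink[OF closure_lie_ball[OF z] that])
    show "(norm z)\<^sup>2 \<le> real 2" using closure_lie_ball(1)[OF z] by simp
    show "\<exists>v. v \<noteq> 0 \<and> (\<forall>l. cmod l \<le> 1 \<longrightarrow> z + l *s v \<in> closure lie_ball)" if "(norm z)\<^sup>2 < real 2"
      using lie_ball_disc[OF z] that by simp
  next
    fix z w :: "complex^'a"
    assume z: "z \<in> closure lie_ball" "w \<in> closure lie_ball" and N: "(norm z)\<^sup>2 = real 2" "(norm w)\<^sup>2 = real 2"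
    from lie_ball_real_form[OF z(1)] N obtain \<alpha> x where x: "cis \<alpha> *s z = cx x" "norm x = sqrt 2" by auto
    from lie_ball_real_form[OF z(2)] N obtain \<beta> y where y: "cis \<beta> *s w = cx y" "norm y = sqrt 2" by auto
    obtain L where L: "L \<in> rot lie_ball" "L (cx x) = cx y" using rot_real[OF card, of x y] x(2) y(2) by auto
    have "cis (- \<beta>) *s L (cis \<alpha> *s z) = cis (- \<beta>) *s (cis \<beta> *s w)" by (simp only: x(1) L(2) y(1))
    also have "\<dots> = w" by (simp add: cis_mult)
    finally have "cis (- \<beta>) *s L (cis \<alpha> *s z) = w" .
    then show "\<exists>L\<in>rot lie_ball. L z = w"
      using rot_comp[OF rot_phase rot_comp[OF L(1) rot_phase]] by (intro bexI[of _ "\<lambda>z. cis (- \<beta>) *s L (cis \<alpha> *s z)"])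
  qed simp
qed

theorem theorem3p17:
  fixes \<Omega> :: "(complex^'d::finite) set" and r :: nat
    and X :: "'d fn \<Rightarrow> 'd fn"
  assumes "classical_cartan \<Omega> r"
    and "bounded_op (dz \<Omega>) X"
  shows "(\<exists>\<phi>\<in>Linf (dz \<Omega>). op_eq (dz \<Omega>) X (dualT (dz \<Omega>) \<phi>)) \<longleftrightarrow>
         op_eq (dz \<Omega>)
           (\<lambda>h x. \<Sum>i\<in>UNIV. adj (dz \<Omega>) (dualT (dz \<Omega>) (\<lambda>z. cnj (z $ i)))
                      (X (dualT (dz \<Omega>) (\<lambda>z. cnj (z $ i)) h)) x)
           (\<lambda>h x. of_nat r * X h x)"
proof -
  interpret cartan_domain \<Omega> r
    using assms(1) cartan_domain_I cartan_domain_II cartan_domain_III cartan_domain_IV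
    unfolding classical_cartan_def by blast
  interpret sphere_space "dz \<Omega>" S r by (rule sphere_space_dz)
  show ?thesis by (rule dual_toeplitz_characterization[OF assms(2)])
qed

end
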